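(* The ITP-preserving symmetric monoidal functor $\phi\colon \mathsf{FinStoch}^{\otimes\infty}\to\mathsf{StoneStoch}_{\mathsf{lc}}$ obtained by extending the inclusion $\mathsf{FinStoch}\hookrightarrow\mathsf{StoneStoch}_{\mathsf{lc}}$ is fully faithful. Moreover, its essential image is given by the (countably) infinite products, in the sense of topological spaces, of finite (discrete) sets.
   Context: $\mathsf{FinStoch}$: objects are finite sets; morphisms $f\colon X\to Y$ are functions $(y,x)\mapsto f(y\mid x)\in\mathbb{R}^{\ge0}$ with $\sum_{y\in Y}f(y\mid x)=1$ for all $x\in X$; composition $gf(z\mid x)=\sum_y g(z\mid y)f(y\mid x)$; tensor is cartesian product of sets with $(f\otimes h)(y,w\mid x,z)=f(y\mid x)h(w\mid z)$; the unit is a one-point set. A Stone space is a compact Hausdorff space with a basis of clopen sets; $\mathsf{Clopen}(X)$ denotes its clopen sets. A locally constant Markov kernel $f$ from $X$ to $Y$ (Stone spaces) is a function $f\colon\mathsf{Clopen}(Y)\times X\to[0,1]$, $(U,x)\mapsto f(U\mid x)$, such that (i) for every $U\in\mathsf{Clopen}(Y)$, $f(U\mid-)$ is locally constant on $X$; (ii) for every $x\in X$, $f(-\mid x)$ is a finitely additive probability measure on $\mathsf{Clopen}(Y)$. $\mathsf{StoneStoch}_{\mathsf{lc}}$ has Stone spaces as objects and locally constant Markov kernels as morphisms. Composition is $gf(V\mid x):=\int_Y g(V\mid y)f(dy\mid x)$, i.e. $\sum_i g(V\mid U_i)f(U_i\mid x)$ for any finite clopen partition $\{U_i\}$ of $Y$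 on whose (nonempty) members $g(V\mid-)$ is constant. The tensor product is the topological product on objects and is determined by $(f\otimes h)(U\times V\mid x,z):=f(U\mid x)h(V\mid z)$ on morphisms; the unit is the one-point space. Finite sets are regarded as discrete Stone spaces, and $f$ in $\mathsf{FinStoch}$ as the kernel $f(U\mid x)=\sum_{y\in U}f(y\mid x)$. A semicartesian category is a symmetric monoidal category $(\mathsf{C},\otimes,I)$ with $I$ terminal; $\mathrm{del}_X\colon X\to I$ is the unique morphism. Symmetric monoidal functors are strong. For a countable set $J$, $\mathsf{FinLO}(J)$ is the category whose objects are finite linearly ordered subsets of $J$, with a morphism $F\to F'$ whenever $F$ is an ordered subset of $F'$ (i.e. $F$ is contained in $F'$ and the inclusion preserves the order); such a morphism is written $F\subseteq F'$. The abstract infinite tensor product of a family $(X_j)_{j\in J}$ is the functor $X\colon\mathsf{FinLO}(J)^{\mathrm{op}}\to\mathsf{C}$, $F\mapsto X_F:=\bigotimes_{j\in F}X_j$, sending $F\subseteq F'$ to the morphism $\pi_{F',F}\colon X_{F'}\to X_F$ which deletes all factors $j\in F'\setminus F$ and keeps the rest unchanged (up to permutation, $\mathrm{id}_{X_F}\otimes\mathrm{del}_{X_{F'\setminus F}}$). A (concrete) infinite tensor product of $(X_j)_{j\in J}$ is a limit of this functor, provided it is preserved by $-\otimes Y$ for all $Y$; $\mathsf{C}$ has infinite tensor products if every abstract one has a concrete one. A symmetric monoidal functor between such categories is ITP-preserving if it sends infinite tensor products (with their limit projections) to infinite tensor products of the image families. The category $\mathsf{StoneStoch}_{\mathsf{lc}}$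 is semicartesian with infinite tensor products, given by topological products. The category $\mathsf{C}^{\otimes\infty}$: equip $[\mathsf{C},\mathsf{Set}]^{\mathrm{op}}$ with the Day convolution (so $\mathsf{C}(A,-)\otimes\mathsf{C}(B,-)\cong\mathsf{C}(A\otimes B,-)$); $\mathsf{C}^{\otimes\infty}$ is the full subcategory whose objects are the infinite tensor products of objects of $\mathsf{C}$, i.e. the limits $\lim_{F}\mathsf{C}(X_F,-)$ (in $[\mathsf{C},\mathsf{Set}]^{\mathrm{op}}$) of abstract infinite tensor products $X$ in $\mathsf{C}$; its morphisms are described by $\mathsf{C}^{\otimes\infty}(X,Y)\cong\lim_G\operatorname{colim}_F\mathsf{C}(X_F,Y_G)$. It is semicartesian with infinite tensor products, $\iota\colon A\mapsto\mathsf{C}(A,-)$ is fully faithful symmetric monoidal, and every symmetric monoidal functor from $\mathsf{C}$ to a semicartesian category with infinite tensor products extends along $\iota$ to an ITP-preserving symmetric monoidal functor on $\mathsf{C}^{\otimes\infty}$, unique up to natural isomorphism; $\phi$ is this extension for $\mathsf{C}=\mathsf{FinStoch}$. "Infinite" always means "countably infinite" (factors may be singletons, so finite sets are included).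
   Formalization: In FinLO(J), finite subsets carry the order inherited from one fixed order on J (J a set of naturals), not arbitrary orders of their own; with arbitrary orders {1<2} and {2<1} have no upper bound, and infinite tensor products would not be topological products. *)

theory Defs
  imports "HOL-Analysis.Analysis"
begin

section \<open>Categories, functors, limits\<close>

record ('o, 'm) cat =
  Ob :: "'o set"
  Ar :: "'m set"
  Dom :: "'m \<Rightarrow> 'o"
  Cod :: "'m \<Rightarrow> 'o"
  Idt :: "'o \<Rightarrow> 'm"
  Comp :: "'m \<Rightarrow> 'm \<Rightarrow> 'm" (infixr "\<cdot>\<index>" 55)

definition hom :: "('o, 'm, 'x) cat_scheme \<Rightarrow> 'o \<Rightarrow> 'o \<Rightarrow> 'm set" where
  "hom C A B = {f \<in> Ar C. Dom C f = A \<and> Cod C f = B}"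

definition inverse_arrows :: "('o, 'm, 'x) cat_scheme \<Rightarrow> 'm \<Rightarrow> 'm \<Rightarrow> bool" where
  "inverse_arrows C f g \<longleftrightarrow>
     f \<in> Ar C \<and> g \<in> hom C (Cod C f) (Dom C f) \<and>
     g \<cdot>\<^bsub>C\<^esub> f = Idt C (Dom C f) \<and> f \<cdot>\<^bsub>C\<^esub> g = Idt C (Cod C f)"

definition is_iso :: "('o, 'm, 'x) cat_scheme \<Rightarrow> 'm \<Rightarrow> bool" where
  "is_iso C f \<longleftrightarrow> (\<exists>g. inverse_arrows C f g)"

definition inv_arrow :: "('o, 'm, 'x) cat_scheme \<Rightarrow> 'm \<Rightarrow> 'm" where
  "inv_arrow C f = (THE g. inverse_arrows C f g)"

definition isomorphic :: "('o, 'm, 'x) cat_scheme \<Rightarrow> 'o \<Rightarrow> 'o \<Rightarrow> bool" where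
  "isomorphic C A B \<longleftrightarrow> (\<exists>f \<in> hom C A B. is_iso C f)"

definition op_cat :: "('o, 'm, 'x) cat_scheme \<Rightarrow> ('o, 'm) cat" where
  "op_cat C =
     \<lparr>Ob = Ob C, Ar = Ar C, Dom = Cod C, Cod = Dom C, Idt = Idt C, Comp = (\<lambda>g f. f \<cdot>\<^bsub>C\<^esub> g)\<rparr>"

definition full_subcat ::
    "('o, 'm, 'x) cat_scheme \<Rightarrow> 'o set \<Rightarrow> ('o, 'm, 'x) cat_scheme" where
  "full_subcat C S = C\<lparr>Ob := S, Ar := {f \<in> Ar C. Dom C f \<in> S \<and> Cod C f \<in> S}\<rparr>"

record ('o, 'm, 'p, 'n) func =
  FO :: "'o \<Rightarrow> 'p"
  FA :: "'m \<Rightarrow> 'n"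

definition is_functor ::
    "('o, 'm, 'x) cat_scheme \<Rightarrow> ('p, 'n, 'y) cat_scheme \<Rightarrow> ('o, 'm, 'p, 'n, 'z) func_scheme \<Rightarrow> bool"
  where
  "is_functor C D F \<longleftrightarrow>
     (\<forall>A \<in> Ob C. FO F A \<in> Ob D) \<and>
     (\<forall>f \<in> Ar C. FA F f \<in> hom D (FO F (Dom C f)) (FO F (Cod C f))) \<and>
     (\<forall>A \<in> Ob C. FA F (Idt C A) = Idt D (FO F A)) \<and>
     (\<forall>f \<in> Ar C. \<forall>g \<in> Ar C. Cod C f = Dom C g \<longrightarrow>
        FA F (g \<cdot>\<^bsub>C\<^esub> f) = FA F g \<cdot>\<^bsub>D\<^esub> FA F f)"

definition func_comp ::
    "('p, 'n, 'q, 'k, 'y) func_scheme \<Rightarrow> ('o, 'm, 'p, 'n, 'z) func_scheme \<Rightarrow> ('o, 'm, 'q, 'k) func"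
  where
  "func_comp G F = \<lparr>FO = FO G \<circ> FO F, FA = FA G \<circ> FA F\<rparr>"

definition is_nat_trans ::
    "('o, 'm, 'x) cat_scheme \<Rightarrow> ('p, 'n, 'y) cat_scheme \<Rightarrow>
     ('o, 'm, 'p, 'n, 'z) func_scheme \<Rightarrow> ('o, 'm, 'p, 'n, 'w) func_scheme \<Rightarrow> ('o \<Rightarrow> 'n) \<Rightarrow> bool" where
  "is_nat_trans C D F G t \<longleftrightarrow>
     (\<forall>A \<in> Ob C. t A \<in> hom D (FO F A) (FO G A)) \<and>
     (\<forall>f \<in> Ar C. t (Cod C f) \<cdot>\<^bsub>D\<^esub> FA F f = FA G f \<cdot>\<^bsub>D\<^esub> t (Dom C f))"

definition fully_faithful ::
    "('o, 'm, 'x) cat_scheme \<Rightarrow> ('p, 'n, 'y) cat_scheme \<Rightarrow> ('o, 'm, 'p, 'n, 'z) func_scheme \<Rightarrow> bool"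
  where
  "fully_faithful C D F \<longleftrightarrow>
     (\<forall>A \<in> Ob C. \<forall>B \<in> Ob C. bij_betw (FA F) (hom C A B) (hom D (FO F A) (FO F B)))"

definition ess_image ::
    "('o, 'm, 'x) cat_scheme \<Rightarrow> ('p, 'n, 'y) cat_scheme \<Rightarrow> ('o, 'm, 'p, 'n, 'z) func_scheme \<Rightarrow> 'p set"
  where
  "ess_image C D F = {B \<in> Ob D. \<exists>A \<in> Ob C. isomorphic D (FO F A) B}"

definition is_cone ::
    "('i, 'u, 'y) cat_scheme \<Rightarrow> ('o, 'm, 'x) cat_scheme \<Rightarrow> ('i, 'u, 'o, 'm, 'z) func_scheme \<Rightarrow>
     'o \<Rightarrow> ('i \<Rightarrow> 'm) \<Rightarrow> bool" where
  "is_cone K C D L p \<longleftrightarrow>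
     L \<in> Ob C \<and> (\<forall>k \<in> Ob K. p k \<in> hom C L (FO D k)) \<and>
     (\<forall>u \<in> Ar K. FA D u \<cdot>\<^bsub>C\<^esub> p (Dom K u) = p (Cod K u))"

definition is_limit ::
    "('i, 'u, 'y) cat_scheme \<Rightarrow> ('o, 'm, 'x) cat_scheme \<Rightarrow> ('i, 'u, 'o, 'm, 'z) func_scheme \<Rightarrow>
     'o \<Rightarrow> ('i \<Rightarrow> 'm) \<Rightarrow> bool" where
  "is_limit K C D L p \<longleftrightarrow>
     is_cone K C D L p \<and>
     (\<forall>M q. is_cone K C D M q \<longrightarrow> (\<exists>!h. h \<in> hom C M L \<and> (\<forall>k \<in> Ob K. p k \<cdot>\<^bsub>C\<^esub> h = q k)))"


section \<open>Symmetric monoidal structure\<close>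

text \<open>
  The coherence isomorphisms have the types
  \<open>assoc A B C : (A \<otimes> B) \<otimes> C \<rightarrow> A \<otimes> (B \<otimes> C)\<close>, \<open>lunit A : I \<otimes> A \<rightarrow> A\<close>,
  \<open>runit A : A \<otimes> I \<rightarrow> A\<close> and \<open>braid A B : A \<otimes> B \<rightarrow> B \<otimes> A\<close>.
\<close>

record ('o, 'm) smcat = "('o, 'm) cat" +
  tensO :: "'o \<Rightarrow> 'o \<Rightarrow> 'o" (infixr "\<otimes>\<index>" 60)
  tensA :: "'m \<Rightarrow> 'm \<Rightarrow> 'm" (infixr "\<boxtimes>\<index>" 60)
  unit :: "'o"
  assoc :: "'o \<Rightarrow> 'o \<Rightarrow> 'o \<Rightarrow> 'm"
  lunit :: "'o \<Rightarrow> 'm"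
  runit :: "'o \<Rightarrow> 'm"
  braid :: "'o \<Rightarrow> 'o \<Rightarrow> 'm"

text \<open>The unique arrow to the unit in a semicartesian category:\<close>

definition del :: "('o, 'm, 'x) smcat_scheme \<Rightarrow> 'o \<Rightarrow> 'm" where
  "del C A = (THE f. f \<in> hom C A (unit C))"

text \<open>
  Strong symmetric monoidal functors, with structure isomorphisms
  \<open>mu A B : F A \<otimes> F B \<rightarrow> F (A \<otimes> B)\<close> and \<open>eps : I \<rightarrow> F I\<close>.
\<close>

record ('o, 'm, 'p, 'n) smfunc = "('o, 'm, 'p, 'n) func" +
  mu :: "'o \<Rightarrow> 'o \<Rightarrow> 'n"
  eps :: "'n"

definition is_smfunctor ::
    "('o, 'm, 'x) smcat_scheme \<Rightarrow> ('p, 'n, 'y) smcat_scheme \<Rightarrow>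
     ('o, 'm, 'p, 'n, 'z) smfunc_scheme \<Rightarrow> bool" where
  "is_smfunctor C D F \<longleftrightarrow>
     is_functor C D F \<and>
     (\<forall>A \<in> Ob C. \<forall>B \<in> Ob C.
        mu F A B \<in> hom D (FO F A \<otimes>\<^bsub>D\<^esub> FO F B) (FO F (A \<otimes>\<^bsub>C\<^esub> B)) \<and> is_iso D (mu F A B)) \<and>
     (\<forall>f \<in> Ar C. \<forall>g \<in> Ar C.
        mu F (Cod C f) (Cod C g) \<cdot>\<^bsub>D\<^esub> (FA F f \<boxtimes>\<^bsub>D\<^esub> FA F g)
        = FA F (f \<boxtimes>\<^bsub>C\<^esub> g) \<cdot>\<^bsub>D\<^esub> mu F (Dom C f) (Dom C g)) \<and>
     eps F \<in> hom D (unit D) (FO F (unit C)) \<and> is_iso D (eps F) \<and>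
     (\<forall>A \<in> Ob C. \<forall>B \<in> Ob C. \<forall>E \<in> Ob C.
        FA F (assoc C A B E) \<cdot>\<^bsub>D\<^esub> mu F (A \<otimes>\<^bsub>C\<^esub> B) E \<cdot>\<^bsub>D\<^esub> (mu F A B \<boxtimes>\<^bsub>D\<^esub> Idt D (FO F E))
        = mu F A (B \<otimes>\<^bsub>C\<^esub> E) \<cdot>\<^bsub>D\<^esub> (Idt D (FO F A) \<boxtimes>\<^bsub>D\<^esub> mu F B E)
            \<cdot>\<^bsub>D\<^esub> assoc D (FO F A) (FO F B) (FO F E)) \<and>
     (\<forall>A \<in> Ob C.
        FA F (lunit C A) \<cdot>\<^bsub>D\<^esub> mu F (unit C) A \<cdot>\<^bsub>D\<^esub> (eps F \<boxtimes>\<^bsub>D\<^esub> Idt D (FO F A)) = lunit D (FO F A) \<and>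
        FA F (runit C A) \<cdot>\<^bsub>D\<^esub> mu F A (unit C) \<cdot>\<^bsub>D\<^esub> (Idt D (FO F A) \<boxtimes>\<^bsub>D\<^esub> eps F) = runit D (FO F A)) \<and>
     (\<forall>A \<in> Ob C. \<forall>B \<in> Ob C.
        FA F (braid C A B) \<cdot>\<^bsub>D\<^esub> mu F A B = mu F B A \<cdot>\<^bsub>D\<^esub> braid D (FO F A) (FO F B))"

definition smfunc_comp ::
    "('q, 'k, 'x) smcat_scheme \<Rightarrow> ('p, 'n, 'q, 'k, 'y) smfunc_scheme \<Rightarrow>
     ('o, 'm, 'p, 'n, 'z) smfunc_scheme \<Rightarrow> ('o, 'm, 'q, 'k) smfunc" where
  "smfunc_comp E G F =
     \<lparr>FO = FO G \<circ> FO F, FA = FA G \<circ> FA F,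
      mu = (\<lambda>A B. FA G (mu F A B) \<cdot>\<^bsub>E\<^esub> mu G (FO F A) (FO F B)),
      eps = FA G (eps F) \<cdot>\<^bsub>E\<^esub> eps G\<rparr>"

definition is_monoidal_nat_iso ::
    "('o, 'm, 'x) smcat_scheme \<Rightarrow> ('p, 'n, 'y) smcat_scheme \<Rightarrow>
     ('o, 'm, 'p, 'n, 'z) smfunc_scheme \<Rightarrow> ('o, 'm, 'p, 'n, 'w) smfunc_scheme \<Rightarrow> ('o \<Rightarrow> 'n) \<Rightarrow> bool"
  where
  "is_monoidal_nat_iso C D F G t \<longleftrightarrow>
     is_nat_trans C D F G t \<and> (\<forall>A \<in> Ob C. is_iso D (t A)) \<and>
     (\<forall>A \<in> Ob C. \<forall>B \<in> Ob C.
        t (A \<otimes>\<^bsub>C\<^esub> B) \<cdot>\<^bsub>D\<^esub> mu F A B = mu G A B \<cdot>\<^bsub>D\<^esub> (t A \<boxtimes>\<^bsub>D\<^esub> t B)) \<and>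
     t (unit C) \<cdot>\<^bsub>D\<^esub> eps F = eps G"

definition monoidally_isomorphic ::
    "('o, 'm, 'x) smcat_scheme \<Rightarrow> ('p, 'n, 'y) smcat_scheme \<Rightarrow>
     ('o, 'm, 'p, 'n, 'z) smfunc_scheme \<Rightarrow> ('o, 'm, 'p, 'n, 'w) smfunc_scheme \<Rightarrow> bool" where
  "monoidally_isomorphic C D F G \<longleftrightarrow> (\<exists>t. is_monoidal_nat_iso C D F G t)"


section \<open>Infinite tensor products\<close>

text \<open>
  A countable index set is a set \<open>J\<close> of natural numbers, finite or infinite, and its subsets
  are linearly ordered by the order of \<open>nat\<close>. An arrow \<open>F \<rightarrow> F'\<close> of \<open>FinLO J\<close> is the pair
  \<open>(F, F')\<close> with \<open>F \<subseteq> F'\<close>. (If every finite subset were allowed to carry an arbitrary order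
  of its own, \<open>{1 < 2}\<close> and \<open>{2 < 1}\<close> would be unrelated, and the limit of the diagram below
  would not be a tensor product even for a two-element \<open>J\<close>.)
\<close>

definition FinLO :: "nat set \<Rightarrow> (nat set, nat set \<times> nat set) cat" where
  "FinLO J =
     \<lparr>Ob = {F. finite F \<and> F \<subseteq> J},
      Ar = {(F, F'). F \<subseteq> F' \<and> finite F' \<and> F' \<subseteq> J},
      Dom = fst, Cod = snd, Idt = (\<lambda>F. (F, F)), Comp = (\<lambda>v u. (fst u, snd v))\<rparr>"

text \<open>
  The tensor product of \<open>X j\<close> for \<open>j\<close> in the list \<open>[j\<^sub>1, \<dots>, j\<^sub>n]\<close> is bracketed as
  \<open>X j\<^sub>1 \<otimes> (\<dots> \<otimes> (X j\<^sub>n \<otimes> I))\<close>; \<open>proj_list C X F js\<close> deletes the factors outside \<open>F\<close>.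
\<close>

fun tens_list :: "('o, 'm, 'x) smcat_scheme \<Rightarrow> (nat \<Rightarrow> 'o) \<Rightarrow> nat list \<Rightarrow> 'o" where
  "tens_list C X [] = unit C"
| "tens_list C X (j # js) = X j \<otimes>\<^bsub>C\<^esub> tens_list C X js"

fun proj_list :: "('o, 'm, 'x) smcat_scheme \<Rightarrow> (nat \<Rightarrow> 'o) \<Rightarrow> nat set \<Rightarrow> nat list \<Rightarrow> 'm" where
  "proj_list C X F [] = Idt C (unit C)"
| "proj_list C X F (j # js) =
     (if j \<in> F then Idt C (X j) \<boxtimes>\<^bsub>C\<^esub> proj_list C X F js
      else lunit C (tens_list C X (filter (\<lambda>i. i \<in> F) js)) \<cdot>\<^bsub>C\<^esub> (del C (X j) \<boxtimes>\<^bsub>C\<^esub> proj_list C X F js))"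

text \<open>The abstract infinite tensor product, as a functor on \<open>op_cat (FinLO J)\<close>:\<close>

definition abstract_itp ::
    "('o, 'm, 'x) smcat_scheme \<Rightarrow> (nat \<Rightarrow> 'o) \<Rightarrow> (nat set, nat set \<times> nat set, 'o, 'm) func" where
  "abstract_itp C X =
     \<lparr>FO = (\<lambda>F. tens_list C X (sorted_list_of_set F)),
      FA = (\<lambda>(F, F'). proj_list C X F (sorted_list_of_set F'))\<rparr>"

definition rtensor :: "('o, 'm, 'x) smcat_scheme \<Rightarrow> 'o \<Rightarrow> ('o, 'm, 'o, 'm) func" where
  "rtensor C Y = \<lparr>FO = (\<lambda>A. A \<otimes>\<^bsub>C\<^esub> Y), FA = (\<lambda>f. f \<boxtimes>\<^bsub>C\<^esub> Idt C Y)\<rparr>"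

definition is_itp ::
    "('o, 'm, 'x) smcat_scheme \<Rightarrow> nat set \<Rightarrow> (nat \<Rightarrow> 'o) \<Rightarrow> 'o \<Rightarrow> (nat set \<Rightarrow> 'm) \<Rightarrow> bool" where
  "is_itp C J X L p \<longleftrightarrow>
     (\<forall>j \<in> J. X j \<in> Ob C) \<and>
     is_limit (op_cat (FinLO J)) C (abstract_itp C X) L p \<and>
     (\<forall>Y \<in> Ob C. is_limit (op_cat (FinLO J)) C (func_comp (rtensor C Y) (abstract_itp C X))
        (L \<otimes>\<^bsub>C\<^esub> Y) (\<lambda>F. p F \<boxtimes>\<^bsub>C\<^esub> Idt C Y))"

text \<open>The iterated structure isomorphism \<open>\<Otimes>\<^sub>j F (X j) \<rightarrow> F (\<Otimes>\<^sub>j X j)\<close>:\<close>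

fun mu_list ::
    "('o, 'm, 'x) smcat_scheme \<Rightarrow> ('p, 'n, 'y) smcat_scheme \<Rightarrow> ('o, 'm, 'p, 'n, 'z) smfunc_scheme \<Rightarrow>
     (nat \<Rightarrow> 'o) \<Rightarrow> nat list \<Rightarrow> 'n" where
  "mu_list C D F X [] = eps F"
| "mu_list C D F X (j # js) =
     mu F (X j) (tens_list C X js) \<cdot>\<^bsub>D\<^esub> (Idt D (FO F (X j)) \<boxtimes>\<^bsub>D\<^esub> mu_list C D F X js)"

definition itp_preserving ::
    "('o, 'm, 'x) smcat_scheme \<Rightarrow> ('p, 'n, 'y) smcat_scheme \<Rightarrow>
     ('o, 'm, 'p, 'n, 'z) smfunc_scheme \<Rightarrow> bool" where
  "itp_preserving C D F \<longleftrightarrow>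
     (\<forall>J X L p. is_itp C J X L p \<longrightarrow>
        is_itp D J (\<lambda>j. FO F (X j)) (FO F L)
          (\<lambda>S. inv_arrow D (mu_list C D F X (sorted_list_of_set S)) \<cdot>\<^bsub>D\<^esub> FA F (p S)))"


section \<open>Copresheaves and Day convolution\<close>

text \<open>Arrows carrying their source and target, used for all concrete categories below.\<close>

datatype ('o, 'f) arrow = Arrow (src: 'o) (fn: 'f) (tgt: 'o)

definition set_fun :: "'w set \<Rightarrow> ('w \<Rightarrow> 'w) \<Rightarrow> 'w set \<Rightarrow> ('w set, 'w \<Rightarrow> 'w) arrow" where
  "set_fun A f B = Arrow A (restrict f A) B"

definition SetCat :: "('w set, ('w set, 'w \<Rightarrow> 'w) arrow) cat" where
  "SetCat =
     \<lparr>Ob = UNIV, Ar = {f. fn f \<in> src f \<rightarrow>\<^sub>E tgt f}, Dom = src, Cod = tgt,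
      Idt = (\<lambda>A. set_fun A (\<lambda>x. x) A),
      Comp = (\<lambda>g f. set_fun (src f) (fn g \<circ> fn f) (tgt g))\<rparr>"

definition functor_cat ::
    "('o, 'm, 'x) cat_scheme \<Rightarrow> ('p, 'n, 'y) cat_scheme \<Rightarrow>
     (('o, 'm, 'p, 'n) func, (('o, 'm, 'p, 'n) func, 'o \<Rightarrow> 'n) arrow) cat" where
  "functor_cat C D =
     \<lparr>Ob = {F. is_functor C D F},
      Ar = {t. is_functor C D (src t) \<and> is_functor C D (tgt t) \<and>
               is_nat_trans C D (src t) (tgt t) (fn t) \<and> fn t \<in> extensional (Ob C)},
      Dom = src, Cod = tgt,
      Idt = (\<lambda>F. Arrow F (\<lambda>A\<in>Ob C. Idt D (FO F A)) F),
      Comp = (\<lambda>s t. Arrow (src t) (\<lambda>A\<in>Ob C. fn s A \<cdot>\<^bsub>D\<^esub> fn t A) (tgt s))\<rparr>"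

text \<open>
  The target of copresheaves on \<open>C\<close> is the category of subsets of the type \<open>elt\<close>, a universe
  containing the arrows of \<open>C\<close> and closed under the formation of generators
  \<open>(h : A \<otimes> B \<rightarrow> D, x \<in> F A, y \<in> G B)\<close> of the coend
  \<open>(F \<otimes> G) D = \<integral>\<^sup>A\<^sup>,\<^sup>B C(A \<otimes> B, D) \<times> F A \<times> G B\<close>.
\<close>

datatype ('o, 'm) elt =
  Hom_elt (arrow_of: 'm)
| Day_elt 'o 'o 'm "('o, 'm) elt" "('o, 'm) elt"

type_synonym ('o, 'm) set_arrow = "(('o, 'm) elt set, ('o, 'm) elt \<Rightarrow> ('o, 'm) elt) arrow"
type_synonym ('o, 'm) copsh = "('o, 'm, ('o, 'm) elt set, ('o, 'm) set_arrow) func"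
type_synonym ('o, 'm) copsh_arrow = "(('o, 'm) copsh, 'o \<Rightarrow> ('o, 'm) set_arrow) arrow"

text \<open>The representable \<open>C(A, -)\<close>:\<close>

definition hom_copsh :: "('o, 'm, 'x) cat_scheme \<Rightarrow> 'o \<Rightarrow> ('o, 'm) copsh" where
  "hom_copsh C A =
     \<lparr>FO = (\<lambda>B. Hom_elt ` hom C A B),
      FA = (\<lambda>g. set_fun (Hom_elt ` hom C A (Dom C g)) (\<lambda>e. Hom_elt (g \<cdot>\<^bsub>C\<^esub> arrow_of e))
                  (Hom_elt ` hom C A (Cod C g)))\<rparr>"

definition nat_arrow ::
    "('o, 'm, 'x) cat_scheme \<Rightarrow> ('o, 'm) copsh \<Rightarrow> ('o \<Rightarrow> ('o, 'm) elt \<Rightarrow> ('o, 'm) elt) \<Rightarrow>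
     ('o, 'm) copsh \<Rightarrow> ('o, 'm) copsh_arrow" where
  "nat_arrow C F t G = Arrow F (\<lambda>D\<in>Ob C. set_fun (FO F D) (t D) (FO G D)) G"

text \<open>
  The relation generating the coend, and the canonical representative of the class of a
  generator; the coend is the set of these representatives.
\<close>

inductive day_step ::
    "('o, 'm, 'x) smcat_scheme \<Rightarrow> ('o, 'm) copsh \<Rightarrow> ('o, 'm) copsh \<Rightarrow>
     ('o, 'm) elt \<Rightarrow> ('o, 'm) elt \<Rightarrow> bool"
  for C F G where
  "\<lbrakk>a \<in> hom C A A'; b \<in> hom C B B'; h \<in> hom C (A' \<otimes>\<^bsub>C\<^esub> B') D; x \<in> FO F A; y \<in> FO G B\<rbrakk> \<Longrightarrow>
     day_step C F G (Day_elt A B (h \<cdot>\<^bsub>C\<^esub> (a \<boxtimes>\<^bsub>C\<^esub> b)) x y)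
                    (Day_elt A' B' h (fn (FA F a) x) (fn (FA G b) y))"

definition day_cls ::
    "('o, 'm, 'x) smcat_scheme \<Rightarrow> ('o, 'm) copsh \<Rightarrow> ('o, 'm) copsh \<Rightarrow> ('o, 'm) elt \<Rightarrow> ('o, 'm) elt"
  where
  "day_cls C F G e = (SOME e'. equivclp (day_step C F G) e e')"

definition day_set ::
    "('o, 'm, 'x) smcat_scheme \<Rightarrow> ('o, 'm) copsh \<Rightarrow> ('o, 'm) copsh \<Rightarrow> 'o \<Rightarrow> ('o, 'm) elt set" where
  "day_set C F G D =
     {day_cls C F G (Day_elt A B h x y) | A B h x y.
        A \<in> Ob C \<and> B \<in> Ob C \<and> h \<in> hom C (A \<otimes>\<^bsub>C\<^esub> B) D \<and> x \<in> FO F A \<and> y \<in> FO G B}"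

definition day :: "('o, 'm, 'x) smcat_scheme \<Rightarrow> ('o, 'm) copsh \<Rightarrow> ('o, 'm) copsh \<Rightarrow> ('o, 'm) copsh" where
  "day C F G =
     \<lparr>FO = day_set C F G,
      FA = (\<lambda>k. set_fun (day_set C F G (Dom C k))
              (\<lambda>e. case e of Day_elt A B h x y \<Rightarrow> day_cls C F G (Day_elt A B (k \<cdot>\<^bsub>C\<^esub> h) x y))
              (day_set C F G (Cod C k)))\<rparr>"

text \<open>
  The symmetric monoidal category \<open>[C, Set]\<^sup>o\<^sup>p\<close>. An arrow from \<open>F\<close> to \<open>G\<close> is a natural
  transformation from \<open>G\<close> to \<open>F\<close>; accordingly, the transformations below are written in the
  direction opposite to that of the coherence arrows which they represent.
\<close>

definition copsh_op :: "('o, 'm, 'x) smcat_scheme \<Rightarrow> (('o, 'm) copsh, ('o, 'm) copsh_arrow) smcat" where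
  "copsh_op C =
     (let P = op_cat (functor_cat C SetCat); I = hom_copsh C (unit C) in
     \<lparr>Ob = Ob P, Ar = Ar P, Dom = Dom P, Cod = Cod P, Idt = Idt P, Comp = Comp P,
      tensO = day C,
      tensA = (\<lambda>s t. nat_arrow C (day C (src s) (src t))
        (\<lambda>D e. case e of Day_elt A B h x y \<Rightarrow>
           day_cls C (tgt s) (tgt t) (Day_elt A B h (fn (fn s A) x) (fn (fn t B) y)))
        (day C (tgt s) (tgt t))),
      unit = I,
      assoc = (\<lambda>F G H. nat_arrow C (day C F (day C G H))
        (\<lambda>D e. case e of Day_elt A Q k x w \<Rightarrow> (case w of Day_elt B E h y z \<Rightarrow>
           day_cls C (day C F G) H
             (Day_elt (A \<otimes>\<^bsub>C\<^esub> B) E (k \<cdot>\<^bsub>C\<^esub> (Idt C A \<boxtimes>\<^bsub>C\<^esub> h) \<cdot>\<^bsub>C\<^esub> assoc C A B E)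
               (day_cls C F G (Day_elt A B (Idt C (A \<otimes>\<^bsub>C\<^esub> B)) x y)) z)))
        (day C (day C F G) H)),
      lunit = (\<lambda>F. nat_arrow C F
        (\<lambda>D x. day_cls C I F (Day_elt (unit C) D (lunit C D) (Hom_elt (Idt C (unit C))) x))
        (day C I F)),
      runit = (\<lambda>F. nat_arrow C F
        (\<lambda>D x. day_cls C F I (Day_elt D (unit C) (runit C D) x (Hom_elt (Idt C (unit C)))))
        (day C F I)),
      braid = (\<lambda>F G. nat_arrow C (day C G F)
        (\<lambda>D e. case e of Day_elt A B h y x \<Rightarrow>
           day_cls C F G (Day_elt B A (h \<cdot>\<^bsub>C\<^esub> braid C B A) x y))
        (day C F G))\<rparr>)"

text \<open>The embedding \<open>\<iota> : C \<rightarrow> [C, Set]\<^sup>o\<^sup>p\<close>, \<open>A \<mapsto> C(A, -)\<close>:\<close>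

definition yoneda ::
    "('o, 'm, 'x) smcat_scheme \<Rightarrow> ('o, 'm, ('o, 'm) copsh, ('o, 'm) copsh_arrow) smfunc" where
  "yoneda C =
     \<lparr>FO = hom_copsh C,
      FA = (\<lambda>f. nat_arrow C (hom_copsh C (Cod C f)) (\<lambda>D e. Hom_elt (arrow_of e \<cdot>\<^bsub>C\<^esub> f))
                  (hom_copsh C (Dom C f))),
      mu = (\<lambda>A B. nat_arrow C (hom_copsh C (A \<otimes>\<^bsub>C\<^esub> B))
              (\<lambda>D e. day_cls C (hom_copsh C A) (hom_copsh C B)
                 (Day_elt A B (arrow_of e) (Hom_elt (Idt C A)) (Hom_elt (Idt C B))))
              (day C (hom_copsh C A) (hom_copsh C B))),
      eps = Idt (copsh_op C) (hom_copsh C (unit C))\<rparr>"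

text \<open>The category \<open>C\<^sup>\<otimes>\<^sup>\<infinity>\<close>:\<close>

definition itp_completion ::
    "('o, 'm, 'x) smcat_scheme \<Rightarrow> (('o, 'm) copsh, ('o, 'm) copsh_arrow) smcat" where
  "itp_completion C = full_subcat (copsh_op C)
     {L. \<exists>J X p. (\<forall>j \<in> J. X j \<in> Ob C) \<and>
        is_limit (op_cat (FinLO J)) (copsh_op C) (func_comp (yoneda C) (abstract_itp C X)) L p}"


section \<open>Finite sets and Stone spaces\<close>

text \<open>
  A universe of points over an arbitrary type \<open>'a\<close> of atoms, containing the point of the
  one-point space and closed under pairs and sequences, hence under the formation of points of
  binary and of countable topological products.
\<close>

datatype 'a point = Atom 'a | Star | Pr (p1: "'a point") (p2: "'a point") | Sq "nat \<Rightarrow> 'a point"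

definition pr_times :: "'a point set \<Rightarrow> 'a point set \<Rightarrow> 'a point set" where
  "pr_times A B = (\<lambda>(x, y). Pr x y) ` (A \<times> B)"

definition pr_assoc :: "'a point \<Rightarrow> 'a point" where
  "pr_assoc p = Pr (p1 (p1 p)) (Pr (p2 (p1 p)) (p2 p))"

definition pr_swap :: "'a point \<Rightarrow> 'a point" where
  "pr_swap p = Pr (p2 p) (p1 p)"

text \<open>
  In arrows of \<open>FinStoch\<close>, \<open>fn f y x\<close> is \<open>f(y | x)\<close>, set to \<open>0\<close> outside of the domain of
  definition.
\<close>

type_synonym 'a stoch = "('a point set, 'a point \<Rightarrow> 'a point \<Rightarrow> real) arrow"

definition fin_det :: "'a point set \<Rightarrow> ('a point \<Rightarrow> 'a point) \<Rightarrow> 'a point set \<Rightarrow> 'a stoch" where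
  "fin_det A h B = Arrow A (\<lambda>y x. if x \<in> A \<and> y = h x then 1 else 0) B"

definition FinStoch :: "('a point set, 'a stoch) smcat" where
  "FinStoch =
     \<lparr>Ob = {A. finite A},
      Ar = {f. finite (src f) \<and> finite (tgt f) \<and>
               (\<forall>y x. 0 \<le> fn f y x) \<and>
               (\<forall>x \<in> src f. (\<Sum>y\<in>tgt f. fn f y x) = 1) \<and>
               (\<forall>y x. y \<notin> tgt f \<or> x \<notin> src f \<longrightarrow> fn f y x = 0)},
      Dom = src, Cod = tgt,
      Idt = (\<lambda>A. fin_det A (\<lambda>x. x) A),
      Comp = (\<lambda>g f. Arrow (src f) (\<lambda>z x. \<Sum>y\<in>tgt f. fn g z y * fn f y x) (tgt g)),
      tensO = pr_times,
      tensA = (\<lambda>f h. Arrow (pr_times (src f) (src h))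
        (\<lambda>q p. if q \<in> pr_times (tgt f) (tgt h) \<and> p \<in> pr_times (src f) (src h)
               then fn f (p1 q) (p1 p) * fn h (p2 q) (p2 p) else 0)
        (pr_times (tgt f) (tgt h))),
      unit = {Star},
      assoc = (\<lambda>A B C. fin_det (pr_times (pr_times A B) C) pr_assoc (pr_times A (pr_times B C))),
      lunit = (\<lambda>A. fin_det (pr_times {Star} A) p2 A),
      runit = (\<lambda>A. fin_det (pr_times A {Star}) p1 A),
      braid = (\<lambda>A B. fin_det (pr_times A B) pr_swap (pr_times B A))\<rparr>"

definition Clopen :: "'p topology \<Rightarrow> 'p set set" where
  "Clopen T = {U. openin T U \<and> closedin T U}"

definition stone_space :: "'p topology \<Rightarrow> bool" where
  "stone_space T \<longleftrightarrow> compact_space T \<and> Hausdorff_space T \<and>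
     (\<forall>U x. openin T U \<and> x \<in> U \<longrightarrow> (\<exists>V \<in> Clopen T. x \<in> V \<and> V \<subseteq> U))"

definition locally_const :: "'p topology \<Rightarrow> ('p \<Rightarrow> 'b) \<Rightarrow> bool" where
  "locally_const S f \<longleftrightarrow> (\<forall>x \<in> topspace S. \<exists>V. openin S V \<and> x \<in> V \<and> (\<forall>y \<in> V. f y = f x))"

definition fin_add_prob :: "'p topology \<Rightarrow> ('p set \<Rightarrow> real) \<Rightarrow> bool" where
  "fin_add_prob T m \<longleftrightarrow>
     (\<forall>U \<in> Clopen T. 0 \<le> m U) \<and> m (topspace T) = 1 \<and>
     (\<forall>U \<in> Clopen T. \<forall>V \<in> Clopen T. U \<inter> V = {} \<longrightarrow> m (U \<union> V) = m U + m V)"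

text \<open>\<open>fn f U x\<close> is \<open>f(U | x)\<close>, set to \<open>0\<close> outside of the domain of definition.\<close>

type_synonym 'a kernel = "('a point topology, 'a point set \<Rightarrow> 'a point \<Rightarrow> real) arrow"

definition lc_kernel :: "'a kernel \<Rightarrow> bool" where
  "lc_kernel f \<longleftrightarrow>
     (\<forall>U \<in> Clopen (tgt f). locally_const (src f) (fn f U)) \<and>
     (\<forall>x \<in> topspace (src f). fin_add_prob (tgt f) (\<lambda>U. fn f U x)) \<and>
     (\<forall>U x. U \<notin> Clopen (tgt f) \<or> x \<notin> topspace (src f) \<longrightarrow> fn f U x = 0)"

definition stone_det ::
    "'a point topology \<Rightarrow> ('a point \<Rightarrow> 'a point) \<Rightarrow> 'a point topology \<Rightarrow> 'a kernel" where
  "stone_det S h T = Arrow S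
     (\<lambda>U x. if U \<in> Clopen T \<and> x \<in> topspace S \<and> h x \<in> U then 1 else 0) T"

text \<open>The product topology on pairs \<open>Pr x y\<close>:\<close>

definition stone_times :: "'a point topology \<Rightarrow> 'a point topology \<Rightarrow> 'a point topology" where
  "stone_times S T = pullback_topology (pr_times (topspace S) (topspace T))
     (\<lambda>p. (p1 p, p2 p)) (prod_topology S T)"

text \<open>
  Composition is the integral \<open>\<Sum>\<^sub>i g(V | U\<^sub>i) f(U\<^sub>i | x)\<close> for the partition of the middle space into
  the level sets of \<open>g(V | -)\<close>, which are finitely many clopen sets by compactness.
\<close>

definition StoneStoch :: "('a point topology, 'a kernel) smcat" where
  "StoneStoch =
     \<lparr>Ob = {T. stone_space T},
      Ar = {f. stone_space (src f) \<and> stone_space (tgt f) \<and> lc_kernel f},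
      Dom = src, Cod = tgt,
      Idt = (\<lambda>T. stone_det T (\<lambda>x. x) T),
      Comp = (\<lambda>g f. Arrow (src f)
        (\<lambda>V x. \<Sum>r \<in> fn g V ` topspace (tgt f). r * fn f {y \<in> topspace (tgt f). fn g V y = r} x)
        (tgt g)),
      tensO = stone_times,
      tensA = (\<lambda>f h. THE k.
        lc_kernel k \<and> src k = stone_times (src f) (src h) \<and> tgt k = stone_times (tgt f) (tgt h) \<and>
        (\<forall>U \<in> Clopen (tgt f). \<forall>V \<in> Clopen (tgt h). \<forall>x \<in> topspace (src f). \<forall>z \<in> topspace (src h).
           fn k (pr_times U V) (Pr x z) = fn f U x * fn h V z)),
      unit = discrete_topology {Star},
      assoc = (\<lambda>R S T. stone_det (stone_times (stone_times R S) T) pr_assoc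
                 (stone_times R (stone_times S T))),
      lunit = (\<lambda>T. stone_det (stone_times (discrete_topology {Star}) T) p2 T),
      runit = (\<lambda>T. stone_det (stone_times T (discrete_topology {Star})) p1 T),
      braid = (\<lambda>S T. stone_det (stone_times S T) pr_swap (stone_times T S))\<rparr>"

text \<open>
  The inclusion \<open>FinStoch \<hookrightarrow> StoneStoch\<close>. It is strict monoidal: the spaces
  \<open>stone_times (discrete_topology A) (discrete_topology B)\<close> and
  \<open>discrete_topology (pr_times A B)\<close> coincide for finite \<open>A\<close> and \<open>B\<close>.
\<close>

definition fin_incl :: "('a point set, 'a stoch, 'a point topology, 'a kernel) smfunc" where
  "fin_incl =
     \<lparr>FO = discrete_topology,
      FA = (\<lambda>f. Arrow (discrete_topology (src f))
              (\<lambda>U x. if U \<subseteq> tgt f then \<Sum>y\<in>U. fn f y x else 0) (discrete_topology (tgt f))),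
      mu = (\<lambda>A B. Idt StoneStoch (discrete_topology (pr_times A B))),
      eps = Idt StoneStoch (discrete_topology {Star})\<rparr>"

end

theory Submission
  imports Defs
begin

text \<open>
  An object of the completion is a limit, in \<open>[FinStoch, Set]\<^sup>o\<^sup>p\<close>, of the representables of the finite products
  \<open>X\<^sub>F\<close> of a countable family of finite sets \<open>X j\<close>. In the category of copresheaves this is a directed colimit, and
  it is formed pointwise: every element at \<open>B\<close> is the image of a generator \<open>l\<^sub>F\<close> under a stochastic matrix
  \<open>X\<^sub>F \<rightarrow> B\<close>, and two matrices give the same element if and only if they agree after composition with the
  projections from a later stage. This elementwise description is the locale \<open>presentation\<close>; the lemmas
  \<open>presentation_limit\<close> and \<open>limit_presentation\<close> pass between it and limits.

  The functor \<open>\<phi>\<close> is only known to preserve infinite tensor products, but the objects are given as limits of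
  representables. So one shows that these limits are infinite tensor products in the completion
  (\<open>FinStochI_itp\<close>). The diagrams agree up to isomorphism because the Yoneda embedding is strong monoidal. The
  limits are stable under tensoring because Day convolution preserves colimits in both variables, and this
  is proved on elements (\<open>product_presentation\<close>, \<open>rtensor_limit\<close>). In particular, the tensor product of two
  objects of the completion is the limit for the family which interleaves theirs, so the completion is
  closed under it. Consequently \<open>\<phi>\<close> sends the object for the family \<open>X\<close> to a limit of the diagram of
  finite discrete spaces \<open>X\<^sub>F\<close> (\<open>phi_limit\<close>).

  The topological product of the \<open>X j\<close> is also a limit of that diagram: each of its clopen sets is determined by
  finitely many coordinates, so a compatible family of kernels into the \<open>X\<^sub>F\<close> defines finitely additive
  measures on all clopen sets (\<open>sprod_limit\<close>). Thus \<open>\<phi>\<close> takes topological products as its values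
  (\<open>phi_product\<close>).

  For full faithfulness, let the target be a finite set \<open>B\<close> first. A kernel from the product to \<open>B\<close> is locally
  constant on a compact space and therefore factors through some \<open>X\<^sub>F\<close>, uniquely up to passing to a later stage
  (\<open>sprod_factor\<close>, \<open>sprod_factor_unique\<close>). This is the same description as that of the elements at \<open>B\<close> of the
  copresheaf, that is, of the arrows to \<open>B\<close> in the completion (\<open>phi_bij_finite\<close>). A general target is a
  limit of finite sets, and \<open>\<phi>\<close> preserves this limit.

  The essential image is determined up to isomorphism of kernels in this way. It is determined up to
  homeomorphism because an isomorphism of kernels is deterministic (\<open>iso_kernel_det\<close>).
\<close>

section \<open>Categories, limits and symmetric monoidal functors\<close>

locale category =
  fixes C :: "('o, 'm, 'x) cat_scheme" (structure)
  assumes dom_ob: "f \<in> Ar C \<Longrightarrow> Dom C f \<in> Ob C"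
    and cod_ob: "f \<in> Ar C \<Longrightarrow> Cod C f \<in> Ob C"
    and id_hom: "A \<in> Ob C \<Longrightarrow> Idt C A \<in> hom C A A"
    and comp_hom: "f \<in> hom C A B \<Longrightarrow> g \<in> hom C B D \<Longrightarrow> g \<cdot> f \<in> hom C A D"
    and id_left: "f \<in> hom C A B \<Longrightarrow> Idt C B \<cdot> f = f"
    and id_right: "f \<in> hom C A B \<Longrightarrow> f \<cdot> Idt C A = f"
    and comp_assoc: "f \<in> hom C A B \<Longrightarrow> g \<in> hom C B D \<Longrightarrow> h \<in> hom C D E \<Longrightarrow>
      (h \<cdot> g) \<cdot> f = h \<cdot> g \<cdot> f"
begin

lemma hom_ob: "f \<in> hom C A B \<Longrightarrow> A \<in> Ob C \<and> B \<in> Ob C"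
  using dom_ob cod_ob by (auto simp: hom_def)

lemma inverse_arrows_iff:
  assumes "f \<in> hom C A B"
  shows "inverse_arrows C f g \<longleftrightarrow> g \<in> hom C B A \<and> g \<cdot> f = Idt C A \<and> f \<cdot> g = Idt C B"
  using assms by (auto simp: inverse_arrows_def hom_def)

lemma inverse_arrows_unique:
  assumes f: "f \<in> hom C A B" and g: "inverse_arrows C f g" and g': "inverse_arrows C f g'"
  shows "g = g'"
proof -
  have gh: "g \<in> hom C B A" "g \<cdot> f = Idt C A" "g' \<in> hom C B A" "f \<cdot> g' = Idt C B"
    using f g g' by (auto simp: inverse_arrows_iff)
  have "g = g \<cdot> f \<cdot> g'"
    using gh by (simp add: id_right)
  also have "\<dots> = g'"
    using gh comp_assoc[OF gh(3) f gh(1)] by (simp add: id_left)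
  finally show ?thesis .
qed

lemma inv_arrow:
  assumes "f \<in> hom C A B" and "is_iso C f"
  shows "inv_arrow C f \<in> hom C B A" "inv_arrow C f \<cdot> f = Idt C A" "f \<cdot> inv_arrow C f = Idt C B"
proof -
  obtain g where "inverse_arrows C f g"
    using assms(2) by (auto simp: is_iso_def)
  then have "inverse_arrows C f (inv_arrow C f)"
    unfolding inv_arrow_def using inverse_arrows_unique[OF assms(1)] by (metis theI)
  then show "inv_arrow C f \<in> hom C B A" "inv_arrow C f \<cdot> f = Idt C A" "f \<cdot> inv_arrow C f = Idt C B"
    using inverse_arrows_iff[OF assms(1)] by auto
qed

lemma isoI:
  assumes "f \<in> hom C A B" "g \<in> hom C B A" "g \<cdot> f = Idt C A" "f \<cdot> g = Idt C B"
  shows "is_iso C f"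
  using assms inverse_arrows_iff[OF assms(1)] by (auto simp: is_iso_def)

lemma inv_iso:
  assumes "f \<in> hom C A B" and "is_iso C f"
  shows "is_iso C (inv_arrow C f)"
  using isoI[OF inv_arrow(1)[OF assms] assms(1)] inv_arrow[OF assms] by blast

lemma inv_arrow_cancel:
  assumes f: "f \<in> hom C A B" "is_iso C f"
  shows "g \<in> hom C E A \<Longrightarrow> inv_arrow C f \<cdot> f \<cdot> g = g"
    and "g \<in> hom C E B \<Longrightarrow> f \<cdot> inv_arrow C f \<cdot> g = g"
  using comp_assoc[OF _ f(1) inv_arrow(1)[OF f]] comp_assoc[OF _ inv_arrow(1)[OF f] f(1)]
    inv_arrow[OF f] id_left by metis+

lemma iso_comp:
  assumes f: "f \<in> hom C A B" "is_iso C f" and g: "g \<in> hom C B D" "is_iso C g"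
  shows "is_iso C (g \<cdot> f)"
proof (rule isoI)
  note i = inv_arrow[OF f] and j = inv_arrow[OF g]
  show "g \<cdot> f \<in> hom C A D" "inv_arrow C f \<cdot> inv_arrow C g \<in> hom C D A"
    using f g i j comp_hom by blast+
  show "(inv_arrow C f \<cdot> inv_arrow C g) \<cdot> g \<cdot> f = Idt C A"
    using comp_assoc[OF comp_hom[OF f(1) g(1)] j(1) i(1)] inv_arrow_cancel(1)[OF g f(1)] i
    by simp
  show "(g \<cdot> f) \<cdot> inv_arrow C f \<cdot> inv_arrow C g = Idt C D"
    using comp_assoc[OF comp_hom[OF j(1) i(1)] f(1) g(1)] inv_arrow_cancel(2)[OF f j(1)] j
    by simp
qed

lemma iso_id: "A \<in> Ob C \<Longrightarrow> is_iso C (Idt C A)"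
  by (rule isoI[of _ A A "Idt C A"]) (auto simp: id_hom id_left[OF id_hom])

lemma iso_monic:
  assumes f: "f \<in> hom C A B" "is_iso C f" and "g \<in> hom C E A" "g' \<in> hom C E A" "f \<cdot> g = f \<cdot> g'"
  shows "g = g'"
  using inv_arrow_cancel(1)[OF f] assms(3-) by metis

end

text \<open>
  A diagram is recorded by the types of its values only, since cones and limits do not compare its
  values on composite arrows.
\<close>

definition is_diagram where
  "is_diagram K C D \<longleftrightarrow> (\<forall>k \<in> Ob K. FO D k \<in> Ob C) \<and>
     (\<forall>u \<in> Ar K. Dom K u \<in> Ob K \<and> Cod K u \<in> Ob K \<and> FA D u \<in> hom C (FO D (Dom K u)) (FO D (Cod K u)))"

lemma is_limit_cong:
  assumes "is_limit K C D L p"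
    and "\<And>k. k \<in> Ob K \<Longrightarrow> FO D k = FO D' k" "\<And>k. k \<in> Ob K \<Longrightarrow> p k = p' k"
    and "\<And>u. u \<in> Ar K \<Longrightarrow> FA D u = FA D' u \<and> Dom K u \<in> Ob K \<and> Cod K u \<in> Ob K"
  shows "is_limit K C D' L p'"
proof -
  have "is_cone K C D' M q \<longleftrightarrow> is_cone K C D M q" for M q
    using assms(2,4) by (simp add: is_cone_def)
  moreover have "is_cone K C D L p' \<longleftrightarrow> is_cone K C D L p"
    using assms(3,4) by (simp add: is_cone_def)
  moreover have "(\<forall>k\<in>Ob K. p' k \<cdot>\<^bsub>C\<^esub> h = q k) \<longleftrightarrow> (\<forall>k\<in>Ob K. p k \<cdot>\<^bsub>C\<^esub> h = q k)" for h q
    using assms(3) by simp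
  ultimately show ?thesis
    using assms(1) by (simp add: is_limit_def)
qed

context category
begin

lemma cone_precomp:
  assumes "is_diagram K C D" "is_cone K C D L p" "h \<in> hom C M L"
  shows "is_cone K C D M (\<lambda>k. p k \<cdot> h)"
  unfolding is_cone_def
proof (intro conjI ballI)
  show "M \<in> Ob C"
    using hom_ob[OF assms(3)] by simp
  show "p k \<cdot> h \<in> hom C M (FO D k)" if "k \<in> Ob K" for k
    using assms that comp_hom by (auto simp: is_cone_def)
  show "FA D u \<cdot> p (Dom K u) \<cdot> h = p (Cod K u) \<cdot> h" if "u \<in> Ar K" for u
  proof -
    have "p (Dom K u) \<in> hom C L (FO D (Dom K u))" "FA D u \<in> hom C (FO D (Dom K u)) (FO D (Cod K u))"
      "FA D u \<cdot> p (Dom K u) = p (Cod K u)"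
      using assms(1,2) that by (auto simp: is_diagram_def is_cone_def)
    then show ?thesis
      using comp_assoc[OF assms(3)] by metis
  qed
qed

lemma limit_jointly_monic:
  assumes "is_diagram K C D" "is_limit K C D L p" "h \<in> hom C M L" "h' \<in> hom C M L"
    and "\<And>k. k \<in> Ob K \<Longrightarrow> p k \<cdot> h = p k \<cdot> h'"
  shows "h = h'"
proof -
  have "is_cone K C D M (\<lambda>k. p k \<cdot> h)"
    using assms cone_precomp by (auto simp: is_limit_def)
  then have "\<exists>!g. g \<in> hom C M L \<and> (\<forall>k \<in> Ob K. p k \<cdot> g = p k \<cdot> h)"
    using assms(2) by (auto simp: is_limit_def)
  then show ?thesis
    using assms(3-5) by metis
qed

lemma limit_unique:
  assumes D: "is_diagram K C D" and L: "is_limit K C D L p" and L': "is_limit K C D L' p'"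
  obtains h where "h \<in> hom C L L'" "is_iso C h" "\<And>k. k \<in> Ob K \<Longrightarrow> p' k \<cdot> h = p k"
proof -
  have c: "is_cone K C D L p" "is_cone K C D L' p'"
    using L L' by (auto simp: is_limit_def)
  obtain h where h: "h \<in> hom C L L'" "\<And>k. k \<in> Ob K \<Longrightarrow> p' k \<cdot> h = p k"
    using L' c(1) unfolding is_limit_def by metis
  obtain g where g: "g \<in> hom C L' L" "\<And>k. k \<in> Ob K \<Longrightarrow> p k \<cdot> g = p' k"
    using L c(2) unfolding is_limit_def by metis
  have gh: "g \<cdot> h \<in> hom C L L" "h \<cdot> g \<in> hom C L' L'"
    using h g comp_hom by blast+
  have o: "L \<in> Ob C" "L' \<in> Ob C"
    using h hom_ob by auto
  have pk: "p k \<in> hom C L (FO D k)" "p' k \<in> hom C L' (FO D k)" if "k \<in> Ob K" for k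
    using c that by (auto simp: is_cone_def)
  have "g \<cdot> h = Idt C L"
    by (rule limit_jointly_monic[OF D L gh(1) id_hom[OF o(1)]])
       (metis pk comp_assoc[OF h(1) g(1)] g(2) h(2) id_right)
  moreover have "h \<cdot> g = Idt C L'"
    by (rule limit_jointly_monic[OF D L' gh(2) id_hom[OF o(2)]])
       (metis pk comp_assoc[OF g(1) h(1)] g(2) h(2) id_right)
  ultimately show ?thesis
    using that h g isoI by metis
qed

lemma limit_transport:
  assumes D: "is_diagram K C D" and D': "is_diagram K C D'"
    and a: "\<And>k. k \<in> Ob K \<Longrightarrow> a k \<in> hom C (FO D k) (FO D' k)" "\<And>k. k \<in> Ob K \<Longrightarrow> is_iso C (a k)"
    and nat: "\<And>u. u \<in> Ar K \<Longrightarrow> FA D' u \<cdot> a (Dom K u) = a (Cod K u) \<cdot> FA D u"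
    and L: "is_limit K C D L p"
  shows "is_limit K C D' L (\<lambda>k. a k \<cdot> p k)"
  unfolding is_limit_def
proof (intro conjI allI impI)
  have c: "is_cone K C D L p"
    using L by (simp add: is_limit_def)
  have pk: "p k \<in> hom C L (FO D k)" if "k \<in> Ob K" for k
    using c that by (auto simp: is_cone_def)
  show "is_cone K C D' L (\<lambda>k. a k \<cdot> p k)"
    unfolding is_cone_def
  proof (intro conjI ballI)
    show "L \<in> Ob C" using c by (simp add: is_cone_def)
    show "a k \<cdot> p k \<in> hom C L (FO D' k)" if "k \<in> Ob K" for k
      using a pk that comp_hom by blast
    fix u assume u: "u \<in> Ar K"
    have uo: "Dom K u \<in> Ob K" "Cod K u \<in> Ob K" "FA D u \<in> hom C (FO D (Dom K u)) (FO D (Cod K u))"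
       "FA D' u \<in> hom C (FO D' (Dom K u)) (FO D' (Cod K u))"
      using D D' u by (auto simp: is_diagram_def)
    have "FA D' u \<cdot> a (Dom K u) \<cdot> p (Dom K u) = (a (Cod K u) \<cdot> FA D u) \<cdot> p (Dom K u)"
      using comp_assoc[OF pk[OF uo(1)] a(1)[OF uo(1)] uo(4)] nat[OF u] by simp
    also have "\<dots> = a (Cod K u) \<cdot> p (Cod K u)"
      using comp_assoc[OF pk[OF uo(1)] uo(3) a(1)[OF uo(2)]] c u by (simp add: is_cone_def)
    finally show "FA D' u \<cdot> a (Dom K u) \<cdot> p (Dom K u) = a (Cod K u) \<cdot> p (Cod K u)" .
  qed
  fix M q assume q: "is_cone K C D' M q"
  have qk: "q k \<in> hom C M (FO D' k)" if "k \<in> Ob K" for k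
    using q that by (auto simp: is_cone_def)
  define b where "b k = inv_arrow C (a k)" for k
  have b: "b k \<in> hom C (FO D' k) (FO D k)" if "k \<in> Ob K" for k
    unfolding b_def using inv_arrow(1) a that by blast
  have bc: "is_cone K C D M (\<lambda>k. b k \<cdot> q k)"
    unfolding is_cone_def
  proof (intro conjI ballI)
    show "M \<in> Ob C" using q by (simp add: is_cone_def)
    show "b k \<cdot> q k \<in> hom C M (FO D k)" if "k \<in> Ob K" for k
      using b qk that comp_hom by blast
    fix u assume u: "u \<in> Ar K"
    have uo: "Dom K u \<in> Ob K" "Cod K u \<in> Ob K" "FA D u \<in> hom C (FO D (Dom K u)) (FO D (Cod K u))"
       "FA D' u \<in> hom C (FO D' (Dom K u)) (FO D' (Cod K u))"
      using D D' u by (auto simp: is_diagram_def)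
    note bq = comp_hom[OF qk[OF uo(1)] b[OF uo(1)]]
    show "FA D u \<cdot> b (Dom K u) \<cdot> q (Dom K u) = b (Cod K u) \<cdot> q (Cod K u)"
    proof (rule iso_monic[OF a[OF uo(2)] comp_hom[OF bq uo(3)] comp_hom[OF qk[OF uo(2)] b[OF uo(2)]]])
      have "a (Cod K u) \<cdot> FA D u \<cdot> b (Dom K u) \<cdot> q (Dom K u)
          = FA D' u \<cdot> a (Dom K u) \<cdot> b (Dom K u) \<cdot> q (Dom K u)"
        using comp_assoc[OF bq uo(3) a(1)[OF uo(2)]] comp_assoc[OF bq a(1)[OF uo(1)] uo(4)] nat[OF u]
        by simp
      also have "a (Dom K u) \<cdot> b (Dom K u) \<cdot> q (Dom K u) = q (Dom K u)"
        unfolding b_def using inv_arrow_cancel(2) a qk uo by blast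
      also have "FA D' u \<cdot> q (Dom K u) = q (Cod K u)"
        using q u by (simp add: is_cone_def)
      also have "q (Cod K u) = a (Cod K u) \<cdot> b (Cod K u) \<cdot> q (Cod K u)"
        unfolding b_def using inv_arrow_cancel(2) a qk uo by metis
      finally show "a (Cod K u) \<cdot> FA D u \<cdot> b (Dom K u) \<cdot> q (Dom K u)
        = a (Cod K u) \<cdot> b (Cod K u) \<cdot> q (Cod K u)" .
    qed
  qed
  have eq: "(a k \<cdot> p k) \<cdot> h = q k \<longleftrightarrow> p k \<cdot> h = b k \<cdot> q k" if "k \<in> Ob K" "h \<in> hom C M L" for h k
  proof -
    have "(a k \<cdot> p k) \<cdot> h = a k \<cdot> p k \<cdot> h"
      using comp_assoc[OF that(2) pk a(1)] that by blast
    moreover have "b k \<cdot> a k \<cdot> p k \<cdot> h = p k \<cdot> h" "a k \<cdot> b k \<cdot> q k = q k"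
      unfolding b_def using inv_arrow_cancel a that qk comp_hom[OF that(2) pk] by blast+
    ultimately show ?thesis by metis
  qed
  have "\<exists>!h. h \<in> hom C M L \<and> (\<forall>k \<in> Ob K. p k \<cdot> h = b k \<cdot> q k)"
    using L bc by (auto simp: is_limit_def)
  then show "\<exists>!h. h \<in> hom C M L \<and> (\<forall>k \<in> Ob K. (a k \<cdot> p k) \<cdot> h = q k)"
    using eq by (metis (no_types, lifting))
qed

end

lemma full_subcat_simps [simp]:
  "Ob (full_subcat C S) = S" "Dom (full_subcat C S) = Dom C" "Cod (full_subcat C S) = Cod C"
  "Idt (full_subcat C S) = Idt C" "Comp (full_subcat C S) = Comp C"
  by (simp_all add: full_subcat_def)

lemma full_subcat_hom: "hom (full_subcat C S) A B = (if A \<in> S \<and> B \<in> S then hom C A B else {})"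
  by (auto simp: full_subcat_def hom_def)

lemma (in category) full_subcat_category:
  assumes "S \<subseteq> Ob C"
  shows "category (full_subcat C S)"
proof
  show "f \<in> Ar (full_subcat C S) \<Longrightarrow> Dom (full_subcat C S) f \<in> Ob (full_subcat C S)" for f
    by (simp add: full_subcat_def)
  show "f \<in> Ar (full_subcat C S) \<Longrightarrow> Cod (full_subcat C S) f \<in> Ob (full_subcat C S)" for f
    by (simp add: full_subcat_def)
  show "A \<in> Ob (full_subcat C S) \<Longrightarrow> Idt (full_subcat C S) A \<in> hom (full_subcat C S) A A" for A
    using assms id_hom by (auto simp: full_subcat_hom)
qed (auto simp: full_subcat_hom id_left id_right comp_assoc comp_hom split: if_splits)

lemma full_subcat_limit:
  assumes "is_limit K C D L p" "L \<in> S" "\<And>k. k \<in> Ob K \<Longrightarrow> FO D k \<in> S" "S \<subseteq> Ob C"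
  shows "is_limit K (full_subcat C S) D L p"
proof -
  have sub: "is_cone K C D M q" if "is_cone K (full_subcat C S) D M q" for M q
    using that assms(3,4) unfolding is_limit_def is_cone_def
    by (auto simp: full_subcat_hom split: if_splits)
  have ob: "M \<in> S" if "is_cone K (full_subcat C S) D M q" for M q
    using that by (simp add: is_cone_def)
  have "is_cone K (full_subcat C S) D L p"
    using assms unfolding is_limit_def is_cone_def by (auto simp: full_subcat_hom)
  moreover have "\<exists>!h. h \<in> hom (full_subcat C S) M L \<and> (\<forall>k\<in>Ob K. p k \<cdot>\<^bsub>full_subcat C S\<^esub> h = q k)"
    if "is_cone K (full_subcat C S) D M q" for M q
    using assms(1,2) sub[OF that] ob[OF that] unfolding is_limit_def by (simp add: full_subcat_hom)
  ultimately show ?thesis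
    unfolding is_limit_def by blast
qed

lemma op_cat_simps [simp]:
  "Ob (op_cat C) = Ob C" "Ar (op_cat C) = Ar C" "Dom (op_cat C) = Cod C" "Cod (op_cat C) = Dom C"
  "Idt (op_cat C) = Idt C" "Comp (op_cat C) = (\<lambda>g f. f \<cdot>\<^bsub>C\<^esub> g)"
  by (simp_all add: op_cat_def)

lemma FinLO_simps [simp]:
  "Ob (FinLO J) = {F. finite F \<and> F \<subseteq> J}"
  "Ar (FinLO J) = {(F, F'). F \<subseteq> F' \<and> finite F' \<and> F' \<subseteq> J}"
  "Dom (FinLO J) = fst" "Cod (FinLO J) = snd"
  by (simp_all add: FinLO_def)

lemma abstract_itp_simps:
  "FO (abstract_itp C X) F = tens_list C X (sorted_list_of_set F)"
  "FA (abstract_itp C X) (F, F') = proj_list C X F (sorted_list_of_set F')"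
  by (simp_all add: abstract_itp_def)

lemma func_comp_simps [simp]:
  "FO (func_comp G F) A = FO G (FO F A)" "FA (func_comp G F) f = FA G (FA F f)"
  by (simp_all add: func_comp_def)

lemma rtensor_simps [simp]:
  "FO (rtensor C Y) A = A \<otimes>\<^bsub>C\<^esub> Y" "FA (rtensor C Y) f = f \<boxtimes>\<^bsub>C\<^esub> Idt C Y"
  by (simp_all add: rtensor_def)

lemma is_functorD:
  assumes "is_functor C D F"
  shows "A \<in> Ob C \<Longrightarrow> FO F A \<in> Ob D"
    and "f \<in> hom C A B \<Longrightarrow> FA F f \<in> hom D (FO F A) (FO F B)"
    and "A \<in> Ob C \<Longrightarrow> FA F (Idt C A) = Idt D (FO F A)"
    and "f \<in> hom C A B \<Longrightarrow> g \<in> hom C B E \<Longrightarrow> FA F (g \<cdot>\<^bsub>C\<^esub> f) = FA F g \<cdot>\<^bsub>D\<^esub> FA F f"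
  using assms by (auto simp: is_functor_def hom_def)

lemma diagram_functor:
  assumes "is_diagram K C D" "is_functor C E F"
  shows "is_diagram K E (func_comp F D)"
  using assms is_functorD[OF assms(2)] by (auto simp: is_diagram_def)

lemma sorted_list_of_set_filter:
  assumes "finite F'" "F \<subseteq> F'"
  shows "filter (\<lambda>i. i \<in> F) (sorted_list_of_set F') = sorted_list_of_set F"
proof -
  have "set (filter (\<lambda>i. i \<in> F) (sorted_list_of_set F')) = F"
    using assms by (auto simp: finite_subset)
  moreover have "sorted (filter (\<lambda>i. i \<in> F) (sorted_list_of_set F'))"
    by (simp add: sorted_wrt_filter)
  moreover have "distinct (filter (\<lambda>i. i \<in> F) (sorted_list_of_set F'))"
    by simp
  ultimately show ?thesis
    by (metis sorted_list_of_set.idem_if_sorted_distinct)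
qed

text \<open>
  The part of the structure of a symmetric monoidal category from which the diagram of an
  infinite tensor product is built.
\<close>

locale tensor_category = category C
  for C :: "('o, 'm, 'x) smcat_scheme" (structure) +
  assumes tens_ob: "A \<in> Ob C \<Longrightarrow> B \<in> Ob C \<Longrightarrow> A \<otimes> B \<in> Ob C"
    and tens_hom: "f \<in> hom C A A' \<Longrightarrow> g \<in> hom C B B' \<Longrightarrow> f \<boxtimes> g \<in> hom C (A \<otimes> B) (A' \<otimes> B')"
    and tens_id: "A \<in> Ob C \<Longrightarrow> B \<in> Ob C \<Longrightarrow> Idt C A \<boxtimes> Idt C B = Idt C (A \<otimes> B)"
    and tens_comp: "f \<in> hom C A A' \<Longrightarrow> f' \<in> hom C A' A'' \<Longrightarrow> g \<in> hom C B B' \<Longrightarrow> g' \<in> hom C B' B'' \<Longrightarrow>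
      (f' \<cdot> f) \<boxtimes> (g' \<cdot> g) = (f' \<boxtimes> g') \<cdot> (f \<boxtimes> g)"
    and unit_ob: "unit C \<in> Ob C"
    and lunit_hom: "A \<in> Ob C \<Longrightarrow> lunit C A \<in> hom C (unit C \<otimes> A) A"
    and lunit_nat: "f \<in> hom C A B \<Longrightarrow> lunit C B \<cdot> (Idt C (unit C) \<boxtimes> f) = f \<cdot> lunit C A"

locale semicartesian = tensor_category +
  assumes terminal: "A \<in> Ob C \<Longrightarrow> \<exists>!f. f \<in> hom C A (unit C)"
begin

lemma del_hom: "A \<in> Ob C \<Longrightarrow> del C A \<in> hom C A (unit C)"
  unfolding del_def using theI'[OF terminal] by blast

lemma del_unique: "f \<in> hom C A (unit C) \<Longrightarrow> f = del C A"
  using hom_ob[of f A] terminal del_hom by blast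

lemma tens_list_ob: "(\<And>j. j \<in> set js \<Longrightarrow> X j \<in> Ob C) \<Longrightarrow> tens_list C X js \<in> Ob C"
  by (induction js) (auto simp: unit_ob tens_ob)

lemma proj_list_hom:
  "(\<And>j. j \<in> set js \<Longrightarrow> X j \<in> Ob C) \<Longrightarrow>
   proj_list C X F js \<in> hom C (tens_list C X js) (tens_list C X (filter (\<lambda>i. i \<in> F) js))"
proof (induction js)
  case Nil
  then show ?case by (simp add: id_hom unit_ob)
next
  case (Cons j js)
  have p: "proj_list C X F js \<in> hom C (tens_list C X js) (tens_list C X (filter (\<lambda>i. i \<in> F) js))"
    and o: "X j \<in> Ob C"
    using Cons by auto
  show ?case
    using tens_hom[OF id_hom[OF o] p] tens_hom[OF del_hom[OF o] p] comp_hom lunit_hom hom_ob[OF p]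
    by fastforce
qed

lemma abstract_itp_diagram:
  assumes "\<And>j. j \<in> J \<Longrightarrow> X j \<in> Ob C"
  shows "is_diagram (op_cat (FinLO J)) C (abstract_itp C X)"
proof -
  have "proj_list C X F (sorted_list_of_set F') \<in>
      hom C (tens_list C X (sorted_list_of_set F')) (tens_list C X (sorted_list_of_set F))"
    if "F \<subseteq> F'" "finite F'" "F' \<subseteq> J" for F F'
    using that proj_list_hom[of "sorted_list_of_set F'" X F] assms
    by (auto simp: sorted_list_of_set_filter)
  moreover have "tens_list C X (sorted_list_of_set F) \<in> Ob C" if "finite F" "F \<subseteq> J" for F
    using that assms tens_list_ob[of "sorted_list_of_set F" X] by auto
  ultimately show ?thesis
    by (auto simp: is_diagram_def abstract_itp_simps finite_subset)
qed

lemma rtensor_functor: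
  assumes "Y \<in> Ob C"
  shows "is_functor C C (rtensor C Y)"
  unfolding is_functor_def
proof (intro conjI ballI impI)
  note i = id_hom[OF assms]
  show "FO (rtensor C Y) A \<in> Ob C" if "A \<in> Ob C" for A
    using that assms tens_ob by simp
  show "FA (rtensor C Y) f \<in> hom C (FO (rtensor C Y) (Dom C f)) (FO (rtensor C Y) (Cod C f))"
    if "f \<in> Ar C" for f
    using that by (auto intro!: tens_hom i) (simp add: hom_def)
  show "FA (rtensor C Y) (Idt C A) = Idt C (FO (rtensor C Y) A)" if "A \<in> Ob C" for A
    using that assms tens_id by simp
  show "FA (rtensor C Y) (g \<cdot> f) = FA (rtensor C Y) g \<cdot> FA (rtensor C Y) f"
    if "f \<in> Ar C" "g \<in> Ar C" "Cod C f = Dom C g" for f g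
    using that tens_comp[of f _ _ g, OF _ _ i i] id_left[OF i] by (simp add: hom_def)
qed

lemma tens_iso:
  assumes f: "f \<in> hom C A A'" "is_iso C f" and g: "g \<in> hom C B B'" "is_iso C g"
  shows "is_iso C (f \<boxtimes> g)"
proof (rule isoI[OF tens_hom[OF f(1) g(1)] tens_hom[OF inv_arrow(1)[OF f] inv_arrow(1)[OF g]]])
  show "(inv_arrow C f \<boxtimes> inv_arrow C g) \<cdot> (f \<boxtimes> g) = Idt C (A \<otimes> B)"
    using tens_comp[OF f(1) inv_arrow(1)[OF f] g(1) inv_arrow(1)[OF g]]
      inv_arrow[OF f] inv_arrow[OF g] tens_id hom_ob[OF f(1)] hom_ob[OF g(1)] by simp
  show "(f \<boxtimes> g) \<cdot> (inv_arrow C f \<boxtimes> inv_arrow C g) = Idt C (A' \<otimes> B')"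
    using tens_comp[OF inv_arrow(1)[OF f] f(1) inv_arrow(1)[OF g] g(1)]
      inv_arrow[OF f] inv_arrow[OF g] tens_id hom_ob[OF f(1)] hom_ob[OF g(1)] by simp
qed

end

text \<open>
  The part of the structure of a strong symmetric monoidal functor that is compatible with the
  diagrams of infinite tensor products.
\<close>

locale tensor_functor = C: semicartesian C + D: semicartesian D
  for C :: "('o, 'm, 'x) smcat_scheme" and D :: "('p, 'n, 'y) smcat_scheme"
    and F :: "('o, 'm, 'p, 'n, 'z) smfunc_scheme" +
  assumes F_functor: "is_functor C D F"
    and mu_hom: "A \<in> Ob C \<Longrightarrow> B \<in> Ob C \<Longrightarrow>
        mu F A B \<in> hom D (FO F A \<otimes>\<^bsub>D\<^esub> FO F B) (FO F (A \<otimes>\<^bsub>C\<^esub> B))"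
    and mu_iso: "A \<in> Ob C \<Longrightarrow> B \<in> Ob C \<Longrightarrow> is_iso D (mu F A B)"
    and mu_nat: "f \<in> hom C A A' \<Longrightarrow> g \<in> hom C B B' \<Longrightarrow>
        mu F A' B' \<cdot>\<^bsub>D\<^esub> (FA F f \<boxtimes>\<^bsub>D\<^esub> FA F g) = FA F (f \<boxtimes>\<^bsub>C\<^esub> g) \<cdot>\<^bsub>D\<^esub> mu F A B"
    and eps_hom: "eps F \<in> hom D (unit D) (FO F (unit C))"
    and eps_iso: "is_iso D (eps F)"
    and mu_lunit: "A \<in> Ob C \<Longrightarrow>
        FA F (lunit C A) \<cdot>\<^bsub>D\<^esub> mu F (unit C) A \<cdot>\<^bsub>D\<^esub> (eps F \<boxtimes>\<^bsub>D\<^esub> Idt D (FO F A)) = lunit D (FO F A)"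

lemma smfunctor_tensor_functor:
  assumes "is_smfunctor C D F" "semicartesian C" "semicartesian D"
  shows "tensor_functor C D F"
  using assms by (auto simp: tensor_functor_def tensor_functor_axioms_def is_smfunctor_def hom_def)

context tensor_functor
begin

lemma F_ob: "A \<in> Ob C \<Longrightarrow> FO F A \<in> Ob D"
  and F_hom: "f \<in> hom C A B \<Longrightarrow> FA F f \<in> hom D (FO F A) (FO F B)"
  using is_functorD[OF F_functor] by blast+

lemma F_del: 
  assumes "A \<in> Ob C" 
  shows "FA F (del C A) = eps F \<cdot>\<^bsub>D\<^esub> del D (FO F A)"
proof -
  note i = D.inv_arrow[OF eps_hom eps_iso]
  have d: "FA F (del C A) \<in> hom D (FO F A) (FO F (unit C))"
    using F_hom C.del_hom assms by blast
  have "inv_arrow D (eps F) \<cdot>\<^bsub>D\<^esub> FA F (del C A) = del D (FO F A)"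
    by (rule D.del_unique) (rule D.comp_hom[OF d i(1)])
  then show ?thesis
    using D.inv_arrow_cancel(2)[OF eps_hom eps_iso d] by simp
qed

lemma mu_list_hom_iso:
  assumes "\<And>j. j \<in> set js \<Longrightarrow> X j \<in> Ob C"
  shows "mu_list C D F X js \<in> hom D (tens_list D (\<lambda>j. FO F (X j)) js) (FO F (tens_list C X js))"
    and "is_iso D (mu_list C D F X js)"
proof -
  have "mu_list C D F X js \<in> hom D (tens_list D (\<lambda>j. FO F (X j)) js) (FO F (tens_list C X js))
    \<and> is_iso D (mu_list C D F X js)"
    using assms
  proof (induction js)
    case Nil
    then show ?case by (simp add: eps_hom eps_iso)
  next
    case (Cons j js)
    have o: "X j \<in> Ob C" "tens_list C X js \<in> Ob C"
      using Cons.prems by (auto intro: C.tens_list_ob)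
    note m = mu_hom[OF o] mu_iso[OF o]
    have i: "Idt D (FO F (X j)) \<in> hom D (FO F (X j)) (FO F (X j))" "is_iso D (Idt D (FO F (X j)))"
      using o F_ob D.id_hom D.iso_id by auto
    have ih: "mu_list C D F X js \<in> hom D (tens_list D (\<lambda>j. FO F (X j)) js) (FO F (tens_list C X js))"
      "is_iso D (mu_list C D F X js)"
      using Cons by auto
    show ?case
      using D.comp_hom[OF D.tens_hom[OF i(1) ih(1)] m(1)]
        D.iso_comp[OF D.tens_hom[OF i(1) ih(1)] D.tens_iso[OF i ih] m] by simp
  qed
  then show "mu_list C D F X js \<in> hom D (tens_list D (\<lambda>j. FO F (X j)) js) (FO F (tens_list C X js))"
    and "is_iso D (mu_list C D F X js)" by auto
qed

text \<open>
  Along a factor that is kept, this is naturality of \<open>mu\<close>. A factor that is deleted is first mapped to the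
  unit and then absorbed by the left unitor; here the reason is that \<open>F\<close> preserves the arrows to the
  unit up to \<open>eps\<close> (lemma \<open>F_del\<close>) and that \<open>mu\<close> is compatible with the left unitors.
\<close>

lemma mu_list_nat:
  assumes "\<And>j. j \<in> set js \<Longrightarrow> X j \<in> Ob C"
  shows "mu_list C D F X (filter (\<lambda>i. i \<in> S) js) \<cdot>\<^bsub>D\<^esub> proj_list D (\<lambda>j. FO F (X j)) S js
       = FA F (proj_list C X S js) \<cdot>\<^bsub>D\<^esub> mu_list C D F X js"
  using assms
proof (induction js)
  case Nil
  show ?case
    using is_functorD(3)[OF F_functor C.unit_ob] D.id_left[OF eps_hom] D.id_right[OF eps_hom] by simp
next
  case (Cons j js)
  let ?js' = "filter (\<lambda>i. i \<in> S) js"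
  let ?T = "tens_list C X js" and ?T' = "tens_list C X ?js'"
  let ?U = "tens_list D (\<lambda>j. FO F (X j)) js" and ?U' = "tens_list D (\<lambda>j. FO F (X j)) ?js'"
  let ?m = "mu_list C D F X js" and ?m' = "mu_list C D F X ?js'"
  let ?p = "proj_list C X S js" and ?q = "proj_list D (\<lambda>j. FO F (X j)) S js"
  let ?A = "FO F (X j)" and ?i = "Idt D (FO F (X j))"
  have o: "X j \<in> Ob C" "?T \<in> Ob C" "?T' \<in> Ob C" "?A \<in> Ob D"
    using Cons.prems F_ob by (auto intro!: C.tens_list_ob)
  have ih: "?m' \<cdot>\<^bsub>D\<^esub> ?q = FA F ?p \<cdot>\<^bsub>D\<^esub> ?m"
    using Cons by simp
  have m: "?m \<in> hom D ?U (FO F ?T)" "?m' \<in> hom D ?U' (FO F ?T')"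
    using Cons.prems by (auto intro!: mu_list_hom_iso)
  have p: "?p \<in> hom C ?T ?T'" "?q \<in> hom D ?U ?U'"
    using Cons.prems F_ob by (auto intro!: C.proj_list_hom D.proj_list_hom)
  have Fp: "FA F ?p \<in> hom D (FO F ?T) (FO F ?T')"
    using F_hom p by blast
  have i: "?i \<in> hom D ?A ?A" "Idt C (X j) \<in> hom C (X j) (X j)"
    using o D.id_hom C.id_hom by auto
  have im: "?i \<boxtimes>\<^bsub>D\<^esub> ?m \<in> hom D (?A \<otimes>\<^bsub>D\<^esub> ?U) (?A \<otimes>\<^bsub>D\<^esub> FO F ?T)"
    using D.tens_hom i m by blast
  show ?case
  proof (cases "j \<in> S")
    case True
    have "(mu F (X j) ?T' \<cdot>\<^bsub>D\<^esub> (?i \<boxtimes>\<^bsub>D\<^esub> ?m')) \<cdot>\<^bsub>D\<^esub> (?i \<boxtimes>\<^bsub>D\<^esub> ?q) 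
        = mu F (X j) ?T' \<cdot>\<^bsub>D\<^esub> (?i \<boxtimes>\<^bsub>D\<^esub> ?m') \<cdot>\<^bsub>D\<^esub> (?i \<boxtimes>\<^bsub>D\<^esub> ?q)"
      using D.comp_assoc[OF D.tens_hom[OF i(1) p(2)] D.tens_hom[OF i(1) m(2)] mu_hom[OF o(1,3)]] .
    also have "(?i \<boxtimes>\<^bsub>D\<^esub> ?m') \<cdot>\<^bsub>D\<^esub> (?i \<boxtimes>\<^bsub>D\<^esub> ?q) = (?i \<boxtimes>\<^bsub>D\<^esub> FA F ?p) \<cdot>\<^bsub>D\<^esub> (?i \<boxtimes>\<^bsub>D\<^esub> ?m)"
      using D.tens_comp[OF i(1) i(1) p(2) m(2)] D.tens_comp[OF i(1) i(1) m(1) Fp] ih by simp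
    also have "mu F (X j) ?T' \<cdot>\<^bsub>D\<^esub> (?i \<boxtimes>\<^bsub>D\<^esub> FA F ?p) \<cdot>\<^bsub>D\<^esub> (?i \<boxtimes>\<^bsub>D\<^esub> ?m)
        = (mu F (X j) ?T' \<cdot>\<^bsub>D\<^esub> (?i \<boxtimes>\<^bsub>D\<^esub> FA F ?p)) \<cdot>\<^bsub>D\<^esub> (?i \<boxtimes>\<^bsub>D\<^esub> ?m)"
      using D.comp_assoc[OF im D.tens_hom[OF i(1) Fp] mu_hom[OF o(1,3)]] by simp
    also have "mu F (X j) ?T' \<cdot>\<^bsub>D\<^esub> (?i \<boxtimes>\<^bsub>D\<^esub> FA F ?p) 
        = FA F (Idt C (X j) \<boxtimes>\<^bsub>C\<^esub> ?p) \<cdot>\<^bsub>D\<^esub> mu F (X j) ?T"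
      using mu_nat[OF i(2) p(1)] is_functorD(3)[OF F_functor o(1)] by simp
    also have "(FA F (Idt C (X j) \<boxtimes>\<^bsub>C\<^esub> ?p) \<cdot>\<^bsub>D\<^esub> mu F (X j) ?T) \<cdot>\<^bsub>D\<^esub> (?i \<boxtimes>\<^bsub>D\<^esub> ?m)
        = FA F (Idt C (X j) \<boxtimes>\<^bsub>C\<^esub> ?p) \<cdot>\<^bsub>D\<^esub> mu F (X j) ?T \<cdot>\<^bsub>D\<^esub> (?i \<boxtimes>\<^bsub>D\<^esub> ?m)"
      using D.comp_assoc[OF im mu_hom[OF o(1,2)] F_hom[OF C.tens_hom[OF i(2) p(1)]]] .
    finally show ?thesis
      using True by simp
  next
    case False
    let ?d = "del D ?A" and ?I = "Idt D (unit D)" and ?c = "del C (X j)"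
    have d: "?d \<in> hom D ?A (unit D)" "?c \<in> hom C (X j) (unit C)"
      using D.del_hom C.del_hom o by auto
    have I: "?I \<in> hom D (unit D) (unit D)"
      using D.id_hom D.unit_ob by blast
    have TI: "Idt D (FO F ?T') \<in> hom D (FO F ?T') (FO F ?T')"
      using D.id_hom F_ob o by blast
    have mq: "?m' \<cdot>\<^bsub>D\<^esub> ?q \<in> hom D ?U (FO F ?T')"
      using D.comp_hom p m by blast
    have l: "lunit C ?T' \<in> hom C (unit C \<otimes>\<^bsub>C\<^esub> ?T') ?T'" "lunit D ?U' \<in> hom D (unit D \<otimes>\<^bsub>D\<^esub> ?U') ?U'"
      "lunit D (FO F ?T') \<in> hom D (unit D \<otimes>\<^bsub>D\<^esub> FO F ?T') (FO F ?T')"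
      using C.lunit_hom D.lunit_hom o F_ob D.hom_ob[OF m(2)] by auto
    have dp: "?c \<boxtimes>\<^bsub>C\<^esub> ?p \<in> hom C (X j \<otimes>\<^bsub>C\<^esub> ?T) (unit C \<otimes>\<^bsub>C\<^esub> ?T')"
      using C.tens_hom d p by blast
    have dq: "?d \<boxtimes>\<^bsub>D\<^esub> ?q \<in> hom D (?A \<otimes>\<^bsub>D\<^esub> ?U) (unit D \<otimes>\<^bsub>D\<^esub> ?U')"
      using D.tens_hom d p by blast
    have dmq: "?d \<boxtimes>\<^bsub>D\<^esub> (?m' \<cdot>\<^bsub>D\<^esub> ?q) \<in> hom D (?A \<otimes>\<^bsub>D\<^esub> ?U) (unit D \<otimes>\<^bsub>D\<^esub> FO F ?T')"
      using D.tens_hom d mq by blast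
    have eT: "eps F \<boxtimes>\<^bsub>D\<^esub> Idt D (FO F ?T') \<in> hom D (unit D \<otimes>\<^bsub>D\<^esub> FO F ?T') (FO F (unit C) \<otimes>\<^bsub>D\<^esub> FO F ?T')"
      using D.tens_hom eps_hom TI by blast
    note mm = mu_hom[OF o(1,2)] and mI = mu_hom[OF C.unit_ob o(3)]
    have "FA F (lunit C ?T' \<cdot>\<^bsub>C\<^esub> (?c \<boxtimes>\<^bsub>C\<^esub> ?p)) \<cdot>\<^bsub>D\<^esub> mu F (X j) ?T \<cdot>\<^bsub>D\<^esub> (?i \<boxtimes>\<^bsub>D\<^esub> ?m)
        = FA F (lunit C ?T') \<cdot>\<^bsub>D\<^esub> FA F (?c \<boxtimes>\<^bsub>C\<^esub> ?p) \<cdot>\<^bsub>D\<^esub> mu F (X j) ?T \<cdot>\<^bsub>D\<^esub> (?i \<boxtimes>\<^bsub>D\<^esub> ?m)"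
      using D.comp_assoc[OF D.comp_hom[OF im mm] F_hom[OF dp] F_hom[OF l(1)]]
        is_functorD(4)[OF F_functor dp l(1)] by simp
    also have "FA F (?c \<boxtimes>\<^bsub>C\<^esub> ?p) \<cdot>\<^bsub>D\<^esub> mu F (X j) ?T \<cdot>\<^bsub>D\<^esub> (?i \<boxtimes>\<^bsub>D\<^esub> ?m)
        = (mu F (unit C) ?T' \<cdot>\<^bsub>D\<^esub> (FA F ?c \<boxtimes>\<^bsub>D\<^esub> FA F ?p)) \<cdot>\<^bsub>D\<^esub> (?i \<boxtimes>\<^bsub>D\<^esub> ?m)"
      using D.comp_assoc[OF im mm F_hom[OF dp]] mu_nat[OF d(2) p(1)] by simp
    also have "\<dots> = mu F (unit C) ?T' \<cdot>\<^bsub>D\<^esub> (FA F ?c \<boxtimes>\<^bsub>D\<^esub> FA F ?p) \<cdot>\<^bsub>D\<^esub> (?i \<boxtimes>\<^bsub>D\<^esub> ?m)"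
      using D.comp_assoc[OF im D.tens_hom[OF F_hom[OF d(2)] Fp] mI] .
    also have "(FA F ?c \<boxtimes>\<^bsub>D\<^esub> FA F ?p) \<cdot>\<^bsub>D\<^esub> (?i \<boxtimes>\<^bsub>D\<^esub> ?m) = (FA F ?c \<cdot>\<^bsub>D\<^esub> ?i) \<boxtimes>\<^bsub>D\<^esub> (FA F ?p \<cdot>\<^bsub>D\<^esub> ?m)"
      using D.tens_comp[OF i(1) F_hom[OF d(2)] m(1) Fp] by simp
    also have "\<dots> = (eps F \<cdot>\<^bsub>D\<^esub> ?d) \<boxtimes>\<^bsub>D\<^esub> (Idt D (FO F ?T') \<cdot>\<^bsub>D\<^esub> ?m' \<cdot>\<^bsub>D\<^esub> ?q)"
      using D.id_right[OF F_hom[OF d(2)]] F_del[OF o(1)] ih D.id_left[OF mq] by simp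
    also have "\<dots> = (eps F \<boxtimes>\<^bsub>D\<^esub> Idt D (FO F ?T')) \<cdot>\<^bsub>D\<^esub> (?d \<boxtimes>\<^bsub>D\<^esub> (?m' \<cdot>\<^bsub>D\<^esub> ?q))"
      using D.tens_comp[OF d(1) eps_hom mq TI] .
    also have "FA F (lunit C ?T') \<cdot>\<^bsub>D\<^esub> mu F (unit C) ?T' \<cdot>\<^bsub>D\<^esub> \<dots>
        = (FA F (lunit C ?T') \<cdot>\<^bsub>D\<^esub> mu F (unit C) ?T' \<cdot>\<^bsub>D\<^esub> (eps F \<boxtimes>\<^bsub>D\<^esub> Idt D (FO F ?T')))
            \<cdot>\<^bsub>D\<^esub> (?d \<boxtimes>\<^bsub>D\<^esub> (?m' \<cdot>\<^bsub>D\<^esub> ?q))"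
      using D.comp_assoc[OF dmq D.comp_hom[OF eT mI] F_hom[OF l(1)]] D.comp_assoc[OF dmq eT mI] by simp
    also have "\<dots> = lunit D (FO F ?T') \<cdot>\<^bsub>D\<^esub> (?d \<boxtimes>\<^bsub>D\<^esub> (?m' \<cdot>\<^bsub>D\<^esub> ?q))"
      using mu_lunit[OF o(3)] by simp
    also have "?d \<boxtimes>\<^bsub>D\<^esub> (?m' \<cdot>\<^bsub>D\<^esub> ?q) = (?I \<boxtimes>\<^bsub>D\<^esub> ?m') \<cdot>\<^bsub>D\<^esub> (?d \<boxtimes>\<^bsub>D\<^esub> ?q)"
      using D.tens_comp[OF d(1) I p(2) m(2)] D.id_left[OF d(1)] by simp
    also have "lunit D (FO F ?T') \<cdot>\<^bsub>D\<^esub> (?I \<boxtimes>\<^bsub>D\<^esub> ?m') \<cdot>\<^bsub>D\<^esub> (?d \<boxtimes>\<^bsub>D\<^esub> ?q)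
        = ?m' \<cdot>\<^bsub>D\<^esub> lunit D ?U' \<cdot>\<^bsub>D\<^esub> (?d \<boxtimes>\<^bsub>D\<^esub> ?q)"
      using D.comp_assoc[OF dq D.tens_hom[OF I m(2)] l(3)] D.comp_assoc[OF dq l(2) m(2)]
        D.lunit_nat[OF m(2)] by simp
    finally show ?thesis
      using False by simp
  qed
qed

end

section \<open>Copresheaves and Day convolution\<close>

text \<open>
  Copresheaves are handled through their elements: equations between arrows of \<open>copsh_op C\<close> are checked
  by evaluating the underlying transformations. An arrow from \<open>L\<close> to \<open>M\<close> is a transformation from \<open>M\<close> to
  \<open>L\<close>, so that \<open>app\<close> reverses composition.
\<close>

definition act :: "('o, 'm) copsh \<Rightarrow> 'm \<Rightarrow> ('o, 'm) elt \<Rightarrow> ('o, 'm) elt" where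
  "act L f x = fn (FA L f) x"

definition app :: "('o, 'm) copsh_arrow \<Rightarrow> 'o \<Rightarrow> ('o, 'm) elt \<Rightarrow> ('o, 'm) elt" where
  "app t D x = fn (fn t D) x"

lemma SetCat_simps [simp]:
  "Ob SetCat = UNIV" "Dom SetCat = src" "Cod SetCat = tgt" "Idt SetCat A = set_fun A (\<lambda>x. x) A"
  by (simp_all add: SetCat_def)

lemma SetCat_hom: "f \<in> hom SetCat A B \<longleftrightarrow> src f = A \<and> tgt f = B \<and> fn f \<in> A \<rightarrow>\<^sub>E B"
  by (auto simp: hom_def SetCat_def)

lemma SetCat_ext:
  "f \<in> hom SetCat A B \<Longrightarrow> g \<in> hom SetCat A B \<Longrightarrow> (\<And>x. x \<in> A \<Longrightarrow> fn f x = fn g x) \<Longrightarrow> f = g"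
  by (cases f; cases g) (auto simp: SetCat_hom intro: PiE_ext)

lemma set_fun_hom: "(\<And>x. x \<in> A \<Longrightarrow> f x \<in> B) \<Longrightarrow> set_fun A f B \<in> hom SetCat A B"
  by (auto simp: SetCat_hom set_fun_def)

lemma fn_set_fun: "x \<in> A \<Longrightarrow> fn (set_fun A f B) x = f x"
  by (simp add: set_fun_def)

lemma SetCat_comp:
  assumes "f \<in> hom SetCat A B" "g \<in> hom SetCat B E"
  shows "g \<cdot>\<^bsub>SetCat\<^esub> f \<in> hom SetCat A E"
    and "x \<in> A \<Longrightarrow> fn (g \<cdot>\<^bsub>SetCat\<^esub> f) x = fn g (fn f x)"
proof -
  have "Comp SetCat g f = set_fun (src f) (fn g \<circ> fn f) (tgt g)"
    by (simp add: SetCat_def)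
  then show "g \<cdot>\<^bsub>SetCat\<^esub> f \<in> hom SetCat A E" "x \<in> A \<Longrightarrow> fn (g \<cdot>\<^bsub>SetCat\<^esub> f) x = fn g (fn f x)"
    using assms by (auto simp: SetCat_hom fn_set_fun intro!: set_fun_hom[unfolded SetCat_hom])
qed

lemma copsh_op_simps [simp]:
  "Ob (copsh_op C) = {F. is_functor C SetCat F}"
  "tensO (copsh_op C) = day C"
  "unit (copsh_op C) = hom_copsh C (unit C)"
  by (simp_all add: copsh_op_def Let_def functor_cat_def)

lemma copsh_op_hom:
  "t \<in> hom (copsh_op C) L M \<longleftrightarrow> src t = M \<and> tgt t = L \<and> is_functor C SetCat M \<and> is_functor C SetCat L \<and>
     is_nat_trans C SetCat M L (fn t) \<and> fn t \<in> extensional (Ob C)"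
  by (auto simp: hom_def copsh_op_def Let_def functor_cat_def)

lemma yoneda_simps [simp]: "FO (yoneda C) A = hom_copsh C A"
  by (simp add: yoneda_def)

context tensor_category
begin

lemma copsheafI:
  assumes "\<And>A B f. f \<in> hom C A B \<Longrightarrow> FA L f \<in> hom SetCat (FO L A) (FO L B)"
    and "\<And>A x. A \<in> Ob C \<Longrightarrow> x \<in> FO L A \<Longrightarrow> act L (Idt C A) x = x"
    and "\<And>A B D f g x. f \<in> hom C A B \<Longrightarrow> g \<in> hom C B D \<Longrightarrow> x \<in> FO L A \<Longrightarrow>
      act L (g \<cdot> f) x = act L g (act L f x)"
  shows "is_functor C SetCat L"
  unfolding is_functor_def
proof (intro conjI ballI impI)
  show "FA L f \<in> hom SetCat (FO L (Dom C f)) (FO L (Cod C f))" if "f \<in> Ar C" for f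
    using assms(1) that by (auto simp: hom_def)
  show "FA L (Idt C A) = Idt SetCat (FO L A)" if "A \<in> Ob C" for A
    unfolding SetCat_simps
    by (rule SetCat_ext[OF assms(1)[OF id_hom[OF that]] set_fun_hom])
       (use assms(2)[OF that] in \<open>auto simp: fn_set_fun act_def\<close>)
  show "FA L (g \<cdot> f) = FA L g \<cdot>\<^bsub>SetCat\<^esub> FA L f"
    if "f \<in> Ar C" "g \<in> Ar C" "Cod C f = Dom C g" for f g
  proof -
    have h: "f \<in> hom C (Dom C f) (Dom C g)" "g \<in> hom C (Dom C g) (Cod C g)"
      using that by (auto simp: hom_def)
    show ?thesis
      by (rule SetCat_ext[OF assms(1)[OF comp_hom[OF h]] SetCat_comp(1)[OF assms(1)[OF h(1)] assms(1)[OF h(2)]]])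
         (use assms(3)[OF h] SetCat_comp(2)[OF assms(1)[OF h(1)] assms(1)[OF h(2)]] in \<open>auto simp: act_def\<close>)
  qed
qed auto

lemma copsheafD:
  assumes "is_functor C SetCat L"
  shows "f \<in> hom C A B \<Longrightarrow> x \<in> FO L A \<Longrightarrow> act L f x \<in> FO L B"
    and "A \<in> Ob C \<Longrightarrow> x \<in> FO L A \<Longrightarrow> act L (Idt C A) x = x"
    and "f \<in> hom C A B \<Longrightarrow> g \<in> hom C B D \<Longrightarrow> x \<in> FO L A \<Longrightarrow> act L (g \<cdot> f) x = act L g (act L f x)"
proof -
  note F = is_functorD[OF assms]
  show "act L f x \<in> FO L B" if "f \<in> hom C A B" "x \<in> FO L A"
    using F(2)[OF that(1)] that(2) by (auto simp: SetCat_hom act_def)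
  show "act L (Idt C A) x = x" if "A \<in> Ob C" "x \<in> FO L A"
    using F(3)[OF that(1)] that(2) by (simp add: act_def fn_set_fun)
  show "act L (g \<cdot> f) x = act L g (act L f x)" if "f \<in> hom C A B" "g \<in> hom C B D" "x \<in> FO L A"
    using F(4)[OF that(1,2)] that(3) SetCat_comp(2)[OF F(2)[OF that(1)] F(2)[OF that(2)]]
    by (simp add: act_def)
qed

lemma app_nat_arrow: "D \<in> Ob C \<Longrightarrow> x \<in> FO M D \<Longrightarrow> app (nat_arrow C M \<tau> L) D x = \<tau> D x"
  by (simp add: app_def nat_arrow_def fn_set_fun)

lemma copsh_homI:
  assumes L: "is_functor C SetCat L" and M: "is_functor C SetCat M"
    and \<tau>: "\<And>D x. D \<in> Ob C \<Longrightarrow> x \<in> FO M D \<Longrightarrow> \<tau> D x \<in> FO L D"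
    and nat: "\<And>A B f x. f \<in> hom C A B \<Longrightarrow> x \<in> FO M A \<Longrightarrow> \<tau> B (act M f x) = act L f (\<tau> A x)"
  shows "nat_arrow C M \<tau> L \<in> hom (copsh_op C) L M"
proof -
  have h: "set_fun (FO M D) (\<tau> D) (FO L D) \<in> hom SetCat (FO M D) (FO L D)" if "D \<in> Ob C" for D
    using \<tau> that by (auto intro: set_fun_hom)
  have "set_fun (FO M B) (\<tau> B) (FO L B) \<cdot>\<^bsub>SetCat\<^esub> FA M f = FA L f \<cdot>\<^bsub>SetCat\<^esub> set_fun (FO M A) (\<tau> A) (FO L A)"
    if f: "f \<in> hom C A B" for f A B
  proof -
    have o: "A \<in> Ob C" "B \<in> Ob C" using hom_ob[OF f] by auto
    note m = is_functorD(2)[OF M f] and l = is_functorD(2)[OF L f]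
    show ?thesis
    proof (rule SetCat_ext[OF SetCat_comp(1)[OF m h[OF o(2)]] SetCat_comp(1)[OF h[OF o(1)] l]])
      fix x assume x: "x \<in> FO M A"
      show "fn (set_fun (FO M B) (\<tau> B) (FO L B) \<cdot>\<^bsub>SetCat\<^esub> FA M f) x
          = fn (FA L f \<cdot>\<^bsub>SetCat\<^esub> set_fun (FO M A) (\<tau> A) (FO L A)) x"
        using SetCat_comp(2)[OF m h[OF o(2)] x] SetCat_comp(2)[OF h[OF o(1)] l x] nat[OF f x]
          copsheafD(1)[OF M f x] x by (simp add: fn_set_fun act_def)
    qed
  qed
  moreover have "f \<in> hom C (Dom C f) (Cod C f)" if "f \<in> Ar C" for f
    using that by (simp add: hom_def)
  ultimately show ?thesis
    using h L M dom_ob cod_ob unfolding copsh_op_hom is_nat_trans_def nat_arrow_def by auto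
qed

lemma copsh_homD:
  assumes "t \<in> hom (copsh_op C) L M"
  shows "is_functor C SetCat L" "is_functor C SetCat M" "src t = M" "tgt t = L"
    and "D \<in> Ob C \<Longrightarrow> x \<in> FO M D \<Longrightarrow> app t D x \<in> FO L D"
    and "f \<in> hom C A B \<Longrightarrow> x \<in> FO M A \<Longrightarrow> app t B (act M f x) = act L f (app t A x)"
proof -
  have t: "src t = M" "tgt t = L" "is_functor C SetCat M" "is_functor C SetCat L"
    "is_nat_trans C SetCat M L (fn t)"
    using assms by (auto simp: copsh_op_hom)
  show "is_functor C SetCat L" "is_functor C SetCat M" "src t = M" "tgt t = L"
    using t by auto
  have h: "fn t D \<in> hom SetCat (FO M D) (FO L D)" if "D \<in> Ob C" for D
    using t that by (auto simp: is_nat_trans_def)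
  show "app t D x \<in> FO L D" if "D \<in> Ob C" "x \<in> FO M D"
    using h[OF that(1)] that(2) by (auto simp: app_def SetCat_hom)
  show "app t B (act M f x) = act L f (app t A x)" if f: "f \<in> hom C A B" and x: "x \<in> FO M A"
  proof -
    have o: "A \<in> Ob C" "B \<in> Ob C" using hom_ob[OF f] by auto
    have "fn t B \<cdot>\<^bsub>SetCat\<^esub> FA M f = FA L f \<cdot>\<^bsub>SetCat\<^esub> fn t A"
      using t(5) f by (auto simp: is_nat_trans_def hom_def)
    then show ?thesis
      using SetCat_comp(2)[OF is_functorD(2)[OF t(3) f] h[OF o(2)] x]
        SetCat_comp(2)[OF h[OF o(1)] is_functorD(2)[OF t(4) f] x] by (simp add: app_def act_def)
  qed
qed

lemma copsh_ext:
  assumes t: "t \<in> hom (copsh_op C) L M" and s: "s \<in> hom (copsh_op C) L M"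
    and eq: "\<And>D x. D \<in> Ob C \<Longrightarrow> x \<in> FO M D \<Longrightarrow> app t D x = app s D x"
  shows "t = s"
proof -
  have "fn t D = fn s D" for D
  proof (cases "D \<in> Ob C")
    case True
    then have "fn t D \<in> hom SetCat (FO M D) (FO L D)" "fn s D \<in> hom SetCat (FO M D) (FO L D)"
      using t s by (auto simp: copsh_op_hom is_nat_trans_def)
    then show ?thesis
      using eq[OF True] by (auto simp: app_def intro: SetCat_ext)
  next
    case False
    then show ?thesis
      using t s by (auto simp: copsh_op_hom extensional_def)
  qed
  then show ?thesis
    using t s by (cases t; cases s) (auto simp: copsh_op_hom)
qed

end

lemma copsh_op_Comp:
  "s \<cdot>\<^bsub>copsh_op C\<^esub> t = Arrow (src s) (\<lambda>A\<in>Ob C. fn t A \<cdot>\<^bsub>SetCat\<^esub> fn s A) (tgt t)"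
  by (simp add: copsh_op_def Let_def functor_cat_def)

lemma copsh_op_Idt: "Idt (copsh_op C) L = nat_arrow C L (\<lambda>D x. x) L"
  by (simp add: copsh_op_def Let_def functor_cat_def nat_arrow_def)

context tensor_category
begin

lemma copsh_comp:
  assumes t: "t \<in> hom (copsh_op C) L M" and s: "s \<in> hom (copsh_op C) M N"
  shows "s \<cdot>\<^bsub>copsh_op C\<^esub> t \<in> hom (copsh_op C) L N"
    and "D \<in> Ob C \<Longrightarrow> x \<in> FO N D \<Longrightarrow> app (s \<cdot>\<^bsub>copsh_op C\<^esub> t) D x = app t D (app s D x)"
proof -
  note T = copsh_homD[OF t] and S = copsh_homD[OF s]
  have h: "fn t D \<in> hom SetCat (FO M D) (FO L D)" "fn s D \<in> hom SetCat (FO N D) (FO M D)"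
    if "D \<in> Ob C" for D
    using t s that by (auto simp: copsh_op_hom is_nat_trans_def)
  have *: "fn t D \<cdot>\<^bsub>SetCat\<^esub> fn s D = set_fun (FO N D) (\<lambda>x. app t D (app s D x)) (FO L D)"
    if D: "D \<in> Ob C" for D
    by (rule SetCat_ext[OF SetCat_comp(1)[OF h(2)[OF D] h(1)[OF D]] set_fun_hom])
       (use S(5) T(5) D SetCat_comp(2)[OF h(2)[OF D] h(1)[OF D]] in \<open>auto simp: fn_set_fun app_def\<close>)
  have eq: "s \<cdot>\<^bsub>copsh_op C\<^esub> t = nat_arrow C N (\<lambda>D x. app t D (app s D x)) L"
    unfolding copsh_op_Comp nat_arrow_def using T S * by (auto simp: restrict_def)
  show "s \<cdot>\<^bsub>copsh_op C\<^esub> t \<in> hom (copsh_op C) L N"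
    unfolding eq using T S hom_ob by (intro copsh_homI) auto
  show "app (s \<cdot>\<^bsub>copsh_op C\<^esub> t) D x = app t D (app s D x)" if "D \<in> Ob C" "x \<in> FO N D"
    unfolding eq using app_nat_arrow that by simp
qed

lemma copsh_id:
  assumes "is_functor C SetCat L"
  shows "Idt (copsh_op C) L \<in> hom (copsh_op C) L L"
    and "D \<in> Ob C \<Longrightarrow> x \<in> FO L D \<Longrightarrow> app (Idt (copsh_op C) L) D x = x"
  using assms by (auto simp: copsh_op_Idt app_nat_arrow intro: copsh_homI)

lemma copsh_category: "category (copsh_op C)"
proof
  show "Dom (copsh_op C) f \<in> Ob (copsh_op C)" "Cod (copsh_op C) f \<in> Ob (copsh_op C)"
    if "f \<in> Ar (copsh_op C)" for f
    using that copsh_homD[of f "Dom (copsh_op C) f" "Cod (copsh_op C) f"] by (auto simp: hom_def)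
  show "Idt (copsh_op C) A \<in> hom (copsh_op C) A A" if "A \<in> Ob (copsh_op C)" for A
    using that by (auto intro: copsh_id)
  show "g \<cdot>\<^bsub>copsh_op C\<^esub> f \<in> hom (copsh_op C) A D"
    if "f \<in> hom (copsh_op C) A B" "g \<in> hom (copsh_op C) B D" for f g A B D
    using copsh_comp that by blast
  show "Idt (copsh_op C) B \<cdot>\<^bsub>copsh_op C\<^esub> f = f" if f: "f \<in> hom (copsh_op C) A B" for f A B
    using copsh_comp[OF f copsh_id(1)[OF copsh_homD(2)[OF f]]] f copsh_homD[OF f]
    by (intro copsh_ext[of _ A B]) (auto simp: copsh_id)
  show "f \<cdot>\<^bsub>copsh_op C\<^esub> Idt (copsh_op C) A = f" if f: "f \<in> hom (copsh_op C) A B" for f A B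
    using copsh_comp[OF copsh_id(1)[OF copsh_homD(1)[OF f]] f] f copsh_homD[OF f]
    by (intro copsh_ext[of _ A B]) (auto simp: copsh_id)
  show "(h \<cdot>\<^bsub>copsh_op C\<^esub> g) \<cdot>\<^bsub>copsh_op C\<^esub> f = h \<cdot>\<^bsub>copsh_op C\<^esub> g \<cdot>\<^bsub>copsh_op C\<^esub> f"
    if f: "f \<in> hom (copsh_op C) A B" and g: "g \<in> hom (copsh_op C) B D" and h: "h \<in> hom (copsh_op C) D E"
    for f g h A B D E
    using copsh_comp[OF f g] copsh_comp[OF g h] copsh_comp[OF copsh_comp(1)[OF f g] h]
      copsh_comp[OF f copsh_comp(1)[OF g h]] copsh_homD(5)[OF h]
    by (intro copsh_ext[of _ A E]) auto
qed

subsection \<open>Representable copresheaves\<close>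

lemma hom_copsh_functor: "is_functor C SetCat (hom_copsh C A)"
  and hom_copsh_act: "f \<in> hom C A B \<Longrightarrow> g \<in> hom C B D \<Longrightarrow> act (hom_copsh C A) g (Hom_elt f) = Hom_elt (g \<cdot> f)"
proof -
  have a: "act (hom_copsh C A) g (Hom_elt f) = Hom_elt (g \<cdot> f)"
    if "f \<in> hom C A B" "g \<in> hom C B D" for f g B D
    using that by (simp add: act_def hom_copsh_def hom_def fn_set_fun)
  then show "f \<in> hom C A B \<Longrightarrow> g \<in> hom C B D \<Longrightarrow> act (hom_copsh C A) g (Hom_elt f) = Hom_elt (g \<cdot> f)" .
  show "is_functor C SetCat (hom_copsh C A)"
  proof (rule copsheafI)
    show "FA (hom_copsh C A) g \<in> hom SetCat (FO (hom_copsh C A) B) (FO (hom_copsh C A) D)"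
      if "g \<in> hom C B D" for g B D
    proof -
      have "Dom C g = B" "Cod C g = D" using that by (auto simp: hom_def)
      then show ?thesis
        using that comp_hom by (auto simp: hom_copsh_def intro!: set_fun_hom)
    qed
    show "act (hom_copsh C A) (Idt C B) x = x" if "B \<in> Ob C" "x \<in> FO (hom_copsh C A) B" for B x
      using that a[OF _ id_hom] by (auto simp: hom_copsh_def[of C A, THEN arg_cong[of _ _ FO]] id_left)
    show "act (hom_copsh C A) (g \<cdot> f) x = act (hom_copsh C A) g (act (hom_copsh C A) f x)"
      if f: "f \<in> hom C B D" and g: "g \<in> hom C D E" and x: "x \<in> FO (hom_copsh C A) B" for B D E f g x
    proof -
      obtain k where k: "x = Hom_elt k" "k \<in> hom C A B"
        using x by (auto simp: hom_copsh_def)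
      show ?thesis
        using a[OF k(2) comp_hom[OF f g]] a[OF k(2) f] a[OF comp_hom[OF k(2) f] g]
          comp_assoc[OF k(2) f g] k(1) by simp
    qed
  qed
qed

lemma FO_hom_copsh [simp]: "FO (hom_copsh C A) B = Hom_elt ` hom C A B"
  by (simp add: hom_copsh_def)

text \<open>The Yoneda lemma: an arrow from \<open>M\<close> to \<open>C(A, -)\<close> is determined by an element of \<open>M A\<close>.\<close>

lemma yoneda_arrow:
  assumes M: "is_functor C SetCat M" and x: "x \<in> FO M A"
  defines "t \<equiv> nat_arrow C (hom_copsh C A) (\<lambda>D e. act M (arrow_of e) x) M"
  shows "t \<in> hom (copsh_op C) M (hom_copsh C A)"
    and "f \<in> hom C A D \<Longrightarrow> app t D (Hom_elt f) = act M f x"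
proof -
  show "t \<in> hom (copsh_op C) M (hom_copsh C A)"
    unfolding t_def
  proof (rule copsh_homI[OF M hom_copsh_functor])
    show "act M (arrow_of e) x \<in> FO M D" if "D \<in> Ob C" "e \<in> FO (hom_copsh C A) D" for D e
      using that copsheafD(1)[OF M _ x] by auto
    show "act M (arrow_of (act (hom_copsh C A) f e)) x = act M f (act M (arrow_of e) x)"
      if f: "f \<in> hom C B D" and e: "e \<in> FO (hom_copsh C A) B" for B D f e
      using e hom_copsh_act[OF _ f] copsheafD(3)[OF M _ f x] by auto
  qed
  show "f \<in> hom C A D \<Longrightarrow> app t D (Hom_elt f) = act M f x"
    unfolding t_def using hom_ob by (subst app_nat_arrow) auto
qed

lemma app_yoneda:
  assumes t: "t \<in> hom (copsh_op C) M (hom_copsh C A)" and f: "f \<in> hom C A D"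
  shows "app t D (Hom_elt f) = act M f (app t A (Hom_elt (Idt C A)))"
proof -
  have A: "Idt C A \<in> hom C A A" using hom_ob[OF f] id_hom by blast
  show ?thesis
    using copsh_homD(6)[OF t f, of "Hom_elt (Idt C A)"] A hom_copsh_act[OF A f] id_right[OF f] by simp
qed

lemma yoneda_elt:
  assumes t: "t \<in> hom (copsh_op C) M (hom_copsh C A)" and A: "A \<in> Ob C"
  shows "app t A (Hom_elt (Idt C A)) \<in> FO M A"
  using copsh_homD(5)[OF t A, of "Hom_elt (Idt C A)"] id_hom[OF A] by simp

lemma yoneda_ext:
  assumes t: "t \<in> hom (copsh_op C) M (hom_copsh C A)" and s: "s \<in> hom (copsh_op C) M (hom_copsh C A)"
    and "app t A (Hom_elt (Idt C A)) = app s A (Hom_elt (Idt C A))"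
  shows "t = s"
  using app_yoneda[OF t] app_yoneda[OF s] assms(3) by (intro copsh_ext[OF t s]) auto

end

context tensor_category
begin

lemma FA_yoneda:
  assumes f: "f \<in> hom C A B"
  shows "FA (yoneda C) f \<in> hom (copsh_op C) (hom_copsh C A) (hom_copsh C B)"
    and "g \<in> hom C B D \<Longrightarrow> app (FA (yoneda C) f) D (Hom_elt g) = Hom_elt (g \<cdot> f)"
proof -
  have "Dom C f = A" "Cod C f = B" using f by (auto simp: hom_def)
  then have eq: "FA (yoneda C) f = nat_arrow C (hom_copsh C B) (\<lambda>D e. Hom_elt (arrow_of e \<cdot> f)) (hom_copsh C A)"
    by (simp add: yoneda_def)
  show "FA (yoneda C) f \<in> hom (copsh_op C) (hom_copsh C A) (hom_copsh C B)"
    unfolding eq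
  proof (rule copsh_homI[OF hom_copsh_functor hom_copsh_functor])
    show "Hom_elt (arrow_of e \<cdot> f) \<in> FO (hom_copsh C A) D" if "D \<in> Ob C" "e \<in> FO (hom_copsh C B) D" for D e
      using that comp_hom[OF f] by auto
    show "Hom_elt (arrow_of (act (hom_copsh C B) k e) \<cdot> f) = act (hom_copsh C A) k (Hom_elt (arrow_of e \<cdot> f))"
      if "k \<in> hom C D E" "e \<in> FO (hom_copsh C B) D" for D E k e
      using that hom_copsh_act[OF _ that(1)] comp_assoc[OF f _ that(1)] comp_hom[OF f] by auto
  qed
  show "g \<in> hom C B D \<Longrightarrow> app (FA (yoneda C) f) D (Hom_elt g) = Hom_elt (g \<cdot> f)"
    unfolding eq using hom_ob by (subst app_nat_arrow) auto
qed

lemma app_yoneda_comp: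
  assumes t: "t \<in> hom (copsh_op C) M (hom_copsh C A)" and f: "f \<in> hom C A B"
  shows "app (FA (yoneda C) f \<cdot>\<^bsub>copsh_op C\<^esub> t) B (Hom_elt (Idt C B)) = act M f (app t A (Hom_elt (Idt C A)))"
proof -
  have B: "B \<in> Ob C" "Idt C B \<in> hom C B B" using hom_ob[OF f] id_hom by blast+
  show ?thesis
    using copsh_comp(2)[OF t FA_yoneda(1)[OF f] B(1), of "Hom_elt (Idt C B)"] B FA_yoneda(2)[OF f B(2)]
      id_left[OF f] app_yoneda[OF t f] by simp
qed

lemma yoneda_functor: "is_functor C (copsh_op C) (yoneda C)"
proof -
  have h: "f \<in> hom C (Dom C f) (Cod C f)" if "f \<in> Ar C" for f using that by (simp add: hom_def)
  show ?thesis
    unfolding is_functor_def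
  proof (intro conjI ballI impI)
    show "FO (yoneda C) A \<in> Ob (copsh_op C)" for A using hom_copsh_functor by simp
    show "FA (yoneda C) f \<in> hom (copsh_op C) (FO (yoneda C) (Dom C f)) (FO (yoneda C) (Cod C f))"
      if "f \<in> Ar C" for f using FA_yoneda(1)[OF h[OF that]] by simp
    show "FA (yoneda C) (Idt C A) = Idt (copsh_op C) (FO (yoneda C) A)" if A: "A \<in> Ob C" for A
      using FA_yoneda[OF id_hom[OF A]] copsh_id[OF hom_copsh_functor]
      by (intro copsh_ext[of _ "hom_copsh C A" "hom_copsh C A"]) (auto simp: id_right)
    show "FA (yoneda C) (g \<cdot> f) = FA (yoneda C) g \<cdot>\<^bsub>copsh_op C\<^esub> FA (yoneda C) f"
      if "f \<in> Ar C" "g \<in> Ar C" "Cod C f = Dom C g" for f g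
    proof -
      have f: "f \<in> hom C (Dom C f) (Dom C g)" using h[OF that(1)] that(3) by simp
      note g = h[OF that(2)] and y = FA_yoneda
      note c = copsh_comp[OF y(1)[OF f] y(1)[OF g]]
      show ?thesis
        using y[OF comp_hom[OF f g]] c
        by (rule_tac copsh_ext[OF y(1)[OF comp_hom[OF f g]] c(1)])
           (auto simp: y(2)[OF f] y(2)[OF g] comp_assoc[OF f g] comp_hom[OF g])
    qed
  qed
qed

subsection \<open>Day convolution\<close>

text \<open>\<open>day_cls\<close> picks an unspecified representative; functions on the coend are evaluated on it.
  They agree with their value on any other generator if they respect a single step.\<close>

lemma day_lift:
  assumes F: "is_functor C SetCat F" and G: "is_functor C SetCat G"
    and step: "\<And>A A' B B' a b h x y. a \<in> hom C A A' \<Longrightarrow> b \<in> hom C B B' \<Longrightarrow> h \<in> hom C (A' \<otimes> B') D \<Longrightarrow>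
       x \<in> FO F A \<Longrightarrow> y \<in> FO G B \<Longrightarrow>
       \<phi> (Day_elt A B (h \<cdot> (a \<boxtimes> b)) x y) = \<phi> (Day_elt A' B' h (act F a x) (act G b y))"
    and h: "h \<in> hom C (A \<otimes> B) D"
  shows "\<phi> (day_cls C F G (Day_elt A B h x y)) = \<phi> (Day_elt A B h x y)"
proof -
  define valid where "valid e \<longleftrightarrow> (\<exists>A B h x y. e = Day_elt A B h x y \<and> h \<in> hom C (A \<otimes> B) D)" for e
  have s: "(valid e \<longrightarrow> valid e' \<and> \<phi> e = \<phi> e') \<and> (valid e' \<longrightarrow> valid e \<and> \<phi> e = \<phi> e')"
    if "day_step C F G e e'" for e e'
    using that
  proof cases
    case (1 a A A' b B B' h D' x y)
    have c: "h \<cdot> (a \<boxtimes> b) \<in> hom C (A \<otimes> B) D'"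
      using comp_hom[OF tens_hom[OF 1(3,4)] 1(5)] .
    have "D' = D" if "valid e"
      using that c 1(1) by (auto simp: valid_def hom_def)
    moreover have "D' = D" if "valid e'"
      using that 1(2,5) by (auto simp: valid_def hom_def)
    moreover have "valid e" "valid e'" "\<phi> e = \<phi> e'" if "D' = D"
      using that 1 c step[of a A A' b B B' h x y] unfolding valid_def act_def by auto
    ultimately show ?thesis by blast
  qed
  have inv: "valid e' \<and> \<phi> e' = \<phi> e" if "equivclp (day_step C F G) e e'" "valid e" for e e'
    using that
  proof (induction rule: equivclp_induct)
    case base
    then show ?case by simp
  next
    case (step y z)
    then show ?case using s[of y z] s[of z y] by auto
  qed
  have "equivclp (day_step C F G) (Day_elt A B h x y) (day_cls C F G (Day_elt A B h x y))"
    unfolding day_cls_def by (rule someI[of _ "Day_elt A B h x y"]) simp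
  moreover have "valid (Day_elt A B h x y)"
    using h by (auto simp: valid_def)
  ultimately show ?thesis
    using inv by blast
qed

lemma day_slide:
  assumes "a \<in> hom C A A'" "b \<in> hom C B B'" "h \<in> hom C (A' \<otimes> B') D" "x \<in> FO F A" "y \<in> FO G B"
  shows "day_cls C F G (Day_elt A B (h \<cdot> (a \<boxtimes> b)) x y)
       = day_cls C F G (Day_elt A' B' h (act F a x) (act G b y))"
proof -
  have "equivclp (day_step C F G) (Day_elt A B (h \<cdot> (a \<boxtimes> b)) x y) (Day_elt A' B' h (act F a x) (act G b y))"
    unfolding act_def using day_step.intros[OF assms] by blast
  then have "equivclp (day_step C F G) (Day_elt A B (h \<cdot> (a \<boxtimes> b)) x y) e
     \<longleftrightarrow> equivclp (day_step C F G) (Day_elt A' B' h (act F a x) (act G b y)) e" for e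
    by (meson equivclp_sym equivclp_trans)
  then show ?thesis
    unfolding day_cls_def by presburger
qed

lemma day_setI:
  "h \<in> hom C (A \<otimes> B) D \<Longrightarrow> A \<in> Ob C \<Longrightarrow> B \<in> Ob C \<Longrightarrow> x \<in> FO F A \<Longrightarrow> y \<in> FO G B \<Longrightarrow>
   day_cls C F G (Day_elt A B h x y) \<in> day_set C F G D"
  unfolding day_set_def by blast

lemma FO_day [simp]: "FO (day C F G) = day_set C F G"
  by (simp add: day_def)

lemma day_setE:
  assumes "e \<in> day_set C F G D"
  obtains A B h x y where "A \<in> Ob C" "B \<in> Ob C" "h \<in> hom C (A \<otimes> B) D" "x \<in> FO F A" "y \<in> FO G B"
    "e = day_cls C F G (Day_elt A B h x y)"
  using assms unfolding day_set_def by blast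

lemma day_act:
  assumes F: "is_functor C SetCat F" and G: "is_functor C SetCat G"
    and h: "h \<in> hom C (A \<otimes> B) D" and xy: "A \<in> Ob C" "B \<in> Ob C" "x \<in> FO F A" "y \<in> FO G B"
    and k: "k \<in> hom C D E"
  shows "act (day C F G) k (day_cls C F G (Day_elt A B h x y)) = day_cls C F G (Day_elt A B (k \<cdot> h) x y)"
proof -
  have D: "Dom C k = D" using k by (auto simp: hom_def)
  have "act (day C F G) k (day_cls C F G (Day_elt A B h x y)) =
     (case day_cls C F G (Day_elt A B h x y) of Day_elt A B h x y \<Rightarrow> day_cls C F G (Day_elt A B (k \<cdot> h) x y))"
    unfolding act_def day_def using day_setI[OF h xy] D by (simp add: fn_set_fun)
  also have "\<dots> = day_cls C F G (Day_elt A B (k \<cdot> h) x y)"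
  proof (subst day_lift[OF F G _ h, where \<phi> = "\<lambda>e. case e of Day_elt A B h x y \<Rightarrow> day_cls C F G (Day_elt A B (k \<cdot> h) x y)"])
    fix A A' B B' a b h x y
    assume s: "a \<in> hom C A A'" "b \<in> hom C B B'" "h \<in> hom C (A' \<otimes> B') D" "x \<in> FO F A" "y \<in> FO G B"
    show "(case Day_elt A B (h \<cdot> (a \<boxtimes> b)) x y of Day_elt A B h x y \<Rightarrow> day_cls C F G (Day_elt A B (k \<cdot> h) x y)) =
      (case Day_elt A' B' h (act F a x) (act G b y) of Day_elt A B h x y \<Rightarrow> day_cls C F G (Day_elt A B (k \<cdot> h) x y))"
      using day_slide[OF s(1,2) comp_hom[OF s(3) k] s(4,5)] comp_assoc[OF tens_hom[OF s(1,2)] s(3) k] by simp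
  qed simp
  finally show ?thesis .
qed

lemma day_functor:
  assumes F: "is_functor C SetCat F" and G: "is_functor C SetCat G"
  shows "is_functor C SetCat (day C F G)"
proof (rule copsheafI)
  fix D E k assume k: "k \<in> hom C D E"
  have "act (day C F G) k e \<in> day_set C F G E" if e: "e \<in> day_set C F G D" for e
    using e
  proof (rule day_setE)
    fix A B h x y assume *: "A \<in> Ob C" "B \<in> Ob C" "h \<in> hom C (A \<otimes> B) D" "x \<in> FO F A" "y \<in> FO G B"
      "e = day_cls C F G (Day_elt A B h x y)"
    show ?thesis
      using day_act[OF F G *(3) *(1,2,4,5) k] day_setI[OF comp_hom[OF *(3) k] *(1,2,4,5)] *(6) by simp
  qed
  moreover have "Dom C k = D" "Cod C k = E" using k by (auto simp: hom_def)
  ultimately show "FA (day C F G) k \<in> hom SetCat (FO (day C F G) D) (FO (day C F G) E)"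
    unfolding act_def day_def by (auto intro!: set_fun_hom simp: fn_set_fun)
next
  fix D e assume D: "D \<in> Ob C" and "e \<in> FO (day C F G) D"
  then have "e \<in> day_set C F G D" by simp
  then show "act (day C F G) (Idt C D) e = e"
    by (rule day_setE) (simp add: day_act[OF F G _ _ _ _ _ id_hom[OF D]] id_left)
next
  fix D E E' k k' e assume k: "k \<in> hom C D E" "k' \<in> hom C E E'" and "e \<in> FO (day C F G) D"
  then have "e \<in> day_set C F G D" by simp
  then show "act (day C F G) (k' \<cdot> k) e = act (day C F G) k' (act (day C F G) k e)"
    by (rule day_setE)
       (simp add: day_act[OF F G _ _ _ _ _ comp_hom[OF k]] day_act[OF F G _ _ _ _ _ k(1)]
          day_act[OF F G comp_hom[OF _ k(1)] _ _ _ _ k(2)] comp_assoc[OF _ k])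
qed

lemma day_nat_ext:
  assumes t: "t \<in> hom (copsh_op C) M (day C F G)" and s: "s \<in> hom (copsh_op C) M (day C F G)"
    and eq: "\<And>A B h D x y. A \<in> Ob C \<Longrightarrow> B \<in> Ob C \<Longrightarrow> h \<in> hom C (A \<otimes> B) D \<Longrightarrow> x \<in> FO F A \<Longrightarrow> y \<in> FO G B \<Longrightarrow>
       app t D (day_cls C F G (Day_elt A B h x y)) = app s D (day_cls C F G (Day_elt A B h x y))"
  shows "t = s"
  by (rule copsh_ext[OF t s]) (auto elim!: day_setE intro: eq)

text \<open>
  A transformation out of the coend amounts to a function of the generators which respects the
  coend relation; by \<open>day_lift\<close>, its value does not depend on the choice of representatives.
\<close>

lemma day_nat_arrow:
  assumes F: "is_functor C SetCat F" and G: "is_functor C SetCat G" and M: "is_functor C SetCat M"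
    and mem: "\<And>A B h D x y. A \<in> Ob C \<Longrightarrow> B \<in> Ob C \<Longrightarrow> h \<in> hom C (A \<otimes> B) D \<Longrightarrow> x \<in> FO F A \<Longrightarrow> y \<in> FO G B \<Longrightarrow>
      \<psi> A B h x y \<in> FO M D"
    and nat: "\<And>A B h D k E x y. A \<in> Ob C \<Longrightarrow> B \<in> Ob C \<Longrightarrow> h \<in> hom C (A \<otimes> B) D \<Longrightarrow> x \<in> FO F A \<Longrightarrow> y \<in> FO G B \<Longrightarrow>
      k \<in> hom C D E \<Longrightarrow> \<psi> A B (k \<cdot> h) x y = act M k (\<psi> A B h x y)"
    and step: "\<And>A A' B B' a b h D x y. a \<in> hom C A A' \<Longrightarrow> b \<in> hom C B B' \<Longrightarrow> h \<in> hom C (A' \<otimes> B') D \<Longrightarrow>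
       x \<in> FO F A \<Longrightarrow> y \<in> FO G B \<Longrightarrow> \<psi> A B (h \<cdot> (a \<boxtimes> b)) x y = \<psi> A' B' h (act F a x) (act G b y)"
  defines "t \<equiv> nat_arrow C (day C F G) (\<lambda>D e. case e of Day_elt A B h x y \<Rightarrow> \<psi> A B h x y) M"
  shows "t \<in> hom (copsh_op C) M (day C F G)"
    and "A \<in> Ob C \<Longrightarrow> B \<in> Ob C \<Longrightarrow> h \<in> hom C (A \<otimes> B) D \<Longrightarrow> x \<in> FO F A \<Longrightarrow> y \<in> FO G B \<Longrightarrow>
      app t D (day_cls C F G (Day_elt A B h x y)) = \<psi> A B h x y"
proof -
  let ?\<phi> = "\<lambda>e. case e of Day_elt A B h x y \<Rightarrow> \<psi> A B h x y"
  have ev: "?\<phi> (day_cls C F G (Day_elt A B h x y)) = \<psi> A B h x y"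
    if "h \<in> hom C (A \<otimes> B) D" for A B h D x y
    using day_lift[OF F G _ that, where \<phi> = ?\<phi>] step by simp
  show "t \<in> hom (copsh_op C) M (day C F G)"
    unfolding t_def
  proof (rule copsh_homI[OF M day_functor[OF F G]])
    fix D e assume "e \<in> FO (day C F G) D"
    then have "e \<in> day_set C F G D" by simp
    then show "?\<phi> e \<in> FO M D"
      by (rule day_setE) (simp only: ev mem)
  next
    fix D E k e assume k: "k \<in> hom C D E" and "e \<in> FO (day C F G) D"
    then have "e \<in> day_set C F G D" by simp
    then show "?\<phi> (act (day C F G) k e) = act M k (?\<phi> e)"
      by (rule day_setE) (simp only: day_act[OF F G _ _ _ _ _ k] ev[OF comp_hom[OF _ k]] ev nat[OF _ _ _ _ _ k])
  qed
  show "app t D (day_cls C F G (Day_elt A B h x y)) = \<psi> A B h x y"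
    if "A \<in> Ob C" "B \<in> Ob C" "h \<in> hom C (A \<otimes> B) D" "x \<in> FO F A" "y \<in> FO G B"
    unfolding t_def
    using day_setI[OF that(3,1,2,4,5)] ev[OF that(3)] hom_ob[OF that(3)] by (subst app_nat_arrow) auto
qed

lemma day_tensA:
  assumes s: "s \<in> hom (copsh_op C) F F'" and t: "t \<in> hom (copsh_op C) G G'"
  shows "s \<boxtimes>\<^bsub>copsh_op C\<^esub> t \<in> hom (copsh_op C) (day C F G) (day C F' G')"
    and "A \<in> Ob C \<Longrightarrow> B \<in> Ob C \<Longrightarrow> h \<in> hom C (A \<otimes> B) D \<Longrightarrow> x \<in> FO F' A \<Longrightarrow> y \<in> FO G' B \<Longrightarrow>
      app (s \<boxtimes>\<^bsub>copsh_op C\<^esub> t) D (day_cls C F' G' (Day_elt A B h x y)) =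
      day_cls C F G (Day_elt A B h (app s A x) (app t B y))"
proof -
  note S = copsh_homD[OF s] and T = copsh_homD[OF t]
  let ?\<psi> = "\<lambda>A B h x y. day_cls C F G (Day_elt A B h (app s A x) (app t B y))"
  have eq: "s \<boxtimes>\<^bsub>copsh_op C\<^esub> t =
      nat_arrow C (day C F' G') (\<lambda>D e. case e of Day_elt A B h x y \<Rightarrow> ?\<psi> A B h x y) (day C F G)"
    unfolding app_def by (simp add: copsh_op_def Let_def S T)
  have m: "?\<psi> A B h x y \<in> FO (day C F G) D"
    if "A \<in> Ob C" "B \<in> Ob C" "h \<in> hom C (A \<otimes> B) D" "x \<in> FO F' A" "y \<in> FO G' B" for A B h D x y
    using day_setI[OF that(3,1,2) S(5)[OF that(1,4)] T(5)[OF that(2,5)]] by simp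
  have n: "?\<psi> A B (k \<cdot> h) x y = act (day C F G) k (?\<psi> A B h x y)"
    if "A \<in> Ob C" "B \<in> Ob C" "h \<in> hom C (A \<otimes> B) D" "x \<in> FO F' A" "y \<in> FO G' B" "k \<in> hom C D E"
    for A B h D k E x y
    using day_act[OF S(1) T(1) that(3,1,2) S(5)[OF that(1,4)] T(5)[OF that(2,5)] that(6)] by simp
  have st: "?\<psi> A B (h \<cdot> (a \<boxtimes> b)) x y = ?\<psi> A' B' h (act F' a x) (act G' b y)"
    if "a \<in> hom C A A'" "b \<in> hom C B B'" "h \<in> hom C (A' \<otimes> B') D" "x \<in> FO F' A" "y \<in> FO G' B"
    for A A' B B' a b h D x y
    using day_slide[OF that(1-3) S(5) T(5), of x y] S(6)[OF that(1,4)] T(6)[OF that(2,5)]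
      hom_ob[OF that(1)] hom_ob[OF that(2)] that(4,5) by simp
  show "s \<boxtimes>\<^bsub>copsh_op C\<^esub> t \<in> hom (copsh_op C) (day C F G) (day C F' G')"
    unfolding eq by (rule day_nat_arrow(1)[OF S(2) T(2) day_functor[OF S(1) T(1)] m n st]) assumption+
  show "app (s \<boxtimes>\<^bsub>copsh_op C\<^esub> t) D (day_cls C F' G' (Day_elt A B h x y)) = ?\<psi> A B h x y"
    if "A \<in> Ob C" "B \<in> Ob C" "h \<in> hom C (A \<otimes> B) D" "x \<in> FO F' A" "y \<in> FO G' B"
    unfolding eq by (rule day_nat_arrow(2)[OF S(2) T(2) day_functor[OF S(1) T(1)] m n st that]) assumption+
qed

lemma copsh_lunit:
  assumes F: "is_functor C SetCat F"
  shows "lunit (copsh_op C) F \<in> hom (copsh_op C) (day C (hom_copsh C (unit C)) F) F"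
    and "D \<in> Ob C \<Longrightarrow> x \<in> FO F D \<Longrightarrow> app (lunit (copsh_op C) F) D x =
      day_cls C (hom_copsh C (unit C)) F (Day_elt (unit C) D (lunit C D) (Hom_elt (Idt C (unit C))) x)"
proof -
  let ?I = "hom_copsh C (unit C)" and ?i = "Hom_elt (Idt C (unit C))"
  let ?\<tau> = "\<lambda>D x. day_cls C ?I F (Day_elt (unit C) D (lunit C D) ?i x)"
  have eq: "lunit (copsh_op C) F = nat_arrow C F ?\<tau> (day C ?I F)"
    by (simp add: copsh_op_def Let_def)
  have I: "Idt C (unit C) \<in> hom C (unit C) (unit C)" using id_hom unit_ob by blast
  then have i: "?i \<in> FO ?I (unit C)" by simp
  show "lunit (copsh_op C) F \<in> hom (copsh_op C) (day C ?I F) F"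
    unfolding eq
  proof (rule copsh_homI[OF day_functor[OF hom_copsh_functor F] F])
    show "?\<tau> D x \<in> FO (day C ?I F) D" if "D \<in> Ob C" "x \<in> FO F D" for D x
      using day_setI[OF lunit_hom[OF that(1)] unit_ob that(1) i that(2)] by simp
    show "?\<tau> E (act F f x) = act (day C ?I F) f (?\<tau> D x)" if f: "f \<in> hom C D E" and x: "x \<in> FO F D" for D E f x
    proof -
      have o: "D \<in> Ob C" "E \<in> Ob C" using hom_ob[OF f] by auto
      have "?\<tau> E (act F f x) = day_cls C ?I F (Day_elt (unit C) D (lunit C E \<cdot> (Idt C (unit C) \<boxtimes> f)) ?i x)"
        using day_slide[OF I f lunit_hom[OF o(2)] i x] hom_copsh_act[OF I I] id_left[OF I] by simp
      also have "\<dots> = act (day C ?I F) f (?\<tau> D x)"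
        using lunit_nat[OF f] day_act[OF hom_copsh_functor F lunit_hom[OF o(1)] unit_ob o(1) i x f] by simp
      finally show ?thesis .
    qed
  qed
  show "D \<in> Ob C \<Longrightarrow> x \<in> FO F D \<Longrightarrow> app (lunit (copsh_op C) F) D x = ?\<tau> D x"
    unfolding eq by (rule app_nat_arrow)
qed

lemma copsh_tensor_category: "tensor_category (copsh_op C)"
proof (rule tensor_category.intro[OF copsh_category], unfold_locales)
  interpret P: category "copsh_op C" by (rule copsh_category)
  show "A \<otimes>\<^bsub>copsh_op C\<^esub> B \<in> Ob (copsh_op C)" if "A \<in> Ob (copsh_op C)" "B \<in> Ob (copsh_op C)" for A B
    using that day_functor by simp
  show "f \<boxtimes>\<^bsub>copsh_op C\<^esub> g \<in> hom (copsh_op C) (A \<otimes>\<^bsub>copsh_op C\<^esub> B) (A' \<otimes>\<^bsub>copsh_op C\<^esub> B')"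
    if "f \<in> hom (copsh_op C) A A'" "g \<in> hom (copsh_op C) B B'" for f g A A' B B'
    using day_tensA(1)[OF that] by simp
  show "Idt (copsh_op C) A \<boxtimes>\<^bsub>copsh_op C\<^esub> Idt (copsh_op C) B = Idt (copsh_op C) (A \<otimes>\<^bsub>copsh_op C\<^esub> B)"
    if "A \<in> Ob (copsh_op C)" "B \<in> Ob (copsh_op C)" for A B
  proof -
    have ab: "is_functor C SetCat A" "is_functor C SetCat B" using that by auto
    note iA = copsh_id[OF ab(1)] and iB = copsh_id[OF ab(2)] and iD = copsh_id[OF day_functor[OF ab]]
    have "Idt (copsh_op C) A \<boxtimes>\<^bsub>copsh_op C\<^esub> Idt (copsh_op C) B = Idt (copsh_op C) (day C A B)"
    proof (rule day_nat_ext[OF day_tensA(1)[OF iA(1) iB(1)] iD(1)])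
      fix A' B' h D x y assume *: "A' \<in> Ob C" "B' \<in> Ob C" "h \<in> hom C (A' \<otimes> B') D" "x \<in> FO A A'" "y \<in> FO B B'"
      show "app (Idt (copsh_op C) A \<boxtimes>\<^bsub>copsh_op C\<^esub> Idt (copsh_op C) B) D (day_cls C A B (Day_elt A' B' h x y)) =
          app (Idt (copsh_op C) (day C A B)) D (day_cls C A B (Day_elt A' B' h x y))"
        using day_tensA(2)[OF iA(1) iB(1) *] iA(2)[OF *(1,4)] iB(2)[OF *(2,5)] iD(2)[of D]
          day_setI[OF *(3,1,2,4,5)] hom_ob[OF *(3)] by simp
    qed
    then show ?thesis by simp
  qed
  show "(f' \<cdot>\<^bsub>copsh_op C\<^esub> f) \<boxtimes>\<^bsub>copsh_op C\<^esub> (g' \<cdot>\<^bsub>copsh_op C\<^esub> g) =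
      (f' \<boxtimes>\<^bsub>copsh_op C\<^esub> g') \<cdot>\<^bsub>copsh_op C\<^esub> (f \<boxtimes>\<^bsub>copsh_op C\<^esub> g)"
    if f: "f \<in> hom (copsh_op C) A A'" and f': "f' \<in> hom (copsh_op C) A' A''"
      and g: "g \<in> hom (copsh_op C) B B'" and g': "g' \<in> hom (copsh_op C) B' B''"
    for f f' g g' A A' A'' B B' B''
  proof -
    note ff = copsh_comp[OF f f'] and gg = copsh_comp[OF g g']
    note t = day_tensA[OF f g] and t' = day_tensA[OF f' g']
    show ?thesis
    proof (rule day_nat_ext[OF day_tensA(1)[OF ff(1) gg(1)] copsh_comp(1)[OF t(1) t'(1)]])
      fix E E' h D x y
      assume *: "E \<in> Ob C" "E' \<in> Ob C" "h \<in> hom C (E \<otimes> E') D" "x \<in> FO A'' E" "y \<in> FO B'' E'"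
      have xy: "app f' E x \<in> FO A' E" "app g' E' y \<in> FO B' E'"
        using copsh_homD(5)[OF f'] copsh_homD(5)[OF g'] * by auto
      let ?e = "day_cls C A'' B'' (Day_elt E E' h x y)"
      have e: "?e \<in> FO (day C A'' B'') D" "D \<in> Ob C"
        using day_setI[OF *(3,1,2,4,5)] hom_ob[OF *(3)] by auto
      show "app ((f' \<cdot>\<^bsub>copsh_op C\<^esub> f) \<boxtimes>\<^bsub>copsh_op C\<^esub> (g' \<cdot>\<^bsub>copsh_op C\<^esub> g)) D ?e =
          app ((f' \<boxtimes>\<^bsub>copsh_op C\<^esub> g') \<cdot>\<^bsub>copsh_op C\<^esub> (f \<boxtimes>\<^bsub>copsh_op C\<^esub> g)) D ?e"
        using day_tensA(2)[OF ff(1) gg(1) *] copsh_comp(2)[OF t(1) t'(1) e(2,1)]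
          t'(2)[OF *] t(2)[OF *(1-3) xy] ff(2)[OF *(1,4)] gg(2)[OF *(2,5)] by simp
    qed
  qed
  show "unit (copsh_op C) \<in> Ob (copsh_op C)"
    using hom_copsh_functor by simp
  show "lunit (copsh_op C) A \<in> hom (copsh_op C) (unit (copsh_op C) \<otimes>\<^bsub>copsh_op C\<^esub> A) A"
    if "A \<in> Ob (copsh_op C)" for A
    using that copsh_lunit(1) by simp
  show "lunit (copsh_op C) B \<cdot>\<^bsub>copsh_op C\<^esub> (Idt (copsh_op C) (unit (copsh_op C)) \<boxtimes>\<^bsub>copsh_op C\<^esub> f) =
       f \<cdot>\<^bsub>copsh_op C\<^esub> lunit (copsh_op C) A"
    if f: "f \<in> hom (copsh_op C) A B" for f A B
  proof -
    note ff = copsh_homD[OF f]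
    let ?I = "hom_copsh C (unit C)" and ?i = "Hom_elt (Idt C (unit C))"
    note id = copsh_id[OF hom_copsh_functor]
    note la = copsh_lunit[OF ff(1)] and lb = copsh_lunit[OF ff(2)] and t = day_tensA[OF id(1) f]
    have "lunit (copsh_op C) B \<cdot>\<^bsub>copsh_op C\<^esub> (Idt (copsh_op C) ?I \<boxtimes>\<^bsub>copsh_op C\<^esub> f) =
       f \<cdot>\<^bsub>copsh_op C\<^esub> lunit (copsh_op C) A"
    proof (rule copsh_ext[OF copsh_comp(1)[OF t(1) lb(1)] copsh_comp(1)[OF la(1) f]])
      fix D x assume *: "D \<in> Ob C" "x \<in> FO B D"
      have i: "?i \<in> FO ?I (unit C)" using id_hom unit_ob by simp
      show "app (lunit (copsh_op C) B \<cdot>\<^bsub>copsh_op C\<^esub> (Idt (copsh_op C) ?I \<boxtimes>\<^bsub>copsh_op C\<^esub> f)) D x =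
         app (f \<cdot>\<^bsub>copsh_op C\<^esub> lunit (copsh_op C) A) D x"
        using copsh_comp(2)[OF t(1) lb(1) *] copsh_comp(2)[OF la(1) f *] lb(2)[OF *]
          la(2)[OF *(1) ff(5)[OF *]] t(2)[OF unit_ob *(1) lunit_hom[OF *(1)] i *(2)] id(2)[OF unit_ob i]
        by simp
    qed
    then show ?thesis by simp
  qed
qed

text \<open>
  The inverse of \<open>mu\<close> sends the generator \<open>(h, f, g)\<close> to \<open>h \<cdot> (f \<otimes> g)\<close>. By \<open>day_slide\<close> along \<open>f\<close> and \<open>g\<close>,
  that generator is equal to \<open>(h \<cdot> (f \<otimes> g), id, id)\<close>, which is the value of \<open>mu\<close>.
\<close>

lemma yoneda_mu:
  assumes A: "A \<in> Ob C" and B: "B \<in> Ob C"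
  shows "mu (yoneda C) A B \<in> hom (copsh_op C) (day C (hom_copsh C A) (hom_copsh C B)) (hom_copsh C (A \<otimes> B))"
    and "k \<in> hom C (A \<otimes> B) D \<Longrightarrow> app (mu (yoneda C) A B) D (Hom_elt k) =
      day_cls C (hom_copsh C A) (hom_copsh C B) (Day_elt A B k (Hom_elt (Idt C A)) (Hom_elt (Idt C B)))"
    and "is_iso (copsh_op C) (mu (yoneda C) A B)"
proof -
  interpret P: tensor_category "copsh_op C" by (rule copsh_tensor_category)
  let ?A = "hom_copsh C A" and ?B = "hom_copsh C B" and ?i = "Hom_elt (Idt C A)" and ?j = "Hom_elt (Idt C B)"
  let ?AB = "hom_copsh C (A \<otimes> B)"
  let ?m = "mu (yoneda C) A B"
  have eq: "?m = nat_arrow C ?AB (\<lambda>D e. day_cls C ?A ?B (Day_elt A B (arrow_of e) ?i ?j)) (day C ?A ?B)"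
    by (simp add: yoneda_def)
  have i: "?i \<in> FO ?A A" "?j \<in> FO ?B B" using id_hom A B by auto
  note ff = hom_copsh_functor
  show m: "?m \<in> hom (copsh_op C) (day C ?A ?B) ?AB"
    unfolding eq
  proof (rule copsh_homI[OF day_functor[OF ff ff] ff])
    show "day_cls C ?A ?B (Day_elt A B (arrow_of e) ?i ?j) \<in> FO (day C ?A ?B) D" if "e \<in> FO ?AB D" for D e
      using that day_setI[OF _ A B i] by auto
    show "day_cls C ?A ?B (Day_elt A B (arrow_of (act ?AB f e)) ?i ?j) =
       act (day C ?A ?B) f (day_cls C ?A ?B (Day_elt A B (arrow_of e) ?i ?j))"
      if f: "f \<in> hom C D E" and e: "e \<in> FO ?AB D" for D E f e
      using e day_act[OF ff ff _ A B i f] hom_copsh_act[OF _ f] by auto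
  qed
  show ev: "app ?m D (Hom_elt k) = day_cls C ?A ?B (Day_elt A B k ?i ?j)" if "k \<in> hom C (A \<otimes> B) D" for k D
    unfolding eq using that hom_ob[OF that] by (subst app_nat_arrow) auto
  let ?\<psi> = "\<lambda>A' B' h x y. Hom_elt (h \<cdot> (arrow_of x \<boxtimes> arrow_of y))"
  define n where "n = nat_arrow C (day C ?A ?B) (\<lambda>D e. case e of Day_elt A' B' h x y \<Rightarrow> ?\<psi> A' B' h x y) ?AB"
  have n1: "?\<psi> A' B' h x y \<in> FO ?AB D"
    if "A' \<in> Ob C" "B' \<in> Ob C" "h \<in> hom C (A' \<otimes> B') D" "x \<in> FO ?A A'" "y \<in> FO ?B B'" for A' B' h D x y
    using that tens_hom comp_hom by fastforce
  have n2: "?\<psi> A' B' (k \<cdot> h) x y = act ?AB k (?\<psi> A' B' h x y)"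
    if "A' \<in> Ob C" "B' \<in> Ob C" and h: "h \<in> hom C (A' \<otimes> B') D" and x: "x \<in> FO ?A A'"
      and y: "y \<in> FO ?B B'" and k: "k \<in> hom C D E" for A' B' h D k E x y
  proof -
    obtain f g where f: "x = Hom_elt f" "f \<in> hom C A A'" and g: "y = Hom_elt g" "g \<in> hom C B B'"
      using x y by auto
    note fg = tens_hom[OF f(2) g(2)]
    show ?thesis
      using comp_assoc[OF fg h k] hom_copsh_act[OF comp_hom[OF fg h] k] f g by simp
  qed
  have n3: "?\<psi> A1 B1 (h \<cdot> (a \<boxtimes> b)) x y = ?\<psi> A' B' h (act ?A a x) (act ?B b y)"
    if a: "a \<in> hom C A1 A'" and b: "b \<in> hom C B1 B'" and h: "h \<in> hom C (A' \<otimes> B') D"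
      and x: "x \<in> FO ?A A1" and y: "y \<in> FO ?B B1" for A1 A' B1 B' a b h D x y
  proof -
    obtain f g where f: "x = Hom_elt f" "f \<in> hom C A A1" and g: "y = Hom_elt g" "g \<in> hom C B B1"
      using x y by auto
    show ?thesis
      using comp_assoc[OF tens_hom[OF f(2) g(2)] tens_hom[OF a b] h] f g
        hom_copsh_act[OF f(2) a] hom_copsh_act[OF g(2) b] tens_comp[OF f(2) a g(2) b]
      by simp
  qed
  have n: "n \<in> hom (copsh_op C) ?AB (day C ?A ?B)"
    unfolding n_def by (rule day_nat_arrow(1)[OF ff ff ff n1 n2 n3]) assumption+
  have nev: "app n D (day_cls C ?A ?B (Day_elt A' B' h x y)) = ?\<psi> A' B' h x y"
    if "A' \<in> Ob C" "B' \<in> Ob C" "h \<in> hom C (A' \<otimes> B') D" "x \<in> FO ?A A'" "y \<in> FO ?B B'" for A' B' h D x y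
    unfolding n_def by (rule day_nat_arrow(2)[OF ff ff ff n1 n2 n3 that]) assumption+
  show "is_iso (copsh_op C) ?m"
  proof (rule P.isoI[OF m n])
    note idd = copsh_id[OF day_functor[OF ff ff]]
    show "n \<cdot>\<^bsub>copsh_op C\<^esub> ?m = Idt (copsh_op C) (day C ?A ?B)"
    proof (rule day_nat_ext[OF copsh_comp(1)[OF m n] idd(1)])
      fix A' B' h D x y
      assume *: "A' \<in> Ob C" "B' \<in> Ob C" "h \<in> hom C (A' \<otimes> B') D" "x \<in> FO ?A A'" "y \<in> FO ?B B'"
      obtain f g where f: "x = Hom_elt f" "f \<in> hom C A A'" and g: "y = Hom_elt g" "g \<in> hom C B B'"
        using *(4,5) by auto
      let ?e = "day_cls C ?A ?B (Day_elt A' B' h x y)"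
      have e: "?e \<in> FO (day C ?A ?B) D" "D \<in> Ob C"
        using day_setI[OF *(3,1,2,4,5)] hom_ob[OF *(3)] by auto
      have "app (n \<cdot>\<^bsub>copsh_op C\<^esub> ?m) D ?e = day_cls C ?A ?B (Day_elt A B (h \<cdot> (f \<boxtimes> g)) ?i ?j)"
        using copsh_comp(2)[OF m n e(2,1)] nev[OF *] ev[OF comp_hom[OF tens_hom[OF f(2) g(2)] *(3)]] f g
        by simp
      also have "\<dots> = ?e"
        using day_slide[OF f(2) g(2) *(3) i] hom_copsh_act[OF id_hom[OF A] f(2)]
          hom_copsh_act[OF id_hom[OF B] g(2)] id_right[OF f(2)] id_right[OF g(2)] f g by simp
      finally show "app (n \<cdot>\<^bsub>copsh_op C\<^esub> ?m) D ?e = app (Idt (copsh_op C) (day C ?A ?B)) D ?e"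
        using idd(2)[OF e(2,1)] by simp
    qed
    show "?m \<cdot>\<^bsub>copsh_op C\<^esub> n = Idt (copsh_op C) ?AB"
    proof (rule copsh_ext[OF copsh_comp(1)[OF n m] copsh_id(1)[OF ff]])
      fix D x assume *: "D \<in> Ob C" "x \<in> FO ?AB D"
      then obtain k where k: "x = Hom_elt k" "k \<in> hom C (A \<otimes> B) D" by auto
      show "app (?m \<cdot>\<^bsub>copsh_op C\<^esub> n) D x = app (Idt (copsh_op C) ?AB) D x"
        using copsh_comp(2)[OF n m *] ev[OF k(2)] nev[OF A B k(2) i] copsh_id(2)[OF ff *] k
          tens_id[OF A B] id_right[OF k(2)] by simp
    qed
  qed
qed

lemma yoneda_mu_nat:
  assumes f: "f \<in> hom C A A'" and g: "g \<in> hom C B B'"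
  shows "mu (yoneda C) A' B' \<cdot>\<^bsub>copsh_op C\<^esub> (FA (yoneda C) f \<boxtimes>\<^bsub>copsh_op C\<^esub> FA (yoneda C) g)
     = FA (yoneda C) (f \<boxtimes> g) \<cdot>\<^bsub>copsh_op C\<^esub> mu (yoneda C) A B"
proof -
  have o: "A \<in> Ob C" "B \<in> Ob C" "A' \<in> Ob C" "B' \<in> Ob C" using hom_ob[OF f] hom_ob[OF g] by auto
  note m = yoneda_mu[OF o(1,2)] and m' = yoneda_mu[OF o(3,4)]
  note yf = FA_yoneda[OF f] and yg = FA_yoneda[OF g] and fg = tens_hom[OF f g]
  note t = day_tensA[OF yf(1) yg(1)] and yfg = FA_yoneda[OF fg]
  show ?thesis
  proof (rule copsh_ext[OF copsh_comp(1)[OF t(1) m'(1)] copsh_comp(1)[OF m(1) yfg(1)]])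
    fix D x assume *: "D \<in> Ob C" "x \<in> FO (hom_copsh C (A' \<otimes> B')) D"
    then obtain k where k: "x = Hom_elt k" "k \<in> hom C (A' \<otimes> B') D" by auto
    have i: "Hom_elt (Idt C A') \<in> FO (hom_copsh C A') A'" "Hom_elt (Idt C B') \<in> FO (hom_copsh C B') B'"
      "Hom_elt (Idt C A) \<in> FO (hom_copsh C A) A" "Hom_elt (Idt C B) \<in> FO (hom_copsh C B) B"
      using o id_hom by auto
    show "app (mu (yoneda C) A' B' \<cdot>\<^bsub>copsh_op C\<^esub> (FA (yoneda C) f \<boxtimes>\<^bsub>copsh_op C\<^esub> FA (yoneda C) g)) D x
       = app (FA (yoneda C) (f \<boxtimes> g) \<cdot>\<^bsub>copsh_op C\<^esub> mu (yoneda C) A B) D x"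
      using copsh_comp(2)[OF t(1) m'(1) *] copsh_comp(2)[OF m(1) yfg(1) *] m'(2)[OF k(2)] k
        t(2)[OF o(3,4) k(2) i(1,2)] yf(2)[OF id_hom[OF o(3)]] yg(2)[OF id_hom[OF o(4)]] id_left[OF f] id_left[OF g]
        yfg(2)[OF k(2)] m(2)[OF comp_hom[OF fg k(2)]] day_slide[OF f g k(2) i(3,4)]
        hom_copsh_act[OF id_hom[OF o(1)] f] hom_copsh_act[OF id_hom[OF o(2)] g] id_right[OF f] id_right[OF g]
      by simp
  qed
qed

lemma yoneda_mu_lunit:
  assumes A: "A \<in> Ob C"
  shows "FA (yoneda C) (lunit C A) \<cdot>\<^bsub>copsh_op C\<^esub> mu (yoneda C) (unit C) A \<cdot>\<^bsub>copsh_op C\<^esub>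
      (eps (yoneda C) \<boxtimes>\<^bsub>copsh_op C\<^esub> Idt (copsh_op C) (hom_copsh C A)) = lunit (copsh_op C) (hom_copsh C A)"
proof -
  interpret P: tensor_category "copsh_op C" by (rule copsh_tensor_category)
  let ?I = "hom_copsh C (unit C)" and ?A = "hom_copsh C A"
  note m = yoneda_mu[OF unit_ob A] and l = FA_yoneda[OF lunit_hom[OF A]]
  have e: "eps (yoneda C) \<boxtimes>\<^bsub>copsh_op C\<^esub> Idt (copsh_op C) ?A = Idt (copsh_op C) (day C ?I ?A)"
    using P.tens_id[of ?I ?A] hom_copsh_functor by (simp add: yoneda_def)
  have "FA (yoneda C) (lunit C A) \<cdot>\<^bsub>copsh_op C\<^esub> mu (yoneda C) (unit C) A = lunit (copsh_op C) ?A"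
  proof (rule copsh_ext[OF copsh_comp(1)[OF m(1) l(1)] copsh_lunit(1)[OF hom_copsh_functor]])
    fix D x assume *: "D \<in> Ob C" "x \<in> FO ?A D"
    then obtain k where k: "x = Hom_elt k" "k \<in> hom C A D" by auto
    have i: "Hom_elt (Idt C (unit C)) \<in> FO ?I (unit C)" "Hom_elt (Idt C A) \<in> FO ?A A"
      using id_hom A unit_ob by auto
    note I = id_hom[OF unit_ob]
    show "app (FA (yoneda C) (lunit C A) \<cdot>\<^bsub>copsh_op C\<^esub> mu (yoneda C) (unit C) A) D x = app (lunit (copsh_op C) ?A) D x"
      using copsh_comp(2)[OF m(1) l(1) *] k l(2)[OF k(2)] m(2)[OF comp_hom[OF lunit_hom[OF A] k(2)]]
        copsh_lunit(2)[OF hom_copsh_functor *] day_slide[OF I k(2) lunit_hom[OF *(1)] i] lunit_nat[OF k(2)]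
        hom_copsh_act[OF I I] id_left[OF I] hom_copsh_act[OF id_hom[OF A] k(2)] id_right[OF k(2)] by simp
  qed
  then show ?thesis
    using e P.id_right[OF m(1)] by simp
qed

end

section \<open>Directed colimits of representables\<close>

text \<open>
  The arrows \<open>d i k\<close> go from the later stage \<open>k\<close> to the earlier stage \<open>i\<close>, like the projections between finite
  tensor products. Thus the representables \<open>C(A i, -)\<close> form a directed diagram of copresheaves.
\<close>

locale directed_diagram = tensor_category C
  for C :: "('o, 'm, 'x) smcat_scheme" (structure) +
  fixes I :: "'i set" and le :: "'i \<Rightarrow> 'i \<Rightarrow> bool" and A :: "'i \<Rightarrow> 'o" and d :: "'i \<Rightarrow> 'i \<Rightarrow> 'm"
  assumes nonempty: "I \<noteq> {}"
    and directed: "i \<in> I \<Longrightarrow> j \<in> I \<Longrightarrow> \<exists>k\<in>I. le i k \<and> le j k"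
    and le_trans: "i \<in> I \<Longrightarrow> j \<in> I \<Longrightarrow> k \<in> I \<Longrightarrow> le i j \<Longrightarrow> le j k \<Longrightarrow> le i k"
    and A_ob: "i \<in> I \<Longrightarrow> A i \<in> Ob C"
    and d_hom: "i \<in> I \<Longrightarrow> k \<in> I \<Longrightarrow> le i k \<Longrightarrow> d i k \<in> hom C (A k) (A i)"
    and d_comp: "i \<in> I \<Longrightarrow> j \<in> I \<Longrightarrow> k \<in> I \<Longrightarrow> le i j \<Longrightarrow> le j k \<Longrightarrow> d i j \<cdot> d j k = d i k"
begin

text \<open>Equality in the directed colimit of the sets \<open>C(A i, D)\<close>.\<close>

definition germ_eq :: "'i \<Rightarrow> 'm \<Rightarrow> 'i \<Rightarrow> 'm \<Rightarrow> bool" where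
  "germ_eq i f j g \<longleftrightarrow> (\<exists>k\<in>I. le i k \<and> le j k \<and> f \<cdot> d i k = g \<cdot> d j k)"

lemma germ_refl: "i \<in> I \<Longrightarrow> germ_eq i f i f"
  using directed[of i i] by (auto simp: germ_eq_def)

lemma germ_sym: "germ_eq i f j g \<Longrightarrow> germ_eq j g i f"
  unfolding germ_eq_def by metis

lemma germ_later:
  assumes "i \<in> I" "k \<in> I" "n \<in> I" "le i k" "le k n" "f \<in> hom C (A i) D"
  shows "f \<cdot> d i n = (f \<cdot> d i k) \<cdot> d k n"
  using comp_assoc[OF d_hom d_hom, of k n i f D] d_comp[of i k n] assms by simp

lemma germ_trans:
  assumes "i \<in> I" "j \<in> I" "m \<in> I" "f \<in> hom C (A i) D" "g \<in> hom C (A j) D" "h \<in> hom C (A m) D"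
    and "germ_eq i f j g" "germ_eq j g m h"
  shows "germ_eq i f m h"
proof -
  obtain k where k: "k \<in> I" "le i k" "le j k" "f \<cdot> d i k = g \<cdot> d j k"
    using assms(7) by (auto simp: germ_eq_def)
  obtain k' where k': "k' \<in> I" "le j k'" "le m k'" "g \<cdot> d j k' = h \<cdot> d m k'"
    using assms(8) by (auto simp: germ_eq_def)
  obtain n where n: "n \<in> I" "le k n" "le k' n"
    using directed k(1) k'(1) by blast
  have "f \<cdot> d i n = (f \<cdot> d i k) \<cdot> d k n" "g \<cdot> d j n = (g \<cdot> d j k) \<cdot> d k n"
    "g \<cdot> d j n = (g \<cdot> d j k') \<cdot> d k' n" "h \<cdot> d m n = (h \<cdot> d m k') \<cdot> d k' n"
    using germ_later[OF assms(1) k(1) n(1) k(2) n(2) assms(4)] germ_later[OF assms(2) k(1) n(1) k(3) n(2) assms(5)]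
      germ_later[OF assms(2) k'(1) n(1) k'(2) n(3) assms(5)] germ_later[OF assms(3) k'(1) n(1) k'(3) n(3) assms(6)]
    by simp_all
  then have "f \<cdot> d i n = h \<cdot> d m n"
    using k(4) k'(4) by simp
  then show ?thesis
    unfolding germ_eq_def using n k k' le_trans assms(1-3) by blast
qed

lemma germ_comp:
  assumes "i \<in> I" "j \<in> I" "f \<in> hom C (A i) D" "g \<in> hom C (A j) D" "h \<in> hom C D E" "germ_eq i f j g"
  shows "germ_eq i (h \<cdot> f) j (h \<cdot> g)"
proof -
  obtain k where k: "k \<in> I" "le i k" "le j k" "f \<cdot> d i k = g \<cdot> d j k"
    using assms(6) by (auto simp: germ_eq_def)
  have "(h \<cdot> f) \<cdot> d i k = (h \<cdot> g) \<cdot> d j k"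
    using comp_assoc[OF d_hom[OF assms(1) k(1,2)] assms(3,5)] comp_assoc[OF d_hom[OF assms(2) k(1,3)] assms(4,5)] k(4)
    by simp
  then show ?thesis
    unfolding germ_eq_def using k by blast
qed

lemma germ_d:
  assumes "i \<in> I" "k \<in> I" "le i k" "f \<in> hom C (A i) D"
  shows "germ_eq i f k (f \<cdot> d i k)"
proof -
  obtain n where "n \<in> I" "le i n" "le k n"
    using directed assms by blast
  then show ?thesis
    unfolding germ_eq_def using germ_later[of i k n f D] assms by blast
qed

end

text \<open>
  By the Yoneda lemma, a cocone from the representables \<open>C(A i, -)\<close> to \<open>L\<close> is a compatible family of
  elements \<open>l i \<in> L (A i)\<close>. The last two axioms say that \<open>L\<close> is the pointwise colimit.
\<close>

locale presentation = directed_diagram C I le A d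
  for C :: "('o, 'm, 'x) smcat_scheme" (structure) and I :: "'i set" and le A d +
  fixes L :: "('o, 'm) copsh" and l :: "'i \<Rightarrow> ('o, 'm) elt"
  assumes copsheaf: "is_functor C SetCat L"
    and elt_mem: "i \<in> I \<Longrightarrow> l i \<in> FO L (A i)"
    and elt_compat: "i \<in> I \<Longrightarrow> k \<in> I \<Longrightarrow> le i k \<Longrightarrow> act L (d i k) (l k) = l i"
    and elt_surj: "D \<in> Ob C \<Longrightarrow> x \<in> FO L D \<Longrightarrow> \<exists>i\<in>I. \<exists>f\<in>hom C (A i) D. x = act L f (l i)"
    and elt_inj: "i \<in> I \<Longrightarrow> j \<in> I \<Longrightarrow> f \<in> hom C (A i) D \<Longrightarrow> g \<in> hom C (A j) D \<Longrightarrow>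
      act L f (l i) = act L g (l j) \<Longrightarrow> germ_eq i f j g"

lemma (in directed_diagram) germ_act_eq:
  assumes M: "is_functor C SetCat M"
    and mem: "\<And>i. i \<in> I \<Longrightarrow> m i \<in> FO M (A i)"
    and compat: "\<And>i k. i \<in> I \<Longrightarrow> k \<in> I \<Longrightarrow> le i k \<Longrightarrow> act M (d i k) (m k) = m i"
    and i: "i \<in> I" "f \<in> hom C (A i) D" and j: "j \<in> I" "g \<in> hom C (A j) D" and eq: "germ_eq i f j g"
  shows "act M f (m i) = act M g (m j)"
proof -
  obtain k where k: "k \<in> I" "le i k" "le j k" "f \<cdot> d i k = g \<cdot> d j k"
    using eq by (auto simp: germ_eq_def)
  show ?thesis
    using copsheafD(3)[OF M d_hom[OF i(1) k(1,2)] i(2) mem[OF k(1)]]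
      copsheafD(3)[OF M d_hom[OF j(1) k(1,3)] j(2) mem[OF k(1)]] compat[OF i(1) k(1,2)] compat[OF j(1) k(1,3)] k(4)
    by simp
qed

context presentation
begin

lemma act_eq_iff:
  assumes "i \<in> I" "j \<in> I" "f \<in> hom C (A i) D" "g \<in> hom C (A j) D"
  shows "act L f (l i) = act L g (l j) \<longleftrightarrow> germ_eq i f j g"
  using elt_inj[OF assms] germ_act_eq[OF copsheaf elt_mem elt_compat assms(1,3,2,4)] by blast

lemma elt_id: "i \<in> I \<Longrightarrow> act L (Idt C (A i)) (l i) = l i"
  using copsheafD(2)[OF copsheaf A_ob elt_mem] .

text \<open>
  Because of the opposite category, the universal property of the colimit \<open>L\<close> concerns arrows into \<open>L\<close>.
\<close>

lemma universal_ex: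
  assumes M: "is_functor C SetCat M"
    and mem: "\<And>i. i \<in> I \<Longrightarrow> m i \<in> FO M (A i)"
    and compat: "\<And>i k. i \<in> I \<Longrightarrow> k \<in> I \<Longrightarrow> le i k \<Longrightarrow> act M (d i k) (m k) = m i"
  obtains h where "h \<in> hom (copsh_op C) M L" "\<And>i. i \<in> I \<Longrightarrow> app h (A i) (l i) = m i"
proof -
  define \<tau> where "\<tau> D x = (THE y. \<exists>i\<in>I. \<exists>f\<in>hom C (A i) D. x = act L f (l i) \<and> y = act M f (m i))" for D x
  have ev: "\<tau> D (act L f (l i)) = act M f (m i)" if "i \<in> I" "f \<in> hom C (A i) D" for i f D
    unfolding \<tau>_def
  proof (rule the_equality)
    show "\<exists>i'\<in>I. \<exists>f'\<in>hom C (A i') D. act L f (l i) = act L f' (l i') \<and> act M f (m i) = act M f' (m i')"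
      using that by blast
    show "y = act M f (m i)" 
      if "\<exists>i'\<in>I. \<exists>f'\<in>hom C (A i') D. act L f (l i) = act L f' (l i') \<and> y = act M f' (m i')" for y
      using that \<open>i \<in> I\<close> \<open>f \<in> hom C (A i) D\<close> germ_act_eq[OF M mem compat] elt_inj by metis
  qed
  let ?h = "nat_arrow C L \<tau> M"
  have h: "?h \<in> hom (copsh_op C) M L"
  proof (rule copsh_homI[OF M copsheaf])
    show "\<tau> D x \<in> FO M D" if "D \<in> Ob C" "x \<in> FO L D" for D x
      using elt_surj[OF that] ev copsheafD(1)[OF M _ mem] by auto
    show "\<tau> E (act L k x) = act M k (\<tau> D x)" if k: "k \<in> hom C D E" and x: "x \<in> FO L D" for D E k x
    proof -
      obtain i f where f: "i \<in> I" "f \<in> hom C (A i) D" "x = act L f (l i)"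
        using elt_surj x hom_ob[OF k] by blast
      show ?thesis
        using copsheafD(3)[OF copsheaf f(2) k elt_mem[OF f(1)]] copsheafD(3)[OF M f(2) k mem[OF f(1)]]
          ev[OF f(1,2)] ev[OF f(1) comp_hom[OF f(2) k]] f(3) by simp
    qed
  qed
  show thesis
  proof (rule that[OF h])
    show "app ?h (A i) (l i) = m i" if "i \<in> I" for i
      using app_nat_arrow[OF A_ob[OF that], of "l i" L \<tau> M] elt_mem[OF that] ev[OF that id_hom[OF A_ob[OF that]]]
        elt_id[OF that] copsheafD(2)[OF M A_ob[OF that] mem[OF that]] by simp
  qed
qed

lemma universal_eq:
  assumes h: "h \<in> hom (copsh_op C) M L" "h' \<in> hom (copsh_op C) M L"
    and eq: "\<And>i. i \<in> I \<Longrightarrow> app h (A i) (l i) = app h' (A i) (l i)"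
  shows "h = h'"
proof (rule copsh_ext[OF h])
  fix D x assume "D \<in> Ob C" "x \<in> FO L D"
  then obtain i f where f: "i \<in> I" "f \<in> hom C (A i) D" "x = act L f (l i)"
    using elt_surj by blast
  then show "app h D x = app h' D x"
    using copsh_homD(6)[OF h(1) f(2) elt_mem[OF f(1)]] copsh_homD(6)[OF h(2) f(2) elt_mem[OF f(1)]] eq by simp
qed

lemma presentation_cong:
  assumes "\<And>i. i \<in> I \<Longrightarrow> l' i = l i"
  shows "presentation C I le A d L l'"
proof
  show "act L (d i k) (l' k) = l' i" if "i \<in> I" "k \<in> I" "le i k" for i k
    using assms elt_compat[OF that] that by simp
  show "\<exists>i\<in>I. \<exists>f\<in>hom C (A i) D. x = act L f (l' i)" if "D \<in> Ob C" "x \<in> FO L D" for D x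
    using assms elt_surj[OF that] by simp
  show "germ_eq i f j g" if "i \<in> I" "j \<in> I" "f \<in> hom C (A i) D" "g \<in> hom C (A j) D"
    "act L f (l' i) = act L g (l' j)" for i j f g D
    using elt_inj[OF that(1-4)] that(5) assms[OF that(1)] assms[OF that(2)] by simp
qed (simp_all add: assms copsheaf elt_mem)

lemma presentation_iso:
  assumes t: "t \<in> hom (copsh_op C) K L" "is_iso (copsh_op C) t"
  shows "presentation C I le A d K (\<lambda>i. app t (A i) (l i))"
proof
  interpret P: category "copsh_op C" by (rule copsh_category)
  let ?s = "inv_arrow (copsh_op C) t"
  note s = P.inv_arrow[OF t] and T = copsh_homD[OF t(1)]
  note S = copsh_homD[OF s(1)]
  have ts: "app t D (app ?s D x) = x" if "D \<in> Ob C" "x \<in> FO K D" for D x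
    using copsh_comp(2)[OF t(1) s(1) that] s(2) copsh_id(2)[OF T(1) that] by simp
  have st: "app ?s D (app t D x) = x" if "D \<in> Ob C" "x \<in> FO L D" for D x
    using copsh_comp(2)[OF s(1) t(1) that] s(3) copsh_id(2)[OF T(2) that] by simp
  show "is_functor C SetCat K" by (rule T(1))
  show "app t (A i) (l i) \<in> FO K (A i)" if "i \<in> I" for i
    using T(5) A_ob elt_mem that by blast
  show "act K (d i k) (app t (A k) (l k)) = app t (A i) (l i)" if "i \<in> I" "k \<in> I" "le i k" for i k
    using T(6)[OF d_hom[OF that] elt_mem[OF that(2)]] elt_compat[OF that] by simp
  show "\<exists>i\<in>I. \<exists>f\<in>hom C (A i) D. x = act K f (app t (A i) (l i))" if D: "D \<in> Ob C" and x: "x \<in> FO K D" for D x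
  proof -
    obtain i f where f: "i \<in> I" "f \<in> hom C (A i) D" "app ?s D x = act L f (l i)"
      using elt_surj[OF D S(5)[OF D x]] by blast
    then have "x = act K f (app t (A i) (l i))"
      using ts[OF D x] T(6)[OF f(2) elt_mem[OF f(1)]] by simp
    then show ?thesis using f by blast
  qed
  show "germ_eq i f j g"
    if "i \<in> I" "j \<in> I" and f: "f \<in> hom C (A i) D" and g: "g \<in> hom C (A j) D"
      and eq: "act K f (app t (A i) (l i)) = act K g (app t (A j) (l j))" for i j f g D
  proof -
    have "app t D (act L f (l i)) = app t D (act L g (l j))"
      using eq T(6)[OF f elt_mem] T(6)[OF g elt_mem] that(1,2) by simp
    then have "act L f (l i) = act L g (l j)"
      using st[of D "act L f (l i)"] st[of D "act L g (l j)"] copsheafD(1)[OF copsheaf _ elt_mem] f g that(1,2)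
        hom_ob[OF f] by metis
    then show ?thesis
      using elt_inj that(1,2) f g by blast
  qed
qed

end

text \<open>
  Every directed diagram whose index set embeds in the universe of elements has a colimit there: its
  elements are chosen representatives of germs, tagged with their index.
\<close>

lemma (in directed_diagram) presentation_exists:
  fixes code :: "'i \<Rightarrow> ('o, 'm) elt"
  assumes code: "inj_on code I"
  obtains L l where "presentation C I le A d L l"
proof -
  define cl where "cl i f = (SOME e. \<exists>j\<in>I. \<exists>g\<in>hom C (A j) (Cod C f). germ_eq i f j g \<and>
    e = Day_elt (A j) (A j) g (code j) (code j))" for i f
  have cl: "\<exists>j\<in>I. \<exists>g\<in>hom C (A j) D. germ_eq i f j g \<and> cl i f = Day_elt (A j) (A j) g (code j) (code j)"
    if "i \<in> I" "f \<in> hom C (A i) D" for i f D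
  proof -
    have c: "Cod C f = D" using that by (simp add: hom_def)
    have ex: "\<exists>e. \<exists>j\<in>I. \<exists>g\<in>hom C (A j) D. germ_eq i f j g \<and> e = Day_elt (A j) (A j) g (code j) (code j)"
      using that germ_refl by blast
    from someI_ex[OF ex] show ?thesis
      unfolding cl_def c .
  qed
  have cl_eq: "cl i f = cl j g \<longleftrightarrow> germ_eq i f j g"
    if i: "i \<in> I" "f \<in> hom C (A i) D" and j: "j \<in> I" "g \<in> hom C (A j) D" for i f j g D
  proof
    assume "germ_eq i f j g"
    then have "germ_eq i f k h \<longleftrightarrow> germ_eq j g k h" if "k \<in> I" "h \<in> hom C (A k) D" for k h
      using germ_trans[OF i(1) j(1) that(1) i(2) j(2) that(2)] germ_trans[OF j(1) i(1) that(1) j(2) i(2) that(2)]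
        germ_sym by blast
    then have "(\<lambda>e. \<exists>k\<in>I. \<exists>h\<in>hom C (A k) D. germ_eq i f k h \<and> e = Day_elt (A k) (A k) h (code k) (code k)) =
        (\<lambda>e. \<exists>k\<in>I. \<exists>h\<in>hom C (A k) D. germ_eq j g k h \<and> e = Day_elt (A k) (A k) h (code k) (code k))"
      by auto
    moreover have "Cod C f = D" "Cod C g = D" using i j by (auto simp: hom_def)
    ultimately show "cl i f = cl j g"
      unfolding cl_def by simp
  next
    assume eq: "cl i f = cl j g"
    obtain i' f' where *: "i' \<in> I" "f' \<in> hom C (A i') D" "germ_eq i f i' f'"
      "cl i f = Day_elt (A i') (A i') f' (code i') (code i')"
      using cl[OF i] by blast
    obtain j' g' where **: "j' \<in> I" "g' \<in> hom C (A j') D" "germ_eq j g j' g'"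
      "cl j g = Day_elt (A j') (A j') g' (code j') (code j')"
      using cl[OF j] by blast
    have "i' = j'" "f' = g'"
      using eq * ** code by (auto simp: inj_on_def)
    then show "germ_eq i f j g"
      using germ_trans[OF i(1) *(1) j(1) i(2) *(2) j(2) *(3)] **(3) germ_sym by blast
  qed
  define K0 where "K0 D = {cl i f | i f. i \<in> I \<and> f \<in> hom C (A i) D}" for D
  define kact where "kact g e = (THE e'. \<exists>i\<in>I. \<exists>f\<in>hom C (A i) (Dom C g). e = cl i f \<and> e' = cl i (g \<cdot> f))" for g e
  define K where "K = \<lparr>FO = K0, FA = (\<lambda>g. set_fun (K0 (Dom C g)) (kact g) (K0 (Cod C g)))\<rparr>"
  have kact: "kact g (cl i f) = cl i (g \<cdot> f)" if "i \<in> I" "f \<in> hom C (A i) D" "g \<in> hom C D E" for g i f D E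
    unfolding kact_def
  proof (rule the_equality)
    have D: "Dom C g = D" using that by (simp add: hom_def)
    show "\<exists>i'\<in>I. \<exists>f'\<in>hom C (A i') (Dom C g). cl i f = cl i' f' \<and> cl i (g \<cdot> f) = cl i' (g \<cdot> f')"
      using that D by blast
    fix e' assume "\<exists>i'\<in>I. \<exists>f'\<in>hom C (A i') (Dom C g). cl i f = cl i' f' \<and> e' = cl i' (g \<cdot> f')"
    then obtain i' f' where *: "i' \<in> I" "f' \<in> hom C (A i') D" "cl i f = cl i' f'" "e' = cl i' (g \<cdot> f')"
      using D by blast
    then show "e' = cl i (g \<cdot> f)"
      using cl_eq[OF that(1,2) *(1,2)] germ_comp[OF that(1) *(1) that(2) *(2) that(3)]
        cl_eq[OF that(1) comp_hom[OF that(2,3)] *(1) comp_hom[OF *(2) that(3)]] by simp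
  qed
  have K0I: "cl i f \<in> FO K D" if "i \<in> I" "f \<in> hom C (A i) D" for i f D
    using that by (auto simp: K_def K0_def)
  have K0E: "\<exists>i\<in>I. \<exists>f\<in>hom C (A i) D. e = cl i f" if "e \<in> FO K D" for e D
    using that by (auto simp: K_def K0_def)
  have Kact: "act K g (cl i f) = cl i (g \<cdot> f)" if "i \<in> I" "f \<in> hom C (A i) D" "g \<in> hom C D E" for g i f D E
    using kact[OF that] K0I[OF that(1,2)] that by (simp add: act_def K_def fn_set_fun hom_def)
  have KF: "is_functor C SetCat K"
  proof (rule copsheafI)
    fix D E g assume g: "g \<in> hom C D E"
    have "kact g e \<in> FO K E" if "e \<in> FO K D" for e
      using K0E[OF that] kact[OF _ _ g] K0I comp_hom[OF _ g] by auto
    then show "FA K g \<in> hom SetCat (FO K D) (FO K E)"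
      using g by (auto simp: K_def hom_def[of C] intro!: set_fun_hom)
  next
    show "act K (Idt C D) x = x" if "D \<in> Ob C" "x \<in> FO K D" for D x
      using K0E[OF that(2)] Kact[OF _ _ id_hom[OF that(1)]] id_left by auto
  next
    fix D E E' f g x assume fg: "f \<in> hom C D E" "g \<in> hom C E E'" and x: "x \<in> FO K D"
    obtain i k where k: "i \<in> I" "k \<in> hom C (A i) D" "x = cl i k"
      using K0E[OF x] by blast
    show "act K (g \<cdot> f) x = act K g (act K f x)"
      using Kact[OF k(1,2) comp_hom[OF fg]] Kact[OF k(1,2) fg(1)] Kact[OF k(1) comp_hom[OF k(2) fg(1)] fg(2)]
        comp_assoc[OF k(2) fg] k(3) by simp
  qed
  define kl where "kl i = cl i (Idt C (A i))" for i
  have kl: "act K f (kl i) = cl i f" if "i \<in> I" "f \<in> hom C (A i) D" for i f D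
    unfolding kl_def using Kact[OF that(1) id_hom[OF A_ob[OF that(1)]] that(2)] id_right[OF that(2)] by simp
  have "presentation C I le A d K kl"
  proof
    show "is_functor C SetCat K" by (rule KF)
    show "kl i \<in> FO K (A i)" if "i \<in> I" for i
      unfolding kl_def using K0I id_hom A_ob that by blast
    show "act K (d i k) (kl k) = kl i" if "i \<in> I" "k \<in> I" "le i k" for i k
    proof -
      have "germ_eq i (Idt C (A i)) k (d i k)"
        using germ_d[OF that id_hom[OF A_ob[OF that(1)]]] id_left[OF d_hom[OF that]] by simp
      then show ?thesis
        using kl[OF that(2) d_hom[OF that]] cl_eq[OF that(1) id_hom[OF A_ob[OF that(1)]] that(2) d_hom[OF that]]
        by (simp add: kl_def)
    qed
    show "\<exists>i\<in>I. \<exists>f\<in>hom C (A i) D. x = act K f (kl i)" if "D \<in> Ob C" "x \<in> FO K D" for D x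
      using K0E[OF that(2)] kl by metis
    show "germ_eq i f j g"
      if "i \<in> I" "j \<in> I" "f \<in> hom C (A i) D" "g \<in> hom C (A j) D" "act K f (kl i) = act K g (kl j)" for i j f g D
      using that kl cl_eq by metis
  qed
  then show thesis by (rule that)
qed

lemma product_diagram:
  assumes "directed_diagram C I le A d" "directed_diagram C I' le' B e"
  shows "directed_diagram C (I \<times> I') (\<lambda>p q. le (fst p) (fst q) \<and> le' (snd p) (snd q))
    (\<lambda>p. A (fst p) \<otimes>\<^bsub>C\<^esub> B (snd p)) (\<lambda>p q. d (fst p) (fst q) \<boxtimes>\<^bsub>C\<^esub> e (snd p) (snd q))"
proof -
  interpret P: directed_diagram C I le A d by fact
  interpret Q: directed_diagram C I' le' B e by fact
  show ?thesis
  proof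
    show "I \<times> I' \<noteq> {}" using P.nonempty Q.nonempty by blast
    show "\<exists>k\<in>I \<times> I'. (le (fst i) (fst k) \<and> le' (snd i) (snd k)) \<and> le (fst j) (fst k) \<and> le' (snd j) (snd k)"
      if "i \<in> I \<times> I'" "j \<in> I \<times> I'" for i j
      using P.directed[of "fst i" "fst j"] Q.directed[of "snd i" "snd j"] that by force
    show "le (fst i) (fst k) \<and> le' (snd i) (snd k)"
      if "i \<in> I \<times> I'" "j \<in> I \<times> I'" "k \<in> I \<times> I'" "le (fst i) (fst j) \<and> le' (snd i) (snd j)"
        "le (fst j) (fst k) \<and> le' (snd j) (snd k)" for i j k
      using that P.le_trans[of "fst i" "fst j" "fst k"] Q.le_trans[of "snd i" "snd j" "snd k"] by auto
  qed (auto simp: P.A_ob Q.A_ob P.tens_ob P.tens_hom P.d_hom Q.d_hom P.d_comp Q.d_comp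
        P.tens_comp[OF P.d_hom P.d_hom Q.d_hom Q.d_hom, symmetric])
qed

text \<open>
  A generator \<open>(h, x, y)\<close> of the convolution with \<open>x = f l\<^sub>i\<close> and \<open>y = g m\<^sub>j\<close> slides to \<open>(h (f \<otimes> g), l\<^sub>i, m\<^sub>j)\<close>,
  so each element comes from a stage \<open>A\<^sub>i \<otimes> B\<^sub>j\<close>. For injectivity, one assigns to a generator the set of all
  germs \<open>h (f \<otimes> g)\<close> arising in this way. They are equal to each other, and a step of the coend relation
  does not change their class; hence the class is a function on the coend that recovers the germ.
\<close>

lemma product_presentation:
  assumes P: "presentation C I le A d L l" and Q: "presentation C I' le' B e M m"
  shows "presentation C (I \<times> I') (\<lambda>p q. le (fst p) (fst q) \<and> le' (snd p) (snd q))
    (\<lambda>p. A (fst p) \<otimes>\<^bsub>C\<^esub> B (snd p)) (\<lambda>p q. d (fst p) (fst q) \<boxtimes>\<^bsub>C\<^esub> e (snd p) (snd q)) (day C L M)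
    (\<lambda>p. day_cls C L M (Day_elt (A (fst p)) (B (snd p)) (Idt C (A (fst p) \<otimes>\<^bsub>C\<^esub> B (snd p))) (l (fst p)) (m (snd p))))"
proof -
  interpret P: presentation C I le A d L l by fact
  interpret Q: presentation C I' le' B e M m by fact
  let ?J = "I \<times> I'" and ?le = "\<lambda>p q. le (fst p) (fst q) \<and> le' (snd p) (snd q)"
    and ?A = "\<lambda>p. A (fst p) \<otimes>\<^bsub>C\<^esub> B (snd p)" and ?d = "\<lambda>p q. d (fst p) (fst q) \<boxtimes>\<^bsub>C\<^esub> e (snd p) (snd q)"
    and ?l = "\<lambda>p. day_cls C L M (Day_elt (A (fst p)) (B (snd p)) (Idt C (A (fst p) \<otimes>\<^bsub>C\<^esub> B (snd p))) (l (fst p)) (m (snd p)))"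
  interpret D: directed_diagram C ?J ?le ?A ?d
    by (rule product_diagram) unfold_locales
  note LM = P.copsheaf Q.copsheaf
  have act: "act (day C L M) h (?l p) = day_cls C L M (Day_elt (A (fst p)) (B (snd p)) h (l (fst p)) (m (snd p)))"
    if "p \<in> ?J" "h \<in> hom C (?A p) D" for p h D
    using that P.day_act[OF LM P.id_hom[OF D.A_ob[OF that(1)]] P.A_ob Q.A_ob P.elt_mem Q.elt_mem that(2)]
      P.id_right[OF that(2)] by auto
  have slide: "act (day C L M) (h \<cdot>\<^bsub>C\<^esub> (f \<boxtimes>\<^bsub>C\<^esub> g)) (?l p) =
      day_cls C L M (Day_elt X Y h (act L f (l (fst p))) (act M g (m (snd p))))"
    if p: "p \<in> ?J" and f: "f \<in> hom C (A (fst p)) X" and g: "g \<in> hom C (B (snd p)) Y" and h: "h \<in> hom C (X \<otimes>\<^bsub>C\<^esub> Y) D"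
    for p f g h X Y D
    using act[OF p P.comp_hom[OF P.tens_hom[OF f g] h]] P.day_slide[OF f g h P.elt_mem Q.elt_mem] p by auto
  show ?thesis
  proof
    show "is_functor C SetCat (day C L M)" by (rule P.day_functor[OF LM])
    show "?l p \<in> FO (day C L M) (?A p)" if "p \<in> ?J" for p
      unfolding P.FO_day using that D.A_ob[OF that]
      by (intro P.day_setI P.id_hom P.A_ob Q.A_ob P.elt_mem Q.elt_mem) auto
    show "act (day C L M) (?d p q) (?l q) = ?l p" if p: "p \<in> ?J" and q: "q \<in> ?J" and pq: "?le p q" for p q
    proof -
      have h: "d (fst p) (fst q) \<in> hom C (A (fst q)) (A (fst p))" "e (snd p) (snd q) \<in> hom C (B (snd q)) (B (snd p))"
        using P.d_hom Q.d_hom p q pq by auto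
      have "?d p q = Idt C (?A p) \<cdot>\<^bsub>C\<^esub> ?d p q"
        using P.id_left[OF P.tens_hom[OF h]] by simp
      then show ?thesis
        using slide[OF q h P.id_hom[OF D.A_ob[OF p]]] P.elt_compat[of "fst p" "fst q"] Q.elt_compat[of "snd p" "snd q"] p q pq
        by auto
    qed
    show "\<exists>p\<in>?J. \<exists>h\<in>hom C (?A p) D. w = act (day C L M) h (?l p)"
      if "D \<in> Ob C" "w \<in> FO (day C L M) D" for D w
    proof -
      have "w \<in> day_set C L M D" using that(2) by simp
      then show ?thesis
      proof (rule P.day_setE)
        fix X Y h x y
        assume *: "X \<in> Ob C" "Y \<in> Ob C" "h \<in> hom C (X \<otimes>\<^bsub>C\<^esub> Y) D" "x \<in> FO L X" "y \<in> FO M Y"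
          "w = day_cls C L M (Day_elt X Y h x y)"
        obtain i f where f: "i \<in> I" "f \<in> hom C (A i) X" "x = act L f (l i)"
          using P.elt_surj * by blast
        obtain j g where g: "j \<in> I'" "g \<in> hom C (B j) Y" "y = act M g (m j)"
          using Q.elt_surj * by blast
        have "w = act (day C L M) (h \<cdot>\<^bsub>C\<^esub> (f \<boxtimes>\<^bsub>C\<^esub> g)) (?l (i, j))"
          using slide[of "(i, j)" f X g Y h D] f g * by simp
        moreover have "h \<cdot>\<^bsub>C\<^esub> (f \<boxtimes>\<^bsub>C\<^esub> g) \<in> hom C (?A (i, j)) D"
          using P.comp_hom[OF P.tens_hom[OF f(2) g(2)] *(3)] by simp
        ultimately show ?thesis using f g by blast
      qed
    qed
    show "D.germ_eq p f q g"
      if p: "p \<in> ?J" and q: "q \<in> ?J" and f: "f \<in> hom C (?A p) D" and g: "g \<in> hom C (?A q) D"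
        and eq: "act (day C L M) f (?l p) = act (day C L M) g (?l q)" for p q f g D
    proof -
      \<comment> \<open>The germs represented by a generator of the coend, and the class of germs equal to all of them.\<close>
      define germs where "germs w = (case w of Day_elt X Y h x y \<Rightarrow>
         {(p, k). p \<in> ?J \<and> (\<exists>f\<in>hom C (A (fst p)) X. \<exists>g\<in>hom C (B (snd p)) Y.
            x = act L f (l (fst p)) \<and> y = act M g (m (snd p)) \<and> k = h \<cdot>\<^bsub>C\<^esub> (f \<boxtimes>\<^bsub>C\<^esub> g))})" for w
      define \<phi> where "\<phi> w = {(q, k). q \<in> ?J \<and> k \<in> hom C (?A q) D \<and> (\<forall>(p, k') \<in> germs w. D.germ_eq p k' q k)}" for w
      have typed: "p \<in> ?J \<and> k \<in> hom C (?A p) D" if "h \<in> hom C (X \<otimes>\<^bsub>C\<^esub> Y) D" "(p, k) \<in> germs (Day_elt X Y h x y)"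
        for p k X Y h x y
        using that P.comp_hom[OF P.tens_hom that(1)] by (auto simp: germs_def)
      have all_eq: "D.germ_eq p k p' k'"
        if h: "h \<in> hom C (X \<otimes>\<^bsub>C\<^esub> Y) D" and k: "(p, k) \<in> germs (Day_elt X Y h x y)"
          and k': "(p', k') \<in> germs (Day_elt X Y h x y)"
        for p k p' k' X Y h x y
      proof -
        obtain f g where f: "p \<in> ?J" "f \<in> hom C (A (fst p)) X" "g \<in> hom C (B (snd p)) Y"
            "x = act L f (l (fst p))" "y = act M g (m (snd p))" "k = h \<cdot>\<^bsub>C\<^esub> (f \<boxtimes>\<^bsub>C\<^esub> g)"
          using k by (auto simp: germs_def)
        obtain f' g' where f': "p' \<in> ?J" "f' \<in> hom C (A (fst p')) X" "g' \<in> hom C (B (snd p')) Y"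
            "x = act L f' (l (fst p'))" "y = act M g' (m (snd p'))" "k' = h \<cdot>\<^bsub>C\<^esub> (f' \<boxtimes>\<^bsub>C\<^esub> g')"
          using k' by (auto simp: germs_def)
        have "P.germ_eq (fst p) f (fst p') f'" "Q.germ_eq (snd p) g (snd p') g'"
          using P.elt_inj[of "fst p" "fst p'" f X f'] Q.elt_inj[of "snd p" "snd p'" g Y g'] f f' by auto
        then obtain i j where i: "i \<in> I" "le (fst p) i" "le (fst p') i" "f \<cdot>\<^bsub>C\<^esub> d (fst p) i = f' \<cdot>\<^bsub>C\<^esub> d (fst p') i"
          and j: "j \<in> I'" "le' (snd p) j" "le' (snd p') j" "g \<cdot>\<^bsub>C\<^esub> e (snd p) j = g' \<cdot>\<^bsub>C\<^esub> e (snd p') j"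
          unfolding P.germ_eq_def Q.germ_eq_def by blast
        have di: "d (fst p) i \<in> hom C (A i) (A (fst p))" "d (fst p') i \<in> hom C (A i) (A (fst p'))"
          using P.d_hom i f(1) f'(1) by auto
        have ej: "e (snd p) j \<in> hom C (B j) (B (snd p))" "e (snd p') j \<in> hom C (B j) (B (snd p'))"
          using Q.d_hom j f(1) f'(1) by auto
        have "(h \<cdot>\<^bsub>C\<^esub> (f \<boxtimes>\<^bsub>C\<^esub> g)) \<cdot>\<^bsub>C\<^esub> (d (fst p) i \<boxtimes>\<^bsub>C\<^esub> e (snd p) j)
            = h \<cdot>\<^bsub>C\<^esub> ((f \<cdot>\<^bsub>C\<^esub> d (fst p) i) \<boxtimes>\<^bsub>C\<^esub> (g \<cdot>\<^bsub>C\<^esub> e (snd p) j))"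
          using P.comp_assoc[OF P.tens_hom[OF di(1) ej(1)] P.tens_hom[OF f(2,3)] h]
            P.tens_comp[OF di(1) f(2) ej(1) f(3)] by simp
        moreover have "(h \<cdot>\<^bsub>C\<^esub> (f' \<boxtimes>\<^bsub>C\<^esub> g')) \<cdot>\<^bsub>C\<^esub> (d (fst p') i \<boxtimes>\<^bsub>C\<^esub> e (snd p') j)
            = h \<cdot>\<^bsub>C\<^esub> ((f' \<cdot>\<^bsub>C\<^esub> d (fst p') i) \<boxtimes>\<^bsub>C\<^esub> (g' \<cdot>\<^bsub>C\<^esub> e (snd p') j))"
          using P.comp_assoc[OF P.tens_hom[OF di(2) ej(2)] P.tens_hom[OF f'(2,3)] h]
            P.tens_comp[OF di(2) f'(2) ej(2) f'(3)] by simp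
        ultimately show ?thesis
          unfolding D.germ_eq_def using i j f f' by (intro bexI[of _ "(i, j)"]) auto
      qed
      have nonempty: "germs (Day_elt X Y h x y) \<noteq> {}"
        if X: "X \<in> Ob C" "x \<in> FO L X" and Y: "Y \<in> Ob C" "y \<in> FO M Y" for X Y h x y
      proof -
        obtain i f where f: "i \<in> I" "f \<in> hom C (A i) X" "x = act L f (l i)"
          using P.elt_surj[OF X] by blast
        obtain j g where g: "j \<in> I'" "g \<in> hom C (B j) Y" "y = act M g (m j)"
          using Q.elt_surj[OF Y] by blast
        have "((i, j), h \<cdot>\<^bsub>C\<^esub> (f \<boxtimes>\<^bsub>C\<^esub> g)) \<in> germs (Day_elt X Y h x y)"
          using f g by (auto simp: germs_def)
        then show ?thesis by blast
      qed
      have step: "\<phi> (Day_elt X Y (h \<cdot>\<^bsub>C\<^esub> (a \<boxtimes>\<^bsub>C\<^esub> b)) x y) = \<phi> (Day_elt X' Y' h (act L a x) (act M b y))"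
        if a: "a \<in> hom C X X'" and b: "b \<in> hom C Y Y'" and h: "h \<in> hom C (X' \<otimes>\<^bsub>C\<^esub> Y') D"
          and x: "x \<in> FO L X" and y: "y \<in> FO M Y" for X X' Y Y' a b h x y
      proof -
        let ?w = "Day_elt X Y (h \<cdot>\<^bsub>C\<^esub> (a \<boxtimes>\<^bsub>C\<^esub> b)) x y" and ?w' = "Day_elt X' Y' h (act L a x) (act M b y)"
        have hab: "h \<cdot>\<^bsub>C\<^esub> (a \<boxtimes>\<^bsub>C\<^esub> b) \<in> hom C (X \<otimes>\<^bsub>C\<^esub> Y) D"
          using P.comp_hom[OF P.tens_hom[OF a b] h] .
        have sub: "germs ?w \<subseteq> germs ?w'"
        proof
          fix z assume "z \<in> germs ?w"
          then obtain p f g where f: "p \<in> ?J" "f \<in> hom C (A (fst p)) X" "g \<in> hom C (B (snd p)) Y"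
            "x = act L f (l (fst p))" "y = act M g (m (snd p))" "z = (p, (h \<cdot>\<^bsub>C\<^esub> (a \<boxtimes>\<^bsub>C\<^esub> b)) \<cdot>\<^bsub>C\<^esub> (f \<boxtimes>\<^bsub>C\<^esub> g))"
            by (auto simp: germs_def)
          have "(h \<cdot>\<^bsub>C\<^esub> (a \<boxtimes>\<^bsub>C\<^esub> b)) \<cdot>\<^bsub>C\<^esub> (f \<boxtimes>\<^bsub>C\<^esub> g) = h \<cdot>\<^bsub>C\<^esub> ((a \<cdot>\<^bsub>C\<^esub> f) \<boxtimes>\<^bsub>C\<^esub> (b \<cdot>\<^bsub>C\<^esub> g))"
            using P.comp_assoc[OF P.tens_hom[OF f(2,3)] P.tens_hom[OF a b] h] P.tens_comp[OF f(2) a f(3) b] by simp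
          moreover have "act L a x = act L (a \<cdot>\<^bsub>C\<^esub> f) (l (fst p))" "act M b y = act M (b \<cdot>\<^bsub>C\<^esub> g) (m (snd p))"
            using P.copsheafD(3)[OF P.copsheaf f(2) a P.elt_mem] P.copsheafD(3)[OF Q.copsheaf f(3) b Q.elt_mem] f(1,4,5)
            by auto
          ultimately show "z \<in> germs ?w'"
            using f P.comp_hom[OF f(2) a] P.comp_hom[OF f(3) b] by (auto simp: germs_def)
        qed
        obtain z where z: "z \<in> germs ?w"
          using nonempty[of X x Y y] P.hom_ob[OF a] P.hom_ob[OF b] x y by blast
        have "D.germ_eq p' k' q k"
          if "\<forall>(p, k') \<in> germs ?w. D.germ_eq p k' q k" "(p', k') \<in> germs ?w'" "q \<in> ?J" "k \<in> hom C (?A q) D" for p' k' q k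
        proof -
          obtain p k1 where zz: "z = (p, k1)" by (cases z)
          have "D.germ_eq p' k' p k1"
            using all_eq[OF h that(2)] sub z zz by blast
          moreover have "D.germ_eq p k1 q k" using that(1) z zz by blast
          ultimately show ?thesis
            using D.germ_trans[of p' p q k' D k1 k] typed[OF h that(2)] typed[OF hab, of p k1 x y] z zz that(3,4) by blast
        qed
        then show ?thesis
          unfolding \<phi>_def using sub by blast
      qed
      let ?w = "Day_elt (A (fst p)) (B (snd p)) f (l (fst p)) (m (snd p))"
        and ?w' = "Day_elt (A (fst q)) (B (snd q)) g (l (fst q)) (m (snd q))"
      have "day_cls C L M ?w = day_cls C L M ?w'"
        using act[OF p f] act[OF q g] eq by simp
      then have "\<phi> ?w = \<phi> ?w'"
        using P.day_lift[OF LM, where \<phi> = \<phi> and D = D] step f g by metis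
      moreover have gI: "(p, f) \<in> germs (Day_elt (A (fst p)) (B (snd p)) f (l (fst p)) (m (snd p)))"
        if p: "p \<in> ?J" and f: "f \<in> hom C (?A p) D" for p f
      proof -
        have i: "Idt C (A (fst p)) \<in> hom C (A (fst p)) (A (fst p))" "Idt C (B (snd p)) \<in> hom C (B (snd p)) (B (snd p))"
          "f \<cdot>\<^bsub>C\<^esub> (Idt C (A (fst p)) \<boxtimes>\<^bsub>C\<^esub> Idt C (B (snd p))) = f"
          using p P.id_hom P.A_ob Q.A_ob P.tens_id P.id_right[OF f] by auto
        have "l (fst p) = act L (Idt C (A (fst p))) (l (fst p))" "m (snd p) = act M (Idt C (B (snd p))) (m (snd p))"
          using p P.elt_id Q.elt_id by auto
        then have "\<exists>f'\<in>hom C (A (fst p)) (A (fst p)). \<exists>g\<in>hom C (B (snd p)) (B (snd p)).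
            l (fst p) = act L f' (l (fst p)) \<and> m (snd p) = act M g (m (snd p)) \<and> f = f \<cdot>\<^bsub>C\<^esub> (f' \<boxtimes>\<^bsub>C\<^esub> g)"
          using i by metis
        then show ?thesis
          using p by (simp add: germs_def)
      qed
      moreover have "(q, g) \<in> \<phi> ?w'"
        unfolding \<phi>_def using all_eq[OF g _ gI[OF q g]] q g by auto
      ultimately show ?thesis
        unfolding \<phi>_def using gI[OF p f] by blast
    qed
  qed
qed

section \<open>Infinite tensor products of representables\<close>

abbreviation "fin_sub J \<equiv> {F. finite F \<and> F \<subseteq> J}"

lemma FinLO_Ar_ball:
  "(\<forall>u\<in>Ar (FinLO J). R u) \<longleftrightarrow> (\<forall>F\<in>fin_sub J. \<forall>F'\<in>fin_sub J. F \<subseteq> F' \<longrightarrow> R (F, F'))"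
proof (intro iffI ballI impI)
  fix u assume *: "\<forall>F\<in>fin_sub J. \<forall>F'\<in>fin_sub J. F \<subseteq> F' \<longrightarrow> R (F, F')" and "u \<in> Ar (FinLO J)"
  then obtain F F' where "u = (F, F')" "F \<subseteq> F'" "finite F'" "F' \<subseteq> J" by auto
  then show "R u" using * finite_subset[of F F'] by blast
qed auto

abbreviation itp_presentation where
  "itp_presentation C J X \<equiv> presentation C (fin_sub J) (\<subseteq>) (FO (abstract_itp C X)) (\<lambda>F F'. FA (abstract_itp C X) (F, F'))"

context semicartesian
begin

text \<open>
  A pointwise colimit of copresheaves is a limit in the opposite category. Under the Yoneda lemma,
  the legs \<open>p F\<close> of a cone correspond to the generating elements.
\<close>

lemma presentation_limit:
  assumes pr: "itp_presentation C J X L (\<lambda>F. app (p F) (FO (abstract_itp C X) F) (Hom_elt (Idt C (FO (abstract_itp C X) F))))"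
    and p: "\<And>F. F \<in> fin_sub J \<Longrightarrow> p F \<in> hom (copsh_op C) L (hom_copsh C (FO (abstract_itp C X) F))"
  shows "is_limit (op_cat (FinLO J)) (copsh_op C) (func_comp (yoneda C) (abstract_itp C X)) L p"
proof -
  let ?A = "FO (abstract_itp C X)" and ?d = "\<lambda>F F'. FA (abstract_itp C X) (F, F')"
  let ?el = "\<lambda>t F. app t (?A F) (Hom_elt (Idt C (?A F)))"
  interpret P: presentation C "fin_sub J" "(\<subseteq>)" ?A ?d L "\<lambda>F. ?el (p F) F" by (rule pr)
  interpret K: category "copsh_op C" by (rule copsh_category)
  have cone: "is_cone (op_cat (FinLO J)) (copsh_op C) (func_comp (yoneda C) (abstract_itp C X)) M q \<longleftrightarrow>
     is_functor C SetCat M \<and> (\<forall>F\<in>fin_sub J. q F \<in> hom (copsh_op C) M (hom_copsh C (?A F))) \<and>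
     (\<forall>F\<in>fin_sub J. \<forall>F'\<in>fin_sub J. F \<subseteq> F' \<longrightarrow> act M (?d F F') (?el (q F') F') = ?el (q F) F)" (is "_ = ?R")
    for M q
  proof -
    have *: "FA (yoneda C) (?d F F') \<cdot>\<^bsub>copsh_op C\<^esub> q F' = q F \<longleftrightarrow> act M (?d F F') (?el (q F') F') = ?el (q F) F"
      if q: "\<forall>F\<in>fin_sub J. q F \<in> hom (copsh_op C) M (hom_copsh C (?A F))"
        and F: "F \<in> fin_sub J" "F' \<in> fin_sub J" "F \<subseteq> F'" for F F'
    proof -
      have q': "q F \<in> hom (copsh_op C) M (hom_copsh C (?A F))" "q F' \<in> hom (copsh_op C) M (hom_copsh C (?A F'))"
        using q F by blast+
      note yd = FA_yoneda(1)[OF P.d_hom[OF F]]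
      show ?thesis
        using app_yoneda_comp[OF q'(2) P.d_hom[OF F]] yoneda_ext[OF copsh_comp(1)[OF q'(2) yd] q'(1)] by auto
    qed
    show ?thesis
      unfolding is_cone_def op_cat_simps FinLO_Ar_ball using * by (simp cong: conj_cong)
  qed
  show ?thesis
    unfolding is_limit_def
  proof (intro conjI allI impI)
    show "is_cone (op_cat (FinLO J)) (copsh_op C) (func_comp (yoneda C) (abstract_itp C X)) L p"
      unfolding cone using P.copsheaf p P.elt_compat by auto
    fix M q assume "is_cone (op_cat (FinLO J)) (copsh_op C) (func_comp (yoneda C) (abstract_itp C X)) M q"
    then have M: "is_functor C SetCat M" and q: "\<And>F. F \<in> fin_sub J \<Longrightarrow> q F \<in> hom (copsh_op C) M (hom_copsh C (?A F))"
      and c: "\<And>F F'. F \<in> fin_sub J \<Longrightarrow> F' \<in> fin_sub J \<Longrightarrow> F \<subseteq> F' \<Longrightarrow> act M (?d F F') (?el (q F') F') = ?el (q F) F"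
      unfolding cone by auto
    have iff: "p F \<cdot>\<^bsub>copsh_op C\<^esub> h = q F \<longleftrightarrow> app h (?A F) (?el (p F) F) = ?el (q F) F"
      if h: "h \<in> hom (copsh_op C) M L" and F: "F \<in> fin_sub J" for h F
    proof -
      have "Hom_elt (Idt C (?A F)) \<in> FO (hom_copsh C (?A F)) (?A F)" using id_hom P.A_ob F by auto
      then have "?el (p F \<cdot>\<^bsub>copsh_op C\<^esub> h) F = app h (?A F) (?el (p F) F)"
        using copsh_comp(2)[OF h p[OF F] P.A_ob[OF F]] by blast
      then show ?thesis
        using yoneda_ext[OF copsh_comp(1)[OF h p[OF F]] q[OF F]] by auto
    qed
    obtain h where h: "h \<in> hom (copsh_op C) M L" "\<And>F. F \<in> fin_sub J \<Longrightarrow> app h (?A F) (?el (p F) F) = ?el (q F) F"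
      using P.universal_ex[OF M yoneda_elt[OF q P.A_ob] c] by blast
    show "\<exists>!h. h \<in> hom (copsh_op C) M L \<and> (\<forall>k\<in>Ob (op_cat (FinLO J)). p k \<cdot>\<^bsub>copsh_op C\<^esub> h = q k)"
    proof (rule ex1I[of _ h])
      show "h \<in> hom (copsh_op C) M L \<and> (\<forall>k\<in>Ob (op_cat (FinLO J)). p k \<cdot>\<^bsub>copsh_op C\<^esub> h = q k)"
        using h iff by auto
      fix h' assume h': "h' \<in> hom (copsh_op C) M L \<and> (\<forall>k\<in>Ob (op_cat (FinLO J)). p k \<cdot>\<^bsub>copsh_op C\<^esub> h' = q k)"
      then have "h' \<in> hom (copsh_op C) M L" by blast
      then show "h' = h"
        using h' h iff by (intro P.universal_eq[OF _ h(1)]) auto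
    qed
  qed
qed

text \<open>
  The chosen colimit tags its elements with their stage, hence the finite sets \<open>F\<close> are coded as elements,
  by the nesting depth \<open>set_encode F\<close>.
\<close>

definition index_code :: "nat set \<Rightarrow> ('o, 'm) elt" where
  "index_code F = ((\<lambda>e. Day_elt undefined undefined undefined e e) ^^ set_encode F) (Hom_elt undefined)"

lemma index_code_inj: "inj_on index_code {F. finite F}"
proof -
  have eq: "m = n" if "((\<lambda>e. Day_elt a b f e e) ^^ m) (Hom_elt g) = ((\<lambda>e. Day_elt a b f e e) ^^ n) (Hom_elt g)"
    for m n and a b :: 'o and f g :: 'm
    using that
  proof (induction m arbitrary: n)
    case 0 then show ?case by (cases n) auto
  next
    case (Suc m) then show ?case by (cases n) auto
  qed
  show ?thesis
  proof (rule inj_onI)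
    fix F G assume FG: "F \<in> {F. finite F}" "G \<in> {F. finite F}" and "index_code F = index_code G"
    then have "set_encode F = set_encode G"
      unfolding index_code_def by (rule_tac eq)
    then show "F = G"
      using inj_onD[OF inj_on_set_encode] FG by blast
  qed
qed

text \<open>
  Limits are unique up to isomorphism, so an arbitrary limit can be compared with the chosen pointwise
  colimit. This makes the elements of the copresheaves in the completion accessible.
\<close>

lemma limit_presentation:
  assumes dir: "directed_diagram C (fin_sub J) (\<subseteq>) (FO (abstract_itp C X)) (\<lambda>F F'. FA (abstract_itp C X) (F, F'))"
    and lim: "is_limit (op_cat (FinLO J)) (copsh_op C) (func_comp (yoneda C) (abstract_itp C X)) L p"
  shows "itp_presentation C J X L (\<lambda>F. app (p F) (FO (abstract_itp C X) F) (Hom_elt (Idt C (FO (abstract_itp C X) F))))"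
proof -
  let ?A = "FO (abstract_itp C X)" and ?d = "\<lambda>F F'. FA (abstract_itp C X) (F, F')"
  interpret P: directed_diagram C "fin_sub J" "(\<subseteq>)" ?A ?d by (rule dir)
  interpret K: category "copsh_op C" by (rule copsh_category)
  have "inj_on index_code (fin_sub J)"
    using index_code_inj by (rule inj_on_subset) auto
  then obtain M m where M: "itp_presentation C J X M m"
    by (rule P.presentation_exists)
  interpret M: presentation C "fin_sub J" "(\<subseteq>)" ?A ?d M m by (rule M)
  define q where "q F = nat_arrow C (hom_copsh C (?A F)) (\<lambda>D e. act M (arrow_of e) (m F)) M" for F
  have q: "q F \<in> hom (copsh_op C) M (hom_copsh C (?A F))" "app (q F) (?A F) (Hom_elt (Idt C (?A F))) = m F"
    if "F \<in> fin_sub J" for F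
    unfolding q_def using yoneda_arrow[OF M.copsheaf M.elt_mem[OF that]] id_hom[OF P.A_ob[OF that]] M.elt_id[OF that] by auto
  have "itp_presentation C J X M (\<lambda>F. app (q F) (?A F) (Hom_elt (Idt C (?A F))))"
    using q(2) by (rule M.presentation_cong)
  then have qlim: "is_limit (op_cat (FinLO J)) (copsh_op C) (func_comp (yoneda C) (abstract_itp C X)) M q"
    using q(1) by (rule presentation_limit)
  have "is_diagram (op_cat (FinLO J)) (copsh_op C) (func_comp (yoneda C) (abstract_itp C X))"
    unfolding is_diagram_def op_cat_simps FinLO_Ar_ball
    using FA_yoneda(1)[OF P.d_hom] hom_copsh_functor by simp
  then obtain t where t: "t \<in> hom (copsh_op C) L M" "is_iso (copsh_op C) t"
      "\<And>F. F \<in> fin_sub J \<Longrightarrow> q F \<cdot>\<^bsub>copsh_op C\<^esub> t = p F"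
    using K.limit_unique[OF _ lim qlim] by auto
  have el: "app (p F) (?A F) (Hom_elt (Idt C (?A F))) = app t (?A F) (m F)" if "F \<in> fin_sub J" for F
    using copsh_comp(2)[OF t(1) q(1)[OF that] P.A_ob[OF that], of "Hom_elt (Idt C (?A F))"] id_hom[OF P.A_ob[OF that]]
      t(3)[OF that] q(2)[OF that] by simp
  interpret T: presentation C "fin_sub J" "(\<subseteq>)" ?A ?d L "\<lambda>F. app t (?A F) (m F)"
    by (rule M.presentation_iso[OF t(1,2)])
  show ?thesis
    by (rule T.presentation_cong) (rule el)
qed

text \<open>
  The copresheaf \<open>Y\<close> is itself a colimit of representables \<open>C(B j, -)\<close>, and \<open>L \<otimes> Y\<close> is the colimit over the pairs
  \<open>(F, j)\<close>. A cone over the diagram of the copresheaves \<open>C(A F, -) \<otimes> Y\<close> is determined by its values on the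
  generators \<open>w F j\<close>, and these are a cocone over the diagram of pairs.
\<close>

lemma rtensor_limit:
  assumes lim: "is_limit (op_cat (FinLO J)) (copsh_op C) (func_comp (yoneda C) (abstract_itp C X)) L p"
    and pr: "itp_presentation C J X L (\<lambda>F. app (p F) (FO (abstract_itp C X) F) (Hom_elt (Idt C (FO (abstract_itp C X) F))))"
    and Q: "presentation C I le B e Y m"
  shows "is_limit (op_cat (FinLO J)) (copsh_op C)
     (func_comp (rtensor (copsh_op C) Y) (func_comp (yoneda C) (abstract_itp C X)))
     (day C L Y) (\<lambda>F. p F \<boxtimes>\<^bsub>copsh_op C\<^esub> Idt (copsh_op C) Y)"
proof -
  let ?A = "FO (abstract_itp C X)" and ?d = "\<lambda>F F'. FA (abstract_itp C X) (F, F')"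
  let ?D = "func_comp (rtensor (copsh_op C) Y) (func_comp (yoneda C) (abstract_itp C X))"
  let ?y = "Idt (copsh_op C) Y"
  define l where "l F = app (p F) (?A F) (Hom_elt (Idt C (?A F)))" for F
  interpret K: tensor_category "copsh_op C" by (rule copsh_tensor_category)
  interpret P: presentation C "fin_sub J" "(\<subseteq>)" ?A ?d L l using pr unfolding l_def[abs_def] .
  interpret Q: presentation C I le B e Y m by (rule Q)
  interpret PQ: presentation C "fin_sub J \<times> I" "\<lambda>p q. fst p \<subseteq> fst q \<and> le (snd p) (snd q)"
    "\<lambda>p. ?A (fst p) \<otimes>\<^bsub>C\<^esub> B (snd p)" "\<lambda>p q. ?d (fst p) (fst q) \<boxtimes>\<^bsub>C\<^esub> e (snd p) (snd q)" "day C L Y"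
    "\<lambda>p. day_cls C L Y (Day_elt (?A (fst p)) (B (snd p)) (Idt C (?A (fst p) \<otimes>\<^bsub>C\<^esub> B (snd p))) (l (fst p)) (m (snd p)))"
    by (rule product_presentation) unfold_locales
  have p: "p F \<in> hom (copsh_op C) L (hom_copsh C (?A F))" if "F \<in> fin_sub J" for F
    using lim that by (auto simp: is_limit_def is_cone_def)
  have y: "?y \<in> hom (copsh_op C) Y Y" using copsh_id(1)[OF Q.copsheaf] .
  have yd: "FA (yoneda C) (?d F F') \<in> hom (copsh_op C) (hom_copsh C (?A F')) (hom_copsh C (?A F))"
    if "F \<in> fin_sub J" "F' \<in> fin_sub J" "F \<subseteq> F'" for F F'
    using FA_yoneda(1)[OF P.d_hom[OF that]] .
  \<comment> \<open>The generators of \<open>C(A F, -) \<otimes> Y\<close>.\<close>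
  define w where "w F j = day_cls C (hom_copsh C (?A F)) Y
     (Day_elt (?A F) (B j) (Idt C (?A F \<otimes> B j)) (Hom_elt (Idt C (?A F))) (m j))" for F j
  have i: "Hom_elt (Idt C (?A F)) \<in> FO (hom_copsh C (?A F)) (?A F)" if "F \<in> fin_sub J" for F
    using id_hom P.A_ob that by auto
  have w: "w F j \<in> FO (day C (hom_copsh C (?A F)) Y) (?A F \<otimes> B j)" if "F \<in> fin_sub J" "j \<in> I" for F j
    unfolding w_def FO_day
    by (rule day_setI[OF id_hom[OF tens_ob] _ _ i]) (use that P.A_ob Q.A_ob Q.elt_mem in auto)
  have act_w: "act (day C (hom_copsh C (?A F)) Y) h (w F j) = day_cls C (hom_copsh C (?A F)) Y
     (Day_elt (?A F) (B j) h (Hom_elt (Idt C (?A F))) (m j))"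
    if F: "F \<in> fin_sub J" and j: "j \<in> I" and h: "h \<in> hom C (?A F \<otimes> B j) D" for F j h D
    unfolding w_def using day_act[OF hom_copsh_functor Q.copsheaf id_hom[OF tens_ob] _ _ i Q.elt_mem h]
      P.A_ob[OF F] Q.A_ob[OF j] F j id_right[OF h] by simp
  have gen: "t = s"
    if F: "F \<in> fin_sub J" and t: "t \<in> hom (copsh_op C) M (day C (hom_copsh C (?A F)) Y)"
      and s: "s \<in> hom (copsh_op C) M (day C (hom_copsh C (?A F)) Y)"
      and eq: "\<And>j. j \<in> I \<Longrightarrow> app t (?A F \<otimes> B j) (w F j) = app s (?A F \<otimes> B j) (w F j)" for F t s M
  proof (rule day_nat_ext[OF t s])
    fix A' B' h D x y
    assume *: "A' \<in> Ob C" "B' \<in> Ob C" "h \<in> hom C (A' \<otimes> B') D" "x \<in> FO (hom_copsh C (?A F)) A'" "y \<in> FO Y B'"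
    obtain f where f: "f \<in> hom C (?A F) A'" "x = Hom_elt f" using *(4) by auto
    obtain j g where g: "j \<in> I" "g \<in> hom C (B j) B'" "y = act Y g (m j)" using Q.elt_surj *(2,5) by blast
    note hfg = comp_hom[OF tens_hom[OF f(1) g(2)] *(3)]
    have "act (day C (hom_copsh C (?A F)) Y) (h \<cdot> (f \<boxtimes> g)) (w F j) =
        day_cls C (hom_copsh C (?A F)) Y (Day_elt A' B' h x y)"
      using act_w[OF F g(1) hfg] day_slide[OF f(1) g(2) *(3) i[OF F] Q.elt_mem[OF g(1)]]
        hom_copsh_act[OF id_hom[OF P.A_ob[OF F]] f(1)] id_right[OF f(1)] f(2) g(3) by simp
    then show "app t D (day_cls C (hom_copsh C (?A F)) Y (Day_elt A' B' h x y)) =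
        app s D (day_cls C (hom_copsh C (?A F)) Y (Day_elt A' B' h x y))"
      using copsh_homD(6)[OF t hfg w[OF F g(1)]] copsh_homD(6)[OF s hfg w[OF F g(1)]] eq[OF g(1)] by simp
  qed
  have cone: "is_cone (op_cat (FinLO J)) (copsh_op C) ?D M q \<longleftrightarrow>
     is_functor C SetCat M \<and> (\<forall>F\<in>fin_sub J. q F \<in> hom (copsh_op C) M (day C (hom_copsh C (?A F)) Y)) \<and>
     (\<forall>F\<in>fin_sub J. \<forall>F'\<in>fin_sub J. F \<subseteq> F' \<longrightarrow> (FA (yoneda C) (?d F F') \<boxtimes>\<^bsub>copsh_op C\<^esub> ?y) \<cdot>\<^bsub>copsh_op C\<^esub> q F' = q F)"
    for M q
  proof -
    show ?thesis
      unfolding is_cone_def op_cat_simps FinLO_Ar_ball by simp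
  qed
  have pcone: "is_cone (op_cat (FinLO J)) (copsh_op C) (func_comp (yoneda C) (abstract_itp C X)) L p"
    using lim by (simp add: is_limit_def)
  show ?thesis
    unfolding is_limit_def
  proof (intro conjI allI impI)
    have "FA (yoneda C) (?d F F') \<cdot>\<^bsub>copsh_op C\<^esub> p F' = p F" if "F \<in> fin_sub J" "F' \<in> fin_sub J" "F \<subseteq> F'" for F F'
      using pcone that by (auto simp: is_cone_def)
    then have "(FA (yoneda C) (?d F F') \<boxtimes>\<^bsub>copsh_op C\<^esub> ?y) \<cdot>\<^bsub>copsh_op C\<^esub> (p F' \<boxtimes>\<^bsub>copsh_op C\<^esub> ?y) = p F \<boxtimes>\<^bsub>copsh_op C\<^esub> ?y"
      if "F \<in> fin_sub J" "F' \<in> fin_sub J" "F \<subseteq> F'" for F F'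
      using K.tens_comp[OF p[OF that(2)] yd[OF that] y y] K.id_left[OF y] that by simp
    then show "is_cone (op_cat (FinLO J)) (copsh_op C) ?D (day C L Y) (\<lambda>F. p F \<boxtimes>\<^bsub>copsh_op C\<^esub> ?y)"
      unfolding cone using day_tensA(1)[OF p y] PQ.copsheaf by blast
    fix M q assume "is_cone (op_cat (FinLO J)) (copsh_op C) ?D M q"
    then have M: "is_functor C SetCat M"
      and q: "\<And>F. F \<in> fin_sub J \<Longrightarrow> q F \<in> hom (copsh_op C) M (day C (hom_copsh C (?A F)) Y)"
      and c: "\<And>F F'. F \<in> fin_sub J \<Longrightarrow> F' \<in> fin_sub J \<Longrightarrow> F \<subseteq> F' \<Longrightarrow>
        (FA (yoneda C) (?d F F') \<boxtimes>\<^bsub>copsh_op C\<^esub> ?y) \<cdot>\<^bsub>copsh_op C\<^esub> q F' = q F"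
      unfolding cone by auto
    define v where "v F j = app (q F) (?A F \<otimes> B j) (w F j)" for F j
    have v: "v F j \<in> FO M (?A F \<otimes> B j)" if "F \<in> fin_sub J" "j \<in> I" for F j
      unfolding v_def using copsh_homD(5)[OF q[OF that(1)] _ w[OF that]] tens_ob P.A_ob Q.A_ob that by blast
    have vc: "act M (?d F F' \<boxtimes> e j j') (v F' j') = v F j"
      if F: "F \<in> fin_sub J" "F' \<in> fin_sub J" "F \<subseteq> F'" and j: "j \<in> I" "j' \<in> I" "le j j'" for F F' j j'
    proof -
      note dF = P.d_hom[OF F] and ej = Q.d_hom[OF j]
      note de = tens_hom[OF dF ej]
      let ?ij = "Idt C (?A F \<otimes> B j)"
      have ij: "?ij \<in> hom C (?A F \<otimes> B j) (?A F \<otimes> B j)" 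
        by (rule id_hom[OF tens_ob[OF P.A_ob[OF F(1)] Q.A_ob[OF j(1)]]])
      have "act M (?d F F' \<boxtimes> e j j') (v F' j') =
         app (q F') (?A F \<otimes> B j) (act (day C (hom_copsh C (?A F')) Y) (?d F F' \<boxtimes> e j j') (w F' j'))"
        unfolding v_def using copsh_homD(6)[OF q[OF F(2)] de w[OF F(2) j(2)]] by simp
      also have "act (day C (hom_copsh C (?A F')) Y) (?d F F' \<boxtimes> e j j') (w F' j') =
         day_cls C (hom_copsh C (?A F')) Y (Day_elt (?A F) (B j) ?ij (Hom_elt (?d F F')) (m j))"
        using act_w[OF F(2) j(2) de] day_slide[OF dF ej ij i[OF F(2)] Q.elt_mem[OF j(2)]] id_left[OF de]
          hom_copsh_act[OF id_hom[OF P.A_ob[OF F(2)]] dF] id_right[OF dF] Q.elt_compat[OF j] by simp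
      also have "\<dots> = app (FA (yoneda C) (?d F F') \<boxtimes>\<^bsub>copsh_op C\<^esub> ?y) (?A F \<otimes> B j) (w F j)"
        unfolding w_def
        using day_tensA(2)[OF yd[OF F] y P.A_ob[OF F(1)] Q.A_ob[OF j(1)] ij i[OF F(1)] Q.elt_mem[OF j(1)]]
          FA_yoneda(2)[OF dF id_hom[OF P.A_ob[OF F(1)]]] id_left[OF dF]
          copsh_id(2)[OF Q.copsheaf Q.A_ob[OF j(1)] Q.elt_mem[OF j(1)]] by simp
      also have "app (q F') (?A F \<otimes> B j) \<dots> = v F j"
        using copsh_comp(2)[OF q[OF F(2)] day_tensA(1)[OF yd[OF F] y] _ w[OF F(1) j(1)]] c[OF F]
          tens_ob P.A_ob[OF F(1)] Q.A_ob[OF j(1)] unfolding v_def by simp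
      finally show ?thesis .
    qed
    have app_p: "app (p F \<boxtimes>\<^bsub>copsh_op C\<^esub> ?y) (?A F \<otimes> B j) (w F j) =
       day_cls C L Y (Day_elt (?A F) (B j) (Idt C (?A F \<otimes> B j)) (l F) (m j))" if F: "F \<in> fin_sub J" and j: "j \<in> I" for F j
      unfolding w_def l_def
      using day_tensA(2)[OF p[OF F] y P.A_ob[OF F] Q.A_ob[OF j] id_hom[OF tens_ob[OF P.A_ob[OF F] Q.A_ob[OF j]]] i[OF F] Q.elt_mem[OF j]]
        copsh_id(2)[OF Q.copsheaf Q.A_ob[OF j] Q.elt_mem[OF j]] by simp
    have iff: "(p F \<boxtimes>\<^bsub>copsh_op C\<^esub> ?y) \<cdot>\<^bsub>copsh_op C\<^esub> h = q F \<longleftrightarrow> (\<forall>j\<in>I. app h (?A F \<otimes> B j)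
        (day_cls C L Y (Day_elt (?A F) (B j) (Idt C (?A F \<otimes> B j)) (l F) (m j))) = v F j)"
      if h: "h \<in> hom (copsh_op C) M (day C L Y)" and F: "F \<in> fin_sub J" for h F
    proof -
      have "app ((p F \<boxtimes>\<^bsub>copsh_op C\<^esub> ?y) \<cdot>\<^bsub>copsh_op C\<^esub> h) (?A F \<otimes> B j) (w F j) = app h (?A F \<otimes> B j)
        (day_cls C L Y (Day_elt (?A F) (B j) (Idt C (?A F \<otimes> B j)) (l F) (m j)))" if "j \<in> I" for j
        using copsh_comp(2)[OF h day_tensA(1)[OF p[OF F] y] _ w[OF F that]] app_p[OF F that] tens_ob P.A_ob Q.A_ob F that by simp
      then show ?thesis
        using gen[OF F copsh_comp(1)[OF h day_tensA(1)[OF p[OF F] y]] q[OF F]] unfolding v_def by auto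
    qed
    have vz: "v (fst z) (snd z) \<in> FO M (?A (fst z) \<otimes> B (snd z))" if "z \<in> fin_sub J \<times> I" for z
      by (rule v) (use that in \<open>simp_all only: mem_Times_iff\<close>)
    have vcz: "act M (?d (fst z) (fst z') \<boxtimes> e (snd z) (snd z')) (v (fst z') (snd z')) = v (fst z) (snd z)"
      if "z \<in> fin_sub J \<times> I" "z' \<in> fin_sub J \<times> I" "fst z \<subseteq> fst z' \<and> le (snd z) (snd z')" for z z'
      by (rule vc) (use that in \<open>simp_all only: mem_Times_iff\<close>)
    obtain h where h: "h \<in> hom (copsh_op C) M (day C L Y)"
      and hz: "\<And>z. z \<in> fin_sub J \<times> I \<Longrightarrow> app h (?A (fst z) \<otimes> B (snd z))
        (day_cls C L Y (Day_elt (?A (fst z)) (B (snd z)) (Idt C (?A (fst z) \<otimes> B (snd z))) (l (fst z)) (m (snd z)))) = v (fst z) (snd z)"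
      by (rule PQ.universal_ex[OF M vz vcz]) (assumption | rule that; assumption)+
    have hFj: "app h (?A F \<otimes> B j)
        (day_cls C L Y (Day_elt (?A F) (B j) (Idt C (?A F \<otimes> B j)) (l F) (m j))) = v F j"
      if "F \<in> fin_sub J" "j \<in> I" for F j
      using hz[of "(F, j)"] that by simp
    show "\<exists>!h. h \<in> hom (copsh_op C) M (day C L Y) \<and>
       (\<forall>k\<in>Ob (op_cat (FinLO J)). (p k \<boxtimes>\<^bsub>copsh_op C\<^esub> ?y) \<cdot>\<^bsub>copsh_op C\<^esub> h = q k)"
    proof (rule ex1I[of _ h])
      show "h \<in> hom (copsh_op C) M (day C L Y) \<and>
         (\<forall>k\<in>Ob (op_cat (FinLO J)). (p k \<boxtimes>\<^bsub>copsh_op C\<^esub> ?y) \<cdot>\<^bsub>copsh_op C\<^esub> h = q k)"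
        using h iff[OF h] hFj by simp
      fix h' assume h': "h' \<in> hom (copsh_op C) M (day C L Y) \<and>
         (\<forall>k\<in>Ob (op_cat (FinLO J)). (p k \<boxtimes>\<^bsub>copsh_op C\<^esub> ?y) \<cdot>\<^bsub>copsh_op C\<^esub> h' = q k)"
      then have hh: "h' \<in> hom (copsh_op C) M (day C L Y)" by blast
      show "h' = h"
      proof (rule PQ.universal_eq[OF hh h])
        fix z assume z: "z \<in> fin_sub J \<times> I"
        then have z': "fst z \<in> fin_sub J" "snd z \<in> I" by (simp_all only: mem_Times_iff)
        have "(p (fst z) \<boxtimes>\<^bsub>copsh_op C\<^esub> ?y) \<cdot>\<^bsub>copsh_op C\<^esub> h' = q (fst z)"
          using h' z' by simp
        then show "app h' (?A (fst z) \<otimes> B (snd z))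
            (day_cls C L Y (Day_elt (?A (fst z)) (B (snd z)) (Idt C (?A (fst z) \<otimes> B (snd z))) (l (fst z)) (m (snd z))))
          = app h (?A (fst z) \<otimes> B (snd z))
            (day_cls C L Y (Day_elt (?A (fst z)) (B (snd z)) (Idt C (?A (fst z) \<otimes> B (snd z))) (l (fst z)) (m (snd z))))"
          using iff[OF hh z'(1)] hz[OF z] z'(2) by simp
      qed
    qed
  qed
qed

end

section \<open>The category FinStoch and its infinite tensor products\<close>

lemma (in tensor_category) full_subcat_tensor_category:
  assumes S: "S \<subseteq> Ob C" "unit C \<in> S" and closed: "\<And>A B. A \<in> S \<Longrightarrow> B \<in> S \<Longrightarrow> A \<otimes> B \<in> S"
  shows "tensor_category (full_subcat C S)"
proof -
  have [simp]: "tensO (full_subcat C S) = tensO C" "tensA (full_subcat C S) = tensA C"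
    "unit (full_subcat C S) = unit C" "lunit (full_subcat C S) = lunit C"
    by (simp_all add: full_subcat_def)
  interpret F: category "full_subcat C S" using S(1) by (rule full_subcat_category)
  show ?thesis
  proof
    show "lunit (full_subcat C S) A \<in> hom (full_subcat C S) (unit (full_subcat C S) \<otimes>\<^bsub>full_subcat C S\<^esub> A) A"
      if "A \<in> Ob (full_subcat C S)" for A
      using that S closed lunit_hom by (auto simp: full_subcat_hom)
  qed (use S closed in \<open>auto simp: full_subcat_hom tens_hom tens_id lunit_nat tens_comp subset_eq split: if_splits\<close>)
qed

subsection \<open>Stochastic matrices\<close>

lemma FinStoch_simps [simp]:
  "Ob FinStoch = {A. finite A}" "Dom FinStoch = src" "Cod FinStoch = tgt"
  "Idt FinStoch A = fin_det A (\<lambda>x. x) A" "unit FinStoch = {Star}" "tensO FinStoch = pr_times"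
  "lunit FinStoch A = fin_det (pr_times {Star} A) p2 A"
  by (simp_all add: FinStoch_def)

lemma FinStoch_hom:
  "f \<in> hom FinStoch A B \<longleftrightarrow> src f = A \<and> tgt f = B \<and> finite A \<and> finite B \<and> (\<forall>y x. 0 \<le> fn f y x) \<and>
     (\<forall>x\<in>A. (\<Sum>y\<in>B. fn f y x) = 1) \<and> (\<forall>y x. y \<notin> B \<or> x \<notin> A \<longrightarrow> fn f y x = 0)"
  by (auto simp: hom_def FinStoch_def)

lemma FinStoch_ext:
  assumes "f \<in> hom FinStoch A B" "g \<in> hom FinStoch A B"
    and "\<And>x y. x \<in> A \<Longrightarrow> y \<in> B \<Longrightarrow> fn f y x = fn g y x"
  shows "f = g"
proof -
  have "fn f y x = fn g y x" for y x
    using assms by (cases "x \<in> A \<and> y \<in> B") (auto simp: FinStoch_hom)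
  then have "fn f = fn g" by (intro ext)
  then show ?thesis
    using assms by (cases f; cases g) (auto simp: FinStoch_hom)
qed

lemma fn_FinStoch_Comp: "fn (g \<cdot>\<^bsub>FinStoch\<^esub> f) z x = (\<Sum>y\<in>tgt f. fn g z y * fn f y x)"
  by (simp add: FinStoch_def)

lemma fin_det_hom:
  assumes "finite A" "finite B" "\<And>x. x \<in> A \<Longrightarrow> h x \<in> B"
  shows "fin_det A h B \<in> hom FinStoch A B"
  using assms by (auto simp: FinStoch_hom fin_det_def if_distrib sum.delta cong: if_cong)

lemma fin_det_cong: "(\<And>x. x \<in> A \<Longrightarrow> h x = h' x) \<Longrightarrow> fin_det A h B = fin_det A h' B"
  by (auto simp: fin_det_def fun_eq_iff)

lemma FinStoch_comp_hom:
  assumes f: "f \<in> hom FinStoch A B" and g: "g \<in> hom FinStoch B D"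
  shows "g \<cdot>\<^bsub>FinStoch\<^esub> f \<in> hom FinStoch A D"
proof -
  have "(\<Sum>z\<in>D. \<Sum>y\<in>B. fn g z y * fn f y x) = 1" if "x \<in> A" for x
  proof -
    have "(\<Sum>z\<in>D. \<Sum>y\<in>B. fn g z y * fn f y x) = (\<Sum>y\<in>B. (\<Sum>z\<in>D. fn g z y) * fn f y x)"
      by (subst sum.swap) (simp add: sum_distrib_right)
    then show ?thesis
      using f g that by (simp add: FinStoch_hom)
  qed
  then show ?thesis
    using f g by (auto simp: FinStoch_hom fn_FinStoch_Comp intro!: sum_nonneg) (auto simp: FinStoch_def)
qed

lemma comp_fin_det:
  assumes h: "\<And>x. x \<in> A \<Longrightarrow> h x \<in> B" and A: "finite A" and g: "g \<in> hom FinStoch B D" and x: "x \<in> A"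
  shows "fn (g \<cdot>\<^bsub>FinStoch\<^esub> fin_det A h B) z x = fn g z (h x)"
proof -
  have "fn (g \<cdot>\<^bsub>FinStoch\<^esub> fin_det A h B) z x = (\<Sum>y\<in>B. if y = h x then fn g z y else 0)"
    unfolding fn_FinStoch_Comp using x by (auto simp: fin_det_def intro: sum.cong)
  then show ?thesis
    using g h[OF x] by (simp add: FinStoch_hom)
qed

lemma fin_det_comp:
  assumes "\<And>x. x \<in> A \<Longrightarrow> h x \<in> B" "\<And>y. y \<in> B \<Longrightarrow> k y \<in> D" "finite A" "finite B" "finite D"
  shows "fin_det B k D \<cdot>\<^bsub>FinStoch\<^esub> fin_det A h B = fin_det A (\<lambda>x. k (h x)) D"
proof (rule FinStoch_ext[of _ A D])
  show "fin_det B k D \<cdot>\<^bsub>FinStoch\<^esub> fin_det A h B \<in> hom FinStoch A D"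
    using FinStoch_comp_hom fin_det_hom assms by metis
  show "fin_det A (\<lambda>x. k (h x)) D \<in> hom FinStoch A D"
    using assms by (auto intro: fin_det_hom)
  show "fn (fin_det B k D \<cdot>\<^bsub>FinStoch\<^esub> fin_det A h B) y x = fn (fin_det A (\<lambda>x. k (h x)) D) y x"
    if "x \<in> A" "y \<in> D" for x y
    using comp_fin_det[OF assms(1,3) fin_det_hom[OF assms(4,5,2)] that(1)] that assms(1) by (simp add: fin_det_def)
qed

lemma FinStoch_category: "category FinStoch"
proof
  show "Dom FinStoch f \<in> Ob FinStoch" "Cod FinStoch f \<in> Ob FinStoch" if "f \<in> Ar FinStoch" for f
    using that by (auto simp: FinStoch_def)
  show "Idt FinStoch A \<in> hom FinStoch A A" if "A \<in> Ob FinStoch" for A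
    using that by (auto intro: fin_det_hom)
  show "g \<cdot>\<^bsub>FinStoch\<^esub> f \<in> hom FinStoch A D" if "f \<in> hom FinStoch A B" "g \<in> hom FinStoch B D" for f g A B D
    using FinStoch_comp_hom that by blast
  show "Idt FinStoch B \<cdot>\<^bsub>FinStoch\<^esub> f = f" if f: "f \<in> hom FinStoch A B" for f A B
  proof (rule FinStoch_ext[OF FinStoch_comp_hom[OF f] f])
    show "Idt FinStoch B \<in> hom FinStoch B B"
      using f by (auto simp: FinStoch_hom[of f] intro: fin_det_hom)
    fix x y assume "x \<in> A" "y \<in> B"
    have t: "tgt f = B" using f by (simp add: FinStoch_hom)
    have "fn (Idt FinStoch B \<cdot>\<^bsub>FinStoch\<^esub> f) y x = (\<Sum>y'\<in>B. if y' = y then fn f y' x else 0)"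
      unfolding fn_FinStoch_Comp t by (intro sum.cong refl) (simp add: fin_det_def)
    then show "fn (Idt FinStoch B \<cdot>\<^bsub>FinStoch\<^esub> f) y x = fn f y x"
      using f \<open>y \<in> B\<close> by (simp add: FinStoch_hom)
  qed
  show "f \<cdot>\<^bsub>FinStoch\<^esub> Idt FinStoch A = f" if f: "f \<in> hom FinStoch A B" for f A B
  proof (rule FinStoch_ext[OF FinStoch_comp_hom[OF _ f] f])
    have A: "finite A" using f by (simp add: FinStoch_hom)
    show "Idt FinStoch A \<in> hom FinStoch A A"
      using A by (auto intro: fin_det_hom)
    show "fn (f \<cdot>\<^bsub>FinStoch\<^esub> Idt FinStoch A) y x = fn f y x" if "x \<in> A" "y \<in> B" for x y
      using comp_fin_det[OF _ A f that(1)] by simp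
  qed
  show "(h \<cdot>\<^bsub>FinStoch\<^esub> g) \<cdot>\<^bsub>FinStoch\<^esub> f = h \<cdot>\<^bsub>FinStoch\<^esub> g \<cdot>\<^bsub>FinStoch\<^esub> f"
    if f: "f \<in> hom FinStoch A B" and g: "g \<in> hom FinStoch B D" and h: "h \<in> hom FinStoch D E" for f g h A B D E
  proof (rule FinStoch_ext[of _ A E])
    show "(h \<cdot>\<^bsub>FinStoch\<^esub> g) \<cdot>\<^bsub>FinStoch\<^esub> f \<in> hom FinStoch A E" "h \<cdot>\<^bsub>FinStoch\<^esub> g \<cdot>\<^bsub>FinStoch\<^esub> f \<in> hom FinStoch A E"
      using FinStoch_comp_hom f g h by blast+
    have t: "tgt (g \<cdot>\<^bsub>FinStoch\<^esub> f) = D"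
      using FinStoch_comp_hom[OF f g] by (simp add: FinStoch_hom)
    have "(\<Sum>y\<in>B. (\<Sum>w\<in>D. fn h z w * fn g w y) * fn f y x) = (\<Sum>w\<in>D. fn h z w * (\<Sum>y\<in>B. fn g w y * fn f y x))" for x z
      by (simp add: sum_distrib_left sum_distrib_right mult.assoc) (rule sum.swap)
    then show "fn ((h \<cdot>\<^bsub>FinStoch\<^esub> g) \<cdot>\<^bsub>FinStoch\<^esub> f) z x = fn (h \<cdot>\<^bsub>FinStoch\<^esub> g \<cdot>\<^bsub>FinStoch\<^esub> f) z x" for x z
      using f g h t by (simp add: fn_FinStoch_Comp FinStoch_hom)
  qed
qed

lemma pr_times_iff: "Pr x y \<in> pr_times A B \<longleftrightarrow> x \<in> A \<and> y \<in> B"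
  by (auto simp: pr_times_def)

lemma pr_timesE: "p \<in> pr_times A B \<Longrightarrow> (\<And>x y. p = Pr x y \<Longrightarrow> x \<in> A \<Longrightarrow> y \<in> B \<Longrightarrow> thesis) \<Longrightarrow> thesis"
  by (auto simp: pr_times_def)

lemma finite_pr_times: "finite A \<Longrightarrow> finite B \<Longrightarrow> finite (pr_times A B)"
  by (simp add: pr_times_def)

lemma sum_pr_times: "(\<Sum>p\<in>pr_times A B. g p) = (\<Sum>x\<in>A. \<Sum>y\<in>B. g (Pr x y))"
proof -
  have "(\<Sum>p\<in>pr_times A B. g p) = (\<Sum>(x, y)\<in>A \<times> B. g (Pr x y))"
    unfolding pr_times_def by (subst sum.reindex) (auto simp: inj_on_def split_def)
  then show ?thesis by (simp add: sum.cartesian_product)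
qed

lemma FinStoch_tensA:
  assumes f: "f \<in> hom FinStoch A A'" and g: "g \<in> hom FinStoch B B'"
  shows "f \<boxtimes>\<^bsub>FinStoch\<^esub> g \<in> hom FinStoch (pr_times A B) (pr_times A' B')"
    and "x \<in> A \<Longrightarrow> z \<in> B \<Longrightarrow> y \<in> A' \<Longrightarrow> w \<in> B' \<Longrightarrow>
      fn (f \<boxtimes>\<^bsub>FinStoch\<^esub> g) (Pr y w) (Pr x z) = fn f y x * fn g w z"
proof -
  have s: "src f = A" "tgt f = A'" "src g = B" "tgt g = B'"
    using f g by (auto simp: FinStoch_hom)
  have eq: "f \<boxtimes>\<^bsub>FinStoch\<^esub> g = Arrow (pr_times A B) (\<lambda>q p. if q \<in> pr_times A' B' \<and> p \<in> pr_times A B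
       then fn f (p1 q) (p1 p) * fn g (p2 q) (p2 p) else 0) (pr_times A' B')"
    by (simp add: FinStoch_def s)
  show "x \<in> A \<Longrightarrow> z \<in> B \<Longrightarrow> y \<in> A' \<Longrightarrow> w \<in> B' \<Longrightarrow>
      fn (f \<boxtimes>\<^bsub>FinStoch\<^esub> g) (Pr y w) (Pr x z) = fn f y x * fn g w z"
    unfolding eq by (simp add: pr_times_iff)
  have "(\<Sum>q\<in>pr_times A' B'. fn f (p1 q) (p1 p) * fn g (p2 q) (p2 p)) = 1" if "p \<in> pr_times A B" for p
  proof -
    have "(\<Sum>q\<in>pr_times A' B'. fn f (p1 q) (p1 p) * fn g (p2 q) (p2 p)) =
       (\<Sum>y\<in>A'. fn f y (p1 p)) * (\<Sum>w\<in>B'. fn g w (p2 p))"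
      by (simp add: sum_pr_times sum_product)
    then show ?thesis
      using f g that by (auto simp: FinStoch_hom elim!: pr_timesE)
  qed
  then show "f \<boxtimes>\<^bsub>FinStoch\<^esub> g \<in> hom FinStoch (pr_times A B) (pr_times A' B')"
    unfolding eq using f g by (auto simp: FinStoch_hom finite_pr_times cong: sum.cong)
qed

lemma fin_det_tensA:
  assumes A: "finite A" "finite A'" "\<And>x. x \<in> A \<Longrightarrow> h x \<in> A'" and B: "finite B" "finite B'" "\<And>x. x \<in> B \<Longrightarrow> k x \<in> B'"
  shows "fin_det A h A' \<boxtimes>\<^bsub>FinStoch\<^esub> fin_det B k B' =
    fin_det (pr_times A B) (\<lambda>p. Pr (h (p1 p)) (k (p2 p))) (pr_times A' B')"
proof -
  note f = fin_det_hom[of A A' h, OF A] and g = fin_det_hom[of B B' k, OF B]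
  show ?thesis
  proof (rule FinStoch_ext[OF FinStoch_tensA(1)[OF f g] fin_det_hom])
    fix p q assume p: "p \<in> pr_times A B" and q: "q \<in> pr_times A' B'"
    obtain x z where x: "p = Pr x z" "x \<in> A" "z \<in> B" using p by (rule pr_timesE)
    obtain y w where y: "q = Pr y w" "y \<in> A'" "w \<in> B'" using q by (rule pr_timesE)
    show "fn (fin_det A h A' \<boxtimes>\<^bsub>FinStoch\<^esub> fin_det B k B') q p =
        fn (fin_det (pr_times A B) (\<lambda>p. Pr (h (p1 p)) (k (p2 p))) (pr_times A' B')) q p"
      using FinStoch_tensA(2)[OF f g x(2,3) y(2,3)] x y p by (simp add: fin_det_def)
  qed (use A B in \<open>auto simp: finite_pr_times pr_times_iff elim!: pr_timesE\<close>)
qed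

lemma FinStoch_semicartesian: "semicartesian FinStoch"
proof -
  interpret category FinStoch by (rule FinStoch_category)
  have Star_hom: "fin_det A (\<lambda>_. Star) {Star} \<in> hom FinStoch A {Star}" if "finite A" for A :: "'a point set"
    using that by (auto intro: fin_det_hom)
  show ?thesis
  proof
    show "A \<otimes>\<^bsub>FinStoch\<^esub> B \<in> Ob FinStoch" if "A \<in> Ob FinStoch" "B \<in> Ob FinStoch" for A B :: "'a point set"
      using that by (simp add: finite_pr_times)
    show "f \<boxtimes>\<^bsub>FinStoch\<^esub> g \<in> hom FinStoch (A \<otimes>\<^bsub>FinStoch\<^esub> B) (A' \<otimes>\<^bsub>FinStoch\<^esub> B')"
      if "f \<in> hom FinStoch A A'" "g \<in> hom FinStoch B B'" for f g :: "'a stoch" and A A' B B'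
      using FinStoch_tensA(1)[OF that] by simp
    show "Idt FinStoch A \<boxtimes>\<^bsub>FinStoch\<^esub> Idt FinStoch B = Idt FinStoch (A \<otimes>\<^bsub>FinStoch\<^esub> B)"
      if "A \<in> Ob FinStoch" "B \<in> Ob FinStoch" for A B :: "'a point set"
      using that by (simp add: fin_det_tensA) (auto intro!: fin_det_cong elim!: pr_timesE)
    show "(f' \<cdot>\<^bsub>FinStoch\<^esub> f) \<boxtimes>\<^bsub>FinStoch\<^esub> (g' \<cdot>\<^bsub>FinStoch\<^esub> g) = (f' \<boxtimes>\<^bsub>FinStoch\<^esub> g') \<cdot>\<^bsub>FinStoch\<^esub> (f \<boxtimes>\<^bsub>FinStoch\<^esub> g)"
      if f: "f \<in> hom FinStoch A A'" and f': "f' \<in> hom FinStoch A' A''"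
        and g: "g \<in> hom FinStoch B B'" and g': "g' \<in> hom FinStoch B' B''"
      for f f' g g' :: "'a stoch" and A A' A'' B B' B''
    proof (rule FinStoch_ext[OF FinStoch_tensA(1)[OF FinStoch_comp_hom[OF f f'] FinStoch_comp_hom[OF g g']]
          FinStoch_comp_hom[OF FinStoch_tensA(1)[OF f g] FinStoch_tensA(1)[OF f' g']]])
      fix p q assume "p \<in> pr_times A B" "q \<in> pr_times A'' B''"
      then obtain x z y w where p: "p = Pr x z" "x \<in> A" "z \<in> B" and q: "q = Pr y w" "y \<in> A''" "w \<in> B''"
        by (auto elim!: pr_timesE)
      have t: "tgt f = A'" "tgt g = B'" "tgt (f \<boxtimes>\<^bsub>FinStoch\<^esub> g) = pr_times A' B'"
        using f g FinStoch_tensA(1)[OF f g] by (auto simp: FinStoch_hom)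
      have "fn ((f' \<boxtimes>\<^bsub>FinStoch\<^esub> g') \<cdot>\<^bsub>FinStoch\<^esub> (f \<boxtimes>\<^bsub>FinStoch\<^esub> g)) q p =
         (\<Sum>a\<in>A'. \<Sum>b\<in>B'. (fn f' y a * fn g' w b) * (fn f a x * fn g b z))"
        unfolding fn_FinStoch_Comp t sum_pr_times p q
        by (intro sum.cong refl) (simp add: FinStoch_tensA(2)[OF f g] FinStoch_tensA(2)[OF f' g'] p q)
      also have "\<dots> = fn (f' \<cdot>\<^bsub>FinStoch\<^esub> f) y x * fn (g' \<cdot>\<^bsub>FinStoch\<^esub> g) w z"
        by (simp add: fn_FinStoch_Comp t sum_product mult_ac)
      finally show "fn ((f' \<cdot>\<^bsub>FinStoch\<^esub> f) \<boxtimes>\<^bsub>FinStoch\<^esub> (g' \<cdot>\<^bsub>FinStoch\<^esub> g)) q p =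
          fn ((f' \<boxtimes>\<^bsub>FinStoch\<^esub> g') \<cdot>\<^bsub>FinStoch\<^esub> (f \<boxtimes>\<^bsub>FinStoch\<^esub> g)) q p"
        using FinStoch_tensA(2)[OF FinStoch_comp_hom[OF f f'] FinStoch_comp_hom[OF g g']] p q by simp
    qed
    show "unit FinStoch \<in> Ob FinStoch" by simp
    show l: "lunit FinStoch A \<in> hom FinStoch (unit FinStoch \<otimes>\<^bsub>FinStoch\<^esub> A) A" if "A \<in> Ob FinStoch" for A :: "'a point set"
      using that by (auto intro!: fin_det_hom simp: finite_pr_times elim: pr_timesE)
    show "lunit FinStoch B \<cdot>\<^bsub>FinStoch\<^esub> (Idt FinStoch (unit FinStoch) \<boxtimes>\<^bsub>FinStoch\<^esub> f) = f \<cdot>\<^bsub>FinStoch\<^esub> lunit FinStoch A"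
      if f: "f \<in> hom FinStoch A B" for f :: "'a stoch" and A B
    proof -
      have o: "A \<in> Ob FinStoch" "B \<in> Ob FinStoch" "finite A" "finite B" using f by (auto simp: FinStoch_hom)
      have i: "fin_det {Star} (\<lambda>x. x) {Star} \<in> hom FinStoch {Star} {Star}" by (auto intro: fin_det_hom)
      note t = FinStoch_tensA[OF i f]
      have lB: "lunit FinStoch B \<in> hom FinStoch (pr_times {Star} B) B" and lA: "lunit FinStoch A \<in> hom FinStoch (pr_times {Star} A) A"
        using l o by auto
      have "lunit FinStoch B \<cdot>\<^bsub>FinStoch\<^esub> (fin_det {Star} (\<lambda>x. x) {Star} \<boxtimes>\<^bsub>FinStoch\<^esub> f) = f \<cdot>\<^bsub>FinStoch\<^esub> lunit FinStoch A"
      proof (rule FinStoch_ext[OF FinStoch_comp_hom[OF t(1) lB] FinStoch_comp_hom[OF lA f]])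
        fix p y assume p: "p \<in> pr_times {Star} A" and y: "y \<in> B"
        obtain x where x: "p = Pr Star x" "x \<in> A" using p by (auto elim: pr_timesE)
        have tg: "tgt (fin_det {Star} (\<lambda>x. x) {Star} \<boxtimes>\<^bsub>FinStoch\<^esub> f) = pr_times {Star} B"
          using t(1) by (simp add: FinStoch_hom)
        have "fn (lunit FinStoch B \<cdot>\<^bsub>FinStoch\<^esub> (fin_det {Star} (\<lambda>x. x) {Star} \<boxtimes>\<^bsub>FinStoch\<^esub> f)) y p
           = (\<Sum>b\<in>B. if b = y then fn f b x else 0)"
          unfolding fn_FinStoch_Comp tg sum_pr_times x
          using x t(2)[of Star x Star] by (simp add: fin_det_def pr_times_iff) (auto intro!: sum.cong)
        also have "\<dots> = fn f y x"
          using o y by simp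
        also have "\<dots> = fn (f \<cdot>\<^bsub>FinStoch\<^esub> lunit FinStoch A) y p"
        proof -
          have "p2 q \<in> A" if "q \<in> pr_times {Star} A" for q
            using that by (auto elim: pr_timesE)
          then show ?thesis
            using comp_fin_det[of "pr_times {Star} A" p2 A f B p y] f p x o by (simp add: finite_pr_times)
        qed
        finally show "fn (lunit FinStoch B \<cdot>\<^bsub>FinStoch\<^esub> (fin_det {Star} (\<lambda>x. x) {Star} \<boxtimes>\<^bsub>FinStoch\<^esub> f)) y p =
           fn (f \<cdot>\<^bsub>FinStoch\<^esub> lunit FinStoch A) y p" .
      qed
      then show ?thesis by simp
    qed
    show "\<exists>!f. f \<in> hom FinStoch A (unit FinStoch)" if "A \<in> Ob FinStoch" for A :: "'a point set"
    proof (rule ex1I)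
      have "finite A" using that by simp
      then show "fin_det A (\<lambda>_. Star) {Star} \<in> hom FinStoch A (unit FinStoch)" using Star_hom by simp
      show "f = fin_det A (\<lambda>_. Star) {Star}" if "f \<in> hom FinStoch A (unit FinStoch)" for f
        by (rule FinStoch_ext[of _ A "{Star}"])
           (use that Star_hom[OF \<open>finite A\<close>] in \<open>auto simp: FinStoch_hom fin_det_def\<close>)
    qed
  qed
qed

interpretation FS: semicartesian FinStoch by (rule FinStoch_semicartesian)

lemma fin_det_iso:
  assumes "finite A" "finite B" "bij_betw h A B"
  shows "is_iso FinStoch (fin_det A h B)"
proof -
  define k where "k = inv_into A h"
  have hk: "\<And>x. x \<in> A \<Longrightarrow> h x \<in> B \<and> k (h x) = x" "\<And>y. y \<in> B \<Longrightarrow> k y \<in> A \<and> h (k y) = y"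
    using assms(3) unfolding k_def
    by (auto simp: bij_betw_inv_into_left bij_betw_inv_into_right bij_betw_apply bij_betw_inv_into)
       (auto simp: bij_betw_def inv_into_into)
  show ?thesis
  proof (rule FS.isoI[of _ A B "fin_det B k A"])
    show "fin_det B k A \<cdot>\<^bsub>FinStoch\<^esub> fin_det A h B = Idt FinStoch A"
      using hk assms by (subst fin_det_comp) (auto intro: fin_det_cong)
    show "fin_det A h B \<cdot>\<^bsub>FinStoch\<^esub> fin_det B k A = Idt FinStoch B"
      using hk assms by (subst fin_det_comp) (auto intro: fin_det_cong)
  qed (use hk assms in \<open>auto intro: fin_det_hom\<close>)
qed

subsection \<open>Finite products as sets of tuples\<close>

fun tuple :: "nat list \<Rightarrow> (nat \<Rightarrow> 'a point) \<Rightarrow> 'a point" where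
  "tuple [] f = Star"
| "tuple (j # js) f = Pr (f j) (tuple js f)"

fun coord :: "nat list \<Rightarrow> 'a point \<Rightarrow> nat \<Rightarrow> 'a point" where
  "coord [] t i = Star"
| "coord (j # js) t i = (if i = j then p1 t else coord js (p2 t) i)"

lemma coord_tuple: "j \<in> set js \<Longrightarrow> coord js (tuple js f) j = f j"
  by (induction js) auto

lemma tuple_cong: "(\<And>j. j \<in> set js \<Longrightarrow> f j = g j) \<Longrightarrow> tuple js f = tuple js g"
  by (induction js) auto

lemma tens_list_tuple:
  "distinct js \<Longrightarrow> tens_list FinStoch X js = {tuple js f | f. \<forall>j\<in>set js. f j \<in> X j}"
proof (induction js)
  case Nil
  then show ?case by auto
next
  case (Cons j js)
  have "pr_times (X j) {tuple js f | f. \<forall>i\<in>set js. f i \<in> X i} = {tuple (j # js) f | f. \<forall>i\<in>set (j # js). f i \<in> X i}"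
    (is "?L = ?R")
  proof
    show "?L \<subseteq> ?R"
    proof
      fix p assume "p \<in> ?L"
      then obtain x f where p: "p = Pr x (tuple js f)" "x \<in> X j" "\<forall>i\<in>set js. f i \<in> X i"
        by (auto elim!: pr_timesE)
      have "tuple js (f(j := x)) = tuple js f"
        using Cons.prems by (intro tuple_cong) auto
      then have "p = tuple (j # js) (f(j := x)) \<and> (\<forall>i\<in>set (j # js). (f(j := x)) i \<in> X i)"
        using p by auto
      then show "p \<in> ?R" by blast
    qed
    show "?R \<subseteq> ?L" by (auto simp: pr_times_iff)
  qed
  then show ?case using Cons by simp
qed

text \<open>
  The iterated tensor product of the sets \<open>X j\<close> for \<open>j \<in> F\<close> is \<open>fprod X F\<close>, with the points \<open>itup F f\<close> for families
  \<open>f\<close>. The arrows of the abstract infinite tensor product are the deterministic matrices of \<open>fproj\<close>, which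
  restricts families.
\<close>

definition itup :: "nat set \<Rightarrow> (nat \<Rightarrow> 'a point) \<Rightarrow> 'a point" where
  "itup F f = tuple (sorted_list_of_set F) f"

definition fprod :: "(nat \<Rightarrow> 'a point set) \<Rightarrow> nat set \<Rightarrow> 'a point set" where
  "fprod X F = {itup F f | f. \<forall>j\<in>F. f j \<in> X j}"

definition fproj :: "nat set \<Rightarrow> nat set \<Rightarrow> 'a point \<Rightarrow> 'a point" where
  "fproj F F' t = itup F (coord (sorted_list_of_set F') t)"

lemma fprodI: "(\<And>j. j \<in> F \<Longrightarrow> f j \<in> X j) \<Longrightarrow> itup F f \<in> fprod X F"
  by (auto simp: fprod_def)

lemma fprodE: 
  assumes "t \<in> fprod X F" 
  obtains f where "t = itup F f" "\<And>j. j \<in> F \<Longrightarrow> f j \<in> X j"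
  using assms by (auto simp: fprod_def)

lemma itup_eq_iff: "finite F \<Longrightarrow> itup F f = itup F g \<longleftrightarrow> (\<forall>j\<in>F. f j = g j)"
  unfolding itup_def using coord_tuple[of _ "sorted_list_of_set F"] tuple_cong[of "sorted_list_of_set F"]
  by (metis set_sorted_list_of_set)

lemma fproj_itup: "finite F' \<Longrightarrow> F \<subseteq> F' \<Longrightarrow> fproj F F' (itup F' f) = itup F f"
  unfolding fproj_def by (subst itup_eq_iff) (auto simp: itup_def coord_tuple finite_subset)

lemma fproj_mem: "finite F' \<Longrightarrow> F \<subseteq> F' \<Longrightarrow> t \<in> fprod X F' \<Longrightarrow> fproj F F' t \<in> fprod X F"
  by (erule fprodE) (simp add: fproj_itup fprodI subset_iff)

lemma abstract_itp_FO: "finite F \<Longrightarrow> FO (abstract_itp FinStoch X) F = fprod X F"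
  unfolding abstract_itp_simps fprod_def itup_def by (subst tens_list_tuple) auto

lemma finite_fprod:
  assumes "finite F" "\<And>j. j \<in> F \<Longrightarrow> finite (X j)"
  shows "finite (fprod X F)"
  using FS.tens_list_ob[of "sorted_list_of_set F" X] assms
  by (simp add: abstract_itp_FO[symmetric] abstract_itp_simps)

lemma proj_list_fin_det:
  fixes X :: "nat \<Rightarrow> 'a point set"
  assumes "distinct js" "\<And>j. j \<in> set js \<Longrightarrow> finite (X j)"
  shows "proj_list FinStoch X F js = fin_det (tens_list FinStoch X js)
    (\<lambda>t. tuple (filter (\<lambda>i. i \<in> F) js) (coord js t)) (tens_list FinStoch X (filter (\<lambda>i. i \<in> F) js))"
  using assms
proof (induction js)
  case Nil
  then show ?case by (auto intro: fin_det_cong)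
next
  case (Cons j js)
  let ?js' = "filter (\<lambda>i. i \<in> F) js"
  let ?T = "tens_list FinStoch X js" and ?T' = "tens_list FinStoch X ?js'"
  let ?h = "\<lambda>t. tuple ?js' (coord js t)"
  have fin: "finite (X j)" "finite ?T" "finite ?T'"
    using FS.tens_list_ob[of js X] FS.tens_list_ob[of ?js' X] Cons.prems by auto
  have h: "?h t \<in> ?T'" if "t \<in> ?T" for t
    using that Cons.prems by (auto simp: tens_list_tuple coord_tuple)
  have ih: "proj_list FinStoch X F js = fin_det ?T ?h ?T'"
    using Cons by simp
  have coord: "tuple ?js' (coord (j # js) t) = ?h (p2 t)" for t :: "'a point"
    using Cons.prems by (intro tuple_cong) auto
  show ?case
  proof (cases "j \<in> F")
    case True
    have e: "(\<lambda>t :: 'a point. tuple (filter (\<lambda>i. i \<in> F) (j # js)) (coord (j # js) t)) = (\<lambda>t. Pr (p1 t) (?h (p2 t)))"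
      using True coord by (intro ext) simp
    have p: "proj_list FinStoch X F (j # js) =
        fin_det (pr_times (X j) ?T) (\<lambda>t. Pr (p1 t) (?h (p2 t))) (pr_times (X j) ?T')"
      using True fin h by (simp add: ih fin_det_tensA)
    have "tens_list FinStoch X (j # js) = pr_times (X j) ?T"
      "tens_list FinStoch X (filter (\<lambda>i. i \<in> F) (j # js)) = pr_times (X j) ?T'"
      using True by simp_all
    then show ?thesis
      by (simp only: e p)
  next
    case False
    have del: "del FinStoch (X j) = fin_det (X j) (\<lambda>_. Star) {Star}"
      using fin by (intro FS.del_unique[symmetric]) (auto intro: fin_det_hom)
    have "proj_list FinStoch X F (j # js) = fin_det (pr_times {Star} ?T') p2 ?T' \<cdot>\<^bsub>FinStoch\<^esub>
       fin_det (pr_times (X j) ?T) (\<lambda>p. Pr Star (?h (p2 p))) (pr_times {Star} ?T')"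
      using False fin h by (simp add: ih del fin_det_tensA)
    also have "\<dots> = fin_det (pr_times (X j) ?T) (\<lambda>p. ?h (p2 p)) ?T'"
      using fin h by (subst fin_det_comp) (auto simp: finite_pr_times pr_times_iff elim!: pr_timesE)
    finally show ?thesis
      using False coord by (simp del: coord.simps proj_list.simps)
  qed
qed

lemma abstract_itp_FA:
  assumes "finite F'" "F \<subseteq> F'" "\<And>j. j \<in> F' \<Longrightarrow> finite (X j)"
  shows "FA (abstract_itp FinStoch X) (F, F') = fin_det (fprod X F') (fproj F F') (fprod X F)"
proof -
  have F: "finite F" using assms finite_subset by blast
  have "tens_list FinStoch X (sorted_list_of_set F') = fprod X F'" "tens_list FinStoch X (sorted_list_of_set F) = fprod X F"
    using abstract_itp_FO[of F X] abstract_itp_FO[of F' X] F assms by (simp_all add: abstract_itp_simps)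
  then show ?thesis
    unfolding abstract_itp_simps using assms
    by (subst proj_list_fin_det) (auto simp: sorted_list_of_set_filter fproj_def itup_def intro!: fin_det_cong)
qed

lemma FinStoch_directed_diagram:
  assumes "\<And>j. j \<in> J \<Longrightarrow> finite (X j)"
  shows "directed_diagram FinStoch (fin_sub J) (\<subseteq>) (FO (abstract_itp FinStoch X)) (\<lambda>F F'. FA (abstract_itp FinStoch X) (F, F'))"
proof
  have fin: "finite (X j)" if "F \<in> fin_sub J" "j \<in> F" for F j using that assms by auto
  show "fin_sub J \<noteq> {}" by auto
  show "\<exists>k\<in>fin_sub J. i \<subseteq> k \<and> j \<subseteq> k" if "i \<in> fin_sub J" "j \<in> fin_sub J" for i j
    using that by (intro bexI[of _ "i \<union> j"]) auto
  show "i \<subseteq> k" if "i \<subseteq> j" "j \<subseteq> k" for i j k :: "nat set" using that by auto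
  show "FO (abstract_itp FinStoch X) F \<in> Ob FinStoch" if "F \<in> fin_sub J" for F
    using that assms by (auto simp: abstract_itp_FO intro!: finite_fprod)
  show "FA (abstract_itp FinStoch X) (F, F') \<in> hom FinStoch (FO (abstract_itp FinStoch X) F') (FO (abstract_itp FinStoch X) F)"
    if "F \<in> fin_sub J" "F' \<in> fin_sub J" "F \<subseteq> F'" for F F'
    using that fin[OF that(1)] fin[OF that(2)] by (simp add: abstract_itp_FO abstract_itp_FA)
      (auto intro!: fin_det_hom finite_fprod fproj_mem)
  show "FA (abstract_itp FinStoch X) (F, G) \<cdot>\<^bsub>FinStoch\<^esub> FA (abstract_itp FinStoch X) (G, H) = FA (abstract_itp FinStoch X) (F, H)"
    if F: "F \<in> fin_sub J" and G: "G \<in> fin_sub J" and H: "H \<in> fin_sub J" and s: "F \<subseteq> G" "G \<subseteq> H" for F G H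
  proof -
    have fG: "finite G" and fH: "finite H" and FH: "F \<subseteq> H" using G H s by auto
    have "fin_det (fprod X G) (fproj F G) (fprod X F) \<cdot>\<^bsub>FinStoch\<^esub> fin_det (fprod X H) (fproj G H) (fprod X G)
        = fin_det (fprod X H) (\<lambda>t. fproj F G (fproj G H t)) (fprod X F)"
      using F G H s fin[OF F] fin[OF G] fin[OF H] by (intro fin_det_comp) (auto intro!: finite_fprod fproj_mem)
    also have "\<dots> = fin_det (fprod X H) (fproj F H) (fprod X F)"
      using fG fH s FH by (intro fin_det_cong) (auto simp: fproj_itup elim!: fprodE)
    finally show ?thesis
      using fin[OF G] fin[OF H] fG fH s FH by (simp add: abstract_itp_FA)
  qed
qed

section \<open>The completion of FinStoch under infinite tensor products\<close>

text \<open>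
  Transport of a presentation along an isomorphism of directed diagrams: \<open>u\<close> relates the index sets,
  and \<open>b\<close> the objects.
\<close>

lemma presentation_reindex:
  assumes P: "presentation C I le A d L l" and D: "directed_diagram C I2 le2 A2 d2"
    and u: "\<And>i. i \<in> I2 \<Longrightarrow> u i \<in> I" "\<And>j. j \<in> I \<Longrightarrow> \<exists>i\<in>I2. u i = j"
      "\<And>i k. i \<in> I2 \<Longrightarrow> k \<in> I2 \<Longrightarrow> le2 i k \<longleftrightarrow> le (u i) (u k)"
    and b: "\<And>i. i \<in> I2 \<Longrightarrow> b i \<in> hom C (A (u i)) (A2 i)" "\<And>i. i \<in> I2 \<Longrightarrow> is_iso C (b i)"
    and nat: "\<And>i k. i \<in> I2 \<Longrightarrow> k \<in> I2 \<Longrightarrow> le2 i k \<Longrightarrow> d2 i k \<cdot>\<^bsub>C\<^esub> b k = b i \<cdot>\<^bsub>C\<^esub> d (u i) (u k)"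
  shows "presentation C I2 le2 A2 d2 L (\<lambda>i. act L (b i) (l (u i)))"
proof -
  interpret P: presentation C I le A d L l by fact
  interpret D: directed_diagram C I2 le2 A2 d2 by fact
  have act: "act L f (act L (b i) (l (u i))) = act L (f \<cdot>\<^bsub>C\<^esub> b i) (l (u i))"
    if "i \<in> I2" "f \<in> hom C (A2 i) E" for i f E
    using P.copsheafD(3)[OF P.copsheaf b(1)[OF that(1)] that(2) P.elt_mem[OF u(1)[OF that(1)]]] by simp
  show ?thesis
  proof
    show "is_functor C SetCat L" by (rule P.copsheaf)
    show "act L (b i) (l (u i)) \<in> FO L (A2 i)" if "i \<in> I2" for i
      using P.copsheafD(1)[OF P.copsheaf b(1) P.elt_mem] u that by blast
    show "act L (d2 i k) (act L (b k) (l (u k))) = act L (b i) (l (u i))" if ik: "i \<in> I2" "k \<in> I2" "le2 i k" for i k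
    proof -
      have le: "le (u i) (u k)" using u(3) ik by simp
      show ?thesis
        using act[OF ik(2) D.d_hom[OF ik]] nat[OF ik] P.elt_compat[OF u(1)[OF ik(1)] u(1)[OF ik(2)] le]
          P.copsheafD(3)[OF P.copsheaf P.d_hom[OF u(1)[OF ik(1)] u(1)[OF ik(2)] le] b(1)[OF ik(1)] P.elt_mem[OF u(1)[OF ik(2)]]]
        by simp
    qed
    show "\<exists>i\<in>I2. \<exists>f\<in>hom C (A2 i) E. x = act L f (act L (b i) (l (u i)))" if E: "E \<in> Ob C" "x \<in> FO L E" for E x
    proof -
      obtain j f where f: "j \<in> I" "f \<in> hom C (A j) E" "x = act L f (l j)"
        using P.elt_surj[OF E] by blast
      obtain i where i: "i \<in> I2" "u i = j" using u(2)[OF f(1)] by blast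
      note v = P.inv_arrow[OF b(1)[OF i(1)] b(2)[OF i(1)]]
      have f': "f \<in> hom C (A (u i)) E" using f i by simp
      have "f = (f \<cdot>\<^bsub>C\<^esub> inv_arrow C (b i)) \<cdot>\<^bsub>C\<^esub> b i"
        using P.comp_assoc[OF b(1)[OF i(1)] v(1) f'] v(2) P.id_right[OF f'] by simp
      then have "x = act L (f \<cdot>\<^bsub>C\<^esub> inv_arrow C (b i)) (act L (b i) (l (u i)))"
        using act[OF i(1) P.comp_hom[OF v(1) f']] f(3) i(2) by simp
      then show ?thesis using i(1) P.comp_hom[OF v(1) f'] by blast
    qed
    show "D.germ_eq i f j g"
      if i: "i \<in> I2" and j: "j \<in> I2" and f: "f \<in> hom C (A2 i) E" and g: "g \<in> hom C (A2 j) E"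
        and eq: "act L f (act L (b i) (l (u i))) = act L g (act L (b j) (l (u j)))" for i j f g E
    proof -
      note fb = P.comp_hom[OF b(1)[OF i] f] and gb = P.comp_hom[OF b(1)[OF j] g]
      have "P.germ_eq (u i) (f \<cdot>\<^bsub>C\<^esub> b i) (u j) (g \<cdot>\<^bsub>C\<^esub> b j)"
        using P.elt_inj[OF u(1)[OF i] u(1)[OF j] fb gb] eq act[OF i f] act[OF j g] by simp
      then obtain k' where k': "k' \<in> I" "le (u i) k'" "le (u j) k'"
          "(f \<cdot>\<^bsub>C\<^esub> b i) \<cdot>\<^bsub>C\<^esub> d (u i) k' = (g \<cdot>\<^bsub>C\<^esub> b j) \<cdot>\<^bsub>C\<^esub> d (u j) k'"
        unfolding P.germ_eq_def by blast
      obtain k where k: "k \<in> I2" "u k = k'" using u(2)[OF k'(1)] by blast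
      have ik: "le2 i k" "le2 j k" using u(3) i j k k' by auto
      have *: "(f \<cdot>\<^bsub>C\<^esub> d2 i k) \<cdot>\<^bsub>C\<^esub> b k = (f \<cdot>\<^bsub>C\<^esub> b i) \<cdot>\<^bsub>C\<^esub> d (u i) k'"
        if i: "i \<in> I2" and f: "f \<in> hom C (A2 i) E" and ik: "le2 i k" for i f
      proof -
        have le: "le (u i) (u k)" using u(3)[OF i k(1)] ik by simp
        show ?thesis
          using P.comp_assoc[OF b(1)[OF k(1)] D.d_hom[OF i k(1) ik] f] nat[OF i k(1) ik]
            P.comp_assoc[OF P.d_hom[OF u(1)[OF i] u(1)[OF k(1)] le] b(1)[OF i] f] k(2) by simp
      qed
      have eq: "(f \<cdot>\<^bsub>C\<^esub> d2 i k) \<cdot>\<^bsub>C\<^esub> b k = (g \<cdot>\<^bsub>C\<^esub> d2 j k) \<cdot>\<^bsub>C\<^esub> b k"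
        using *[OF i f ik(1)] *[OF j g ik(2)] k'(4) by simp
      note v = P.inv_arrow[OF b(1)[OF k(1)] b(2)[OF k(1)]]
      have **: "h = (h \<cdot>\<^bsub>C\<^esub> b k) \<cdot>\<^bsub>C\<^esub> inv_arrow C (b k)" if "h \<in> hom C (A2 k) E" for h
        using P.comp_assoc[OF v(1) b(1)[OF k(1)] that] v(3) P.id_right[OF that] by simp
      have "f \<cdot>\<^bsub>C\<^esub> d2 i k = g \<cdot>\<^bsub>C\<^esub> d2 j k"
        using **[OF P.comp_hom[OF D.d_hom[OF i k(1) ik(1)] f]] **[OF P.comp_hom[OF D.d_hom[OF j k(1) ik(2)] g]] eq by simp
      then show ?thesis
        unfolding D.germ_eq_def using k(1) ik by blast
    qed
  qed
qed

text \<open>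
  If there is a last stage, then the colimit is attained there.
\<close>

lemma (in directed_diagram) top_presentation:
  assumes n: "n \<in> I" "\<And>i. i \<in> I \<Longrightarrow> le i n" "d n n = Idt C (A n)"
  shows "presentation C I le A d (hom_copsh C (A n)) (\<lambda>i. Hom_elt (d i n))"
proof
  show "is_functor C SetCat (hom_copsh C (A n))" by (rule hom_copsh_functor)
  show "Hom_elt (d i n) \<in> FO (hom_copsh C (A n)) (A i)" if "i \<in> I" for i
    using d_hom[OF that n(1) n(2)[OF that]] by simp
  show "act (hom_copsh C (A n)) (d i k) (Hom_elt (d k n)) = Hom_elt (d i n)" if "i \<in> I" "k \<in> I" "le i k" for i k
    using hom_copsh_act[OF d_hom[OF that(2) n(1) n(2)[OF that(2)]] d_hom[OF that]] d_comp[OF that(1,2) n(1) that(3) n(2)[OF that(2)]]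
    by simp
  show "\<exists>i\<in>I. \<exists>f\<in>hom C (A i) D. x = act (hom_copsh C (A n)) f (Hom_elt (d i n))"
    if "D \<in> Ob C" and x: "x \<in> FO (hom_copsh C (A n)) D" for D x
  proof -
    obtain f where f: "x = Hom_elt f" "f \<in> hom C (A n) D" using x by auto
    then have "x = act (hom_copsh C (A n)) f (Hom_elt (d n n))"
      using hom_copsh_act[OF d_hom[OF n(1) n(1) n(2)[OF n(1)]] f(2)] n(3) id_right[OF f(2)] by simp
    then show ?thesis using f n(1) by blast
  qed
  show "germ_eq i f j g"
    if "i \<in> I" "j \<in> I" and f: "f \<in> hom C (A i) D" and g: "g \<in> hom C (A j) D"
      and eq: "act (hom_copsh C (A n)) f (Hom_elt (d i n)) = act (hom_copsh C (A n)) g (Hom_elt (d j n))" for i j f g D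
    using eq hom_copsh_act[OF d_hom[OF that(1) n(1) n(2)[OF that(1)]] f]
      hom_copsh_act[OF d_hom[OF that(2) n(1) n(2)[OF that(2)]] g] n(1) n(2)[OF that(1)] n(2)[OF that(2)]
    unfolding germ_eq_def by auto
qed

lemma functor_iso:
  assumes "category C" "category D" and F: "is_functor C D F" and f: "f \<in> hom C A B" "is_iso C f"
  shows "is_iso D (FA F f)"
proof -
  interpret C: category C by fact
  interpret D: category D by fact
  note v = C.inv_arrow[OF f] and o = C.hom_ob[OF f(1)]
  show ?thesis
    using is_functorD(4)[OF F f(1) v(1)] is_functorD(4)[OF F v(1) f(1)] v o
      is_functorD(3)[OF F] 
    by (intro D.isoI[OF is_functorD(2)[OF F f(1)] is_functorD(2)[OF F v(1)]]) auto
qed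

text \<open>
  By the Yoneda lemma, such arrows are elements of \<open>L\<close> at the unit. Each of them comes from an arrow of
  some \<open>A i\<close> to the unit; this arrow is unique, and all stages agree by directedness.
\<close>

lemma (in presentation) terminal_arrow:
  assumes "semicartesian C"
  shows "\<exists>!t. t \<in> hom (copsh_op C) L (hom_copsh C (unit C))"
proof -
  interpret S: semicartesian C by fact
  obtain i where i: "i \<in> I" using nonempty by blast
  note U = id_hom[OF unit_ob]
  have *: "act L f (l i) = act L g (l j)"
    if i: "i \<in> I" and j: "j \<in> I" and f: "f \<in> hom C (A i) (unit C)" and g: "g \<in> hom C (A j) (unit C)" for i j f g
  proof -
    obtain k where k: "k \<in> I" "le i k" "le j k" using directed[OF i j] by blast
    have "f \<cdot> d i k = g \<cdot> d j k"
      using S.del_unique[OF comp_hom[OF d_hom[OF i k(1,2)] f]] S.del_unique[OF comp_hom[OF d_hom[OF j k(1,3)] g]]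
      by simp
    then have "germ_eq i f j g" unfolding germ_eq_def using k by blast
    then show ?thesis using act_eq_iff[OF i j f g] by simp
  qed
  show ?thesis
  proof (rule ex_ex1I)
    have "act L (del C (A i)) (l i) \<in> FO L (unit C)"
      using copsheafD(1)[OF copsheaf S.del_hom[OF A_ob[OF i]] elt_mem[OF i]] .
    then show "\<exists>t. t \<in> hom (copsh_op C) L (hom_copsh C (unit C))"
      using yoneda_arrow(1)[OF copsheaf] by blast
    fix t s assume t: "t \<in> hom (copsh_op C) L (hom_copsh C (unit C))" and s: "s \<in> hom (copsh_op C) L (hom_copsh C (unit C))"
    obtain i f where f: "i \<in> I" "f \<in> hom C (A i) (unit C)" "app t (unit C) (Hom_elt (Idt C (unit C))) = act L f (l i)"
      using elt_surj[OF unit_ob yoneda_elt[OF t unit_ob]] by blast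
    obtain j g where g: "j \<in> I" "g \<in> hom C (A j) (unit C)" "app s (unit C) (Hom_elt (Idt C (unit C))) = act L g (l j)"
      using elt_surj[OF unit_ob yoneda_elt[OF s unit_ob]] by blast
    show "t = s"
      using yoneda_ext[OF t s] *[OF f(1) g(1) f(2) g(2)] f(3) g(3) by simp
  qed
qed

subsection \<open>The tensor product of two infinite tensor products\<close>

text \<open>
  The completion is closed under tensor products since two families indexed by sets of natural numbers
  merge into one, using even and odd indices.
\<close>

definition interleave :: "(nat \<Rightarrow> 'b) \<Rightarrow> (nat \<Rightarrow> 'b) \<Rightarrow> nat \<Rightarrow> 'b" where
  "interleave X Y i = (if even i then X (i div 2) else Y (i div 2))"

definition interleave_set :: "nat set \<Rightarrow> nat set \<Rightarrow> nat set" where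
  "interleave_set F G = (\<lambda>j. 2 * j) ` F \<union> (\<lambda>j. 2 * j + 1) ` G"

definition split_set :: "nat set \<Rightarrow> nat set \<times> nat set" where
  "split_set H = ({j. 2 * j \<in> H}, {j. 2 * j + 1 \<in> H})"

lemma split_interleave_set: "split_set (interleave_set F G) = (F, G)"
  by (auto simp: split_set_def interleave_set_def) presburger+

lemma finite_split_set: "finite H \<Longrightarrow> finite (fst (split_set H)) \<and> finite (snd (split_set H))"
  unfolding split_set_def using finite_vimageI[of H "\<lambda>j. 2 * j"] finite_vimageI[of H "\<lambda>j. 2 * j + 1"]
  by (auto simp: inj_on_def vimage_def)

lemma split_set_mono: "H \<subseteq> H' \<longleftrightarrow> fst (split_set H) \<subseteq> fst (split_set H') \<and> snd (split_set H) \<subseteq> snd (split_set H')"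
proof
  assume *: "fst (split_set H) \<subseteq> fst (split_set H') \<and> snd (split_set H) \<subseteq> snd (split_set H')"
  show "H \<subseteq> H'"
  proof
    fix i assume "i \<in> H"
    then show "i \<in> H'" using * by (cases "even i") (auto simp: split_set_def elim!: evenE oddE)
  qed
qed (auto simp: split_set_def)

definition merge_tuples :: "nat set \<Rightarrow> 'a point \<Rightarrow> 'a point" where
  "merge_tuples H p = itup H (interleave (coord (sorted_list_of_set (fst (split_set H))) (p1 p))
                                  (coord (sorted_list_of_set (snd (split_set H))) (p2 p)))"

lemma merge_itup:
  assumes "finite H"
  shows "merge_tuples H (Pr (itup (fst (split_set H)) f) (itup (snd (split_set H)) g)) = itup H (interleave f g)"
  unfolding merge_tuples_def itup_eq_iff[OF assms] using finite_split_set[OF assms]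
  by (auto simp: interleave_def itup_def coord_tuple split_set_def elim!: evenE oddE)

lemma merge_bij:
  assumes "finite H"
  shows "bij_betw (merge_tuples H) (pr_times (fprod X (fst (split_set H))) (fprod Y (snd (split_set H)))) (fprod (interleave X Y) H)"
proof -
  let ?F = "fst (split_set H)" and ?G = "snd (split_set H)"
  have fin: "finite ?F" "finite ?G" using finite_split_set[OF assms] by auto
  have FG: "2 * j \<in> H \<longleftrightarrow> j \<in> ?F" "2 * j + 1 \<in> H \<longleftrightarrow> j \<in> ?G" for j
    by (auto simp: split_set_def)
  have mem: "(\<forall>i\<in>H. interleave f g i \<in> interleave X Y i) \<longleftrightarrow> (\<forall>j\<in>?F. f j \<in> X j) \<and> (\<forall>j\<in>?G. g j \<in> Y j)" for f g
    using FG by (auto simp: interleave_def elim!: evenE oddE) fastforce+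
  show ?thesis
    unfolding bij_betw_def
  proof (intro conjI inj_onI subset_antisym subsetI)
    fix p q assume p: "p \<in> pr_times (fprod X ?F) (fprod Y ?G)" and q: "q \<in> pr_times (fprod X ?F) (fprod Y ?G)"
      and eq: "merge_tuples H p = merge_tuples H q"
    obtain f g where f: "p = Pr (itup ?F f) (itup ?G g)" using p by (auto elim!: pr_timesE fprodE)
    obtain f' g' where f': "q = Pr (itup ?F f') (itup ?G g')" using q by (auto elim!: pr_timesE fprodE)
    have "\<forall>i\<in>H. interleave f g i = interleave f' g' i"
      using eq unfolding f f' merge_itup[OF assms] itup_eq_iff[OF assms] .
    then have "\<forall>j\<in>?F. f j = f' j" "\<forall>j\<in>?G. g j = g' j"
      using FG by (force simp: interleave_def)+
    then show "p = q" unfolding f f' using fin by (simp add: itup_eq_iff)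
  next
    fix t assume "t \<in> merge_tuples H ` pr_times (fprod X ?F) (fprod Y ?G)"
    then obtain p where p: "t = merge_tuples H p" "p \<in> pr_times (fprod X ?F) (fprod Y ?G)" by blast
    obtain x y where xy: "p = Pr x y" "x \<in> fprod X ?F" "y \<in> fprod Y ?G" using p(2) by (rule pr_timesE)
    obtain f where f: "x = itup ?F f" "\<And>j. j \<in> ?F \<Longrightarrow> f j \<in> X j" using xy(2) by (rule fprodE) blast
    obtain g where g: "y = itup ?G g" "\<And>j. j \<in> ?G \<Longrightarrow> g j \<in> Y j" using xy(3) by (rule fprodE) blast
    have "t = itup H (interleave f g)" "\<forall>j\<in>?F. f j \<in> X j" "\<forall>j\<in>?G. g j \<in> Y j"
      using merge_itup[OF assms] p(1) xy(1) f g by simp_all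
    then have "t = itup H (interleave f g)" "\<forall>i\<in>H. interleave f g i \<in> interleave X Y i"
      using mem[of f g] by blast+
    then show "t \<in> fprod (interleave X Y) H"
      by (simp add: fprodI)
  next
    fix t assume "t \<in> fprod (interleave X Y) H"
    then obtain z where z: "t = itup H z" "\<forall>i\<in>H. z i \<in> interleave X Y i" by (auto elim!: fprodE)
    define f g where "f j = z (2 * j)" and "g j = z (2 * j + 1)" for j
    have zi: "interleave f g = z" by (auto simp: interleave_def f_def g_def elim!: evenE oddE)
    have "t = merge_tuples H (Pr (itup ?F f) (itup ?G g))"
      using merge_itup[OF assms, of f g] zi z(1) by simp
    moreover have "Pr (itup ?F f) (itup ?G g) \<in> pr_times (fprod X ?F) (fprod Y ?G)"
      using mem[of f g] z(2) zi by (auto simp: pr_times_iff intro!: fprodI)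
    ultimately show "t \<in> merge_tuples H ` pr_times (fprod X ?F) (fprod Y ?G)" by blast
  qed
qed

text \<open>
  The convolution is a colimit over pairs of finite sets of indices. These correspond to the finite
  subsets of the interleaved index set, and the products of two finite products to the finite products
  of the interleaved family.
\<close>

lemma interleave_presentation:
  assumes X: "\<And>j. j \<in> J \<Longrightarrow> finite (X j)" and Y: "\<And>j. j \<in> J' \<Longrightarrow> finite (Y j)"
    and L: "itp_presentation FinStoch J X L l" and M: "itp_presentation FinStoch J' Y M m"
  shows "\<exists>k. itp_presentation FinStoch (interleave_set J J') (interleave X Y) (day FinStoch L M) k"
proof -
  let ?K = "interleave_set J J'" and ?Z = "interleave X Y"
  have Z: "finite (?Z i)" if "i \<in> ?K" for i
    using that X Y by (auto simp: interleave_set_def interleave_def)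
  have fin: "finite (X j)" if "F \<in> fin_sub J" "j \<in> F" for F j using that X by auto
  have fin': "finite (Y j)" if "F \<in> fin_sub J'" "j \<in> F" for F j using that Y by auto
  have finZ: "finite (?Z j)" if "F \<in> fin_sub ?K" "j \<in> F" for F j using that Z by auto
  have u: "split_set H \<in> fin_sub J \<times> fin_sub J'" if "H \<in> fin_sub ?K" for H
  proof -
    have "fst (split_set H) \<subseteq> fst (split_set ?K)" "snd (split_set H) \<subseteq> snd (split_set ?K)"
      using that split_set_mono[of H ?K] by auto
    then show ?thesis
      using that finite_split_set[of H] split_interleave_set by (auto simp: mem_Times_iff)
  qed
  let ?b = "\<lambda>H. fin_det (pr_times (fprod X (fst (split_set H))) (fprod Y (snd (split_set H)))) (merge_tuples H) (fprod ?Z H)"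
  have FO: "FO (abstract_itp FinStoch X) (fst (split_set H)) \<otimes>\<^bsub>FinStoch\<^esub> FO (abstract_itp FinStoch Y) (snd (split_set H))
      = pr_times (fprod X (fst (split_set H))) (fprod Y (snd (split_set H)))" if "H \<in> fin_sub ?K" for H
    using u[OF that] by (simp add: mem_Times_iff abstract_itp_FO)
  have finP: "finite (fprod X (fst (split_set H)))" "finite (fprod Y (snd (split_set H)))" if "H \<in> fin_sub ?K" for H
    using u[OF that] fin fin' by (auto simp: mem_Times_iff intro!: finite_fprod)
  have finQ: "finite (fprod ?Z H)" if "H \<in> fin_sub ?K" for H
    using that finZ[OF that] by (auto intro: finite_fprod)
  have mem: "merge_tuples H p \<in> fprod ?Z H" if "H \<in> fin_sub ?K" "p \<in> pr_times (fprod X (fst (split_set H))) (fprod Y (snd (split_set H)))" for H p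
    using merge_bij[of H X Y] that by (auto simp: bij_betw_def)
  have "itp_presentation FinStoch ?K ?Z (day FinStoch L M) (\<lambda>H. act (day FinStoch L M) (?b H)
     ((\<lambda>p. day_cls FinStoch L M (Day_elt (FO (abstract_itp FinStoch X) (fst p)) (FO (abstract_itp FinStoch Y) (snd p))
        (Idt FinStoch (FO (abstract_itp FinStoch X) (fst p) \<otimes>\<^bsub>FinStoch\<^esub> FO (abstract_itp FinStoch Y) (snd p)))
        (l (fst p)) (m (snd p)))) (split_set H)))"
  proof (rule presentation_reindex[OF product_presentation[OF L M] FinStoch_directed_diagram[of ?K ?Z] u])
    show "finite (?Z j)" if "j \<in> ?K" for j using Z that .
    show "\<exists>H\<in>fin_sub ?K. split_set H = p" if "p \<in> fin_sub J \<times> fin_sub J'" for p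
      using that split_interleave_set[of "fst p" "snd p"]
      by (intro bexI[of _ "interleave_set (fst p) (snd p)"]) (auto simp: interleave_set_def)
    show "H \<subseteq> H' \<longleftrightarrow> fst (split_set H) \<subseteq> fst (split_set H') \<and> snd (split_set H) \<subseteq> snd (split_set H')" for H H'
      by (rule split_set_mono)
    show "?b H \<in> hom FinStoch (FO (abstract_itp FinStoch X) (fst (split_set H)) \<otimes>\<^bsub>FinStoch\<^esub> FO (abstract_itp FinStoch Y) (snd (split_set H)))
       (FO (abstract_itp FinStoch ?Z) H)" if H: "H \<in> fin_sub ?K" for H
      unfolding FO[OF H] using H finP[OF H] finQ[OF H] mem[OF H]
      by (auto simp: abstract_itp_FO finite_pr_times intro!: fin_det_hom)
    show "is_iso FinStoch (?b H)" if H: "H \<in> fin_sub ?K" for H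
      using H finP[OF H] finQ[OF H] merge_bij by (intro fin_det_iso) (auto simp: finite_pr_times)
    show "FA (abstract_itp FinStoch ?Z) (H, H') \<cdot>\<^bsub>FinStoch\<^esub> ?b H' =
       ?b H \<cdot>\<^bsub>FinStoch\<^esub> (FA (abstract_itp FinStoch X) (fst (split_set H), fst (split_set H')) \<boxtimes>\<^bsub>FinStoch\<^esub>
                  FA (abstract_itp FinStoch Y) (snd (split_set H), snd (split_set H')))"
      if H: "H \<in> fin_sub ?K" and H': "H' \<in> fin_sub ?K" and s: "H \<subseteq> H'" for H H'
    proof -
      let ?F = "fst (split_set H)" and ?G = "snd (split_set H)" and ?F' = "fst (split_set H')" and ?G' = "snd (split_set H')"
      have fH: "finite H" "finite H'" "finite ?F'" "finite ?G'" using H H' u[OF H'] by (auto simp: mem_Times_iff)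
      have sub: "?F \<subseteq> ?F'" "?G \<subseteq> ?G'" using split_set_mono[of H H'] s by auto
      have FAX: "FA (abstract_itp FinStoch X) (?F, ?F') = fin_det (fprod X ?F') (fproj ?F ?F') (fprod X ?F)"
        using sub fH u[OF H'] X by (intro abstract_itp_FA) (auto simp: mem_Times_iff)
      have FAY: "FA (abstract_itp FinStoch Y) (?G, ?G') = fin_det (fprod Y ?G') (fproj ?G ?G') (fprod Y ?G)"
        using sub fH u[OF H'] Y by (intro abstract_itp_FA) (auto simp: mem_Times_iff)
      have FAZ: "FA (abstract_itp FinStoch ?Z) (H, H') = fin_det (fprod ?Z H') (fproj H H') (fprod ?Z H)"
        using fH s finZ[OF H'] by (intro abstract_itp_FA) auto
      have "FA (abstract_itp FinStoch ?Z) (H, H') \<cdot>\<^bsub>FinStoch\<^esub> ?b H' =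
         fin_det (pr_times (fprod X ?F') (fprod Y ?G')) (\<lambda>p. fproj H H' (merge_tuples H' p)) (fprod ?Z H)"
        unfolding FAZ using fH s finP[OF H'] finQ[OF H] finQ[OF H'] mem[OF H']
        by (intro fin_det_comp) (auto simp: finite_pr_times fproj_mem)
      also have "\<dots> = fin_det (pr_times (fprod X ?F') (fprod Y ?G')) 
          (\<lambda>p. merge_tuples H (Pr (fproj ?F ?F' (p1 p)) (fproj ?G ?G' (p2 p)))) (fprod ?Z H)"
      proof (rule fin_det_cong)
        fix p assume "p \<in> pr_times (fprod X ?F') (fprod Y ?G')"
        then obtain f g where p: "p = Pr (itup ?F' f) (itup ?G' g)" by (auto elim!: pr_timesE fprodE)
        show "fproj H H' (merge_tuples H' p) = merge_tuples H (Pr (fproj ?F ?F' (p1 p)) (fproj ?G ?G' (p2 p)))"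
          unfolding p using fH s sub by (simp add: merge_itup fproj_itup)
      qed
      also have "\<dots> = ?b H \<cdot>\<^bsub>FinStoch\<^esub> (FA (abstract_itp FinStoch X) (?F, ?F') \<boxtimes>\<^bsub>FinStoch\<^esub> FA (abstract_itp FinStoch Y) (?G, ?G'))"
      proof -
        have t: "fin_det (fprod X ?F') (fproj ?F ?F') (fprod X ?F) \<boxtimes>\<^bsub>FinStoch\<^esub> fin_det (fprod Y ?G') (fproj ?G ?G') (fprod Y ?G) =
          fin_det (pr_times (fprod X ?F') (fprod Y ?G')) (\<lambda>p. Pr (fproj ?F ?F' (p1 p)) (fproj ?G ?G' (p2 p))) (pr_times (fprod X ?F) (fprod Y ?G))"
          using fH sub finP[OF H] finP[OF H'] by (intro fin_det_tensA) (auto simp: fproj_mem)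
        show ?thesis
          unfolding FAX FAY t using fH sub finP[OF H] finP[OF H'] finQ[OF H] mem[OF H]
          by (intro fin_det_comp[symmetric]) (auto simp: finite_pr_times pr_times_iff fproj_mem elim!: pr_timesE)
      qed
      finally show ?thesis .
    qed
  qed
  then show ?thesis by blast
qed

lemma representable_presentation:
  assumes A: "finite A"
  shows "\<exists>l. itp_presentation FinStoch {0} (\<lambda>_. A) (hom_copsh FinStoch A) l"
proof -
  let ?X = "\<lambda>_ :: nat. A" and ?P = "fprod (\<lambda>_. A) {0}"
  interpret D: directed_diagram FinStoch "fin_sub {0}" "(\<subseteq>)" "FO (abstract_itp FinStoch ?X)" "\<lambda>F F'. FA (abstract_itp FinStoch ?X) (F, F')"
    using A by (intro FinStoch_directed_diagram)
  have P: "FO (abstract_itp FinStoch ?X) {0} = ?P" "finite ?P"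
    using A by (auto simp: abstract_itp_FO intro: finite_fprod)
  have "FA (abstract_itp FinStoch ?X) ({0}, {0}) = Idt FinStoch ?P"
    using A by (auto simp: abstract_itp_FA fproj_itup intro!: fin_det_cong elim!: fprodE)
  then have pr: "itp_presentation FinStoch {0} ?X (hom_copsh FinStoch (FO (abstract_itp FinStoch ?X) {0}))
      (\<lambda>F. Hom_elt (FA (abstract_itp FinStoch ?X) (F, {0})))"
    using P by (intro D.top_presentation) auto
  interpret pr: presentation FinStoch "fin_sub {0}" "(\<subseteq>)" "FO (abstract_itp FinStoch ?X)" "\<lambda>F F'. FA (abstract_itp FinStoch ?X) (F, F')"
    "hom_copsh FinStoch (FO (abstract_itp FinStoch ?X) {0})" "\<lambda>F. Hom_elt (FA (abstract_itp FinStoch ?X) (F, {0}))"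
    by (rule pr)
  let ?r = "fin_det A (\<lambda>a. itup {0} (\<lambda>_. a)) ?P"
  have "bij_betw (\<lambda>a. itup {0} (\<lambda>_. a)) A ?P"
    unfolding bij_betw_def
  proof (intro conjI inj_onI subset_antisym subsetI)
    show "t \<in> (\<lambda>a. itup {0} (\<lambda>_. a)) ` A" if "t \<in> ?P" for t
      using that
    proof (rule fprodE)
      fix f assume f: "t = itup {0} f" "\<And>j. j \<in> {0} \<Longrightarrow> f j \<in> A"
      then have "t = itup {0} (\<lambda>_. f 0)" by (simp add: itup_eq_iff)
      then show ?thesis using f(2) by blast
    qed
  qed (auto simp: itup_eq_iff intro: fprodI)
  then have r: "?r \<in> hom FinStoch A ?P" "is_iso FinStoch ?r"
    using A P by (auto intro!: fin_det_hom fin_det_iso fprodI)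
  have "FA (yoneda FinStoch) ?r \<in> hom (copsh_op FinStoch) (hom_copsh FinStoch A) (hom_copsh FinStoch (FO (abstract_itp FinStoch ?X) {0}))"
    "is_iso (copsh_op FinStoch) (FA (yoneda FinStoch) ?r)"
    using FS.FA_yoneda(1)[OF r(1)] functor_iso[OF FinStoch_category FS.copsh_category FS.yoneda_functor r] P by auto
  then show ?thesis
    using pr.presentation_iso by blast
qed

subsection \<open>The completion is semicartesian\<close>

abbreviation "FinStochI \<equiv> itp_completion FinStoch"

lemma itp_limit_presentation:
  assumes "\<And>j. j \<in> J \<Longrightarrow> finite (X j)"
    and "is_limit (op_cat (FinLO J)) (copsh_op FinStoch) (func_comp (yoneda FinStoch) (abstract_itp FinStoch X)) L p"
  shows "itp_presentation FinStoch J X L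
    (\<lambda>F. app (p F) (FO (abstract_itp FinStoch X) F) (Hom_elt (Idt FinStoch (FO (abstract_itp FinStoch X) F))))"
  using FS.limit_presentation[OF FinStoch_directed_diagram assms(2)] assms(1) by blast

lemma itp_presentation_limit:
  assumes pr: "itp_presentation FinStoch J X L l"
  shows "\<exists>p. is_limit (op_cat (FinLO J)) (copsh_op FinStoch) (func_comp (yoneda FinStoch) (abstract_itp FinStoch X)) L p"
proof -
  let ?A = "FO (abstract_itp FinStoch X)"
  interpret pr: presentation FinStoch "fin_sub J" "(\<subseteq>)" ?A "\<lambda>F F'. FA (abstract_itp FinStoch X) (F, F')" L l
    by (rule pr)
  define p where "p F = nat_arrow FinStoch (hom_copsh FinStoch (?A F)) (\<lambda>D e. act L (arrow_of e) (l F)) L" for F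
  have p: "p F \<in> hom (copsh_op FinStoch) L (hom_copsh FinStoch (?A F))" "app (p F) (?A F) (Hom_elt (Idt FinStoch (?A F))) = l F"
    if "F \<in> fin_sub J" for F
    unfolding p_def using FS.yoneda_arrow[OF pr.copsheaf pr.elt_mem[OF that]] FS.id_hom[OF pr.A_ob[OF that]] pr.elt_id[OF that] by auto
  have "is_limit (op_cat (FinLO J)) (copsh_op FinStoch) (func_comp (yoneda FinStoch) (abstract_itp FinStoch X)) L p"
    by (rule FS.presentation_limit[OF pr.presentation_cong[OF p(2)] p(1)])
  then show ?thesis by blast
qed

text \<open>
  The limits which define the objects of the completion are replaced by pointwise colimits, which can
  be verified on elements.
\<close>

lemma FinStochI_Ob:
  "L \<in> Ob FinStochI \<longleftrightarrow> (\<exists>J X l. (\<forall>j\<in>J. finite (X j)) \<and> itp_presentation FinStoch J X L l)"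
proof -
  have "L \<in> Ob FinStochI \<longleftrightarrow> (\<exists>J X p. (\<forall>j\<in>J. X j \<in> Ob FinStoch) \<and>
      is_limit (op_cat (FinLO J)) (copsh_op FinStoch) (func_comp (yoneda FinStoch) (abstract_itp FinStoch X)) L p)"
    by (simp add: itp_completion_def)
  also have "\<dots> \<longleftrightarrow> (\<exists>J X l. (\<forall>j\<in>J. finite (X j)) \<and> itp_presentation FinStoch J X L l)"
  proof (intro iffI; elim exE conjE)
    fix J X p
    assume "\<forall>j\<in>J. X j \<in> Ob FinStoch"
      "is_limit (op_cat (FinLO J)) (copsh_op FinStoch) (func_comp (yoneda FinStoch) (abstract_itp FinStoch X)) L p"
    then show "\<exists>J X l. (\<forall>j\<in>J. finite (X j)) \<and> itp_presentation FinStoch J X L l"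
      using itp_limit_presentation[of J X L p] by auto
  next
    fix J X l assume X: "\<forall>j\<in>J. finite (X j)" and "itp_presentation FinStoch J X L l"
    then obtain p where
      "is_limit (op_cat (FinLO J)) (copsh_op FinStoch) (func_comp (yoneda FinStoch) (abstract_itp FinStoch X)) L p"
      using itp_presentation_limit by blast
    then show "\<exists>J X p. (\<forall>j\<in>J. X j \<in> Ob FinStoch) \<and>
      is_limit (op_cat (FinLO J)) (copsh_op FinStoch) (func_comp (yoneda FinStoch) (abstract_itp FinStoch X)) L p"
      using X by (intro exI[of _ J] exI[of _ X] exI[of _ p]) simp
  qed
  finally show ?thesis .
qed

lemma FinStochI_Ob_functor: "Ob FinStochI \<subseteq> Ob (copsh_op FinStoch)"
proof
  fix L :: "('a point set, 'a stoch) copsh" assume "L \<in> Ob FinStochI"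
  then obtain J X l where "itp_presentation FinStoch J X L l" using FinStochI_Ob by blast
  then show "L \<in> Ob (copsh_op FinStoch)" by (simp add: presentation_def presentation_axioms_def)
qed

lemma FinStochI_full: "FinStochI = full_subcat (copsh_op FinStoch) (Ob FinStochI)"
  by (simp add: itp_completion_def)

lemma FinStochI_simps [simp]:
  "Comp FinStochI = Comp (copsh_op FinStoch)" "Idt FinStochI = Idt (copsh_op FinStoch)"
  "tensO FinStochI = day FinStoch" "tensA FinStochI = tensA (copsh_op FinStoch)"
  "unit FinStochI = hom_copsh FinStoch {Star}" "lunit FinStochI = lunit (copsh_op FinStoch)"
proof -
  have "tensO FinStochI = tensO (copsh_op FinStoch)" "unit FinStochI = unit (copsh_op FinStoch)"
    by (simp_all only: itp_completion_def full_subcat_def smcat.simps cat.simps) simp_all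
  then show "tensO FinStochI = day FinStoch" "unit FinStochI = hom_copsh FinStoch {Star}" by simp_all
qed (simp_all add: itp_completion_def full_subcat_def)

lemma FinStochI_hom: "hom FinStochI A B = (if A \<in> Ob FinStochI \<and> B \<in> Ob FinStochI then hom (copsh_op FinStoch) A B else {})"
  by (subst FinStochI_full) (rule full_subcat_hom)

lemma FinStochI_representable: "finite A \<Longrightarrow> hom_copsh FinStoch A \<in> Ob FinStochI"
  unfolding FinStochI_Ob using representable_presentation[of A]
  by (intro exI[of _ "{0}"] exI[of _ "\<lambda>_. A"]) auto

lemma FinStochI_tensor: "L \<in> Ob FinStochI \<Longrightarrow> M \<in> Ob FinStochI \<Longrightarrow> day FinStoch L M \<in> Ob FinStochI"
  unfolding FinStochI_Ob
proof (elim exE conjE)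
  fix J X l J' Y m
  assume *: "\<forall>j\<in>J. finite (X j)" "itp_presentation FinStoch J X L l" "\<forall>j\<in>J'. finite (Y j)" "itp_presentation FinStoch J' Y M m"
  have "\<forall>i\<in>interleave_set J J'. finite (interleave X Y i)"
    using * by (auto simp: interleave_set_def interleave_def)
  then show "\<exists>J X l. (\<forall>j\<in>J. finite (X j)) \<and> itp_presentation FinStoch J X (day FinStoch L M) l"
    using interleave_presentation[OF _ _ *(2,4)] *(1,3) by blast
qed

lemma FinStochI_semicartesian:
  "semicartesian (FinStochI :: (('a point set, 'a stoch) copsh, ('a point set, 'a stoch) copsh_arrow) smcat)"
proof -
  interpret K: tensor_category "copsh_op FinStoch :: (('a point set, 'a stoch) copsh, ('a point set, 'a stoch) copsh_arrow) smcat"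
    by (rule FS.copsh_tensor_category)
  have "tensor_category (full_subcat (copsh_op FinStoch) (Ob FinStochI :: ('a point set, 'a stoch) copsh set))"
    using FinStochI_Ob_functor FinStochI_representable[of "{Star :: 'a point}"] FinStochI_tensor
    by (intro K.full_subcat_tensor_category) auto
  then interpret tensor_category "FinStochI :: (('a point set, 'a stoch) copsh, ('a point set, 'a stoch) copsh_arrow) smcat"
    using FinStochI_full by metis
  show ?thesis
  proof
    fix L :: "('a point set, 'a stoch) copsh" assume L: "L \<in> Ob FinStochI"
    then obtain J X l where "itp_presentation FinStoch J X L l" using FinStochI_Ob by blast
    then interpret L: presentation FinStoch "fin_sub J" "(\<subseteq>)" "FO (abstract_itp FinStoch X)"
      "\<lambda>F F'. FA (abstract_itp FinStoch X) (F, F')" L l .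
    show "\<exists>!f. f \<in> hom FinStochI L (unit FinStochI)"
      using L.terminal_arrow[OF FinStoch_semicartesian] L FinStochI_representable[of "{Star :: 'a point}"] by (simp add: FinStochI_hom)
  qed
qed

interpretation FI: semicartesian FinStochI by (rule FinStochI_semicartesian)

text \<open>
  This lets \<open>mu_list\<close> of the Yoneda embedding compare the representable of a finite tensor product with
  the finite tensor product, in the completion, of the representables.
\<close>

lemma yoneda_tensor_functor:
  "tensor_functor (FinStoch :: ('a point set, 'a stoch) smcat) FinStochI (yoneda FinStoch)"
proof
  have ob: "hom_copsh FinStoch A \<in> Ob FinStochI" if "A \<in> Ob FinStoch" for A :: "'a point set"
    using that FinStochI_representable by simp
  have iso: "is_iso FinStochI f" if "f \<in> hom (copsh_op FinStoch) L M" "is_iso (copsh_op FinStoch) f" "L \<in> Ob FinStochI" "M \<in> Ob FinStochI"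
    for f :: "('a point set, 'a stoch) copsh_arrow" and L M
  proof -
    interpret K: category "copsh_op FinStoch" by (rule FS.copsh_category)
    show ?thesis
      using K.inv_arrow[OF that(1,2)] that by (intro FI.isoI[of f L M "inv_arrow (copsh_op FinStoch) f"]) (auto simp: FinStochI_hom)
  qed
  show "is_functor (FinStoch :: ('a point set, 'a stoch) smcat) FinStochI (yoneda FinStoch)"
    unfolding is_functor_def
  proof (intro conjI ballI impI)
    note F = is_functorD[OF FS.yoneda_functor]
    show "FO (yoneda FinStoch) A \<in> Ob FinStochI" if "A \<in> Ob FinStoch" for A :: "'a point set"
      using ob[OF that] by simp
    show "FA (yoneda FinStoch) f \<in> hom FinStochI (FO (yoneda FinStoch) (Dom FinStoch f)) (FO (yoneda FinStoch) (Cod FinStoch f))"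
      if "f \<in> Ar FinStoch" for f :: "'a stoch"
      using F(2)[of f "Dom FinStoch f" "Cod FinStoch f"] that ob[OF FS.dom_ob[OF that]] ob[OF FS.cod_ob[OF that]]
      by (simp add: hom_def[of FinStoch] FinStochI_hom)
    show "FA (yoneda FinStoch) (Idt FinStoch A) = Idt FinStochI (FO (yoneda FinStoch) A)" if "A \<in> Ob FinStoch" for A :: "'a point set"
      using F(3)[OF that] by simp
    show "FA (yoneda FinStoch) (g \<cdot>\<^bsub>FinStoch\<^esub> f) = FA (yoneda FinStoch) g \<cdot>\<^bsub>FinStochI\<^esub> FA (yoneda FinStoch) f"
      if "f \<in> Ar FinStoch" "g \<in> Ar FinStoch" "Cod FinStoch f = Dom FinStoch g" for f g :: "'a stoch"
      using F(4)[of f "Dom FinStoch f" "Cod FinStoch f" g "Cod FinStoch g"] that by (simp add: hom_def[of FinStoch])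
  qed
  fix A B :: "'a point set" assume AB: "A \<in> Ob FinStoch" "B \<in> Ob FinStoch"
  have AB': "A \<otimes>\<^bsub>FinStoch\<^esub> B \<in> Ob FinStoch" using FS.tens_ob AB by blast
  note m = FS.yoneda_mu(1)[OF AB] FS.yoneda_mu(3)[OF AB]
  have d: "day FinStoch (hom_copsh FinStoch A) (hom_copsh FinStoch B) \<in> Ob FinStochI"
    using FinStochI_tensor ob AB by blast
  show "mu (yoneda FinStoch) A B \<in> hom FinStochI (FO (yoneda FinStoch) A \<otimes>\<^bsub>FinStochI\<^esub> FO (yoneda FinStoch) B)
      (FO (yoneda FinStoch) (A \<otimes>\<^bsub>FinStoch\<^esub> B))"
    using m(1) d ob[OF AB'] by (simp add: FinStochI_hom)
  show "is_iso FinStochI (mu (yoneda FinStoch) A B)"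
    using iso[OF m d ob[OF AB']] .
next
  fix f g :: "'a stoch" and A A' B B' assume "f \<in> hom FinStoch A A'" "g \<in> hom FinStoch B B'"
  then show "mu (yoneda FinStoch) A' B' \<cdot>\<^bsub>FinStochI\<^esub> (FA (yoneda FinStoch) f \<boxtimes>\<^bsub>FinStochI\<^esub> FA (yoneda FinStoch) g) =
      FA (yoneda FinStoch) (f \<boxtimes>\<^bsub>FinStoch\<^esub> g) \<cdot>\<^bsub>FinStochI\<^esub> mu (yoneda FinStoch) A B"
    using FS.yoneda_mu_nat by simp
next
  have e: "eps (yoneda (FinStoch :: ('a point set, 'a stoch) smcat)) = Idt FinStochI (unit FinStochI)"
    by (simp add: yoneda_def)
  show "eps (yoneda (FinStoch :: ('a point set, 'a stoch) smcat)) \<in> hom FinStochI (unit FinStochI) (FO (yoneda FinStoch) (unit FinStoch))"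
    unfolding e using FI.id_hom[OF FI.unit_ob] by simp
  show "is_iso FinStochI (eps (yoneda (FinStoch :: ('a point set, 'a stoch) smcat)))"
    unfolding e using FI.iso_id[OF FI.unit_ob] .
next
  fix A :: "'a point set" assume "A \<in> Ob FinStoch"
  then show "FA (yoneda FinStoch) (lunit FinStoch A) \<cdot>\<^bsub>FinStochI\<^esub> mu (yoneda FinStoch) (unit FinStoch) A \<cdot>\<^bsub>FinStochI\<^esub>
      (eps (yoneda FinStoch) \<boxtimes>\<^bsub>FinStochI\<^esub> Idt FinStochI (FO (yoneda FinStoch) A)) = lunit FinStochI (FO (yoneda FinStoch) A)"
    using FS.yoneda_mu_lunit[of A] by simp
qed

interpretation Yo: tensor_functor FinStoch FinStochI "yoneda FinStoch" by (rule yoneda_tensor_functor)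

lemma FinStochI_limit:
  assumes X: "\<And>j. j \<in> J \<Longrightarrow> finite (X j)"
    and lim: "is_limit (op_cat (FinLO J)) (copsh_op FinStoch) (func_comp (yoneda FinStoch) (abstract_itp FinStoch X)) L p"
  shows "L \<in> Ob FinStochI"
    and "is_limit (op_cat (FinLO J)) FinStochI (func_comp (yoneda FinStoch) (abstract_itp FinStoch X)) L p"
proof -
  show L: "L \<in> Ob FinStochI"
    unfolding FinStochI_Ob using itp_limit_presentation[OF X lim] X by blast
  have "FO (func_comp (yoneda FinStoch) (abstract_itp FinStoch X)) F \<in> Ob FinStochI" if "F \<in> Ob (op_cat (FinLO J))" for F
    using that X by (auto simp: abstract_itp_FO intro!: FinStochI_representable finite_fprod)
  then show "is_limit (op_cat (FinLO J)) FinStochI (func_comp (yoneda FinStoch) (abstract_itp FinStoch X)) L p"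
    by (subst FinStochI_full) (intro full_subcat_limit[OF lim L] FinStochI_Ob_functor)
qed

text \<open>
  The isomorphisms \<open>mu_list\<close> of the Yoneda embedding turn the diagram of representables into the abstract
  infinite tensor product in the completion. Each \<open>Y\<close> in the completion is a colimit of representables,
  whence tensoring with \<open>Y\<close> preserves the limit by \<open>rtensor_limit\<close>. Therefore an ITP-preserving functor on the
  completion preserves the limits which define its objects.
\<close>

lemma FinStochI_itp:
  assumes X: "\<And>j. j \<in> J \<Longrightarrow> finite (X j)"
    and lim: "is_limit (op_cat (FinLO J)) (copsh_op FinStoch) (func_comp (yoneda FinStoch) (abstract_itp FinStoch X)) L p"
  shows "is_itp FinStochI J (\<lambda>j. hom_copsh FinStoch (X j)) L
    (\<lambda>F. inv_arrow FinStochI (mu_list FinStoch FinStochI (yoneda FinStoch) X (sorted_list_of_set F)) \<cdot>\<^bsub>FinStochI\<^esub> p F)"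
proof -
  let ?K = "op_cat (FinLO J)" and ?D = "func_comp (yoneda FinStoch) (abstract_itp FinStoch X)"
  let ?Y = "\<lambda>j. hom_copsh FinStoch (X j)"
  let ?E = "abstract_itp FinStochI ?Y"
  let ?m = "\<lambda>F. mu_list FinStoch FinStochI (yoneda FinStoch) X (sorted_list_of_set F)"
  let ?a = "\<lambda>F. inv_arrow FinStochI (?m F)"
  have XO: "X j \<in> Ob FinStoch" if "F \<in> Ob ?K" "j \<in> set (sorted_list_of_set F)" for F j
    using that X by auto
  have YO: "?Y j \<in> Ob FinStochI" if "j \<in> J" for j
    using X that FinStochI_representable by blast
  have Ddiag: "is_diagram ?K FinStochI ?D"
    using X by (intro diagram_functor[OF FS.abstract_itp_diagram Yo.F_functor]) auto
  have Ediag: "is_diagram ?K FinStochI ?E"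
    using YO by (rule FI.abstract_itp_diagram)
  have m: "?m F \<in> hom FinStochI (FO ?E F) (FO ?D F)" "is_iso FinStochI (?m F)" if "F \<in> Ob ?K" for F
    using Yo.mu_list_hom_iso[of "sorted_list_of_set F" X, OF XO[OF that]] by (simp_all add: abstract_itp_simps)
  have a: "?a F \<in> hom FinStochI (FO ?D F) (FO ?E F)" "?m F \<cdot>\<^bsub>FinStochI\<^esub> ?a F = Idt FinStochI (FO ?D F)"
    and ai: "is_iso FinStochI (?a F)" if "F \<in> Ob ?K" for F
    using FI.inv_arrow[OF m[OF that]] FI.inv_iso[OF m[OF that]] by auto
  have nat: "FA ?E u \<cdot>\<^bsub>FinStochI\<^esub> ?a (Dom ?K u) = ?a (Cod ?K u) \<cdot>\<^bsub>FinStochI\<^esub> FA ?D u" if u: "u \<in> Ar ?K" for u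
  proof -
    obtain F F' where F: "u = (F, F')" "F \<subseteq> F'" "finite F'" "F' \<subseteq> J" using u by auto
    have o: "F \<in> Ob ?K" "F' \<in> Ob ?K" using F finite_subset[of F F'] by auto
    have E: "FA ?E (F, F') \<in> hom FinStochI (FO ?E F') (FO ?E F)" and D: "FA ?D (F, F') \<in> hom FinStochI (FO ?D F') (FO ?D F)"
    proof -
      have "FA ?E u \<in> hom FinStochI (FO ?E (Dom ?K u)) (FO ?E (Cod ?K u))"
        "FA ?D u \<in> hom FinStochI (FO ?D (Dom ?K u)) (FO ?D (Cod ?K u))"
        using Ediag Ddiag u unfolding is_diagram_def by blast+
      then show "FA ?E (F, F') \<in> hom FinStochI (FO ?E F') (FO ?E F)" "FA ?D (F, F') \<in> hom FinStochI (FO ?D F') (FO ?D F)"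
        by (simp_all add: F(1))
    qed
    have n: "?m F \<cdot>\<^bsub>FinStochI\<^esub> FA ?E (F, F') = FA ?D (F, F') \<cdot>\<^bsub>FinStochI\<^esub> ?m F'"
      using Yo.mu_list_nat[of "sorted_list_of_set F'" X F] XO[OF o(2)] F by (simp add: abstract_itp_simps sorted_list_of_set_filter)
    have "FA ?E (F, F') \<cdot>\<^bsub>FinStochI\<^esub> ?a F' = ?a F \<cdot>\<^bsub>FinStochI\<^esub> ?m F \<cdot>\<^bsub>FinStochI\<^esub> FA ?E (F, F') \<cdot>\<^bsub>FinStochI\<^esub> ?a F'"
      using FI.inv_arrow_cancel(1)[OF m[OF o(1)] FI.comp_hom[OF a(1)[OF o(2)] E]] by simp
    also have "?m F \<cdot>\<^bsub>FinStochI\<^esub> FA ?E (F, F') \<cdot>\<^bsub>FinStochI\<^esub> ?a F' = (FA ?D (F, F') \<cdot>\<^bsub>FinStochI\<^esub> ?m F') \<cdot>\<^bsub>FinStochI\<^esub> ?a F'"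
      using FI.comp_assoc[OF a(1)[OF o(2)] E m(1)[OF o(1)]] n by simp
    also have "\<dots> = FA ?D (F, F')"
      using FI.comp_assoc[OF a(1)[OF o(2)] m(1)[OF o(2)] D] a(2)[OF o(2)] FI.id_right[OF D] by simp
    finally show ?thesis using F by simp
  qed
  note Lim = FinStochI_limit[OF X lim]
  have pk: "p F \<in> hom FinStochI L (FO ?D F)" if "F \<in> Ob ?K" for F
    using Lim(2) that by (auto simp: is_limit_def is_cone_def)
  have 1: "is_limit ?K FinStochI ?E L (\<lambda>F. ?a F \<cdot>\<^bsub>FinStochI\<^esub> p F)"
    by (rule FI.limit_transport[OF Ddiag Ediag a(1) ai nat Lim(2)])
  have 2: "is_limit ?K FinStochI (func_comp (rtensor FinStochI Y) ?E) (L \<otimes>\<^bsub>FinStochI\<^esub> Y)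
      (\<lambda>F. (?a F \<cdot>\<^bsub>FinStochI\<^esub> p F) \<boxtimes>\<^bsub>FinStochI\<^esub> Idt FinStochI Y)" if Y: "Y \<in> Ob FinStochI" for Y
  proof -
    obtain J' X' m' where pr': "itp_presentation FinStoch J' X' Y m'"
      using Y unfolding FinStochI_Ob by blast
    have "is_limit ?K (copsh_op FinStoch) (func_comp (rtensor (copsh_op FinStoch) Y) ?D)
       (day FinStoch L Y) (\<lambda>F. p F \<boxtimes>\<^bsub>copsh_op FinStoch\<^esub> Idt (copsh_op FinStoch) Y)"
      by (rule FS.rtensor_limit[OF lim itp_limit_presentation[OF X lim] pr'])
    moreover have "func_comp (rtensor (copsh_op FinStoch) Y) ?D = func_comp (rtensor FinStochI Y) ?D"
      by (simp add: func_comp_def rtensor_def)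
    ultimately have l: "is_limit ?K (copsh_op FinStoch) (func_comp (rtensor FinStochI Y) ?D)
       (day FinStoch L Y) (\<lambda>F. p F \<boxtimes>\<^bsub>FinStochI\<^esub> Idt FinStochI Y)"
      by simp
    have ob: "FO (func_comp (rtensor FinStochI Y) ?D) F \<in> Ob FinStochI" if "F \<in> Ob ?K" for F
    proof -
      have "FO ?D F \<in> Ob FinStochI" using FI.hom_ob[OF m(1)[OF that]] by blast
      from FI.tens_ob[OF this Y] show ?thesis by simp
    qed
    have l': "is_limit ?K FinStochI (func_comp (rtensor FinStochI Y) ?D)
       (L \<otimes>\<^bsub>FinStochI\<^esub> Y) (\<lambda>F. p F \<boxtimes>\<^bsub>FinStochI\<^esub> Idt FinStochI Y)"
      using full_subcat_limit[OF l FinStochI_tensor[OF Lim(1) Y] ob FinStochI_Ob_functor]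
      by (simp add: FinStochI_full[symmetric])
    note iY = FI.id_hom[OF Y]
    have "is_limit ?K FinStochI (func_comp (rtensor FinStochI Y) ?E) (L \<otimes>\<^bsub>FinStochI\<^esub> Y)
      (\<lambda>F. (?a F \<boxtimes>\<^bsub>FinStochI\<^esub> Idt FinStochI Y) \<cdot>\<^bsub>FinStochI\<^esub> (p F \<boxtimes>\<^bsub>FinStochI\<^esub> Idt FinStochI Y))"
    proof (rule FI.limit_transport[OF diagram_functor[OF Ddiag FI.rtensor_functor[OF Y]]
          diagram_functor[OF Ediag FI.rtensor_functor[OF Y]] _ _ _ l'])
      show "?a F \<boxtimes>\<^bsub>FinStochI\<^esub> Idt FinStochI Y \<in>
          hom FinStochI (FO (func_comp (rtensor FinStochI Y) ?D) F) (FO (func_comp (rtensor FinStochI Y) ?E) F)" if "F \<in> Ob ?K" for F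
        using FI.tens_hom[OF a(1)[OF that] iY] by simp
      show "is_iso FinStochI (?a F \<boxtimes>\<^bsub>FinStochI\<^esub> Idt FinStochI Y)" if "F \<in> Ob ?K" for F
        using FI.tens_iso[OF a(1)[OF that] ai[OF that] iY FI.iso_id[OF Y]] .
      show "FA (func_comp (rtensor FinStochI Y) ?E) u \<cdot>\<^bsub>FinStochI\<^esub> (?a (Dom ?K u) \<boxtimes>\<^bsub>FinStochI\<^esub> Idt FinStochI Y) =
          (?a (Cod ?K u) \<boxtimes>\<^bsub>FinStochI\<^esub> Idt FinStochI Y) \<cdot>\<^bsub>FinStochI\<^esub> FA (func_comp (rtensor FinStochI Y) ?D) u" if u: "u \<in> Ar ?K" for u
      proof -
        have o: "Dom ?K u \<in> Ob ?K" "Cod ?K u \<in> Ob ?K" "FA ?D u \<in> hom FinStochI (FO ?D (Dom ?K u)) (FO ?D (Cod ?K u))"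
          "FA ?E u \<in> hom FinStochI (FO ?E (Dom ?K u)) (FO ?E (Cod ?K u))"
          using Ddiag Ediag u unfolding is_diagram_def by blast+
        have "(FA ?E u \<cdot>\<^bsub>FinStochI\<^esub> ?a (Dom ?K u)) \<boxtimes>\<^bsub>FinStochI\<^esub> (Idt FinStochI Y \<cdot>\<^bsub>FinStochI\<^esub> Idt FinStochI Y) =
           (?a (Cod ?K u) \<cdot>\<^bsub>FinStochI\<^esub> FA ?D u) \<boxtimes>\<^bsub>FinStochI\<^esub> (Idt FinStochI Y \<cdot>\<^bsub>FinStochI\<^esub> Idt FinStochI Y)"
          using nat[OF u] by simp
        then show ?thesis
          unfolding func_comp_simps rtensor_simps
          using FI.tens_comp[OF a(1)[OF o(1)] o(4) iY iY] FI.tens_comp[OF o(3) a(1)[OF o(2)] iY iY] by simp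
      qed
    qed
    then show ?thesis
    proof (rule is_limit_cong)
      show "(?a F \<boxtimes>\<^bsub>FinStochI\<^esub> Idt FinStochI Y) \<cdot>\<^bsub>FinStochI\<^esub> (p F \<boxtimes>\<^bsub>FinStochI\<^esub> Idt FinStochI Y) =
         (?a F \<cdot>\<^bsub>FinStochI\<^esub> p F) \<boxtimes>\<^bsub>FinStochI\<^esub> Idt FinStochI Y" if "F \<in> Ob ?K" for F
        using FI.tens_comp[OF pk[OF that] a(1)[OF that] iY iY] FI.id_left[OF iY] by simp
      show "FA (func_comp (rtensor FinStochI Y) ?E) u = FA (func_comp (rtensor FinStochI Y) ?E) u \<and> Dom ?K u \<in> Ob ?K \<and> Cod ?K u \<in> Ob ?K"
        if "u \<in> Ar ?K" for u
        using Ddiag that unfolding is_diagram_def by blast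
    qed (rule refl)
  qed
  show ?thesis
    unfolding is_itp_def
  proof (intro conjI ballI)
    show "?Y j \<in> Ob FinStochI" if "j \<in> J" for j by (rule YO[OF that])
    show "is_limit ?K FinStochI ?E L (\<lambda>F. ?a F \<cdot>\<^bsub>FinStochI\<^esub> p F)" by (rule 1)
    show "is_limit ?K FinStochI (func_comp (rtensor FinStochI Y) ?E) (L \<otimes>\<^bsub>FinStochI\<^esub> Y)
      (\<lambda>F. (?a F \<cdot>\<^bsub>FinStochI\<^esub> p F) \<boxtimes>\<^bsub>FinStochI\<^esub> Idt FinStochI Y)" if "Y \<in> Ob FinStochI" for Y
      by (rule 2[OF that])
  qed
qed

section \<open>Locally constant Markov kernels between Stone spaces\<close>

subsection \<open>Clopen sets and locally constant functions\<close>

lemma ClopenD: "U \<in> Clopen T \<Longrightarrow> openin T U" "U \<in> Clopen T \<Longrightarrow> closedin T U" "U \<in> Clopen T \<Longrightarrow> U \<subseteq> topspace T"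
  by (auto simp: Clopen_def openin_subset)

lemma Clopen_ops:
  "topspace T \<in> Clopen T" "{} \<in> Clopen T"
  "U \<in> Clopen T \<Longrightarrow> V \<in> Clopen T \<Longrightarrow> U \<union> V \<in> Clopen T"
  "U \<in> Clopen T \<Longrightarrow> V \<in> Clopen T \<Longrightarrow> U \<inter> V \<in> Clopen T"
  "U \<in> Clopen T \<Longrightarrow> V \<in> Clopen T \<Longrightarrow> U - V \<in> Clopen T"
  by (auto simp: Clopen_def)

lemma Clopen_UN: "finite I \<Longrightarrow> (\<And>i. i \<in> I \<Longrightarrow> U i \<in> Clopen T) \<Longrightarrow> (\<Union>i\<in>I. U i) \<in> Clopen T"
  by (induction I rule: finite_induct) (auto simp: Clopen_ops)

lemma Clopen_preimage:
  "continuous_map S T h \<Longrightarrow> V \<in> Clopen T \<Longrightarrow> {x \<in> topspace S. h x \<in> V} \<in> Clopen S"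
  by (auto simp: Clopen_def openin_continuous_map_preimage closedin_continuous_map_preimage)

lemma locally_const_level:
  assumes "locally_const T f"
  shows "{x \<in> topspace T. P (f x)} \<in> Clopen T"
proof -
  have *: "openin T {x \<in> topspace T. Q (f x)}" for Q
  proof (subst openin_subopen, intro ballI)
    fix x assume x: "x \<in> {x \<in> topspace T. Q (f x)}"
    then obtain V where V: "openin T V" "x \<in> V" "\<forall>y\<in>V. f y = f x"
      using assms unfolding locally_const_def by blast
    have "f y = f x" if "y \<in> V" for y using V(3) that by blast
    then have "Q (f y)" if "y \<in> V" for y using x that by auto
    then show "\<exists>V. openin T V \<and> x \<in> V \<and> V \<subseteq> {x \<in> topspace T. Q (f x)}"
      using V(1,2) openin_subset[OF V(1)] by blast
  qed
  have "topspace T - {x \<in> topspace T. P (f x)} = {x \<in> topspace T. \<not> P (f x)}" by auto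
  then show ?thesis
    using *[of P] *[of "\<lambda>b. \<not> P b"] by (simp add: Clopen_def closedin_def)
qed

lemma locally_const_fibre: "locally_const T f \<Longrightarrow> {x \<in> topspace T. f x = r} \<in> Clopen T"
  by (rule locally_const_level[of T f "\<lambda>b. b = r"])

lemma locally_constI:
  assumes "\<And>x. x \<in> topspace T \<Longrightarrow> {y \<in> topspace T. f y = f x} \<in> Clopen T"
  shows "locally_const T f"
  unfolding locally_const_def
proof
  fix x assume x: "x \<in> topspace T"
  show "\<exists>V. openin T V \<and> x \<in> V \<and> (\<forall>y\<in>V. f y = f x)"
    using ClopenD(1)[OF assms[OF x]] x by (intro exI[of _ "{y \<in> topspace T. f y = f x}"]) auto
qed

lemma locally_const_const: "locally_const T (\<lambda>_. c)"
  unfolding locally_const_def by (metis openin_topspace)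

lemma locally_const_map2:
  assumes "locally_const T f" "locally_const T g"
  shows "locally_const T (\<lambda>x. F (f x) (g x))"
  unfolding locally_const_def
proof
  fix x assume x: "x \<in> topspace T"
  obtain V where V: "openin T V" "x \<in> V" "\<forall>y\<in>V. f y = f x"
    using assms(1) x unfolding locally_const_def by blast
  obtain W where W: "openin T W" "x \<in> W" "\<forall>y\<in>W. g y = g x"
    using assms(2) x unfolding locally_const_def by blast
  have "f y = f x" "g y = g x" if "y \<in> V \<inter> W" for y using V(3) W(3) that by blast+
  then have "\<forall>y\<in>V \<inter> W. F (f y) (g y) = F (f x) (g x)" by metis
  moreover have "openin T (V \<inter> W)" "x \<in> V \<inter> W" using V W by auto
  ultimately show "\<exists>V. openin T V \<and> x \<in> V \<and> (\<forall>y\<in>V. F (f y) (g y) = F (f x) (g x))"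
    by blast
qed

lemma locally_const_map: "locally_const T f \<Longrightarrow> locally_const T (\<lambda>x. F (f x))"
  using locally_const_map2[of T f f "\<lambda>a _. F a"] by simp

lemma locally_const_sum:
  assumes "finite I" "\<And>i. i \<in> I \<Longrightarrow> locally_const T (f i)"
  shows "locally_const T (\<lambda>x. \<Sum>i\<in>I. f i x)"
  using assms
proof (induction I rule: finite_induct)
  case empty
  then show ?case by (simp add: locally_const_const)
next
  case (insert i I)
  then show ?case using locally_const_map2[of T "f i" "\<lambda>x. \<Sum>i\<in>I. f i x" "(+)"] by simp
qed

lemma locally_const_continuous:
  assumes h: "continuous_map S T h" and f: "locally_const T f"
  shows "locally_const S (\<lambda>x. f (h x))"
proof (rule locally_constI)
  fix x assume "x \<in> topspace S"
  have "{y \<in> topspace S. f (h y) = f (h x)} = {y \<in> topspace S. h y \<in> {z \<in> topspace T. f z = f (h x)}}"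
    using continuous_map_image_subset_topspace[OF h] by auto
  then show "{y \<in> topspace S. f (h y) = f (h x)} \<in> Clopen S"
    using Clopen_preimage[OF h locally_const_level[OF f, of "\<lambda>b. b = f (h x)"]] by simp
qed

lemma locally_const_cong:
  assumes "locally_const T f" "\<And>x. x \<in> topspace T \<Longrightarrow> g x = f x"
  shows "locally_const T g"
proof (rule locally_constI)
  fix x assume x: "x \<in> topspace T"
  have "{y \<in> topspace T. g y = g x} = {y \<in> topspace T. f y = f x}"
    using assms(2) x by auto
  then show "{y \<in> topspace T. g y = g x} \<in> Clopen T"
    using locally_const_level[OF assms(1), of "\<lambda>b. b = f x"] by simp
qed

lemma locally_const_finite:
  assumes "compact_space T" "locally_const T f"
  shows "finite (f ` topspace T)"
proof -
  let ?l = "\<lambda>r. {x \<in> topspace T. f x = r}"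
  have "\<forall>U\<in>?l ` f ` topspace T. openin T U"
    using ClopenD(1)[OF locally_const_fibre[OF assms(2)]] by auto
  moreover have "topspace T \<subseteq> \<Union> (?l ` f ` topspace T)" by auto
  ultimately obtain \<F> where F: "finite \<F>" "\<F> \<subseteq> ?l ` f ` topspace T" "topspace T \<subseteq> \<Union>\<F>"
    using assms(1) unfolding compact_space_alt by meson
  obtain R where R: "R \<subseteq> f ` topspace T" "finite R" "\<F> = ?l ` R"
    using finite_subset_image[OF F(1,2)] by blast
  have "f ` topspace T \<subseteq> R" using F(3) R(3) by auto
  then show ?thesis using R(2) finite_subset by blast
qed

subsection \<open>Finitely additive measures and their integral\<close>

lemma fin_add_probD:
  assumes "fin_add_prob T m"
  shows "U \<in> Clopen T \<Longrightarrow> 0 \<le> m U" "m (topspace T) = 1"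
    "U \<in> Clopen T \<Longrightarrow> V \<in> Clopen T \<Longrightarrow> U \<inter> V = {} \<Longrightarrow> m (U \<union> V) = m U + m V" "m {} = 0"
proof -
  show "U \<in> Clopen T \<Longrightarrow> 0 \<le> m U" "m (topspace T) = 1"
    and add: "U \<in> Clopen T \<Longrightarrow> V \<in> Clopen T \<Longrightarrow> U \<inter> V = {} \<Longrightarrow> m (U \<union> V) = m U + m V" for U V
    using assms by (auto simp: fin_add_prob_def)
  show "m {} = 0" using add[of "{}" "{}"] by (simp add: Clopen_ops)
qed

lemma fin_add_prob_UN:
  assumes m: "fin_add_prob T m" and "finite I" "\<And>i. i \<in> I \<Longrightarrow> U i \<in> Clopen T"
    "\<And>i j. i \<in> I \<Longrightarrow> j \<in> I \<Longrightarrow> i \<noteq> j \<Longrightarrow> U i \<inter> U j = {}"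
  shows "m (\<Union>i\<in>I. U i) = (\<Sum>i\<in>I. m (U i))"
  using assms(2-)
proof (induction I rule: finite_induct)
  case empty
  then show ?case by (simp add: fin_add_probD(4)[OF m])
next
  case (insert i I)
  have "U i \<inter> (\<Union>j\<in>I. U j) = {}"
    using insert.hyps(2) insert.prems(2)[of i] by fastforce
  then have "m (\<Union>j\<in>insert i I. U j) = m (U i) + m (\<Union>j\<in>I. U j)"
    using fin_add_probD(3)[OF m, of "U i" "\<Union>j\<in>I. U j"] insert by (simp add: Clopen_UN)
  then show ?case using insert by simp
qed

text \<open>
  Composition of kernels is integration: \<open>gf(V | x)\<close> is the integral of \<open>g(V | -)\<close> with respect to \<open>f(- | x)\<close>.
\<close>

definition integ :: "'p topology \<Rightarrow> ('p set \<Rightarrow> real) \<Rightarrow> ('p \<Rightarrow> real) \<Rightarrow> real" where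
  "integ T m g = (\<Sum>r\<in>g ` topspace T. r * m {y \<in> topspace T. g y = r})"

text \<open>The integral can be computed from any finite clopen partition on whose parts the function is
  constant, here given as the level sets of a locally constant function with values of any type.\<close>

lemma integ_comp:
  assumes T: "compact_space T" and m: "fin_add_prob T m" and e: "locally_const T e"
  shows "integ T m (\<lambda>y. \<phi> (e y)) = (\<Sum>b\<in>e ` topspace T. \<phi> b * m {y \<in> topspace T. e y = b})"
proof -
  let ?B = "e ` topspace T" and ?l = "\<lambda>b. {y \<in> topspace T. e y = b}"
  have fin: "finite ?B" by (rule locally_const_finite[OF T e])
  have "r * m {y \<in> topspace T. \<phi> (e y) = r} = (\<Sum>b\<in>{b \<in> ?B. \<phi> b = r}. \<phi> b * m (?l b))" for r
  proof -
    have "{y \<in> topspace T. \<phi> (e y) = r} = (\<Union>b\<in>{b \<in> ?B. \<phi> b = r}. ?l b)" by auto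
    then have "m {y \<in> topspace T. \<phi> (e y) = r} = (\<Sum>b\<in>{b \<in> ?B. \<phi> b = r}. m (?l b))"
      using fin fin_add_prob_UN[OF m, of "{b \<in> ?B. \<phi> b = r}" ?l] locally_const_fibre[OF e] by auto
    then show ?thesis by (simp add: sum_distrib_left)
  qed
  then have "integ T m (\<lambda>y. \<phi> (e y)) = (\<Sum>r\<in>\<phi> ` ?B. \<Sum>b\<in>{b \<in> ?B. \<phi> b = r}. \<phi> b * m (?l b))"
    unfolding integ_def by (simp add: image_image)
  also have "\<dots> = (\<Sum>b\<in>?B. \<phi> b * m (?l b))"
    using sum.image_gen[OF fin, of "\<lambda>b. \<phi> b * m (?l b)" \<phi>] by simp
  finally show ?thesis .
qed

lemma integ_cong: "(\<And>y. y \<in> topspace T \<Longrightarrow> g y = g' y) \<Longrightarrow> integ T m g = integ T m g'"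
  unfolding integ_def by (auto intro!: sum.cong arg_cong[of _ _ m])

lemma integ_measure_cong:
  "locally_const T g \<Longrightarrow> (\<And>U. U \<in> Clopen T \<Longrightarrow> m U = m' U) \<Longrightarrow> integ T m g = integ T m' g"
  unfolding integ_def by (intro sum.cong refl) (simp add: locally_const_fibre)

lemma integ_nonneg:
  assumes "fin_add_prob T m" "locally_const T g" "\<And>y. y \<in> topspace T \<Longrightarrow> 0 \<le> g y"
  shows "0 \<le> integ T m g"
  unfolding integ_def using assms(3) fin_add_probD(1)[OF assms(1) locally_const_fibre[OF assms(2)]]
  by (auto intro!: sum_nonneg mult_nonneg_nonneg)

context
  fixes T :: "'p topology" and m :: "'p set \<Rightarrow> real"
  assumes T: "compact_space T" and m: "fin_add_prob T m"
begin

lemma integ_add: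
  assumes g: "locally_const T g" and h: "locally_const T h"
  shows "integ T m (\<lambda>y. g y + h y) = integ T m g + integ T m h"
proof -
  note e = locally_const_map2[OF g h, of Pair]
  show ?thesis
    using integ_comp[OF T m e, of fst] integ_comp[OF T m e, of snd] integ_comp[OF T m e, of "\<lambda>p. fst p + snd p"]
    by (simp add: sum.distrib distrib_right)
qed

lemma integ_scale: "locally_const T g \<Longrightarrow> integ T m (\<lambda>y. c * g y) = c * integ T m g"
  using integ_comp[OF T m, of g "(*) c"] integ_comp[OF T m, of g "\<lambda>r. r"]
  by (simp add: sum_distrib_left mult.assoc)

lemma integ_zero: "integ T m (\<lambda>_. 0) = 0"
  unfolding integ_def by (auto intro!: sum.neutral)

lemma integ_sum:
  assumes "finite I" "\<And>i. i \<in> I \<Longrightarrow> locally_const T (g i)"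
  shows "integ T m (\<lambda>y. \<Sum>i\<in>I. c i * g i y) = (\<Sum>i\<in>I. c i * integ T m (g i))"
  using assms
proof (induction I rule: finite_induct)
  case empty
  then show ?case by (simp add: integ_zero)
next
  case (insert i I)
  have "locally_const T (\<lambda>y. \<Sum>i\<in>I. c i * g i y)"
    using insert locally_const_map[of T "g _" "(*) (c _)"] by (intro locally_const_sum) auto
  then show ?case
    using insert integ_add[of "\<lambda>y. c i * g i y" "\<lambda>y. \<Sum>i\<in>I. c i * g i y"] integ_scale[of "g i" "c i"]
      locally_const_map[of T "g i" "(*) (c i)"] by simp
qed

lemma integ_indicator:
  assumes "W \<in> Clopen T"
  shows "integ T m (\<lambda>y. if y \<in> W then c else 0) = c * m W"
proof -
  have W: "{y \<in> topspace T. y \<in> W} = W" "{y \<in> topspace T. y \<notin> W} = topspace T - W"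
    using ClopenD(3)[OF assms] by auto
  have e: "locally_const T (\<lambda>y. y \<in> W)"
  proof (rule locally_constI)
    fix x show "{y \<in> topspace T. (y \<in> W) = (x \<in> W)} \<in> Clopen T"
      using W assms by (cases "x \<in> W") (auto simp: Clopen_ops)
  qed
  have "integ T m (\<lambda>y. if y \<in> W then c else 0) =
     (\<Sum>b\<in>(\<lambda>y. y \<in> W) ` topspace T. (if b then c else 0) * m {y \<in> topspace T. (y \<in> W) = b})"
    using integ_comp[OF T m e, of "\<lambda>b. if b then c else 0"] by simp
  also have "\<dots> = (\<Sum>b\<in>UNIV. (if b then c else 0) * m {y \<in> topspace T. (y \<in> W) = b})"
  proof (rule sum.mono_neutral_left)
    show "\<forall>b\<in>UNIV - (\<lambda>y. y \<in> W) ` topspace T. (if b then c else 0) * m {y \<in> topspace T. (y \<in> W) = b} = 0"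
    proof
      fix b assume "b \<in> UNIV - (\<lambda>y. y \<in> W) ` topspace T"
      then have e: "{y \<in> topspace T. (y \<in> W) = b} = {}" by auto
      show "(if b then c else 0) * m {y \<in> topspace T. (y \<in> W) = b} = 0"
        unfolding e using fin_add_probD(4)[OF m] by simp
    qed
  qed auto
  also have "\<dots> = c * m W"
    using W by (simp add: UNIV_bool)
  finally show ?thesis .
qed

lemma integ_const: "integ T m (\<lambda>_. c) = c"
proof -
  have "integ T m (\<lambda>y. if y \<in> topspace T then c else 0) = c"
    using integ_indicator[OF Clopen_ops(1)] fin_add_probD(2)[OF m] by simp
  moreover have "integ T m (\<lambda>_. c) = integ T m (\<lambda>y. if y \<in> topspace T then c else 0)"
    by (rule integ_cong) simp
  ultimately show ?thesis by simp
qed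

end

subsection \<open>The category of Stone spaces\<close>

lemma stone_compact: "stone_space T \<Longrightarrow> compact_space T"
  by (simp add: stone_space_def)

lemma StoneStoch_simps [simp]:
  "Ob StoneStoch = {T. stone_space T}" "Dom StoneStoch = src" "Cod StoneStoch = tgt"
  "Idt StoneStoch T = stone_det T (\<lambda>x. x) T" "unit StoneStoch = discrete_topology {Star}" "tensO StoneStoch = stone_times"
  "lunit StoneStoch T = stone_det (stone_times (discrete_topology {Star}) T) p2 T"
  by (simp_all add: StoneStoch_def)

lemma StoneStoch_hom:
  "f \<in> hom StoneStoch S T \<longleftrightarrow> src f = S \<and> tgt f = T \<and> stone_space S \<and> stone_space T \<and> lc_kernel f"
  by (auto simp: hom_def StoneStoch_def)

lemma kernelD:
  assumes "f \<in> hom StoneStoch S T"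
  shows "src f = S" "tgt f = T" "stone_space S" "stone_space T" "compact_space S" "compact_space T"
    and "locally_const S (fn f U)"
    and "x \<in> topspace S \<Longrightarrow> fin_add_prob T (\<lambda>U. fn f U x)"
    and "U \<notin> Clopen T \<or> x \<notin> topspace S \<Longrightarrow> fn f U x = 0"
proof -
  show zero: "U \<notin> Clopen T \<or> x \<notin> topspace S \<Longrightarrow> fn f U x = 0" for U x
    using assms by (auto simp: StoneStoch_hom lc_kernel_def)
  show "src f = S" "tgt f = T" "stone_space S" "stone_space T" "compact_space S" "compact_space T"
    "x \<in> topspace S \<Longrightarrow> fin_add_prob T (\<lambda>U. fn f U x)"
    using assms by (auto simp: StoneStoch_hom lc_kernel_def stone_compact)
  show "locally_const S (fn f U)"
  proof (cases "U \<in> Clopen T")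
    case True
    then show ?thesis using assms by (auto simp: StoneStoch_hom lc_kernel_def)
  next
    case False
    then show ?thesis using zero by (intro locally_const_cong[OF locally_const_const[of S 0]]) auto
  qed
qed

lemma kernelI:
  assumes "stone_space S" "stone_space T" "src f = S" "tgt f = T"
    and "\<And>U. U \<in> Clopen T \<Longrightarrow> locally_const S (fn f U)"
    and "\<And>x U. x \<in> topspace S \<Longrightarrow> U \<in> Clopen T \<Longrightarrow> 0 \<le> fn f U x"
    and "\<And>x. x \<in> topspace S \<Longrightarrow> fn f (topspace T) x = 1"
    and "\<And>x U V. x \<in> topspace S \<Longrightarrow> U \<in> Clopen T \<Longrightarrow> V \<in> Clopen T \<Longrightarrow> U \<inter> V = {} \<Longrightarrow>
      fn f (U \<union> V) x = fn f U x + fn f V x"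
    and "\<And>U x. U \<notin> Clopen T \<or> x \<notin> topspace S \<Longrightarrow> fn f U x = 0"
  shows "f \<in> hom StoneStoch S T"
  using assms unfolding StoneStoch_hom lc_kernel_def fin_add_prob_def by simp

lemma kernel_ext:
  assumes f: "f \<in> hom StoneStoch S T" and g: "g \<in> hom StoneStoch S T"
    and eq: "\<And>U x. U \<in> Clopen T \<Longrightarrow> x \<in> topspace S \<Longrightarrow> fn f U x = fn g U x"
  shows "f = g"
proof -
  have "fn f U x = fn g U x" for U x
    using eq kernelD(9)[OF f, of U x] kernelD(9)[OF g, of U x] by (cases "U \<in> Clopen T \<and> x \<in> topspace S") auto
  then have "fn f = fn g" by (intro ext)
  then show ?thesis
    using kernelD(1,2)[OF f] kernelD(1,2)[OF g] by (cases f; cases g) auto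
qed

lemma fn_StoneStoch_Comp: "fn (g \<cdot>\<^bsub>StoneStoch\<^esub> f) V x = integ (tgt f) (\<lambda>U. fn f U x) (fn g V)"
  by (simp add: StoneStoch_def integ_def)

lemma integ_locally_const:
  assumes f: "f \<in> hom StoneStoch S T" and g: "locally_const T g"
  shows "locally_const S (\<lambda>x. integ T (\<lambda>U. fn f U x) g)"
  unfolding integ_def using locally_const_finite[OF kernelD(6)[OF f] g] kernelD(7)[OF f]
  by (intro locally_const_sum) (auto intro: locally_const_map)

lemma kernel_comp_hom:
  assumes f: "f \<in> hom StoneStoch S T" and g: "g \<in> hom StoneStoch T R"
  shows "g \<cdot>\<^bsub>StoneStoch\<^esub> f \<in> hom StoneStoch S R"
proof -
  note F = kernelD[OF f] and G = kernelD[OF g]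
  have c: "fn (g \<cdot>\<^bsub>StoneStoch\<^esub> f) V x = integ T (\<lambda>U. fn f U x) (fn g V)" for V x
    using F by (simp add: fn_StoneStoch_Comp)
  show ?thesis
  proof (rule kernelI)
    show "src (g \<cdot>\<^bsub>StoneStoch\<^esub> f) = S" "tgt (g \<cdot>\<^bsub>StoneStoch\<^esub> f) = R"
      using F G by (simp_all add: StoneStoch_def)
    show "locally_const S (fn (g \<cdot>\<^bsub>StoneStoch\<^esub> f) V)" for V
      using integ_locally_const[OF f G(7)] by (simp add: c[abs_def])
    show "0 \<le> fn (g \<cdot>\<^bsub>StoneStoch\<^esub> f) V x" if "x \<in> topspace S" "V \<in> Clopen R" for x V
      unfolding c using integ_nonneg[OF F(8)[OF that(1)] G(7)] fin_add_probD(1)[OF G(8) that(2)] by simp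
    show "fn (g \<cdot>\<^bsub>StoneStoch\<^esub> f) (topspace R) x = 1" if x: "x \<in> topspace S" for x
    proof -
      have "integ T (\<lambda>U. fn f U x) (fn g (topspace R)) = integ T (\<lambda>U. fn f U x) (\<lambda>_. 1)"
        using fin_add_probD(2)[OF G(8)] by (intro integ_cong) auto
      then show ?thesis unfolding c using integ_const[OF F(6) F(8)[OF x]] by simp
    qed
    show "fn (g \<cdot>\<^bsub>StoneStoch\<^esub> f) (U \<union> V) x = fn (g \<cdot>\<^bsub>StoneStoch\<^esub> f) U x + fn (g \<cdot>\<^bsub>StoneStoch\<^esub> f) V x"
      if x: "x \<in> topspace S" and UV: "U \<in> Clopen R" "V \<in> Clopen R" "U \<inter> V = {}" for x U V
    proof -
      have "integ T (\<lambda>U. fn f U x) (fn g (U \<union> V)) = integ T (\<lambda>U. fn f U x) (\<lambda>y. fn g U y + fn g V y)"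
        using fin_add_probD(3)[OF G(8) UV] by (intro integ_cong) auto
      then show ?thesis
        unfolding c using integ_add[OF F(6) F(8)[OF x] G(7) G(7)] by simp
    qed
    show "fn (g \<cdot>\<^bsub>StoneStoch\<^esub> f) U x = 0" if "U \<notin> Clopen R \<or> x \<notin> topspace S" for U x
    proof (cases "U \<in> Clopen R")
      case True
      then have "fn f V x = 0" for V using that F(9) by blast
      then show ?thesis by (simp add: c integ_def)
    next
      case False
      then have "fn g U y = 0" for y using G(9) by blast
      then show ?thesis by (auto simp: c integ_def intro!: sum.neutral)
    qed
  qed (use F G in auto)
qed

lemma stone_det_hom:
  assumes "stone_space S" "stone_space T" and h: "continuous_map S T h"
  shows "stone_det S h T \<in> hom StoneStoch S T"
proof (rule kernelI[OF assms(1,2)])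
  show "locally_const S (fn (stone_det S h T) U)" if U: "U \<in> Clopen T" for U
  proof -
    have "locally_const S (\<lambda>x. x \<in> {x \<in> topspace S. h x \<in> U})"
    proof (rule locally_constI)
      fix x
      have *: "{x \<in> topspace S. h x \<in> U} \<in> Clopen S" by (rule Clopen_preimage[OF h U])
      have "{y \<in> topspace S. (y \<in> {x \<in> topspace S. h x \<in> U}) = b} =
         (if b then {x \<in> topspace S. h x \<in> U} else topspace S - {x \<in> topspace S. h x \<in> U})" for b by auto
      then show "{y \<in> topspace S. (y \<in> {x \<in> topspace S. h x \<in> U}) = (x \<in> {x \<in> topspace S. h x \<in> U})} \<in> Clopen S"
        using * by (simp add: Clopen_ops)
    qed
    then show ?thesis
      using locally_const_map[of S "\<lambda>x. x \<in> {x \<in> topspace S. h x \<in> U}" "\<lambda>b. if b then 1 else (0 :: real)"] U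
      by (simp add: stone_det_def)
  qed
qed (use continuous_map_image_subset_topspace[OF h] in \<open>auto simp: stone_det_def Clopen_ops\<close>)

lemma comp_stone_det:
  assumes g: "g \<in> hom StoneStoch T R" and h: "h x \<in> topspace T" and x: "x \<in> topspace S"
  shows "fn (g \<cdot>\<^bsub>StoneStoch\<^esub> stone_det S h T) V x = fn g V (h x)"
proof -
  note G = kernelD[OF g]
  have "fn (g \<cdot>\<^bsub>StoneStoch\<^esub> stone_det S h T) V x =
      (\<Sum>r\<in>fn g V ` topspace T. if r = fn g V (h x) then r else 0)"
    using locally_const_fibre[OF G(7)] x h
    by (auto simp: fn_StoneStoch_Comp integ_def stone_det_def intro!: sum.cong)
  also have "\<dots> = fn g V (h x)"
    using locally_const_finite[OF G(5) G(7)] h by simp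
  finally show ?thesis .
qed

lemma stone_det_comp:
  assumes f: "f \<in> hom StoneStoch S T" and h: "continuous_map T R h" and R: "stone_space R"
    and V: "V \<in> Clopen R" and x: "x \<in> topspace S"
  shows "fn (stone_det T h R \<cdot>\<^bsub>StoneStoch\<^esub> f) V x = fn f {y \<in> topspace T. h y \<in> V} x"
proof -
  note F = kernelD[OF f]
  have "fn (stone_det T h R \<cdot>\<^bsub>StoneStoch\<^esub> f) V x =
     integ T (\<lambda>U. fn f U x) (\<lambda>y. if y \<in> {y \<in> topspace T. h y \<in> V} then 1 else 0)"
    unfolding fn_StoneStoch_Comp F(2) using V by (intro integ_cong) (simp add: stone_det_def)
  then show ?thesis
    using integ_indicator[OF F(6) F(8)[OF x] Clopen_preimage[OF h V], of 1] by simp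
qed

text \<open>
  Associativity of composition is linearity of the integral: the integral of \<open>h(V | -)\<close> with respect to
  \<open>g(- | y)\<close> is a finite linear combination of locally constant functions \<open>g(U | y)\<close> of \<open>y\<close>.
\<close>

lemma StoneStoch_category: "category StoneStoch"
proof
  show "Dom StoneStoch f \<in> Ob StoneStoch" "Cod StoneStoch f \<in> Ob StoneStoch" if "f \<in> Ar StoneStoch" for f
    using that by (auto simp: StoneStoch_def)
  show "Idt StoneStoch A \<in> hom StoneStoch A A" if "A \<in> Ob StoneStoch" for A
    using that by (simp add: stone_det_hom)
  show "g \<cdot>\<^bsub>StoneStoch\<^esub> f \<in> hom StoneStoch A D" if "f \<in> hom StoneStoch A B" "g \<in> hom StoneStoch B D" for f g A B D
    using kernel_comp_hom that by blast
  show "Idt StoneStoch B \<cdot>\<^bsub>StoneStoch\<^esub> f = f" if f: "f \<in> hom StoneStoch A B" for f A B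
  proof (rule kernel_ext[OF kernel_comp_hom[OF f] f])
    show "Idt StoneStoch B \<in> hom StoneStoch B B" using kernelD(4)[OF f] by (simp add: stone_det_hom)
    show "fn (Idt StoneStoch B \<cdot>\<^bsub>StoneStoch\<^esub> f) U x = fn f U x" if "U \<in> Clopen B" "x \<in> topspace A" for U x
    proof -
      have "{y \<in> topspace B. y \<in> U} = U" using ClopenD(3)[OF that(1)] by auto
      then show ?thesis using stone_det_comp[OF f _ kernelD(4)[OF f] that, of "\<lambda>x. x"] by simp
    qed
  qed
  show "f \<cdot>\<^bsub>StoneStoch\<^esub> Idt StoneStoch A = f" if f: "f \<in> hom StoneStoch A B" for f A B
  proof (rule kernel_ext[OF kernel_comp_hom[OF _ f] f])
    show "Idt StoneStoch A \<in> hom StoneStoch A A" using kernelD(3)[OF f] by (simp add: stone_det_hom)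
    show "fn (f \<cdot>\<^bsub>StoneStoch\<^esub> Idt StoneStoch A) U x = fn f U x" if "x \<in> topspace A" for U x
      using comp_stone_det[OF f _ that, of "\<lambda>x. x"] that by simp
  qed
  show "(h \<cdot>\<^bsub>StoneStoch\<^esub> g) \<cdot>\<^bsub>StoneStoch\<^esub> f = h \<cdot>\<^bsub>StoneStoch\<^esub> g \<cdot>\<^bsub>StoneStoch\<^esub> f"
    if f: "f \<in> hom StoneStoch A B" and g: "g \<in> hom StoneStoch B D" and h: "h \<in> hom StoneStoch D E" for f g h A B D E
  proof (rule kernel_ext[OF kernel_comp_hom[OF f kernel_comp_hom[OF g h]] kernel_comp_hom[OF kernel_comp_hom[OF f g] h]])
    fix U x assume U: "U \<in> Clopen E" and x: "x \<in> topspace A"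
    note F = kernelD[OF f] and G = kernelD[OF g] and H = kernelD[OF h]
    have t: "tgt (g \<cdot>\<^bsub>StoneStoch\<^esub> f) = D" using kernelD(2)[OF kernel_comp_hom[OF f g]] .
    let ?R = "fn h U ` topspace D" and ?l = "\<lambda>r. {z \<in> topspace D. fn h U z = r}"
    have "fn (h \<cdot>\<^bsub>StoneStoch\<^esub> g) U = (\<lambda>y. \<Sum>r\<in>?R. r * fn g (?l r) y)"
      unfolding fn_StoneStoch_Comp[abs_def] G(2) integ_def ..
    then have "fn ((h \<cdot>\<^bsub>StoneStoch\<^esub> g) \<cdot>\<^bsub>StoneStoch\<^esub> f) U x = integ B (\<lambda>V. fn f V x) (\<lambda>y. \<Sum>r\<in>?R. r * fn g (?l r) y)"
      unfolding fn_StoneStoch_Comp[of "h \<cdot>\<^bsub>StoneStoch\<^esub> g"] F(2) by simp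
    also have "\<dots> = (\<Sum>r\<in>?R. r * integ B (\<lambda>V. fn f V x) (fn g (?l r)))"
      by (rule integ_sum[OF F(6) F(8)[OF x] locally_const_finite[OF H(5,7)] G(7)])
    also have "\<dots> = fn (h \<cdot>\<^bsub>StoneStoch\<^esub> g \<cdot>\<^bsub>StoneStoch\<^esub> f) U x"
      unfolding fn_StoneStoch_Comp t F(2) integ_def[of D] ..
    finally show "fn ((h \<cdot>\<^bsub>StoneStoch\<^esub> g) \<cdot>\<^bsub>StoneStoch\<^esub> f) U x = fn (h \<cdot>\<^bsub>StoneStoch\<^esub> g \<cdot>\<^bsub>StoneStoch\<^esub> f) U x" .
  qed
qed

lemma stone_discrete: "finite A \<Longrightarrow> stone_space (discrete_topology A)"
  by (auto simp: stone_space_def compact_space_discrete_topology Clopen_def)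

lemma stone_homeomorphic:
  assumes S: "stone_space S" and hom: "S homeomorphic_space T"
  shows "stone_space T"
proof -
  obtain h k where hk: "homeomorphic_maps S T h k" using hom by (auto simp: homeomorphic_space_def)
  then have c: "continuous_map S T h" "continuous_map T S k"
    and inv: "\<And>x. x \<in> topspace S \<Longrightarrow> k (h x) = x" "\<And>y. y \<in> topspace T \<Longrightarrow> h (k y) = y"
    by (auto simp: homeomorphic_maps_def)
  have "\<exists>V\<in>Clopen T. y \<in> V \<and> V \<subseteq> U" if U: "openin T U" and y: "y \<in> U" for U y
  proof -
    have yT: "y \<in> topspace T" using U y openin_subset by blast
    have "openin S {x \<in> topspace S. h x \<in> U}" using openin_continuous_map_preimage[OF c(1) U] .
    moreover have "k y \<in> {x \<in> topspace S. h x \<in> U}"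
      using continuous_map_image_subset_topspace[OF c(2)] yT inv(2) y by auto
    ultimately obtain V where V: "V \<in> Clopen S" "k y \<in> V" "V \<subseteq> {x \<in> topspace S. h x \<in> U}"
      using S unfolding stone_space_def by meson
    have "{z \<in> topspace T. k z \<in> V} \<in> Clopen T" by (rule Clopen_preimage[OF c(2) V(1)])
    moreover have "{z \<in> topspace T. k z \<in> V} \<subseteq> U" using V(3) inv(2) by force
    moreover have "y \<in> {z \<in> topspace T. k z \<in> V}" using V(2) yT by simp
    ultimately show ?thesis by (intro bexI conjI)
  qed
  then show ?thesis
    using S homeomorphic_compact_space[OF hom] homeomorphic_Hausdorff_space[OF hom]
    by (simp add: stone_space_def)
qed

subsection \<open>The tensor product of kernels\<close>

lemma topspace_stone_times [simp]: "topspace (stone_times S T) = pr_times (topspace S) (topspace T)"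
  by (auto simp: stone_times_def topspace_pullback_topology pr_times_def)

lemma stone_times_homeomorphic: "prod_topology S T homeomorphic_space stone_times S T"
  unfolding homeomorphic_space_def homeomorphic_maps_def
proof (intro exI[of _ "\<lambda>(x, y). Pr x y"] exI[of _ "\<lambda>p. (p1 p, p2 p)"] conjI)
  have "continuous_map (prod_topology S T) (prod_topology S T) ((\<lambda>p. (p1 p, p2 p)) \<circ> (\<lambda>(x, y). Pr x y))"
    by (rule continuous_map_eq[OF continuous_map_id]) auto
  then show "continuous_map (prod_topology S T) (stone_times S T) (\<lambda>(x, y). Pr x y)"
    unfolding stone_times_def by (rule continuous_map_pullback') (auto simp: pr_times_iff)
  show "continuous_map (stone_times S T) (prod_topology S T) (\<lambda>p. (p1 p, p2 p))"
    unfolding stone_times_def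
    using continuous_map_pullback[of "prod_topology S T" "prod_topology S T" "\<lambda>x. x" _ "\<lambda>p. (p1 p, p2 p)"] by (simp add: o_def)
qed (auto elim!: pr_timesE)

lemma continuous_p1: "continuous_map (stone_times S T) S p1"
  and continuous_p2: "continuous_map (stone_times S T) T p2"
proof -
  have "continuous_map (stone_times S T) S (fst \<circ> (\<lambda>p. (p1 p, p2 p)))"
    "continuous_map (stone_times S T) T (snd \<circ> (\<lambda>p. (p1 p, p2 p)))"
    unfolding stone_times_def
    by (rule continuous_map_pullback[OF continuous_map_fst] continuous_map_pullback[OF continuous_map_snd])+
  then show "continuous_map (stone_times S T) S p1" "continuous_map (stone_times S T) T p2"
    by (simp_all add: o_def)
qed

lemma continuous_Pr:
  assumes "w \<in> topspace T"
  shows "continuous_map S (stone_times S T) (\<lambda>y. Pr y w)"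
  unfolding stone_times_def
  by (rule continuous_map_pullback')
    (use assms in \<open>auto simp: o_def pr_times_iff intro!: continuous_map_pairedI\<close>)

lemma Clopen_rectangle:
  assumes U: "U \<in> Clopen S" and V: "V \<in> Clopen T"
  shows "pr_times U V \<in> Clopen (stone_times S T)"
proof -
  have e: "pr_times U V = {p \<in> topspace (stone_times S T). p1 p \<in> U} \<inter> {p \<in> topspace (stone_times S T). p2 p \<in> V}"
    using ClopenD(3)[OF U] ClopenD(3)[OF V] by (auto simp: pr_times_def)
  show ?thesis
    unfolding e by (rule Clopen_ops(4)[OF Clopen_preimage[OF continuous_p1 U] Clopen_preimage[OF continuous_p2 V]])
qed

lemma Clopen_rectangle_nbhd:
  assumes S: "stone_space S" and T: "stone_space T" and W: "openin (stone_times S T) W" and "Pr y w \<in> W"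
  obtains U V where "U \<in> Clopen S" "V \<in> Clopen T" "y \<in> U" "w \<in> V" "pr_times U V \<subseteq> W"
proof -
  obtain Q where Q: "openin (prod_topology S T) Q" "W = (\<lambda>p. (p1 p, p2 p)) -` Q \<inter> pr_times (topspace S) (topspace T)"
    using W unfolding stone_times_def openin_pullback_topology by blast
  then have "(y, w) \<in> Q" using assms(4) by auto
  then obtain U V where UV: "openin S U" "openin T V" "y \<in> U" "w \<in> V" "U \<times> V \<subseteq> Q"
    using Q(1) unfolding openin_prod_topology_alt by meson
  obtain U' where U': "U' \<in> Clopen S" "y \<in> U'" "U' \<subseteq> U" using S UV unfolding stone_space_def by meson
  obtain V' where V': "V' \<in> Clopen T" "w \<in> V'" "V' \<subseteq> V" using T UV unfolding stone_space_def by meson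
  have "U' \<times> V' \<subseteq> Q" using UV(5) U'(3) V'(3) by blast
  then have "pr_times U' V' \<subseteq> W"
    using ClopenD(3)[OF U'(1)] ClopenD(3)[OF V'(1)] Q(2) by (auto simp: pr_times_def)
  then show thesis using that U' V' by blast
qed

lemma stone_times_stone:
  assumes S: "stone_space S" and T: "stone_space T"
  shows "stone_space (stone_times S T)"
  unfolding stone_space_def
proof (intro conjI allI impI)
  have "compact_space (prod_topology S T)" "Hausdorff_space (prod_topology S T)"
    using S T by (auto simp: stone_space_def compact_space_prod_topology Hausdorff_space_prod_topology)
  then show "compact_space (stone_times S T)" "Hausdorff_space (stone_times S T)"
    using homeomorphic_compact_space[OF stone_times_homeomorphic] homeomorphic_Hausdorff_space[OF stone_times_homeomorphic]
    by blast+
  fix W p assume W: "openin (stone_times S T) W \<and> p \<in> W"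
  then have "p \<in> topspace (stone_times S T)" using openin_subset by blast
  then obtain y w where p: "p = Pr y w" by (auto elim: pr_timesE)
  then obtain U V where "U \<in> Clopen S" "V \<in> Clopen T" "y \<in> U" "w \<in> V" "pr_times U V \<subseteq> W"
    using Clopen_rectangle_nbhd[OF S T] W by blast
  then show "\<exists>V\<in>Clopen (stone_times S T). p \<in> V \<and> V \<subseteq> W"
    unfolding p using Clopen_rectangle by (intro bexI[of _ "pr_times U V"]) (auto simp: pr_times_iff)
qed

definition slice :: "'a point topology \<Rightarrow> 'a point set \<Rightarrow> 'a point \<Rightarrow> 'a point set" where
  "slice S W w = {y \<in> topspace S. Pr y w \<in> W}"

lemma slice_Clopen: "w \<in> topspace T \<Longrightarrow> W \<in> Clopen (stone_times S T) \<Longrightarrow> slice S W w \<in> Clopen S"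
  unfolding slice_def by (rule Clopen_preimage[OF continuous_Pr])

text \<open>
  A form of the tube lemma. Each point of the fibre over \<open>w\<close> has a rectangular neighbourhood that lies in
  \<open>W\<close> or in its complement. Finitely many of these cover the fibre, and over the intersection of their bases
  the slice does not change.
\<close>

lemma slice_locally_const:
  assumes S: "stone_space S" and T: "stone_space T" and W: "W \<in> Clopen (stone_times S T)"
  shows "locally_const T (slice S W)"
  unfolding locally_const_def
proof
  fix w assume w: "w \<in> topspace T"
  have "\<exists>U V. U \<in> Clopen S \<and> V \<in> Clopen T \<and> y \<in> U \<and> w \<in> V \<and>
      (\<forall>y'\<in>U. \<forall>w'\<in>V. Pr y' w' \<in> W \<longleftrightarrow> Pr y' w \<in> W)" if y: "y \<in> topspace S" for y
  proof -
    let ?Q = "if Pr y w \<in> W then W else topspace (stone_times S T) - W"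
    have "openin (stone_times S T) ?Q"
      using openin_diff[OF openin_topspace ClopenD(2)[OF W]] ClopenD(1)[OF W] by (simp del: topspace_stone_times)
    moreover have "Pr y w \<in> ?Q"
      using y w by (simp add: pr_times_iff)
    ultimately obtain U V where UV: "U \<in> Clopen S" "V \<in> Clopen T" "y \<in> U" "w \<in> V" "pr_times U V \<subseteq> ?Q"
      using Clopen_rectangle_nbhd[OF S T] by blast
    have "Pr y' w' \<in> W \<longleftrightarrow> Pr y w \<in> W" if "y' \<in> U" "w' \<in> V" for y' w'
      using UV(5) that by (auto simp: pr_times_iff subset_iff split: if_splits)
    then show ?thesis using UV by blast
  qed
  then obtain U V where UV: "\<And>y. y \<in> topspace S \<Longrightarrow> U y \<in> Clopen S \<and> V y \<in> Clopen T \<and> y \<in> U y \<and> w \<in> V y \<and>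
      (\<forall>y'\<in>U y. \<forall>w'\<in>V y. Pr y' w' \<in> W \<longleftrightarrow> Pr y' w \<in> W)" by metis
  have "(\<forall>Q\<in>U ` topspace S. openin S Q) \<and> topspace S \<subseteq> \<Union>(U ` topspace S)"
    using UV ClopenD(1) by blast
  then obtain \<F> where F: "finite \<F>" "\<F> \<subseteq> U ` topspace S" "topspace S \<subseteq> \<Union>\<F>"
    using stone_compact[OF S] unfolding compact_space_alt by meson
  obtain A where A: "A \<subseteq> topspace S" "finite A" "\<F> = U ` A"
    using finite_subset_image[OF F(1,2)] by blast
  let ?V = "topspace T \<inter> (\<Inter>y\<in>A. V y)"
  have "openin T ?V"
    using A UV ClopenD(1) by (intro openin_Int_Inter) blast+
  moreover have "w \<in> ?V" using UV A w by blast
  moreover have "slice S W w' = slice S W w" if w': "w' \<in> ?V" for w'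
  proof -
    have "Pr y' w' \<in> W \<longleftrightarrow> Pr y' w \<in> W" if y': "y' \<in> topspace S" for y'
    proof -
      obtain y where "y \<in> A" "y' \<in> U y" using y' F(3) A(3) by blast
      then show ?thesis using UV A(1) w' by blast
    qed
    then show ?thesis by (auto simp: slice_def)
  qed
  ultimately show "\<exists>V. openin T V \<and> w \<in> V \<and> (\<forall>w'\<in>V. slice S W w' = slice S W w)" by blast
qed

text \<open>
  A clopen set is the disjoint union of finitely many rectangles, one for each of its slices.
\<close>

lemma kernel_rectangles_ext:
  assumes S: "stone_space S" and T: "stone_space T"
    and k: "k \<in> hom StoneStoch R (stone_times S T)" and k': "k' \<in> hom StoneStoch R (stone_times S T)"
    and eq: "\<And>U V x. U \<in> Clopen S \<Longrightarrow> V \<in> Clopen T \<Longrightarrow> x \<in> topspace R \<Longrightarrow> fn k (pr_times U V) x = fn k' (pr_times U V) x"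
  shows "k = k'"
proof (rule kernel_ext[OF k k'])
  fix W x assume W: "W \<in> Clopen (stone_times S T)" and x: "x \<in> topspace R"
  let ?C = "slice S W ` topspace T" and ?l = "\<lambda>c. {w \<in> topspace T. slice S W w = c}"
  note lc = slice_locally_const[OF S T W]
  have fin: "finite ?C" using locally_const_finite[OF stone_compact[OF T] lc] .
  have cl: "c \<in> Clopen S" "?l c \<in> Clopen T" if "c \<in> ?C" for c
    using that slice_Clopen[OF _ W] locally_const_fibre[OF lc] by auto
  have un: "W = (\<Union>c\<in>?C. pr_times c (?l c))"
  proof (intro subset_antisym subsetI)
    fix p assume p: "p \<in> W"
    then have "p \<in> pr_times (topspace S) (topspace T)" using ClopenD(3)[OF W] by auto
    then obtain y w where "p = Pr y w" "y \<in> topspace S" "w \<in> topspace T" by (rule pr_timesE)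
    then show "p \<in> (\<Union>c\<in>?C. pr_times c (?l c))" using p by (auto simp: pr_times_iff slice_def)
  qed (auto simp: pr_times_def slice_def)
  have "fn j W x = (\<Sum>c\<in>?C. fn j (pr_times c (?l c)) x)" if j: "j \<in> hom StoneStoch R (stone_times S T)" for j
  proof -
    have "fn j (\<Union>c\<in>?C. pr_times c (?l c)) x = (\<Sum>c\<in>?C. fn j (pr_times c (?l c)) x)"
      by (rule fin_add_prob_UN[OF kernelD(8)[OF j x] fin]) (auto simp: pr_times_def intro!: Clopen_rectangle[unfolded pr_times_def] cl)
    then show ?thesis using un by simp
  qed
  then show "fn k W x = fn k' W x"
    using k k' eq[OF cl x] by simp
qed

text \<open>
  Fubini's formula: the value at \<open>W\<close> and \<open>(x, z)\<close> is the integral over \<open>w\<close>, with respect to \<open>h(- | z)\<close>, of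
  \<open>f(W\<^sub>w | x)\<close>, where \<open>W\<^sub>w\<close> is the slice of \<open>W\<close> at \<open>w\<close>. It is locally constant by \<open>slice_locally_const\<close>.
\<close>

lemma kernel_tensor_exists:
  assumes f: "f \<in> hom StoneStoch S S'" and h: "h \<in> hom StoneStoch T T'"
  shows "\<exists>k. k \<in> hom StoneStoch (stone_times S T) (stone_times S' T') \<and>
    (\<forall>U\<in>Clopen S'. \<forall>V\<in>Clopen T'. \<forall>x\<in>topspace S. \<forall>z\<in>topspace T. fn k (pr_times U V) (Pr x z) = fn f U x * fn h V z)"
proof -
  note F = kernelD[OF f] and H = kernelD[OF h]
  let ?ST = "stone_times S T" and ?ST' = "stone_times S' T'"
  define v where "v W p = integ T' (\<lambda>V. fn h V (p2 p)) (\<lambda>w. fn f (slice S' W w) (p1 p))" for W p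
  define k where "k = Arrow ?ST (\<lambda>W p. if W \<in> Clopen ?ST' \<and> p \<in> topspace ?ST then v W p else 0) ?ST'"
  have lc: "locally_const T' (\<lambda>w. fn f (slice S' W w) x)" if "W \<in> Clopen ?ST'" for W x
    using locally_const_map[OF slice_locally_const[OF F(4) H(4) that], of "\<lambda>c. fn f c x"] .
  have pT: "p1 p \<in> topspace S" "p2 p \<in> topspace T" if "p \<in> topspace ?ST" for p
    using that by (auto elim: pr_timesE)
  have "k \<in> hom StoneStoch ?ST ?ST'"
  proof (rule kernelI)
    show "stone_space ?ST" "stone_space ?ST'" using F H by (auto intro: stone_times_stone)
    show "locally_const ?ST (fn k W)" if W: "W \<in> Clopen ?ST'" for W
    proof (rule locally_const_cong)
      let ?e = "slice S' W"
      note e = slice_locally_const[OF F(4) H(4) W]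
      have "locally_const ?ST (\<lambda>p. fn f c (p1 p) * fn h {w \<in> topspace T'. ?e w = c} (p2 p))" for c
        by (rule locally_const_map2[OF locally_const_continuous[OF continuous_p1 F(7)] locally_const_continuous[OF continuous_p2 H(7)]])
      then show "locally_const ?ST (\<lambda>p. \<Sum>c\<in>?e ` topspace T'. fn f c (p1 p) * fn h {w \<in> topspace T'. ?e w = c} (p2 p))"
        using locally_const_finite[OF H(6) e] by (intro locally_const_sum)
      fix p assume p: "p \<in> topspace ?ST"
      show "fn k W p = (\<Sum>c\<in>?e ` topspace T'. fn f c (p1 p) * fn h {w \<in> topspace T'. ?e w = c} (p2 p))"
        using integ_comp[OF H(6) H(8)[OF pT(2)[OF p]] e, of "\<lambda>c. fn f c (p1 p)"] W p by (simp add: k_def v_def)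
    qed
    show "0 \<le> fn k W p" if p: "p \<in> topspace ?ST" and W: "W \<in> Clopen ?ST'" for p W
    proof -
      have "0 \<le> v W p"
        unfolding v_def using integ_nonneg[OF H(8)[OF pT(2)[OF p]] lc[OF W, of "p1 p"]]
          fin_add_probD(1)[OF F(8)[OF pT(1)[OF p]]] slice_Clopen[OF _ W] by blast
      then show ?thesis by (simp add: k_def)
    qed
    show "fn k (topspace ?ST') p = 1" if p: "p \<in> topspace ?ST" for p
    proof -
      have "slice S' (topspace ?ST') w = topspace S'" if "w \<in> topspace T'" for w
        using that by (auto simp: slice_def pr_times_iff)
      then have "v (topspace ?ST') p = integ T' (\<lambda>V. fn h V (p2 p)) (\<lambda>_. 1)"
        unfolding v_def using fin_add_probD(2)[OF F(8)[OF pT(1)[OF p]]] by (intro integ_cong) (simp del: topspace_stone_times)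
      then show ?thesis
        using integ_const[OF H(6) H(8)[OF pT(2)[OF p]]] p Clopen_ops(1)[of ?ST'] by (simp add: k_def)
    qed
    show "fn k (W \<union> W') p = fn k W p + fn k W' p"
      if p: "p \<in> topspace ?ST" and W: "W \<in> Clopen ?ST'" "W' \<in> Clopen ?ST'" "W \<inter> W' = {}" for p W W'
    proof -
      have "v (W \<union> W') p = integ T' (\<lambda>V. fn h V (p2 p)) (\<lambda>w. fn f (slice S' W w) (p1 p) + fn f (slice S' W' w) (p1 p))"
        unfolding v_def
      proof (rule integ_cong)
        fix w assume w: "w \<in> topspace T'"
        have "slice S' (W \<union> W') w = slice S' W w \<union> slice S' W' w" "slice S' W w \<inter> slice S' W' w = {}"
          using W(3) by (auto simp: slice_def)
        then show "fn f (slice S' (W \<union> W') w) (p1 p) = fn f (slice S' W w) (p1 p) + fn f (slice S' W' w) (p1 p)"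
          using fin_add_probD(3)[OF F(8)[OF pT(1)[OF p]] slice_Clopen[OF w W(1)] slice_Clopen[OF w W(2)]] by simp
      qed
      also have "\<dots> = v W p + v W' p"
        unfolding v_def using integ_add[OF H(6) H(8)[OF pT(2)[OF p]] lc[OF W(1)] lc[OF W(2)]] .
      finally show ?thesis
        using p W Clopen_ops(3)[OF W(1,2)] by (simp add: k_def)
    qed
  qed (auto simp: k_def)
  moreover have "fn k (pr_times U V) (Pr x z) = fn f U x * fn h V z"
    if U: "U \<in> Clopen S'" and V: "V \<in> Clopen T'" and x: "x \<in> topspace S" and z: "z \<in> topspace T" for U V x z
  proof -
    have "slice S' (pr_times U V) w = (if w \<in> V then U else {})" for w
      using ClopenD(3)[OF U] by (auto simp: slice_def pr_times_iff)
    then have "v (pr_times U V) (Pr x z) = integ T' (\<lambda>V. fn h V z) (\<lambda>w. if w \<in> V then fn f U x else 0)"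
      unfolding v_def point.sel using fin_add_probD(4)[OF F(8)[OF x]] by (intro integ_cong) simp
    then show ?thesis
      using integ_indicator[OF H(6) H(8)[OF z] V] Clopen_rectangle[OF U V] x z by (simp add: k_def pr_times_iff)
  qed
  ultimately show ?thesis by blast
qed

lemma kernel_tensor:
  assumes f: "f \<in> hom StoneStoch S S'" and h: "h \<in> hom StoneStoch T T'"
  shows "f \<boxtimes>\<^bsub>StoneStoch\<^esub> h \<in> hom StoneStoch (stone_times S T) (stone_times S' T')"
    and "U \<in> Clopen S' \<Longrightarrow> V \<in> Clopen T' \<Longrightarrow> x \<in> topspace S \<Longrightarrow> z \<in> topspace T \<Longrightarrow>
      fn (f \<boxtimes>\<^bsub>StoneStoch\<^esub> h) (pr_times U V) (Pr x z) = fn f U x * fn h V z"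
proof -
  note F = kernelD[OF f] and H = kernelD[OF h]
  let ?P = "\<lambda>k. k \<in> hom StoneStoch (stone_times S T) (stone_times S' T') \<and>
    (\<forall>U\<in>Clopen S'. \<forall>V\<in>Clopen T'. \<forall>x\<in>topspace S. \<forall>z\<in>topspace T. fn k (pr_times U V) (Pr x z) = fn f U x * fn h V z)"
  have "\<exists>!k. ?P k"
  proof (rule ex_ex1I[OF kernel_tensor_exists[OF f h]])
    fix k k' assume k: "?P k" and k': "?P k'"
    show "k = k'"
      by (rule kernel_rectangles_ext[OF F(4) H(4) conjunct1[OF k] conjunct1[OF k']])
         (use k k' in \<open>auto elim!: pr_timesE\<close>)
  qed
  moreover have e: "?P k \<longleftrightarrow> lc_kernel k \<and> src k = stone_times (src f) (src h) \<and> tgt k = stone_times (tgt f) (tgt h) \<and>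
      (\<forall>U\<in>Clopen (tgt f). \<forall>V\<in>Clopen (tgt h). \<forall>x\<in>topspace (src f). \<forall>z\<in>topspace (src h).
         fn k (pr_times U V) (Pr x z) = fn f U x * fn h V z)" for k
    unfolding StoneStoch_hom F(1,2) H(1,2) using F H stone_times_stone by blast
  have "f \<boxtimes>\<^bsub>StoneStoch\<^esub> h = (THE k. ?P k)"
    unfolding e by (simp add: StoneStoch_def)
  ultimately have "?P (f \<boxtimes>\<^bsub>StoneStoch\<^esub> h)" using theI'[of ?P] by simp
  then show "f \<boxtimes>\<^bsub>StoneStoch\<^esub> h \<in> hom StoneStoch (stone_times S T) (stone_times S' T')"
    "U \<in> Clopen S' \<Longrightarrow> V \<in> Clopen T' \<Longrightarrow> x \<in> topspace S \<Longrightarrow> z \<in> topspace T \<Longrightarrow>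
      fn (f \<boxtimes>\<^bsub>StoneStoch\<^esub> h) (pr_times U V) (Pr x z) = fn f U x * fn h V z" by blast+
qed

text \<open>
  Two kernels into a tensor product are compared on rectangles. For composites, the level sets of the pair
  of functions \<open>f'(U | -)\<close> and \<open>g'(V | -)\<close> of the two coordinates are rectangles, so that the integral of their
  product is the product of their integrals.
\<close>

lemma StoneStoch_semicartesian: "semicartesian (StoneStoch :: ('a point topology, 'a kernel) smcat)"
proof -
  interpret category "StoneStoch :: ('a point topology, 'a kernel) smcat" by (rule StoneStoch_category)
  let ?I = "discrete_topology {Star} :: 'a point topology"
  have I: "stone_space ?I" by (rule stone_discrete) simp
  show ?thesis
  proof
    fix A B :: "'a point topology" assume AB: "A \<in> Ob StoneStoch" "B \<in> Ob StoneStoch"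
    then have st: "stone_space A" "stone_space B" by auto
    show "A \<otimes>\<^bsub>StoneStoch\<^esub> B \<in> Ob StoneStoch" using st stone_times_stone by simp
    have i: "stone_det A (\<lambda>x. x) A \<in> hom StoneStoch A A" "stone_det B (\<lambda>x. x) B \<in> hom StoneStoch B B"
      "stone_det (stone_times A B) (\<lambda>x. x) (stone_times A B) \<in> hom StoneStoch (stone_times A B) (stone_times A B)"
      using st stone_times_stone by (auto intro!: stone_det_hom)
    have "stone_det A (\<lambda>x. x) A \<boxtimes>\<^bsub>StoneStoch\<^esub> stone_det B (\<lambda>x. x) B = stone_det (stone_times A B) (\<lambda>x. x) (stone_times A B)"
    proof (rule kernel_rectangles_ext[OF st kernel_tensor(1)[OF i(1,2)] i(3)])
      fix U V p assume U: "U \<in> Clopen A" "V \<in> Clopen B" and "p \<in> topspace (stone_times A B)"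
      then obtain x z where "p = Pr x z" "x \<in> topspace A" "z \<in> topspace B" by (auto elim: pr_timesE)
      then show "fn (stone_det A (\<lambda>x. x) A \<boxtimes>\<^bsub>StoneStoch\<^esub> stone_det B (\<lambda>x. x) B) (pr_times U V) p =
          fn (stone_det (stone_times A B) (\<lambda>x. x) (stone_times A B)) (pr_times U V) p"
        using kernel_tensor(2)[OF i(1,2) U] U Clopen_rectangle[OF U] by (simp add: stone_det_def pr_times_iff)
    qed
    then show "Idt StoneStoch A \<boxtimes>\<^bsub>StoneStoch\<^esub> Idt StoneStoch B = Idt StoneStoch (A \<otimes>\<^bsub>StoneStoch\<^esub> B)" by simp
  next
    show "f \<boxtimes>\<^bsub>StoneStoch\<^esub> g \<in> hom StoneStoch (A \<otimes>\<^bsub>StoneStoch\<^esub> B) (A' \<otimes>\<^bsub>StoneStoch\<^esub> B')"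
      if "f \<in> hom StoneStoch A A'" "g \<in> hom StoneStoch B B'" for f g :: "'a kernel" and A A' B B'
      using kernel_tensor(1)[OF that] by simp
  next
    fix f f' g g' :: "'a kernel" and A A' A'' B B' B''
    assume f: "f \<in> hom StoneStoch A A'" and f': "f' \<in> hom StoneStoch A' A''"
      and g: "g \<in> hom StoneStoch B B'" and g': "g' \<in> hom StoneStoch B' B''"
    note F = kernelD[OF f] and F' = kernelD[OF f'] and G = kernelD[OF g] and G' = kernelD[OF g']
    note t = kernel_tensor[OF f g] and t' = kernel_tensor[OF f' g']
    note T = kernelD[OF t(1)]
    show "(f' \<cdot>\<^bsub>StoneStoch\<^esub> f) \<boxtimes>\<^bsub>StoneStoch\<^esub> (g' \<cdot>\<^bsub>StoneStoch\<^esub> g) = (f' \<boxtimes>\<^bsub>StoneStoch\<^esub> g') \<cdot>\<^bsub>StoneStoch\<^esub> (f \<boxtimes>\<^bsub>StoneStoch\<^esub> g)"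
    proof (rule kernel_rectangles_ext[OF F'(4) G'(4) kernel_tensor(1)[OF kernel_comp_hom[OF f f'] kernel_comp_hom[OF g g']]
          kernel_comp_hom[OF t(1) t'(1)]])
      fix U V p assume U: "U \<in> Clopen A''" and V: "V \<in> Clopen B''" and p: "p \<in> topspace (stone_times A B)"
      obtain x z where xz: "p = Pr x z" "x \<in> topspace A" "z \<in> topspace B" using p by (auto elim: pr_timesE)
      let ?e = "\<lambda>q. (fn f' U (p1 q), fn g' V (p2 q))"
      have e: "locally_const (stone_times A' B') ?e"
        by (rule locally_const_map2[OF locally_const_continuous[OF continuous_p1 F'(7)] locally_const_continuous[OF continuous_p2 G'(7)]])
      let ?a = "\<lambda>r. {y \<in> topspace A'. fn f' U y = r}" and ?b = "\<lambda>s. {w \<in> topspace B'. fn g' V w = s}"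
      have lev: "{q \<in> topspace (stone_times A' B'). ?e q = (r, s)} = pr_times (?a r) (?b s)" for r s
        by (auto simp: pr_times_def)
      have img: "?e ` topspace (stone_times A' B') = fn f' U ` topspace A' \<times> fn g' V ` topspace B'"
        by (auto simp: pr_times_def image_iff)
      have "fn ((f' \<boxtimes>\<^bsub>StoneStoch\<^esub> g') \<cdot>\<^bsub>StoneStoch\<^esub> (f \<boxtimes>\<^bsub>StoneStoch\<^esub> g)) (pr_times U V) p
         = integ (stone_times A' B') (\<lambda>W. fn (f \<boxtimes>\<^bsub>StoneStoch\<^esub> g) W p) (\<lambda>q. fst (?e q) * snd (?e q))"
        unfolding fn_StoneStoch_Comp T(2) by (intro integ_cong) (auto simp: t'(2)[OF U V] elim!: pr_timesE)
      also have "\<dots> = (\<Sum>rs\<in>fn f' U ` topspace A' \<times> fn g' V ` topspace B'. fst rs * snd rs *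
          fn (f \<boxtimes>\<^bsub>StoneStoch\<^esub> g) {q \<in> topspace (stone_times A' B'). ?e q = rs} p)"
        using integ_comp[OF T(6) T(8)[OF p] e, of "\<lambda>rs. fst rs * snd rs"] unfolding img .
      also have "\<dots> = (\<Sum>rs\<in>fn f' U ` topspace A' \<times> fn g' V ` topspace B'. (fst rs * fn f (?a (fst rs)) x) * (snd rs * fn g (?b (snd rs)) z))"
      proof (rule sum.cong[OF refl])
        fix rs :: "real \<times> real"
        obtain r s where rs: "rs = (r, s)" by (cases rs)
        have "fn (f \<boxtimes>\<^bsub>StoneStoch\<^esub> g) (pr_times (?a r) (?b s)) p = fn f (?a r) x * fn g (?b s) z"
          unfolding xz(1) by (rule t(2)[OF locally_const_fibre[OF F'(7)] locally_const_fibre[OF G'(7)] xz(2,3)])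
        then show "fst rs * snd rs * fn (f \<boxtimes>\<^bsub>StoneStoch\<^esub> g) {q \<in> topspace (stone_times A' B'). ?e q = rs} p =
            (fst rs * fn f (?a (fst rs)) x) * (snd rs * fn g (?b (snd rs)) z)"
          unfolding rs lev by simp
      qed
      also have "\<dots> = fn (f' \<cdot>\<^bsub>StoneStoch\<^esub> f) U x * fn (g' \<cdot>\<^bsub>StoneStoch\<^esub> g) V z"
        unfolding fn_StoneStoch_Comp F(2) G(2) integ_def sum_product sum.cartesian_product by (simp add: split_def)
      finally show "fn ((f' \<cdot>\<^bsub>StoneStoch\<^esub> f) \<boxtimes>\<^bsub>StoneStoch\<^esub> (g' \<cdot>\<^bsub>StoneStoch\<^esub> g)) (pr_times U V) p =
          fn ((f' \<boxtimes>\<^bsub>StoneStoch\<^esub> g') \<cdot>\<^bsub>StoneStoch\<^esub> (f \<boxtimes>\<^bsub>StoneStoch\<^esub> g)) (pr_times U V) p"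
        using kernel_tensor(2)[OF kernel_comp_hom[OF f f'] kernel_comp_hom[OF g g'] U V xz(2,3)] xz(1) by simp
    qed
  next
    show "unit StoneStoch \<in> Ob (StoneStoch :: ('a point topology, 'a kernel) smcat)" using I by simp
  next
    fix A :: "'a point topology" assume A: "A \<in> Ob StoneStoch"
    show "lunit StoneStoch A \<in> hom StoneStoch (unit StoneStoch \<otimes>\<^bsub>StoneStoch\<^esub> A) A"
      using A I by (auto intro!: stone_det_hom stone_times_stone continuous_p2)
    let ?d = "stone_det A (\<lambda>_. Star) ?I"
    have d: "?d \<in> hom StoneStoch A ?I"
      using A I by (intro stone_det_hom) auto
    show "\<exists>!f. f \<in> hom StoneStoch A (unit StoneStoch)"
    proof (rule ex1I[of _ ?d])
      show "?d \<in> hom StoneStoch A (unit StoneStoch)" using d by simp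
      fix f assume f: "f \<in> hom StoneStoch A (unit StoneStoch)"
      then have f: "f \<in> hom StoneStoch A ?I" by simp
      show "f = ?d"
      proof (rule kernel_ext[OF f d])
        fix U x assume U: "U \<in> Clopen ?I" and x: "x \<in> topspace A"
        have "U = {} \<or> U = topspace ?I" using ClopenD(3)[OF U] by auto
        then show "fn f U x = fn ?d U x"
          using fin_add_probD(2,4)[OF kernelD(8)[OF f x]] fin_add_probD(2,4)[OF kernelD(8)[OF d x]] by metis
      qed
    qed
  next
    fix f :: "'a kernel" and A B assume f: "f \<in> hom StoneStoch A B"
    note F = kernelD[OF f]
    let ?i = "stone_det ?I (\<lambda>x. x) ?I" and ?l = "\<lambda>A. stone_det (stone_times ?I A) p2 A"
    have i: "?i \<in> hom StoneStoch ?I ?I" using I by (intro stone_det_hom) auto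
    have l: "?l S \<in> hom StoneStoch (stone_times ?I S) S" if "stone_space S" for S
      using that I by (intro stone_det_hom stone_times_stone continuous_p2)
    note t = kernel_tensor[OF i f]
    have "?l B \<cdot>\<^bsub>StoneStoch\<^esub> (?i \<boxtimes>\<^bsub>StoneStoch\<^esub> f) = f \<cdot>\<^bsub>StoneStoch\<^esub> ?l A"
    proof (rule kernel_ext[OF kernel_comp_hom[OF t(1) l[OF F(4)]] kernel_comp_hom[OF l[OF F(3)] f]])
      fix V p assume V: "V \<in> Clopen B" and p: "p \<in> topspace (stone_times ?I A)"
      obtain x where x: "p = Pr Star x" "x \<in> topspace A" using p by (auto elim!: pr_timesE)
      have pre: "{q \<in> topspace (stone_times ?I B). p2 q \<in> V} = pr_times {Star} V"
        using ClopenD(3)[OF V] by (auto simp: pr_times_def)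
      have S: "{Star} \<in> Clopen ?I" by (simp add: Clopen_def)
      have "fn (?l B \<cdot>\<^bsub>StoneStoch\<^esub> (?i \<boxtimes>\<^bsub>StoneStoch\<^esub> f)) V p = fn (?i \<boxtimes>\<^bsub>StoneStoch\<^esub> f) (pr_times {Star} V) p"
        using stone_det_comp[OF t(1) continuous_p2 F(4) V p] unfolding pre .
      also have "\<dots> = fn f V x"
        unfolding x(1) using t(2)[OF S V, of Star x] x(2) S by (simp add: stone_det_def)
      also have "\<dots> = fn (f \<cdot>\<^bsub>StoneStoch\<^esub> ?l A) V p"
        using comp_stone_det[OF f _ p, of p2 V] x by simp
      finally show "fn (?l B \<cdot>\<^bsub>StoneStoch\<^esub> (?i \<boxtimes>\<^bsub>StoneStoch\<^esub> f)) V p = fn (f \<cdot>\<^bsub>StoneStoch\<^esub> ?l A) V p" .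
    qed
    then show "lunit StoneStoch B \<cdot>\<^bsub>StoneStoch\<^esub> (Idt StoneStoch (unit StoneStoch) \<boxtimes>\<^bsub>StoneStoch\<^esub> f) = f \<cdot>\<^bsub>StoneStoch\<^esub> lunit StoneStoch A"
      by simp
  qed
qed

interpretation St: semicartesian StoneStoch by (rule StoneStoch_semicartesian)

subsection \<open>Isomorphic Stone spaces are homeomorphic\<close>

lemma stone_separate:
  assumes T: "stone_space T" and y: "y \<in> topspace T" "y' \<in> topspace T"
    and eq: "\<And>U. U \<in> Clopen T \<Longrightarrow> y \<in> U \<longleftrightarrow> y' \<in> U"
  shows "y = y'"
proof (rule ccontr)
  assume "y \<noteq> y'"
  then obtain U V where U: "openin T U" "openin T V" "y \<in> U" "y' \<in> V" "disjnt U V"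
    using T y unfolding stone_space_def Hausdorff_space_def by blast
  then obtain W where "W \<in> Clopen T" "y \<in> W" "W \<subseteq> U"
    using T unfolding stone_space_def by meson
  then show False using eq U(4,5) by (auto simp: disjnt_def)
qed

lemma continuous_map_Clopen:
  assumes T: "stone_space T" and h: "\<And>x. x \<in> topspace S \<Longrightarrow> h x \<in> topspace T"
    and pre: "\<And>U. U \<in> Clopen T \<Longrightarrow> {x \<in> topspace S. h x \<in> U} \<in> Clopen S"
  shows "continuous_map S T h"
  unfolding continuous_map_def
proof (intro conjI allI impI)
  show "h \<in> topspace S \<rightarrow> topspace T" using h by blast
  fix U assume U: "openin T U"
  show "openin S {x \<in> topspace S. h x \<in> U}"
  proof (subst openin_subopen, intro ballI)
    fix x assume x: "x \<in> {x \<in> topspace S. h x \<in> U}"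
    then obtain V where V: "V \<in> Clopen T" "h x \<in> V" "V \<subseteq> U"
      using T U unfolding stone_space_def by blast
    show "\<exists>W. openin S W \<and> x \<in> W \<and> W \<subseteq> {x \<in> topspace S. h x \<in> U}"
      using ClopenD(1)[OF pre[OF V(1)]] V x by (intro exI[of _ "{x \<in> topspace S. h x \<in> V}"]) auto
  qed
qed

text \<open>
  If each point had a clopen neighbourhood of measure zero, then finitely many of them would cover the
  space by compactness.
\<close>

lemma support_nonempty:
  assumes T: "stone_space T" and m: "fin_add_prob T m"
  obtains y where "y \<in> topspace T" "\<And>U. U \<in> Clopen T \<Longrightarrow> y \<in> U \<Longrightarrow> 0 < m U"
proof (rule ccontr)
  assume "\<not> thesis"
  then have "\<forall>y\<in>topspace T. \<exists>U. U \<in> Clopen T \<and> y \<in> U \<and> m U = 0"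
    using that fin_add_probD(1)[OF m] by (metis order_le_less)
  then have cov: "(\<forall>U\<in>{U \<in> Clopen T. m U = 0}. openin T U) \<and> topspace T \<subseteq> \<Union>{U \<in> Clopen T. m U = 0}"
    using ClopenD(1) by blast
  obtain \<F> where F: "finite \<F>" "\<F> \<subseteq> {U \<in> Clopen T. m U = 0}" "topspace T \<subseteq> \<Union>\<F>"
    using stone_compact[OF T] cov unfolding compact_space_alt by meson
  have "m (\<Union>\<F>) = 0 \<and> \<Union>\<F> \<in> Clopen T"
    using F(1,2)
  proof (induction \<F> rule: finite_induct)
    case empty
    then show ?case using fin_add_probD(4)[OF m] by (simp add: Clopen_ops)
  next
    case (insert U \<F>)
    let ?V = "\<Union>\<F>"
    have U: "U \<in> Clopen T" "m U = 0" and V: "?V \<in> Clopen T" "m ?V = 0" using insert by auto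
    have "m (U \<union> ?V) = m U + m (?V - U)"
      using fin_add_probD(3)[OF m U(1) Clopen_ops(5)[OF V(1) U(1)]] by (simp add: Un_Diff_cancel)
    moreover have "m ?V = m (?V - U) + m (?V \<inter> U)"
    proof -
      have "(?V - U) \<union> (?V \<inter> U) = ?V" "(?V - U) \<inter> (?V \<inter> U) = {}" by blast+
      then show ?thesis
        using fin_add_probD(3)[OF m Clopen_ops(5)[OF V(1) U(1)] Clopen_ops(4)[OF V(1) U(1)]] by metis
    qed
    moreover have "0 \<le> m (?V - U)" "0 \<le> m (?V \<inter> U)"
      using fin_add_probD(1)[OF m Clopen_ops(5)[OF V(1) U(1)]] fin_add_probD(1)[OF m Clopen_ops(4)[OF V(1) U(1)]] .
    ultimately show ?case using U V Clopen_ops(3)[OF U(1) V(1)] by simp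
  qed
  moreover have "\<Union>\<F> = topspace T" using F(2,3) ClopenD(3) by blast
  ultimately show False using fin_add_probD(2)[OF m] by simp
qed

text \<open>
  Let \<open>y\<close> be a point of the support of \<open>f(- | x)\<close>. Since \<open>g f = id\<close>, the nonnegative function \<open>g(V | -)\<close> has
  integral zero with respect to \<open>f(- | x)\<close> if \<open>x \<notin> V\<close>; being locally constant, it vanishes at \<open>y\<close>. Hence
  \<open>g(- | y) = \<delta>\<^sub>x\<close>, and \<open>f(- | x) = (f g)(- | y) = \<delta>\<^sub>y\<close> since \<open>f g = id\<close>.
\<close>

lemma iso_kernel_det:
  assumes f: "f \<in> hom StoneStoch S T" and g: "g \<in> hom StoneStoch T S"
    and gf: "g \<cdot>\<^bsub>StoneStoch\<^esub> f = Idt StoneStoch S" and fg: "f \<cdot>\<^bsub>StoneStoch\<^esub> g = Idt StoneStoch T"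
  obtains h where "continuous_map S T h" "f = stone_det S h T"
proof -
  note F = kernelD[OF f] and G = kernelD[OF g]
  have ex: "\<exists>y\<in>topspace T. \<forall>U\<in>Clopen T. fn f U x = (if y \<in> U then 1 else 0)" if x: "x \<in> topspace S" for x
  proof -
    note m = F(8)[OF x]
    obtain y where y: "y \<in> topspace T" "\<And>U. U \<in> Clopen T \<Longrightarrow> y \<in> U \<Longrightarrow> 0 < fn f U x"
      using support_nonempty[OF F(4) m] by blast
    have 0: "fn g V y = 0" if V: "V \<in> Clopen S" "x \<notin> V" for V
    proof -
      let ?l = "\<lambda>r. {z \<in> topspace T. fn g V z = r}"
      have "fn (g \<cdot>\<^bsub>StoneStoch\<^esub> f) V x = 0"
        unfolding gf using V by (simp add: stone_det_def)
      then have "integ T (\<lambda>U. fn f U x) (fn g V) = 0"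
        unfolding fn_StoneStoch_Comp F(2) .
      then have sum: "(\<Sum>r\<in>fn g V ` topspace T. r * fn f (?l r) x) = 0" by (simp add: integ_def)
      have nonneg: "0 \<le> r * fn f (?l r) x" if "r \<in> fn g V ` topspace T" for r
        using that fin_add_probD(1)[OF G(8) V(1)] fin_add_probD(1)[OF m locally_const_fibre[OF G(7)]] by auto
      have "\<forall>r\<in>fn g V ` topspace T. r * fn f (?l r) x = 0"
        by (rule iffD1[OF sum_nonneg_eq_0_iff[OF locally_const_finite[OF F(6) G(7)] nonneg] sum])
      then have "fn g V y * fn f (?l (fn g V y)) x = 0"
        using y(1) by auto
      moreover have "0 < fn f (?l (fn g V y)) x"
        using y by (intro y(2) locally_const_fibre[OF G(7)]) simp
      ultimately show ?thesis by simp
    qed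
    have dirac: "fn g V y = (if x \<in> V then 1 else 0)" if V: "V \<in> Clopen S" for V
    proof (cases "x \<in> V")
      case True
      have c: "topspace S - V \<in> Clopen S" by (rule Clopen_ops(5)[OF Clopen_ops(1) V])
      have "V \<union> (topspace S - V) = topspace S" using ClopenD(3)[OF V] by blast
      then have "fn g V y + fn g (topspace S - V) y = 1"
        using fin_add_probD(3)[OF G(8)[OF y(1)] V c] fin_add_probD(2)[OF G(8)[OF y(1)]] by auto
      then show ?thesis using True 0[OF c] by simp
    next
      case False
      then show ?thesis using 0[OF V] by simp
    qed
    have "fn f U x = (if y \<in> U then 1 else 0)" if U: "U \<in> Clopen T" for U
    proof -
      have "fn (f \<cdot>\<^bsub>StoneStoch\<^esub> g) U y = integ S (\<lambda>V. fn (stone_det T (\<lambda>_. x) S) V y) (fn f U)"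
        unfolding fn_StoneStoch_Comp G(2)
        by (rule integ_measure_cong[OF F(7)]) (simp add: dirac stone_det_def y(1))
      also have "\<dots> = fn (f \<cdot>\<^bsub>StoneStoch\<^esub> stone_det T (\<lambda>_. x) S) U y"
        by (simp add: fn_StoneStoch_Comp stone_det_def)
      also have "\<dots> = fn f U x"
        using comp_stone_det[OF f x y(1)] .
      finally show ?thesis using fg U y(1) by (simp add: stone_det_def)
    qed
    then show ?thesis using y(1) by blast
  qed
  then obtain h where h: "\<And>x. x \<in> topspace S \<Longrightarrow> h x \<in> topspace T \<and> (\<forall>U\<in>Clopen T. fn f U x = (if h x \<in> U then 1 else 0))"
    by metis
  have c: "continuous_map S T h"
  proof (rule continuous_map_Clopen[OF F(4)])
    show "h x \<in> topspace T" if "x \<in> topspace S" for x using h that by blast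
    fix U assume U: "U \<in> Clopen T"
    have "{x \<in> topspace S. h x \<in> U} = {x \<in> topspace S. fn f U x = 1}"
      using h U by (auto split: if_splits)
    then show "{x \<in> topspace S. h x \<in> U} \<in> Clopen S" using locally_const_fibre[OF F(7)] by simp
  qed
  moreover have "f = stone_det S h T"
    by (rule kernel_ext[OF f stone_det_hom[OF F(3,4) c]]) (use h in \<open>simp add: stone_det_def\<close>)
  ultimately show thesis by (rule that)
qed

lemma stone_det_inverse:
  assumes st: "stone_space S" "stone_space T" and h: "continuous_map S T h" and k: "continuous_map T S k"
    and eq: "stone_det T k S \<cdot>\<^bsub>StoneStoch\<^esub> stone_det S h T = Idt StoneStoch S" and x: "x \<in> topspace S"
  shows "k (h x) = x"
proof (rule stone_separate[OF st(1)])
  have hx: "h x \<in> topspace T" using h x continuous_map_image_subset_topspace by blast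
  show "k (h x) \<in> topspace S" using k hx continuous_map_image_subset_topspace by blast
  show "x \<in> topspace S" by (rule x)
  show "k (h x) \<in> U \<longleftrightarrow> x \<in> U" if U: "U \<in> Clopen S" for U
    using comp_stone_det[where h = h, OF stone_det_hom[OF st(2,1) k] hx x, of U] eq U x hx
    by (simp add: stone_det_def split: if_splits)
qed

lemma isomorphic_homeomorphic:
  assumes "isomorphic StoneStoch S T"
  shows "S homeomorphic_space T"
proof -
  obtain f where f: "f \<in> hom StoneStoch S T" "is_iso StoneStoch f"
    using assms by (auto simp: isomorphic_def)
  let ?g = "inv_arrow StoneStoch f"
  note g = St.inv_arrow[OF f]
  obtain h where h: "continuous_map S T h" "f = stone_det S h T"
    using iso_kernel_det[OF f(1) g] by blast
  obtain k where k: "continuous_map T S k" "?g = stone_det T k S"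
    using iso_kernel_det[OF g(1) f(1) g(3,2)] by blast
  have st: "stone_space S" "stone_space T" using kernelD[OF f(1)] by auto
  have "k (h x) = x" if "x \<in> topspace S" for x
    using stone_det_inverse[OF st h(1) k(1) _ that] g(2) h(2) k(2) by simp
  moreover have "h (k y) = y" if "y \<in> topspace T" for y
    using stone_det_inverse[OF st(2,1) k(1) h(1) _ that] g(3) h(2) k(2) by simp
  ultimately show ?thesis
    using h(1) k(1) unfolding homeomorphic_space_def homeomorphic_maps_def by blast
qed

lemma stone_det_iso:
  assumes st: "stone_space S" "stone_space T" and hk: "homeomorphic_maps S T h k"
  shows "is_iso StoneStoch (stone_det S h T)"
proof -
  have c: "continuous_map S T h" "continuous_map T S k"
    and inv: "\<And>x. x \<in> topspace S \<Longrightarrow> k (h x) = x" "\<And>y. y \<in> topspace T \<Longrightarrow> h (k y) = y"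
    using hk by (auto simp: homeomorphic_maps_def)
  have mem: "\<And>x. x \<in> topspace S \<Longrightarrow> h x \<in> topspace T" "\<And>y. y \<in> topspace T \<Longrightarrow> k y \<in> topspace S"
    using c continuous_map_image_subset_topspace by blast+
  note d = stone_det_hom[OF st c(1)] and d' = stone_det_hom[OF st(2,1) c(2)]
  show ?thesis
  proof (rule St.isoI[OF d d'])
    show "stone_det T k S \<cdot>\<^bsub>StoneStoch\<^esub> stone_det S h T = Idt StoneStoch S"
      by (rule kernel_ext[OF kernel_comp_hom[OF d d'] St.id_hom])
         (use st comp_stone_det[where h = h, OF d' mem(1)] inv mem in \<open>auto simp: stone_det_def\<close>)
    show "stone_det S h T \<cdot>\<^bsub>StoneStoch\<^esub> stone_det T k S = Idt StoneStoch T"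
      by (rule kernel_ext[OF kernel_comp_hom[OF d' d] St.id_hom])
         (use st comp_stone_det[where h = k, OF d mem(2)] inv mem in \<open>auto simp: stone_det_def\<close>)
  qed
qed

lemma homeomorphic_isomorphic:
  assumes "stone_space S" "S homeomorphic_space T"
  shows "isomorphic StoneStoch S T"
proof -
  have st: "stone_space S" "stone_space T" using assms stone_homeomorphic by auto
  obtain h k where hk: "homeomorphic_maps S T h k" using assms(2) by (auto simp: homeomorphic_space_def)
  then have "continuous_map S T h" by (simp add: homeomorphic_maps_def)
  then show ?thesis
    using stone_det_iso[OF st hk] stone_det_hom[OF st] unfolding isomorphic_def by blast
qed

section \<open>Topological products of finite sets\<close>

lemma Clopen_discrete: "Clopen (discrete_topology A) = Pow A"
  by (auto simp: Clopen_def)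

subsection \<open>The inclusion of FinStoch\<close>

lemma fin_incl_simps:
  "FO fin_incl A = discrete_topology A"
  "fn (FA fin_incl f) U x = (if U \<subseteq> tgt f then \<Sum>y\<in>U. fn f y x else 0)"
  "src (FA fin_incl f) = discrete_topology (src f)" "tgt (FA fin_incl f) = discrete_topology (tgt f)"
  by (simp_all add: fin_incl_def)

lemma fin_incl_hom:
  assumes f: "f \<in> hom FinStoch A B"
  shows "FA fin_incl f \<in> hom StoneStoch (discrete_topology A) (discrete_topology B)"
proof -
  have F: "finite A" "finite B" "src f = A" "tgt f = B" "\<And>y x. 0 \<le> fn f y x" "\<And>x. x \<in> A \<Longrightarrow> (\<Sum>y\<in>B. fn f y x) = 1"
    "\<And>y x. x \<notin> A \<Longrightarrow> fn f y x = 0"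
    using f by (auto simp: FinStoch_hom)
  show ?thesis
  proof (rule kernelI)
    show "fn (FA fin_incl f) (U \<union> V) x = fn (FA fin_incl f) U x + fn (FA fin_incl f) V x"
      if "U \<in> Clopen (discrete_topology B)" "V \<in> Clopen (discrete_topology B)" "U \<inter> V = {}" for x U V
    proof -
      have "U \<subseteq> B" "V \<subseteq> B" "finite U" "finite V" using that F(2) finite_subset by (auto simp: Clopen_discrete)
      then show ?thesis using that(3) F(4) by (simp add: fin_incl_simps sum.union_disjoint)
    qed
    show "locally_const (discrete_topology A) (fn (FA fin_incl f) U)" for U
      by (rule locally_constI) (auto simp: Clopen_discrete)
  qed (use F in \<open>auto simp: fin_incl_simps stone_discrete Clopen_discrete intro!: sum_nonneg\<close>)
qed

lemma fin_incl_det: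
  fixes A B :: "'a point set"
  assumes "finite B" "\<And>x. x \<in> A \<Longrightarrow> h x \<in> B"
  shows "FA fin_incl (fin_det A h B) = stone_det (discrete_topology A) h (discrete_topology B)"
proof -
  have *: "(\<Sum>y\<in>U. if x \<in> A \<and> y = h x then 1 else (0 :: real)) = (if x \<in> A \<and> h x \<in> U then 1 else 0)" if "U \<subseteq> B" for U x
    using finite_subset[OF that assms(1)] by (cases "x \<in> A") auto
  have eq: "(\<lambda>U x. if U \<subseteq> B then \<Sum>y\<in>U. if x \<in> A \<and> y = h x then 1 else (0 :: real) else 0) =
     (\<lambda>U x. if U \<in> Clopen (discrete_topology B) \<and> x \<in> topspace (discrete_topology A) \<and> h x \<in> U then 1 else 0)"
  proof (intro ext)
    show "(if U \<subseteq> B then \<Sum>y\<in>U. if x \<in> A \<and> y = h x then 1 else (0 :: real) else 0) =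
       (if U \<in> Clopen (discrete_topology B) \<and> x \<in> topspace (discrete_topology A) \<and> h x \<in> U then 1 else 0)" for U x
      by (cases "U \<subseteq> B")
         (simp_all only: * Clopen_discrete Pow_iff topspace_discrete_topology simp_thms if_True if_False)
  qed
  have incl: "FA fin_incl f = Arrow (discrete_topology (src f))
      (\<lambda>U x. if U \<subseteq> tgt f then \<Sum>y\<in>U. fn f y x else 0) (discrete_topology (tgt f))" for f :: "'a stoch"
    by (simp add: fin_incl_def)
  show ?thesis
    unfolding fin_det_def stone_det_def incl arrow.sel by (simp only: eq)
qed

lemma stone_det_det:
  assumes st: "stone_space S" "stone_space T" "stone_space R"
    and h: "continuous_map S T h" and k: "continuous_map T R k"
  shows "stone_det T k R \<cdot>\<^bsub>StoneStoch\<^esub> stone_det S h T = stone_det S (\<lambda>x. k (h x)) R"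
proof (rule kernel_ext[OF kernel_comp_hom[OF stone_det_hom[OF st(1,2) h] stone_det_hom[OF st(2,3) k]]])
  show "stone_det S (\<lambda>x. k (h x)) R \<in> hom StoneStoch S R"
    using continuous_map_compose[OF h k] by (intro stone_det_hom st) (simp add: o_def)
  fix U x assume x: "x \<in> topspace S"
  then have hx: "h x \<in> topspace T" using h continuous_map_image_subset_topspace by blast
  show "fn (stone_det T k R \<cdot>\<^bsub>StoneStoch\<^esub> stone_det S h T) U x = fn (stone_det S (\<lambda>x. k (h x)) R) U x"
    using comp_stone_det[where h = h, OF stone_det_hom[OF st(2,3) k] hx x] x hx by (simp add: stone_det_def)
qed

subsection \<open>The product space\<close>

definition unSq :: "'a point \<Rightarrow> nat \<Rightarrow> 'a point" where
  "unSq p = (case p of Sq f \<Rightarrow> f | _ \<Rightarrow> undefined)"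

lemma unSq_Sq [simp]: "unSq (Sq f) = f"
  by (simp add: unSq_def)

definition sprod :: "nat set \<Rightarrow> (nat \<Rightarrow> 'a point set) \<Rightarrow> 'a point topology" where
  "sprod J X = pullback_topology (Sq ` PiE J X) unSq (product_topology (\<lambda>j. discrete_topology (X j)) J)"

definition sproj :: "nat set \<Rightarrow> 'a point \<Rightarrow> 'a point" where
  "sproj F p = itup F (unSq p)"

lemma topspace_sprod: "topspace (sprod J X) = Sq ` PiE J X"
  by (auto simp: sprod_def topspace_pullback_topology)

lemma sprod_homeomorphic: "product_topology (\<lambda>j. discrete_topology (X j)) J homeomorphic_space sprod J X"
  unfolding homeomorphic_space_def homeomorphic_maps_def
proof (intro exI[of _ Sq] exI[of _ unSq] conjI)
  let ?P = "product_topology (\<lambda>j. discrete_topology (X j)) J"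
  have "continuous_map ?P ?P (unSq \<circ> Sq)"
    by (rule continuous_map_eq[OF continuous_map_id]) auto
  then show "continuous_map ?P (sprod J X) Sq"
    unfolding sprod_def by (rule continuous_map_pullback') auto
  have "continuous_map (sprod J X) ?P ((\<lambda>f. f) \<circ> unSq)"
    unfolding sprod_def by (rule continuous_map_pullback) simp
  then show "continuous_map (sprod J X) ?P unSq" by (simp add: o_def)
qed (auto simp: topspace_sprod)

lemma Clopen_Ball:
  assumes "finite F" "\<And>j. j \<in> F \<Longrightarrow> {p \<in> topspace T. P j p} \<in> Clopen T"
  shows "{p \<in> topspace T. \<forall>j\<in>F. P j p} \<in> Clopen T"
  using assms
proof (induction F rule: finite_induct)
  case empty
  then show ?case by (simp add: Clopen_ops)
next
  case (insert j F)
  have "{p \<in> topspace T. \<forall>j\<in>insert j F. P j p} = {p \<in> topspace T. P j p} \<inter> {p \<in> topspace T. \<forall>j\<in>F. P j p}" by auto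
  then show ?case using insert by (simp add: Clopen_ops(4))
qed

lemma sproj_eq_iff: "finite F \<Longrightarrow> sproj F p = sproj F p' \<longleftrightarrow> (\<forall>j\<in>F. unSq p j = unSq p' j)"
  by (simp add: sproj_def itup_eq_iff)

lemma sproj_mem: "F \<subseteq> J \<Longrightarrow> p \<in> topspace (sprod J X) \<Longrightarrow> sproj F p \<in> fprod X F"
  by (auto simp: topspace_sprod sproj_def intro!: fprodI)

lemma fproj_sproj: "finite F' \<Longrightarrow> F \<subseteq> F' \<Longrightarrow> fproj F F' (sproj F' p) = sproj F p"
  by (simp add: sproj_def fproj_itup)

lemma sproj_locally_const:
  assumes F: "F \<in> fin_sub J"
  shows "locally_const (sprod J X) (sproj F)"
proof (rule locally_constI)
  fix p assume p: "p \<in> topspace (sprod J X)"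
  have c: "continuous_map (sprod J X) (discrete_topology (X j)) (\<lambda>p. unSq p j)" if "j \<in> J" for j
  proof -
    have "continuous_map (sprod J X) (discrete_topology (X j)) ((\<lambda>f. f j) \<circ> unSq)"
      unfolding sprod_def by (rule continuous_map_pullback) (use that in \<open>rule continuous_map_product_projection\<close>)
    then show ?thesis by (simp add: o_def)
  qed
  have "{p' \<in> topspace (sprod J X). unSq p' j = unSq p j} \<in> Clopen (sprod J X)" if "j \<in> F" for j
  proof -
    have j: "j \<in> J" using that F by auto
    have "unSq p j \<in> X j" using p j by (auto simp: topspace_sprod)
    then have "{unSq p j} \<in> Clopen (discrete_topology (X j))" by (simp add: Clopen_discrete)
    from Clopen_preimage[OF c[OF j] this] show ?thesis by simp
  qed
  then have "{p' \<in> topspace (sprod J X). \<forall>j\<in>F. unSq p' j = unSq p j} \<in> Clopen (sprod J X)"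
    using F by (intro Clopen_Ball) auto
  then show "{p' \<in> topspace (sprod J X). sproj F p' = sproj F p} \<in> Clopen (sprod J X)"
    using F by (simp add: sproj_eq_iff)
qed

text \<open>
  Basic open sets of the product topology restrict finitely many coordinates.
\<close>

lemma sprod_nbhd:
  assumes W: "openin (sprod J X) W" and p: "p \<in> W"
  shows "\<exists>F\<in>fin_sub J. {p' \<in> topspace (sprod J X). sproj F p' = sproj F p} \<subseteq> W"
proof -
  let ?P = "product_topology (\<lambda>j. discrete_topology (X j)) J"
  obtain Q where Q: "openin ?P Q" "W = unSq -` Q \<inter> Sq ` PiE J X"
    using W unfolding sprod_def openin_pullback_topology by blast
  have "unSq p \<in> Q" using Q(2) p by auto
  then obtain U where U: "finite {i \<in> J. U i \<noteq> X i}" "unSq p \<in> PiE J U" "PiE J U \<subseteq> Q"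
    using Q(1) unfolding openin_product_topology_alt by fastforce
  let ?F = "{i \<in> J. U i \<noteq> X i}"
  have "{p' \<in> topspace (sprod J X). sproj ?F p' = sproj ?F p} \<subseteq> W"
  proof
    fix p' assume p': "p' \<in> {p' \<in> topspace (sprod J X). sproj ?F p' = sproj ?F p}"
    then obtain f where f: "p' = Sq f" "f \<in> PiE J X" by (auto simp: topspace_sprod)
    have "\<forall>j\<in>?F. unSq p' j = unSq p j"
      using p' sproj_eq_iff[OF U(1), of p' p] by blast
    then have agree: "f j = unSq p j" if "j \<in> ?F" for j
      using that f(1) by simp
    have "f j \<in> U j" if "j \<in> J" for j
      using agree[of j] f(2) U(2) that by (cases "U j = X j") auto
    then have "f \<in> PiE J U" using f(2) by (auto simp: PiE_iff)
    then show "p' \<in> W" using Q(2) U(3) f by auto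
  qed
  then show ?thesis using U(1) by (intro bexI[of _ ?F]) auto
qed

lemma sprod_compact: 
  assumes X: "\<And>j. j \<in> J \<Longrightarrow> finite (X j)"
  shows "compact_space (sprod J X)"
proof -
  have "compact_space (product_topology (\<lambda>j. discrete_topology (X j)) J)"
    using X by (simp add: compact_space_product_topology compact_space_discrete_topology)
  then show ?thesis using homeomorphic_compact_space[OF sprod_homeomorphic[of X J]] by simp
qed

lemma sprod_stone:
  assumes X: "\<And>j. j \<in> J \<Longrightarrow> finite (X j)"
  shows "stone_space (sprod J X)"
  unfolding stone_space_def
proof (intro conjI allI impI sprod_compact X)
  have "Hausdorff_space (product_topology (\<lambda>j. discrete_topology (X j)) J)"
    by (simp add: Hausdorff_space_product_topology)
  then show "Hausdorff_space (sprod J X)" using homeomorphic_Hausdorff_space[OF sprod_homeomorphic[of X J]] by simp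
  fix U p assume U: "openin (sprod J X) U \<and> p \<in> U"
  then obtain F where F: "F \<in> fin_sub J" "{p' \<in> topspace (sprod J X). sproj F p' = sproj F p} \<subseteq> U"
    using sprod_nbhd[of J X U p] by blast
  have "p \<in> topspace (sprod J X)" using U openin_subset by blast
  then show "\<exists>V\<in>Clopen (sprod J X). p \<in> V \<and> V \<subseteq> U"
    using F(2) locally_const_fibre[OF sproj_locally_const[OF F(1)]]
    by (intro bexI[of _ "{p' \<in> topspace (sprod J X). sproj F p' = sproj F p}"]) auto
qed

text \<open>
  Near each point \<open>p\<close>, the function is determined by the coordinates in a finite set \<open>F p\<close>. By compactness,
  finitely many of these neighbourhoods cover the product, and the union of their sets \<open>F p\<close> suffices.
\<close>

lemma sprod_finite_dependence:
  assumes X: "\<And>j. j \<in> J \<Longrightarrow> finite (X j)" and g: "locally_const (sprod J X) g"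
  shows "\<exists>F\<in>fin_sub J. \<forall>p\<in>topspace (sprod J X). \<forall>p'\<in>topspace (sprod J X). sproj F p = sproj F p' \<longrightarrow> g p = g p'"
proof -
  let ?T = "topspace (sprod J X)"
  have "\<exists>F\<in>fin_sub J. \<forall>p'\<in>?T. sproj F p' = sproj F p \<longrightarrow> g p' = g p" if p: "p \<in> ?T" for p
    using sprod_nbhd[OF ClopenD(1)[OF locally_const_fibre[OF g, of "g p"]], of p] p by blast
  then obtain F where F: "\<And>p. p \<in> ?T \<Longrightarrow> F p \<in> fin_sub J"
    "\<And>p p'. p \<in> ?T \<Longrightarrow> p' \<in> ?T \<Longrightarrow> sproj (F p) p' = sproj (F p) p \<Longrightarrow> g p' = g p" by metis
  let ?c = "\<lambda>p. {p' \<in> ?T. sproj (F p) p' = sproj (F p) p}"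
  have "(\<forall>U\<in>?c ` ?T. openin (sprod J X) U) \<and> ?T \<subseteq> \<Union>(?c ` ?T)"
    using ClopenD(1)[OF locally_const_fibre[OF sproj_locally_const[OF F(1)]]] by blast
  then obtain \<F> where \<F>: "finite \<F>" "\<F> \<subseteq> ?c ` ?T" "?T \<subseteq> \<Union>\<F>"
    using sprod_compact[of J X] X unfolding compact_space_alt by meson
  obtain A where A: "A \<subseteq> ?T" "finite A" "\<F> = ?c ` A"
    using finite_subset_image[OF \<F>(1,2)] by blast
  let ?F = "\<Union>p\<in>A. F p"
  have FA: "?F \<in> fin_sub J" using A(1,2) F(1) by fastforce
  have "g p = g p'" if p: "p \<in> ?T" "p' \<in> ?T" "sproj ?F p = sproj ?F p'" for p p'
  proof -
    obtain r where r: "r \<in> A" "sproj (F r) p = sproj (F r) r"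
      using p(1) \<F>(3) A(3) by auto
    have "sproj (F r) p' = sproj (F r) p"
      using p(3) FA r(1) A(1) F(1)[of r] by (auto simp: sproj_eq_iff)
    then show ?thesis using F(2)[of r p] F(2)[of r p'] r A(1) p by auto
  qed
  then show ?thesis using FA by blast
qed

text \<open>If a factor is empty, then so is the product, and the projections are not surjective until that
  factor is included.\<close>

lemma sproj_surj:
  "\<exists>F0\<in>fin_sub J. \<forall>F\<in>fin_sub J. F0 \<subseteq> F \<longrightarrow> sproj F ` topspace (sprod J X) = fprod X F"
proof (cases "\<exists>j\<in>J. X j = {}")
  case True
  then obtain j where j: "j \<in> J" "X j = {}" by blast
  have "fprod X F = {}" if "j \<in> F" for F using j(2) that by (auto simp: fprod_def)
  moreover have "topspace (sprod J X) = {}" using j by (auto simp: topspace_sprod PiE_eq_empty_iff)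
  ultimately show ?thesis using j(1) by (intro bexI[of _ "{j}"]) auto
next
  case False
  define c where "c j = (SOME x. x \<in> X j)" for j
  have c: "c j \<in> X j" if "j \<in> J" for j
    using False that unfolding c_def by (simp add: some_in_eq)
  have "t \<in> sproj F ` topspace (sprod J X)" if F: "F \<in> fin_sub J" and t: "t \<in> fprod X F" for F t
  proof -
    obtain f where f: "t = itup F f" "\<And>j. j \<in> F \<Longrightarrow> f j \<in> X j" using fprodE[OF t] by metis
    let ?g = "\<lambda>j. if j \<in> F then f j else if j \<in> J then c j else undefined"
    have "?g \<in> PiE J X" using F f(2) c by auto
    then have "Sq ?g \<in> topspace (sprod J X)" by (simp add: topspace_sprod)
    moreover have "sproj F (Sq ?g) = t" using F f(1) by (simp add: sproj_def itup_eq_iff)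
    ultimately show ?thesis by blast
  qed
  then show ?thesis using sproj_mem[of _ J _ X] by (intro bexI[of _ "{}"]) auto
qed

context
  fixes J :: "nat set" and X :: "nat \<Rightarrow> 'a point set"
  assumes X: "\<And>j. j \<in> J \<Longrightarrow> finite (X j)"
begin

definition spr :: "nat set \<Rightarrow> 'a kernel" where
  "spr F = stone_det (sprod J X) (sproj F) (discrete_topology (fprod X F))"

lemma finite_fprod': "F \<in> fin_sub J \<Longrightarrow> finite (fprod X F)"
  using X by (auto intro: finite_fprod)

lemma stone_fprod: "F \<in> fin_sub J \<Longrightarrow> stone_space (discrete_topology (fprod X F))"
  using finite_fprod' by (rule stone_discrete)

lemma sproj_continuous:
  assumes "F \<in> fin_sub J"
  shows "continuous_map (sprod J X) (discrete_topology (fprod X F)) (sproj F)"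
proof (rule continuous_map_Clopen[OF stone_fprod[OF assms]])
  show "sproj F p \<in> topspace (discrete_topology (fprod X F))" if "p \<in> topspace (sprod J X)" for p
    using sproj_mem that assms by auto
  show "{p \<in> topspace (sprod J X). sproj F p \<in> U} \<in> Clopen (sprod J X)" for U
    by (rule locally_const_level[OF sproj_locally_const[OF assms]])
qed

lemma spr_hom: "F \<in> fin_sub J \<Longrightarrow> spr F \<in> hom StoneStoch (sprod J X) (discrete_topology (fprod X F))"
  unfolding spr_def using sprod_stone[of J X] X stone_fprod sproj_continuous by (intro stone_det_hom) auto

lemma fproj_continuous:
  "F \<in> fin_sub J \<Longrightarrow> F' \<in> fin_sub J \<Longrightarrow> F \<subseteq> F' \<Longrightarrow>
    continuous_map (discrete_topology (fprod X F')) (discrete_topology (fprod X F)) (fproj F F')"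
  by (auto simp: fproj_mem)

lemma fin_incl_diagram:
  assumes "F \<in> fin_sub J" "F' \<in> fin_sub J" "F \<subseteq> F'"
  shows "FA (func_comp fin_incl (abstract_itp FinStoch X)) (F, F')
    = stone_det (discrete_topology (fprod X F')) (fproj F F') (discrete_topology (fprod X F))"
proof -
  have "FA (abstract_itp FinStoch X) (F, F') = fin_det (fprod X F') (fproj F F') (fprod X F)"
    using assms X by (intro abstract_itp_FA) auto
  then show ?thesis
    using assms finite_fprod'[OF assms(1)] by (simp add: fin_incl_det fproj_mem)
qed

lemma fin_incl_diagram_FO:
  "F \<in> fin_sub J \<Longrightarrow> FO (func_comp fin_incl (abstract_itp FinStoch X)) F = discrete_topology (fprod X F)"
  by (simp add: fin_incl_simps abstract_itp_FO)

definition determined :: "nat set \<Rightarrow> 'a point set \<Rightarrow> bool" where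
  "determined F U \<longleftrightarrow> U \<subseteq> topspace (sprod J X) \<and>
     (\<forall>p\<in>topspace (sprod J X). \<forall>p'\<in>topspace (sprod J X). sproj F p = sproj F p' \<longrightarrow> (p \<in> U \<longleftrightarrow> p' \<in> U))"

lemma determined_mono: "determined F U \<Longrightarrow> F \<subseteq> F' \<Longrightarrow> finite F' \<Longrightarrow> determined F' U"
  unfolding determined_def by (metis finite_subset sproj_eq_iff subsetD)

lemma Clopen_determined:
  assumes "U \<in> Clopen (sprod J X)"
  shows "\<exists>F\<in>fin_sub J. determined F U"
proof -
  have U: "{p \<in> topspace (sprod J X). p \<in> U} = U" "{p \<in> topspace (sprod J X). p \<notin> U} = topspace (sprod J X) - U"
    using ClopenD(3)[OF assms] by auto
  have "locally_const (sprod J X) (\<lambda>p. p \<in> U)"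
  proof (rule locally_constI)
    fix x show "{y \<in> topspace (sprod J X). (y \<in> U) = (x \<in> U)} \<in> Clopen (sprod J X)"
      using U assms Clopen_ops(5)[OF Clopen_ops(1) assms] by (cases "x \<in> U") auto
  qed
  from sprod_finite_dependence[OF X this] show ?thesis
    using ClopenD(3)[OF assms] unfolding determined_def by blast
qed

text \<open>
  A finitely additive Kolmogorov extension. A clopen set \<open>U\<close> of the product is determined by the coordinates
  in a finite set \<open>F\<close>, so a cone \<open>q\<close> forces the value \<open>q F (sproj F ` U)\<close> of the mediating kernel on \<open>U\<close>.
  Compatibility of the cone makes this independent of \<open>F\<close>, if \<open>F\<close> is large enough for the projection to be
  surjective; finite additivity is then inherited from a stage that is common to the sets involved.
\<close>

lemma sprod_limit:
  "is_limit (op_cat (FinLO J)) StoneStoch (func_comp fin_incl (abstract_itp FinStoch X)) (sprod J X) spr"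
proof -
  let ?D = "func_comp fin_incl (abstract_itp FinStoch X)" and ?P = "sprod J X"
  let ?d = "\<lambda>F F'. stone_det (discrete_topology (fprod X F')) (fproj F F') (discrete_topology (fprod X F))"
  have P: "stone_space ?P" using X by (rule sprod_stone)
  have cone: "is_cone (op_cat (FinLO J)) StoneStoch ?D M q \<longleftrightarrow> stone_space M \<and>
     (\<forall>F\<in>fin_sub J. q F \<in> hom StoneStoch M (discrete_topology (fprod X F))) \<and>
     (\<forall>F\<in>fin_sub J. \<forall>F'\<in>fin_sub J. F \<subseteq> F' \<longrightarrow> ?d F F' \<cdot>\<^bsub>StoneStoch\<^esub> q F' = q F)" for M q
    unfolding is_cone_def op_cat_simps FinLO_Ar_ball
    using fin_incl_diagram fin_incl_diagram_FO by (simp del: func_comp_simps)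
  show ?thesis
    unfolding is_limit_def
  proof (intro conjI allI impI)
    have "?d F F' \<cdot>\<^bsub>StoneStoch\<^esub> spr F' = spr F" if F: "F \<in> fin_sub J" "F' \<in> fin_sub J" "F \<subseteq> F'" for F F'
    proof -
      have fin: "finite F'" using F by simp
      show ?thesis
        unfolding spr_def
        by (subst stone_det_det[OF P stone_fprod[OF F(2)] stone_fprod[OF F(1)] sproj_continuous[OF F(2)] fproj_continuous[OF F]])
           (simp add: fproj_sproj[OF fin F(3)])
    qed
    then show "is_cone (op_cat (FinLO J)) StoneStoch ?D ?P spr"
      unfolding cone using P spr_hom by blast
    fix M q assume "is_cone (op_cat (FinLO J)) StoneStoch ?D M q"
    then have M: "stone_space M" and q: "\<And>F. F \<in> fin_sub J \<Longrightarrow> q F \<in> hom StoneStoch M (discrete_topology (fprod X F))"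
      and c: "\<And>F F'. F \<in> fin_sub J \<Longrightarrow> F' \<in> fin_sub J \<Longrightarrow> F \<subseteq> F' \<Longrightarrow> ?d F F' \<cdot>\<^bsub>StoneStoch\<^esub> q F' = q F"
      unfolding cone by auto
    note Q = kernelD[OF q]
    have compat: "fn (q F) V x = fn (q F') {t \<in> fprod X F'. fproj F F' t \<in> V} x"
      if F: "F \<in> fin_sub J" "F' \<in> fin_sub J" "F \<subseteq> F'" and V: "V \<subseteq> fprod X F" and x: "x \<in> topspace M" for F F' V x
      using stone_det_comp[OF q[OF F(2)] fproj_continuous[OF F] stone_fprod[OF F(1)] _ x, of V] V c[OF F]
      by (simp add: Clopen_discrete)
    from sproj_surj[of J X] obtain F0 where F0: "F0 \<in> fin_sub J"
      and surj0: "\<forall>F\<in>fin_sub J. F0 \<subseteq> F \<longrightarrow> sproj F ` topspace ?P = fprod X F" by (rule bexE)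
    note surj = surj0[rule_format]
    have img: "sproj F ` U \<subseteq> fprod X F" if "F \<in> fin_sub J" "U \<subseteq> topspace ?P" for F U
      using sproj_mem[of F J _ X] that by auto
    have lift: "fn (q F) (sproj F ` U) x = fn (q F') (sproj F' ` U) x"
      if F: "F \<in> fin_sub J" "F' \<in> fin_sub J" "F0 \<subseteq> F" "F \<subseteq> F'" and U: "determined F U" and x: "x \<in> topspace M" for F F' U x
    proof -
      have fin: "finite F'" using F by simp
      have UP: "U \<subseteq> topspace ?P" using U by (simp add: determined_def)
      have "{t \<in> fprod X F'. fproj F F' t \<in> sproj F ` U} = sproj F' ` U"
      proof (intro subset_antisym subsetI)
        fix t assume t: "t \<in> {t \<in> fprod X F'. fproj F F' t \<in> sproj F ` U}"
        then obtain p where p: "p \<in> topspace ?P" "t = sproj F' p"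
          using surj[OF F(2)] F(3,4) by blast
        have "sproj F p \<in> sproj F ` U" using t p(2) fproj_sproj[OF fin F(4), of p] by simp
        then show "t \<in> sproj F' ` U" using U p UP unfolding determined_def by blast
      next
        fix t assume "t \<in> sproj F' ` U"
        then show "t \<in> {t \<in> fprod X F'. fproj F F' t \<in> sproj F ` U}"
          using img[OF F(2) UP] by (auto simp: fproj_sproj[OF fin F(4)])
      qed
      then show ?thesis
        using compat[OF F(1,2,4) img[OF F(1) UP] x] by simp
    qed
    define good where "good F U \<longleftrightarrow> F \<in> fin_sub J \<and> F0 \<subseteq> F \<and> determined F U" for F U
    have good_ex: "\<exists>F. good F U \<and> good F V" if U: "U \<in> Clopen ?P" and V: "V \<in> Clopen ?P" for U V
    proof -
      obtain F F' where "F \<in> fin_sub J" "determined F U" "F' \<in> fin_sub J" "determined F' V"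
        using Clopen_determined[OF U] Clopen_determined[OF V] by auto
      then have "good (F \<union> F' \<union> F0) U \<and> good (F \<union> F' \<union> F0) V"
        using F0 determined_mono[of F U "F \<union> F' \<union> F0"] determined_mono[of F' V "F \<union> F' \<union> F0"] by (auto simp: good_def)
      then show ?thesis by blast
    qed
    define h where "h = Arrow M (\<lambda>U x. if U \<in> Clopen ?P \<and> x \<in> topspace M
      then fn (q (SOME F. good F U)) (sproj (SOME F. good F U) ` U) x else 0) ?P"
    have h_val: "fn h U x = fn (q F) (sproj F ` U) x"
      if U: "U \<in> Clopen ?P" and F: "good F U" and x: "x \<in> topspace M" for U F x
    proof -
      define G where "G = (SOME F. good F U)"
      have G: "good G U" unfolding G_def using F by (rule someI)
      have FG: "F \<union> G \<in> fin_sub J" using F G by (auto simp: good_def)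
      have "fn (q G) (sproj G ` U) x = fn (q (F \<union> G)) (sproj (F \<union> G) ` U) x"
        using G FG x by (intro lift) (auto simp: good_def)
      moreover have "fn (q F) (sproj F ` U) x = fn (q (F \<union> G)) (sproj (F \<union> G) ` U) x"
        using F FG x by (intro lift) (auto simp: good_def)
      ultimately show ?thesis using U x by (simp add: h_def G_def)
    qed
    have h: "h \<in> hom StoneStoch M ?P"
    proof (rule kernelI[OF M P])
      show "locally_const M (fn h U)" if U: "U \<in> Clopen ?P" for U
      proof -
        obtain F where F: "good F U" using good_ex[OF U U] by blast
        then have "F \<in> fin_sub J" by (simp add: good_def)
        from Q(7)[OF this] show ?thesis by (rule locally_const_cong) (rule h_val[OF U F])
      qed
      show "0 \<le> fn h U x" if x: "x \<in> topspace M" and U: "U \<in> Clopen ?P" for x U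
      proof -
        obtain F where F: "good F U" using good_ex[OF U U] by blast
        then have F': "F \<in> fin_sub J" and UP: "U \<subseteq> topspace ?P" by (auto simp: good_def determined_def)
        show ?thesis
          unfolding h_val[OF U F x] using img[OF F' UP] by (intro fin_add_probD(1)[OF Q(8)[OF F' x]]) (simp add: Clopen_discrete)
      qed
      show "fn h (topspace ?P) x = 1" if x: "x \<in> topspace M" for x
      proof -
        have g: "good F0 (topspace ?P)" using F0 by (auto simp: good_def determined_def)
        show ?thesis
          unfolding h_val[OF Clopen_ops(1) g x] surj[OF F0 subset_refl] using fin_add_probD(2)[OF Q(8)[OF F0 x]] by simp
      qed
      show "fn h (U \<union> V) x = fn h U x + fn h V x"
        if x: "x \<in> topspace M" and U: "U \<in> Clopen ?P" and V: "V \<in> Clopen ?P" and UV: "U \<inter> V = {}" for x U V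
      proof -
        obtain F where F: "good F U" "good F V" using good_ex[OF U V] by blast
        then have F': "F \<in> fin_sub J" and UP: "U \<subseteq> topspace ?P" "V \<subseteq> topspace ?P" by (auto simp: good_def determined_def)
        have g: "good F (U \<union> V)" using F unfolding good_def determined_def by blast
        have "sproj F ` U \<inter> sproj F ` V = {}"
          using F(1) UV UP unfolding good_def determined_def by blast
        then show ?thesis
          unfolding h_val[OF U F(1) x] h_val[OF V F(2) x] h_val[OF Clopen_ops(3)[OF U V] g x] image_Un
          using img[OF F'] UP by (intro fin_add_probD(3)[OF Q(8)[OF F' x]]) (auto simp: Clopen_discrete)
      qed
    qed (auto simp: h_def)
    have spr_val: "fn (spr F \<cdot>\<^bsub>StoneStoch\<^esub> g) V x = fn g {p \<in> topspace ?P. sproj F p \<in> V} x"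
      if "F \<in> fin_sub J" "g \<in> hom StoneStoch M ?P" "V \<subseteq> fprod X F" "x \<in> topspace M" for F g V x
      unfolding spr_def
      using stone_det_comp[OF that(2) sproj_continuous[OF that(1)] stone_fprod[OF that(1)] _ that(4), of V] that(3)
      by (simp add: Clopen_discrete)
    have hq: "spr F \<cdot>\<^bsub>StoneStoch\<^esub> h = q F" if F: "F \<in> fin_sub J" for F
    proof (rule kernel_ext[OF kernel_comp_hom[OF h spr_hom[OF F]] q[OF F]])
      fix V x assume V: "V \<in> Clopen (discrete_topology (fprod X F))" and x: "x \<in> topspace M"
      let ?U = "{p \<in> topspace ?P. sproj F p \<in> V}" and ?F = "F \<union> F0"
      have V': "V \<subseteq> fprod X F" using V by (simp add: Clopen_discrete)
      have F': "?F \<in> fin_sub J" "finite ?F" using F F0 by auto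
      have U: "?U \<in> Clopen ?P" by (rule locally_const_level[OF sproj_locally_const[OF F]])
      have "determined F ?U" by (auto simp: determined_def)
      then have g: "good ?F ?U" using F' determined_mono[of F ?U ?F] by (simp add: good_def)
      have "sproj ?F ` ?U = {t \<in> fprod X ?F. fproj F ?F t \<in> V}"
      proof (intro subset_antisym subsetI)
        fix t assume "t \<in> {t \<in> fprod X ?F. fproj F ?F t \<in> V}"
        then have "t \<in> sproj ?F ` topspace ?P" "fproj F ?F t \<in> V"
          using surj[OF F'(1)] by auto
        then obtain p where "p \<in> topspace ?P" "t = sproj ?F p" "fproj F ?F t \<in> V" by blast
        then show "t \<in> sproj ?F ` ?U" by (auto simp: fproj_sproj[OF F'(2)])
      qed (use surj[OF F'(1)] in \<open>auto simp: fproj_sproj[OF F'(2)]\<close>)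
      then show "fn (spr F \<cdot>\<^bsub>StoneStoch\<^esub> h) V x = fn (q F) V x"
        using spr_val[OF F h V' x] h_val[OF U g x] compat[OF F F'(1) _ V' x] by simp
    qed
    have uniq: "h' = h" if h': "h' \<in> hom StoneStoch M ?P" and eq: "\<And>F. F \<in> fin_sub J \<Longrightarrow> spr F \<cdot>\<^bsub>StoneStoch\<^esub> h' = q F" for h'
    proof (rule kernel_ext[OF h' h])
      fix U x assume U: "U \<in> Clopen ?P" and x: "x \<in> topspace M"
      obtain F where F: "good F U" using good_ex[OF U U] by blast
      then have F': "F \<in> fin_sub J" and UP: "U \<subseteq> topspace ?P" by (auto simp: good_def determined_def)
      have "{p \<in> topspace ?P. sproj F p \<in> sproj F ` U} = U"
        using F unfolding good_def determined_def by blast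
      then show "fn h' U x = fn h U x"
        using spr_val[OF F' h' img[OF F' UP] x] eq[OF F'] h_val[OF U F x] by simp
    qed
    show "\<exists>!h. h \<in> hom StoneStoch M ?P \<and> (\<forall>k\<in>Ob (op_cat (FinLO J)). spr k \<cdot>\<^bsub>StoneStoch\<^esub> h = q k)"
    proof (rule ex1I[of _ h])
      show "h \<in> hom StoneStoch M ?P \<and> (\<forall>k\<in>Ob (op_cat (FinLO J)). spr k \<cdot>\<^bsub>StoneStoch\<^esub> h = q k)"
        using h hq by simp
      show "h' = h" if "h' \<in> hom StoneStoch M ?P \<and> (\<forall>k\<in>Ob (op_cat (FinLO J)). spr k \<cdot>\<^bsub>StoneStoch\<^esub> h' = q k)" for h'
        by (rule uniq) (use that in simp_all)
    qed
  qed
qed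

lemma fin_incl_spr:
  assumes F: "F \<in> fin_sub J" and f: "f \<in> hom FinStoch (fprod X F) B" and p: "p \<in> topspace (sprod J X)" and U: "U \<subseteq> B"
  shows "fn (FA fin_incl f \<cdot>\<^bsub>StoneStoch\<^esub> spr F) U p = (\<Sum>b\<in>U. fn f b (sproj F p))"
proof -
  have "sproj F p \<in> topspace (discrete_topology (fprod X F))" using sproj_mem[of F J p X] F p by auto
  moreover have "tgt f = B" using f by (simp add: FinStoch_hom)
  ultimately show ?thesis
    unfolding spr_def using comp_stone_det[where h = "sproj F", OF fin_incl_hom[OF f] _ p, of U] U by (simp add: fin_incl_simps)
qed

text \<open>
  The values \<open>k({b} | -)\<close> for \<open>b \<in> B\<close> depend on finitely many coordinates. At a stage \<open>F\<close> containing these and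
  with surjective projection, a preimage of each point of the finite product gives the values of \<open>f\<close>.
\<close>

lemma sprod_factor:
  assumes k: "k \<in> hom StoneStoch (sprod J X) (discrete_topology B)" and B: "finite B"
  shows "\<exists>F\<in>fin_sub J. \<exists>f\<in>hom FinStoch (fprod X F) B. k = FA fin_incl f \<cdot>\<^bsub>StoneStoch\<^esub> spr F"
proof -
  note K = kernelD[OF k]
  let ?P = "sprod J X"
  have lc: "locally_const ?P (\<lambda>p. \<lambda>b\<in>B. fn k {b} p)"
  proof (rule locally_constI)
    fix x
    have "{y \<in> topspace ?P. (\<lambda>b\<in>B. fn k {b} y) = (\<lambda>b\<in>B. fn k {b} x)} = {y \<in> topspace ?P. \<forall>b\<in>B. fn k {b} y = fn k {b} x}"
      by (auto simp: restrict_def fun_eq_iff)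
    then show "{y \<in> topspace ?P. (\<lambda>b\<in>B. fn k {b} y) = (\<lambda>b\<in>B. fn k {b} x)} \<in> Clopen ?P"
      using Clopen_Ball[OF B, of ?P "\<lambda>b y. fn k {b} y = fn k {b} x"] locally_const_fibre[OF K(7)] by simp
  qed
  from sprod_finite_dependence[OF X lc] obtain F1 where F1: "F1 \<in> fin_sub J"
    and dep0: "\<forall>p\<in>topspace ?P. \<forall>p'\<in>topspace ?P. sproj F1 p = sproj F1 p' \<longrightarrow>
      (\<lambda>b\<in>B. fn k {b} p) = (\<lambda>b\<in>B. fn k {b} p')" by (rule bexE)
  note dep = dep0[rule_format]
  from sproj_surj[of J X] obtain F0 where F0: "F0 \<in> fin_sub J"
    and surj0: "\<forall>F\<in>fin_sub J. F0 \<subseteq> F \<longrightarrow> sproj F ` topspace ?P = fprod X F" by (rule bexE)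
  note surj = surj0[rule_format]
  let ?F = "F1 \<union> F0"
  have F: "?F \<in> fin_sub J" using F1 F0 by auto
  define r where "r t = (SOME p. p \<in> topspace ?P \<and> sproj ?F p = t)" for t
  have r: "r t \<in> topspace ?P \<and> sproj ?F (r t) = t" if "t \<in> fprod X ?F" for t
  proof -
    have "t \<in> sproj ?F ` topspace ?P" using surj[OF F] that by simp
    then have "\<exists>p. p \<in> topspace ?P \<and> sproj ?F p = t" by blast
    from someI_ex[OF this] show ?thesis unfolding r_def .
  qed
  have K1: "fn k U p = (\<Sum>b\<in>U. fn k {b} p)" if "p \<in> topspace ?P" "U \<subseteq> B" for U p
    using fin_add_prob_UN[OF K(8)[OF that(1)], of U "\<lambda>b. {b}"] that(2) finite_subset[OF that(2) B]
    by (auto simp: Clopen_discrete)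
  define f where "f = Arrow (fprod X ?F) (\<lambda>b t. if b \<in> B \<and> t \<in> fprod X ?F then fn k {b} (r t) else 0) B"
  have f: "f \<in> hom FinStoch (fprod X ?F) B"
    unfolding FinStoch_hom
  proof (intro conjI allI ballI impI)
    show "0 \<le> fn f b t" for b t
      using r[of t] fin_add_probD(1)[OF K(8), of "r t" "{b}"] by (auto simp: f_def Clopen_discrete)
    show "(\<Sum>b\<in>B. fn f b t) = 1" if t: "t \<in> fprod X ?F" for t
      using K1[of "r t" B] r[OF t] fin_add_probD(2)[OF K(8), of "r t"] t by (simp add: f_def)
  qed (use B finite_fprod'[OF F] in \<open>auto simp: f_def\<close>)
  have "k = FA fin_incl f \<cdot>\<^bsub>StoneStoch\<^esub> spr ?F"
  proof (rule kernel_ext[OF k kernel_comp_hom[OF spr_hom[OF F] fin_incl_hom[OF f]]])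
    fix U p assume U: "U \<in> Clopen (discrete_topology B)" and p: "p \<in> topspace ?P"
    have UB: "U \<subseteq> B" using U by (simp add: Clopen_discrete)
    have m: "sproj ?F p \<in> fprod X ?F" using surj[OF F] p by auto
    have "sproj F1 (r (sproj ?F p)) = sproj F1 p"
      using r[OF m] F F1 by (auto simp: sproj_eq_iff)
    then have e: "(\<lambda>b\<in>B. fn k {b} (r (sproj ?F p))) = (\<lambda>b\<in>B. fn k {b} p)"
      using dep[of "r (sproj ?F p)" p] r[OF m] p by simp
    have "fn k {b} (r (sproj ?F p)) = fn k {b} p" if "b \<in> B" for b
      using that fun_cong[OF e, of b] by simp
    then have "(\<Sum>b\<in>U. fn f b (sproj ?F p)) = (\<Sum>b\<in>U. fn k {b} p)"
      using UB m by (intro sum.cong) (auto simp: f_def)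
    then show "fn k U p = fn (FA fin_incl f \<cdot>\<^bsub>StoneStoch\<^esub> spr ?F) U p"
      using K1[OF p UB] fin_incl_spr[OF F f p UB] by simp
  qed
  then show ?thesis using F f by blast
qed

text \<open>
  The stage \<open>G\<close> is chosen with surjective projection, so that kernels which agree on the product agree on
  the finite product over \<open>G\<close>.
\<close>

lemma sprod_factor_unique:
  assumes F: "F \<in> fin_sub J" and F': "F' \<in> fin_sub J"
    and f: "f \<in> hom FinStoch (fprod X F) B" and f': "f' \<in> hom FinStoch (fprod X F') B"
    and eq: "FA fin_incl f \<cdot>\<^bsub>StoneStoch\<^esub> spr F = FA fin_incl f' \<cdot>\<^bsub>StoneStoch\<^esub> spr F'"
  shows "\<exists>G\<in>fin_sub J. F \<subseteq> G \<and> F' \<subseteq> G \<and>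
    f \<cdot>\<^bsub>FinStoch\<^esub> FA (abstract_itp FinStoch X) (F, G) = f' \<cdot>\<^bsub>FinStoch\<^esub> FA (abstract_itp FinStoch X) (F', G)"
proof -
  let ?P = "sprod J X"
  from sproj_surj[of J X] obtain F0 where F0: "F0 \<in> fin_sub J"
    and surj0: "\<forall>F\<in>fin_sub J. F0 \<subseteq> F \<longrightarrow> sproj F ` topspace ?P = fprod X F" by (rule bexE)
  note surj = surj0[rule_format]
  let ?G = "F \<union> F' \<union> F0"
  have G: "?G \<in> fin_sub J" "finite ?G" using F F' F0 by auto
  have d: "FA (abstract_itp FinStoch X) (H, ?G) = fin_det (fprod X ?G) (fproj H ?G) (fprod X H)" if "H \<subseteq> ?G" for H
    using G that X by (intro abstract_itp_FA) auto
  have dh: "fin_det (fprod X ?G) (fproj H ?G) (fprod X H) \<in> hom FinStoch (fprod X ?G) (fprod X H)" if "H \<in> fin_sub J" "H \<subseteq> ?G" for H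
    using G that finite_fprod' by (intro fin_det_hom) (auto intro: fproj_mem)
  have "f \<cdot>\<^bsub>FinStoch\<^esub> fin_det (fprod X ?G) (fproj F ?G) (fprod X F) = f' \<cdot>\<^bsub>FinStoch\<^esub> fin_det (fprod X ?G) (fproj F' ?G) (fprod X F')"
  proof (rule FinStoch_ext[OF FinStoch_comp_hom[OF dh[OF F] f] FinStoch_comp_hom[OF dh[OF F'] f']])
    fix t b assume t: "t \<in> fprod X ?G" and b: "b \<in> B"
    obtain p where p: "p \<in> topspace ?P" "t = sproj ?G p" using surj[OF G(1)] t by blast
    have "fn f b (sproj F p) = fn f' b (sproj F' p)"
      using fin_incl_spr[OF F f p(1), of "{b}"] fin_incl_spr[OF F' f' p(1), of "{b}"] eq b by simp
    moreover have "fproj F ?G t = sproj F p" "fproj F' ?G t = sproj F' p"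
      unfolding p(2) using G(2) by (auto intro!: fproj_sproj)
    moreover have e: "fn (k \<cdot>\<^bsub>FinStoch\<^esub> fin_det (fprod X ?G) (fproj H ?G) (fprod X H)) b t = fn k b (fproj H ?G t)"
      if "H \<subseteq> ?G" "k \<in> hom FinStoch (fprod X H) B" for H k
      by (rule comp_fin_det[OF _ finite_fprod'[OF G(1)] that(2) t]) (rule fproj_mem[OF G(2) that(1)])
    ultimately show "fn (f \<cdot>\<^bsub>FinStoch\<^esub> fin_det (fprod X ?G) (fproj F ?G) (fprod X F)) b t
        = fn (f' \<cdot>\<^bsub>FinStoch\<^esub> fin_det (fprod X ?G) (fproj F' ?G) (fprod X F')) b t"
    proof -
      have "F \<subseteq> ?G" "F' \<subseteq> ?G" by auto
      then show ?thesis
        using e[of F f] e[of F' f'] f f' \<open>fn f b (sproj F p) = _\<close> \<open>fproj F ?G t = _\<close> \<open>fproj F' ?G t = _\<close> by simp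
    qed
  qed auto
  moreover have s: "F \<subseteq> ?G" "F' \<subseteq> ?G" by auto
  ultimately have "f \<cdot>\<^bsub>FinStoch\<^esub> FA (abstract_itp FinStoch X) (F, ?G) = f' \<cdot>\<^bsub>FinStoch\<^esub> FA (abstract_itp FinStoch X) (F', ?G)"
    unfolding d[OF s(1)] d[OF s(2)] by blast
  then show ?thesis using G(1) s by blast
qed

end

section \<open>The extension of the inclusion to the completion\<close>

context
  fixes J :: "nat set" and X :: "nat \<Rightarrow> 'a point set" and L p
  assumes X: "\<And>j. j \<in> J \<Longrightarrow> finite (X j)"
    and lim: "is_limit (op_cat (FinLO J)) (copsh_op FinStoch) (func_comp (yoneda FinStoch) (abstract_itp FinStoch X)) L p"
begin

lemma limit_proj: "F \<in> fin_sub J \<Longrightarrow> p F \<in> hom FinStochI L (hom_copsh FinStoch (fprod X F))"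
proof -
  assume F: "F \<in> fin_sub J"
  have "is_limit (op_cat (FinLO J)) FinStochI (func_comp (yoneda FinStoch) (abstract_itp FinStoch X)) L p"
    using FinStochI_limit(2)[OF X lim] .
  then show ?thesis using F by (auto simp: is_limit_def is_cone_def abstract_itp_FO)
qed

lemma limit_proj_comp:
  assumes "F \<in> fin_sub J" "F' \<in> fin_sub J" "F \<subseteq> F'"
  shows "FA (yoneda FinStoch) (FA (abstract_itp FinStoch X) (F, F')) \<cdot>\<^bsub>FinStochI\<^esub> p F' = p F"
proof -
  have "is_cone (op_cat (FinLO J)) (copsh_op FinStoch) (func_comp (yoneda FinStoch) (abstract_itp FinStoch X)) L p"
    using lim by (simp add: is_limit_def)
  then have "\<forall>u\<in>Ar (FinLO J). FA (yoneda FinStoch) (FA (abstract_itp FinStoch X) u) \<cdot>\<^bsub>copsh_op FinStoch\<^esub> p (snd u) = p (fst u)"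
    unfolding is_cone_def op_cat_simps FinLO_simps(3,4) func_comp_simps by blast
  then show ?thesis
    unfolding FinLO_Ar_ball using assms by simp
qed

text \<open>
  By the Yoneda lemma, such an arrow is an element of \<open>L B\<close>, and \<open>L\<close> is the pointwise colimit of the finite stages.
\<close>

lemma limit_arrow_factor:
  assumes B: "finite B" and t: "t \<in> hom FinStochI L (hom_copsh FinStoch B)"
  shows "\<exists>F\<in>fin_sub J. \<exists>f\<in>hom FinStoch (fprod X F) B. t = FA (yoneda FinStoch) f \<cdot>\<^bsub>FinStochI\<^esub> p F"
proof -
  interpret P: presentation FinStoch "fin_sub J" "(\<subseteq>)" "FO (abstract_itp FinStoch X)" "\<lambda>F F'. FA (abstract_itp FinStoch X) (F, F')"
    L "\<lambda>F. app (p F) (FO (abstract_itp FinStoch X) F) (Hom_elt (Idt FinStoch (FO (abstract_itp FinStoch X) F)))"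
    by (rule itp_limit_presentation[OF X lim])
  have t': "t \<in> hom (copsh_op FinStoch) L (hom_copsh FinStoch B)"
    using t by (simp add: FinStochI_hom split: if_splits)
  have B': "B \<in> Ob FinStoch" using B by simp
  obtain F f where F: "F \<in> fin_sub J" and f: "f \<in> hom FinStoch (FO (abstract_itp FinStoch X) F) B"
    and eq: "app t B (Hom_elt (Idt FinStoch B)) =
      act L f (app (p F) (FO (abstract_itp FinStoch X) F) (Hom_elt (Idt FinStoch (FO (abstract_itp FinStoch X) F))))"
    using P.elt_surj[OF B' FS.yoneda_elt[OF t' B']] by blast
  have AF: "FO (abstract_itp FinStoch X) F = fprod X F" using F by (simp add: abstract_itp_FO)
  have f': "f \<in> hom FinStoch (fprod X F) B" using f AF by simp
  have pF: "p F \<in> hom (copsh_op FinStoch) L (hom_copsh FinStoch (fprod X F))"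
    using limit_proj[OF F] by (simp add: FinStochI_hom split: if_splits)
  have "t = FA (yoneda FinStoch) f \<cdot>\<^bsub>copsh_op FinStoch\<^esub> p F"
    by (rule FS.yoneda_ext[OF t' FS.copsh_comp(1)[OF pF FS.FA_yoneda(1)[OF f']]])
       (use eq FS.app_yoneda_comp[OF pF f'] AF in simp)
  then show ?thesis using F f' by auto
qed

end

lemma fin_incl_product_diagram:
  fixes X :: "nat \<Rightarrow> 'a point set"
  assumes X: "\<And>j. j \<in> J \<Longrightarrow> finite (X j)"
  shows "is_diagram (op_cat (FinLO J)) StoneStoch (func_comp fin_incl (abstract_itp FinStoch X))"
proof -
  let ?D = "func_comp fin_incl (abstract_itp FinStoch X)"
  have "FO ?D F \<in> Ob StoneStoch" if "F \<in> fin_sub J" for F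
    using that X finite_fprod[of F X] by (auto simp: abstract_itp_FO fin_incl_simps intro!: stone_discrete)
  moreover have "FA ?D (F, F') \<in> hom StoneStoch (FO ?D F') (FO ?D F)" if F: "F \<in> fin_sub J" "F' \<in> fin_sub J" "F \<subseteq> F'" for F F'
    using fin_incl_hom[OF directed_diagram.d_hom[OF FinStoch_directed_diagram[OF X] F]] by (simp add: fin_incl_simps(1))
  ultimately show ?thesis
    unfolding is_diagram_def op_cat_simps FinLO_Ar_ball by simp
qed

context
  fixes \<phi> :: "(('a point set, 'a stoch) copsh, ('a point set, 'a stoch) copsh_arrow, 'a point topology, 'a kernel) smfunc"
    and \<theta> :: "'a point set \<Rightarrow> 'a kernel"
  assumes smf: "is_smfunctor FinStochI StoneStoch \<phi>"
    and pres: "itp_preserving FinStochI StoneStoch \<phi>"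
    and iso: "is_monoidal_nat_iso FinStoch StoneStoch (smfunc_comp StoneStoch \<phi> (yoneda FinStoch)) fin_incl \<theta>"
begin

interpretation Ph: tensor_functor FinStochI StoneStoch \<phi>
  by (rule smfunctor_tensor_functor[OF smf FinStochI_semicartesian StoneStoch_semicartesian])

lemma theta:
  assumes "finite A"
  shows "\<theta> A \<in> hom StoneStoch (FO \<phi> (hom_copsh FinStoch A)) (discrete_topology A)" "is_iso StoneStoch (\<theta> A)"
  using iso assms by (auto simp: is_monoidal_nat_iso_def is_nat_trans_def smfunc_comp_def fin_incl_simps)

lemma theta_nat:
  assumes "f \<in> hom FinStoch A B"
  shows "\<theta> B \<cdot>\<^bsub>StoneStoch\<^esub> FA \<phi> (FA (yoneda FinStoch) f) = FA fin_incl f \<cdot>\<^bsub>StoneStoch\<^esub> \<theta> A"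
proof -
  have "f \<in> Ar FinStoch" "src f = A" "tgt f = B" using assms by (auto simp: hom_def)
  then show ?thesis
    using iso by (auto simp: is_monoidal_nat_iso_def is_nat_trans_def smfunc_comp_def)
qed

text \<open>
  The extension sends the limits defining the completion to the limits of the corresponding diagrams
  of finite discrete spaces. The comparison of the diagrams consists of the iterated structure
  isomorphisms of the Yoneda embedding and of \<open>\<phi>\<close>.
\<close>

lemma phi_limit:
  assumes X: "\<And>j. j \<in> J \<Longrightarrow> finite (X j)"
    and lim: "is_limit (op_cat (FinLO J)) (copsh_op FinStoch) (func_comp (yoneda FinStoch) (abstract_itp FinStoch X)) L p"
  shows "is_limit (op_cat (FinLO J)) StoneStoch (func_comp fin_incl (abstract_itp FinStoch X)) (FO \<phi> L)
    (\<lambda>F. \<theta> (fprod X F) \<cdot>\<^bsub>StoneStoch\<^esub> FA \<phi> (p F))"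
proof -
  let ?K = "op_cat (FinLO J)" and ?Y = "\<lambda>j. hom_copsh FinStoch (X j)"
  let ?E = "abstract_itp StoneStoch (\<lambda>j. FO \<phi> (?Y j))" and ?EI = "abstract_itp FinStochI ?Y"
  let ?D = "func_comp fin_incl (abstract_itp FinStoch X)"
  define mI where "mI F = mu_list FinStoch FinStochI (yoneda FinStoch) X (sorted_list_of_set F)" for F
  define mP where "mP F = mu_list FinStochI StoneStoch \<phi> ?Y (sorted_list_of_set F)" for F
  let ?r = "\<lambda>F. inv_arrow StoneStoch (mP F) \<cdot>\<^bsub>StoneStoch\<^esub> FA \<phi> (inv_arrow FinStochI (mI F) \<cdot>\<^bsub>FinStochI\<^esub> p F)"
  let ?b = "\<lambda>F. \<theta> (fprod X F) \<cdot>\<^bsub>StoneStoch\<^esub> FA \<phi> (mI F) \<cdot>\<^bsub>StoneStoch\<^esub> mP F"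
  have "is_itp StoneStoch J (\<lambda>j. FO \<phi> (?Y j)) (FO \<phi> L) ?r"
    using pres FinStochI_itp[OF X lim] unfolding itp_preserving_def mI_def mP_def by blast
  then have r: "is_limit ?K StoneStoch ?E (FO \<phi> L) ?r"
    by (simp add: is_itp_def)
  have XO: "X j \<in> Ob FinStoch" if "F \<in> fin_sub J" "j \<in> set (sorted_list_of_set F)" for F j
    using that X by auto
  have YO: "?Y j \<in> Ob FinStochI" if "j \<in> J" for j using X that FinStochI_representable by blast
  have YO': "?Y j \<in> Ob FinStochI" if "F \<in> fin_sub J" "j \<in> set (sorted_list_of_set F)" for F j
    using that YO by auto
  have E: "is_diagram ?K StoneStoch ?E" using Ph.F_ob[OF YO] by (rule St.abstract_itp_diagram)
  have EI: "is_diagram ?K FinStochI ?EI" using YO by (rule FI.abstract_itp_diagram)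
  have fin: "finite (fprod X F)" if "F \<in> fin_sub J" for F using X that by (auto intro: finite_fprod)
  have D: "is_diagram ?K StoneStoch ?D" using X by (rule fin_incl_product_diagram)
  have mI: "mI F \<in> hom FinStochI (FO ?EI F) (hom_copsh FinStoch (fprod X F))" "is_iso FinStochI (mI F)" if F: "F \<in> fin_sub J" for F
  proof -
    have "tens_list FinStoch X (sorted_list_of_set F) = fprod X F"
      using abstract_itp_FO[of F X] F by (simp add: abstract_itp_simps)
    then show "mI F \<in> hom FinStochI (FO ?EI F) (hom_copsh FinStoch (fprod X F))" "is_iso FinStochI (mI F)"
      unfolding mI_def using Yo.mu_list_hom_iso[of "sorted_list_of_set F" X, OF XO[OF F]] by (simp_all add: abstract_itp_simps)
  qed
  have mP: "mP F \<in> hom StoneStoch (FO ?E F) (FO \<phi> (FO ?EI F))" "is_iso StoneStoch (mP F)" if F: "F \<in> fin_sub J" for F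
    unfolding mP_def using Ph.mu_list_hom_iso[of "sorted_list_of_set F" ?Y, OF YO'[OF F]] by (simp_all add: abstract_itp_simps)
  note FI_cat = FI.category_axioms and St_cat = St.category_axioms
  have PI: "FA \<phi> (mI F) \<in> hom StoneStoch (FO \<phi> (FO ?EI F)) (FO \<phi> (hom_copsh FinStoch (fprod X F)))" "is_iso StoneStoch (FA \<phi> (mI F))"
    if F: "F \<in> fin_sub J" for F
    using Ph.F_hom[OF mI(1)[OF F]] functor_iso[OF FI_cat St_cat Ph.F_functor mI[OF F]] by auto
  have PP: "FA \<phi> (mI F) \<cdot>\<^bsub>StoneStoch\<^esub> mP F \<in> hom StoneStoch (FO ?E F) (FO \<phi> (hom_copsh FinStoch (fprod X F)))" if F: "F \<in> fin_sub J" for F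
    using St.comp_hom[OF mP(1)[OF F] PI(1)[OF F]] .
  note th = theta(1)[OF fin]
  have "is_limit ?K StoneStoch ?D (FO \<phi> L) (\<lambda>F. ?b F \<cdot>\<^bsub>StoneStoch\<^esub> ?r F)"
  proof (rule St.limit_transport[OF E D _ _ _ r])
    fix F assume "F \<in> Ob ?K"
    then have F: "F \<in> fin_sub J" by simp
    show "?b F \<in> hom StoneStoch (FO ?E F) (FO ?D F)"
      using St.comp_hom[OF PP[OF F] th[OF F]] F by (simp add: abstract_itp_FO fin_incl_simps(1))
    show "is_iso StoneStoch (?b F)"
      by (rule St.iso_comp[OF PP[OF F] St.iso_comp[OF mP[OF F] PI[OF F]] th[OF F] theta(2)[OF fin[OF F]]])
  next
    fix u assume u: "u \<in> Ar ?K"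
    obtain F F' where uF: "u = (F, F')" "F \<subseteq> F'" "finite F'" "F' \<subseteq> J" using u by auto
    have F: "F \<in> fin_sub J" "F' \<in> fin_sub J" using uF finite_subset[of F F'] by auto
    let ?d = "FA (abstract_itp FinStoch X) (F, F')"
    let ?e = "FA ?EI (F, F')" and ?s = "FA ?E (F, F')"
    have d: "?d \<in> hom FinStoch (fprod X F') (fprod X F)"
      using directed_diagram.d_hom[OF FinStoch_directed_diagram[OF X] F uF(2)] F by (simp add: abstract_itp_FO)
    have e: "?e \<in> hom FinStochI (FO ?EI F') (FO ?EI F)" and s: "?s \<in> hom StoneStoch (FO ?E F') (FO ?E F)"
    proof -
      have "FA ?EI u \<in> hom FinStochI (FO ?EI (Dom ?K u)) (FO ?EI (Cod ?K u))" "FA ?E u \<in> hom StoneStoch (FO ?E (Dom ?K u)) (FO ?E (Cod ?K u))"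
        using EI E u unfolding is_diagram_def by blast+
      then show "?e \<in> hom FinStochI (FO ?EI F') (FO ?EI F)" "?s \<in> hom StoneStoch (FO ?E F') (FO ?E F)"
        by (simp_all add: uF(1))
    qed
    have yd: "FA (yoneda FinStoch) ?d \<in> hom FinStochI (hom_copsh FinStoch (fprod X F')) (hom_copsh FinStoch (fprod X F))"
      using Yo.F_hom[OF d] by simp
    have nI: "mI F \<cdot>\<^bsub>FinStochI\<^esub> ?e = FA (yoneda FinStoch) ?d \<cdot>\<^bsub>FinStochI\<^esub> mI F'"
      unfolding mI_def using Yo.mu_list_nat[of "sorted_list_of_set F'" X F] XO[OF F(2)] uF
      by (simp add: abstract_itp_simps sorted_list_of_set_filter)
    have nP: "mP F \<cdot>\<^bsub>StoneStoch\<^esub> ?s = FA \<phi> ?e \<cdot>\<^bsub>StoneStoch\<^esub> mP F'"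
      unfolding mP_def using Ph.mu_list_nat[of "sorted_list_of_set F'" ?Y F] YO'[OF F(2)] uF
      by (simp add: abstract_itp_simps sorted_list_of_set_filter)
    note di = fin_incl_hom[OF d] and Pe = Ph.F_hom[OF e] and Pyd = Ph.F_hom[OF yd]
    have "FA fin_incl ?d \<cdot>\<^bsub>StoneStoch\<^esub> ?b F' = (FA fin_incl ?d \<cdot>\<^bsub>StoneStoch\<^esub> \<theta> (fprod X F')) \<cdot>\<^bsub>StoneStoch\<^esub> FA \<phi> (mI F') \<cdot>\<^bsub>StoneStoch\<^esub> mP F'"
      using St.comp_assoc[OF PP[OF F(2)] th[OF F(2)] di] by simp
    also have "\<dots> = (\<theta> (fprod X F) \<cdot>\<^bsub>StoneStoch\<^esub> FA \<phi> (FA (yoneda FinStoch) ?d)) \<cdot>\<^bsub>StoneStoch\<^esub> FA \<phi> (mI F') \<cdot>\<^bsub>StoneStoch\<^esub> mP F'"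
      using theta_nat[OF d] by simp
    also have "\<dots> = \<theta> (fprod X F) \<cdot>\<^bsub>StoneStoch\<^esub> (FA \<phi> (FA (yoneda FinStoch) ?d) \<cdot>\<^bsub>StoneStoch\<^esub> FA \<phi> (mI F')) \<cdot>\<^bsub>StoneStoch\<^esub> mP F'"
      using St.comp_assoc[OF PP[OF F(2)] Pyd th[OF F(1)]] St.comp_assoc[OF mP(1)[OF F(2)] PI(1)[OF F(2)] Pyd] by simp
    also have "FA \<phi> (FA (yoneda FinStoch) ?d) \<cdot>\<^bsub>StoneStoch\<^esub> FA \<phi> (mI F') = FA \<phi> (mI F) \<cdot>\<^bsub>StoneStoch\<^esub> FA \<phi> ?e"
      using is_functorD(4)[OF Ph.F_functor mI(1)[OF F(2)] yd] is_functorD(4)[OF Ph.F_functor e mI(1)[OF F(1)]] nI by simp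
    also have "(FA \<phi> (mI F) \<cdot>\<^bsub>StoneStoch\<^esub> FA \<phi> ?e) \<cdot>\<^bsub>StoneStoch\<^esub> mP F' = FA \<phi> (mI F) \<cdot>\<^bsub>StoneStoch\<^esub> mP F \<cdot>\<^bsub>StoneStoch\<^esub> ?s"
      using St.comp_assoc[OF mP(1)[OF F(2)] Pe PI(1)[OF F(1)]] nP by simp
    also have "\<theta> (fprod X F) \<cdot>\<^bsub>StoneStoch\<^esub> \<dots> = ?b F \<cdot>\<^bsub>StoneStoch\<^esub> ?s"
      using St.comp_assoc[OF s PP[OF F(1)] th[OF F(1)]] St.comp_assoc[OF s mP(1)[OF F(1)] PI(1)[OF F(1)]] by simp
    finally show "FA ?D u \<cdot>\<^bsub>StoneStoch\<^esub> ?b (Dom ?K u) = ?b (Cod ?K u) \<cdot>\<^bsub>StoneStoch\<^esub> FA ?E u"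
      by (simp add: uF(1))
  qed
  then show ?thesis
  proof (rule is_limit_cong)
    fix F assume "F \<in> Ob ?K"
    then have F: "F \<in> fin_sub J" by simp
    note pF = limit_proj[OF X lim F]
    note i = FI.inv_arrow[OF mI[OF F]] and j = St.inv_arrow[OF mP[OF F]]
    have ip: "inv_arrow FinStochI (mI F) \<cdot>\<^bsub>FinStochI\<^esub> p F \<in> hom FinStochI L (FO ?EI F)"
      by (rule FI.comp_hom[OF pF i(1)])
    note Pip = Ph.F_hom[OF ip]
    have rF: "?r F \<in> hom StoneStoch (FO \<phi> L) (FO ?E F)" by (rule St.comp_hom[OF Pip j(1)])
    have "?b F \<cdot>\<^bsub>StoneStoch\<^esub> ?r F = \<theta> (fprod X F) \<cdot>\<^bsub>StoneStoch\<^esub> FA \<phi> (mI F) \<cdot>\<^bsub>StoneStoch\<^esub> mP F \<cdot>\<^bsub>StoneStoch\<^esub> ?r F"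
      using St.comp_assoc[OF rF PP[OF F] th[OF F]] St.comp_assoc[OF rF mP(1)[OF F] PI(1)[OF F]] by simp
    also have "mP F \<cdot>\<^bsub>StoneStoch\<^esub> ?r F = FA \<phi> (inv_arrow FinStochI (mI F) \<cdot>\<^bsub>FinStochI\<^esub> p F)"
      by (rule St.inv_arrow_cancel(2)[OF mP[OF F] Pip])
    also have "FA \<phi> (mI F) \<cdot>\<^bsub>StoneStoch\<^esub> \<dots> = FA \<phi> (p F)"
      using is_functorD(4)[OF Ph.F_functor ip mI(1)[OF F]] FI.inv_arrow_cancel(2)[OF mI[OF F] pF] by simp
    finally show "?b F \<cdot>\<^bsub>StoneStoch\<^esub> ?r F = \<theta> (fprod X F) \<cdot>\<^bsub>StoneStoch\<^esub> FA \<phi> (p F)" .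
  next
    show "FA ?D u = FA ?D u \<and> Dom ?K u \<in> Ob ?K \<and> Cod ?K u \<in> Ob ?K" if "u \<in> Ar ?K" for u
      using E that unfolding is_diagram_def by blast
  qed (rule refl)
qed

text \<open>
  Both objects are limits of the same diagram of finite discrete spaces.
\<close>

lemma phi_product:
  assumes X: "\<And>j. j \<in> J \<Longrightarrow> finite (X j)"
    and lim: "is_limit (op_cat (FinLO J)) (copsh_op FinStoch) (func_comp (yoneda FinStoch) (abstract_itp FinStoch X)) L p"
  obtains t where "t \<in> hom StoneStoch (FO \<phi> L) (sprod J X)" "is_iso StoneStoch t"
    "\<And>F. F \<in> fin_sub J \<Longrightarrow> spr J X F \<cdot>\<^bsub>StoneStoch\<^esub> t = \<theta> (fprod X F) \<cdot>\<^bsub>StoneStoch\<^esub> FA \<phi> (p F)"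
proof -
  let ?D = "func_comp fin_incl (abstract_itp FinStoch X)"
  have D: "is_diagram (op_cat (FinLO J)) StoneStoch ?D" using X by (rule fin_incl_product_diagram)
  have s: "is_limit (op_cat (FinLO J)) StoneStoch ?D (sprod J X) (spr J X)"
    by (rule sprod_limit) (rule X)
  obtain t where t: "t \<in> hom StoneStoch (FO \<phi> L) (sprod J X)" "is_iso StoneStoch t"
    "\<And>F. F \<in> Ob (op_cat (FinLO J)) \<Longrightarrow> spr J X F \<cdot>\<^bsub>StoneStoch\<^esub> t = \<theta> (fprod X F) \<cdot>\<^bsub>StoneStoch\<^esub> FA \<phi> (p F)"
    using St.limit_unique[OF D phi_limit[OF X lim] s] by blast
  show thesis by (rule that[OF t(1,2)]) (rule t(3), simp)
qed

text \<open>
  On both sides, an arrow to a finite set \<open>B\<close> is a matrix \<open>fprod X F \<rightarrow> B\<close> at a finite stage \<open>F\<close>, up to passing to a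
  later stage: in the completion because of its pointwise colimits, and for kernels because they depend on
  finitely many coordinates. The equation \<open>key\<close> says that \<open>\<phi>\<close> respects these descriptions.
\<close>

lemma phi_bij_finite:
  assumes L: "L \<in> Ob FinStochI" and B: "finite B"
  shows "bij_betw (FA \<phi>) (hom FinStochI L (hom_copsh FinStoch B)) (hom StoneStoch (FO \<phi> L) (FO \<phi> (hom_copsh FinStoch B)))"
proof -
  obtain J X l where X: "\<And>j. j \<in> J \<Longrightarrow> finite (X j)" and pr: "itp_presentation FinStoch J X L l"
    using L unfolding FinStochI_Ob by blast
  obtain p where lim: "is_limit (op_cat (FinLO J)) (copsh_op FinStoch) (func_comp (yoneda FinStoch) (abstract_itp FinStoch X)) L p"
    using itp_presentation_limit[OF pr] by blast
  obtain t where t: "t \<in> hom StoneStoch (FO \<phi> L) (sprod J X)" "is_iso StoneStoch t"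
    and pt: "\<And>F. F \<in> fin_sub J \<Longrightarrow> spr J X F \<cdot>\<^bsub>StoneStoch\<^esub> t = \<theta> (fprod X F) \<cdot>\<^bsub>StoneStoch\<^esub> FA \<phi> (p F)"
    using phi_product[OF X lim] by blast
  note v = St.inv_arrow[OF t] and thB = theta[OF B]
  have pj: "p F \<in> hom FinStochI L (hom_copsh FinStoch (fprod X F))" if "F \<in> fin_sub J" for F
    using limit_proj[OF X lim that] .
  have fin: "finite (fprod X F)" if "F \<in> fin_sub J" for F using X that by (auto intro: finite_fprod)
  have spr: "spr J X F \<in> hom StoneStoch (sprod J X) (discrete_topology (fprod X F))" if "F \<in> fin_sub J" for F
    using spr_hom[of J X F] X that by blast
  have key: "\<theta> B \<cdot>\<^bsub>StoneStoch\<^esub> FA \<phi> (FA (yoneda FinStoch) f \<cdot>\<^bsub>FinStochI\<^esub> p F) = (FA fin_incl f \<cdot>\<^bsub>StoneStoch\<^esub> spr J X F) \<cdot>\<^bsub>StoneStoch\<^esub> t"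
    if F: "F \<in> fin_sub J" and f: "f \<in> hom FinStoch (fprod X F) B" for F f
  proof -
    have yf: "FA (yoneda FinStoch) f \<in> hom FinStochI (hom_copsh FinStoch (fprod X F)) (hom_copsh FinStoch B)"
      using Yo.F_hom[OF f] by simp
    note Pp = Ph.F_hom[OF pj[OF F]] and Pyf = Ph.F_hom[OF yf] and th = theta(1)[OF fin[OF F]]
    have "\<theta> B \<cdot>\<^bsub>StoneStoch\<^esub> FA \<phi> (FA (yoneda FinStoch) f \<cdot>\<^bsub>FinStochI\<^esub> p F)
        = (\<theta> B \<cdot>\<^bsub>StoneStoch\<^esub> FA \<phi> (FA (yoneda FinStoch) f)) \<cdot>\<^bsub>StoneStoch\<^esub> FA \<phi> (p F)"
      using is_functorD(4)[OF Ph.F_functor pj[OF F] yf] St.comp_assoc[OF Pp Pyf thB(1)] by simp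
    also have "\<dots> = FA fin_incl f \<cdot>\<^bsub>StoneStoch\<^esub> spr J X F \<cdot>\<^bsub>StoneStoch\<^esub> t"
      using theta_nat[OF f] St.comp_assoc[OF Pp th fin_incl_hom[OF f]] pt[OF F] by simp
    also have "\<dots> = (FA fin_incl f \<cdot>\<^bsub>StoneStoch\<^esub> spr J X F) \<cdot>\<^bsub>StoneStoch\<^esub> t"
      using St.comp_assoc[OF t(1) spr[OF F] fin_incl_hom[OF f]] by simp
    finally show ?thesis .
  qed
  show ?thesis
    unfolding bij_betw_def
  proof (intro conjI inj_onI subset_antisym subsetI)
    fix u w assume u: "u \<in> hom FinStochI L (hom_copsh FinStoch B)" and w: "w \<in> hom FinStochI L (hom_copsh FinStoch B)"
      and eq: "FA \<phi> u = FA \<phi> w"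
    obtain F f where F: "F \<in> fin_sub J" and f: "f \<in> hom FinStoch (fprod X F) B" and uf: "u = FA (yoneda FinStoch) f \<cdot>\<^bsub>FinStochI\<^esub> p F"
      using limit_arrow_factor[OF X lim B u] by blast
    obtain F' f' where F': "F' \<in> fin_sub J" and f': "f' \<in> hom FinStoch (fprod X F') B" and wf: "w = FA (yoneda FinStoch) f' \<cdot>\<^bsub>FinStochI\<^esub> p F'"
      using limit_arrow_factor[OF X lim B w] by blast
    have c: "(FA fin_incl f \<cdot>\<^bsub>StoneStoch\<^esub> spr J X F) \<cdot>\<^bsub>StoneStoch\<^esub> t = (FA fin_incl f' \<cdot>\<^bsub>StoneStoch\<^esub> spr J X F') \<cdot>\<^bsub>StoneStoch\<^esub> t"
      using key[OF F f] key[OF F' f'] eq uf wf by simp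
    have cancel: "k = (k \<cdot>\<^bsub>StoneStoch\<^esub> t) \<cdot>\<^bsub>StoneStoch\<^esub> inv_arrow StoneStoch t" if "k \<in> hom StoneStoch (sprod J X) (discrete_topology B)" for k
      using St.comp_assoc[OF v(1) t(1) that] v(3) St.id_right[OF that] by simp
    have "FA fin_incl f \<cdot>\<^bsub>StoneStoch\<^esub> spr J X F = FA fin_incl f' \<cdot>\<^bsub>StoneStoch\<^esub> spr J X F'"
      using cancel[OF St.comp_hom[OF spr[OF F] fin_incl_hom[OF f]]] cancel[OF St.comp_hom[OF spr[OF F'] fin_incl_hom[OF f']]] c by simp
    then obtain G where G: "G \<in> fin_sub J" "F \<subseteq> G" "F' \<subseteq> G"
      and fG: "f \<cdot>\<^bsub>FinStoch\<^esub> FA (abstract_itp FinStoch X) (F, G) = f' \<cdot>\<^bsub>FinStoch\<^esub> FA (abstract_itp FinStoch X) (F', G)"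
      using sprod_factor_unique[of J X, OF X F F' f f'] by blast
    have *: "FA (yoneda FinStoch) f \<cdot>\<^bsub>FinStochI\<^esub> p F = FA (yoneda FinStoch) (f \<cdot>\<^bsub>FinStoch\<^esub> FA (abstract_itp FinStoch X) (F, G)) \<cdot>\<^bsub>FinStochI\<^esub> p G"
      if F: "F \<in> fin_sub J" "F \<subseteq> G" and f: "f \<in> hom FinStoch (fprod X F) B" for F f
    proof -
      let ?d = "FA (abstract_itp FinStoch X) (F, G)"
      have d: "?d \<in> hom FinStoch (fprod X G) (fprod X F)"
        using directed_diagram.d_hom[OF FinStoch_directed_diagram[OF X] F(1) G(1) F(2)] F G by (simp add: abstract_itp_FO)
      have y: "FA (yoneda FinStoch) ?d \<in> hom FinStochI (hom_copsh FinStoch (fprod X G)) (hom_copsh FinStoch (fprod X F))"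
        "FA (yoneda FinStoch) f \<in> hom FinStochI (hom_copsh FinStoch (fprod X F)) (hom_copsh FinStoch B)"
        using Yo.F_hom[OF d] Yo.F_hom[OF f] by simp_all
      show ?thesis
        using limit_proj_comp[OF X lim F(1) G(1) F(2)] is_functorD(4)[OF Yo.F_functor d f] FI.comp_assoc[OF pj[OF G(1)] y] by simp
    qed
    show "u = w"
      unfolding uf wf using *[OF F G(2) f] *[OF F' G(3) f'] fG by simp
  next
    fix k assume "k \<in> FA \<phi> ` hom FinStochI L (hom_copsh FinStoch B)"
    then show "k \<in> hom StoneStoch (FO \<phi> L) (FO \<phi> (hom_copsh FinStoch B))"
      using Ph.F_hom by blast
  next
    fix k assume k: "k \<in> hom StoneStoch (FO \<phi> L) (FO \<phi> (hom_copsh FinStoch B))"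
    note bk = St.comp_hom[OF k thB(1)]
    obtain F f where F: "F \<in> fin_sub J" and f: "f \<in> hom FinStoch (fprod X F) B"
      and eq: "(\<theta> B \<cdot>\<^bsub>StoneStoch\<^esub> k) \<cdot>\<^bsub>StoneStoch\<^esub> inv_arrow StoneStoch t = FA fin_incl f \<cdot>\<^bsub>StoneStoch\<^esub> spr J X F"
      using sprod_factor[of J X, OF X St.comp_hom[OF v(1) bk] B] by blast
    have u: "FA (yoneda FinStoch) f \<cdot>\<^bsub>FinStochI\<^esub> p F \<in> hom FinStochI L (hom_copsh FinStoch B)"
      using FI.comp_hom[OF pj[OF F]] Yo.F_hom[OF f] by simp
    have "\<theta> B \<cdot>\<^bsub>StoneStoch\<^esub> FA \<phi> (FA (yoneda FinStoch) f \<cdot>\<^bsub>FinStochI\<^esub> p F) = \<theta> B \<cdot>\<^bsub>StoneStoch\<^esub> k"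
      using key[OF F f] eq St.comp_assoc[OF t(1) v(1) bk] v(2) St.id_right[OF bk] by simp
    then have "FA \<phi> (FA (yoneda FinStoch) f \<cdot>\<^bsub>FinStochI\<^esub> p F) = k"
      using St.iso_monic[OF thB Ph.F_hom[OF u] k] by blast
    then show "k \<in> FA \<phi> ` hom FinStochI L (hom_copsh FinStoch B)" using u by blast
  qed
qed

text \<open>
  An arrow to \<open>M\<close> is a cone over the finite stages of \<open>M\<close>, and one to \<open>\<phi> M\<close> is a cone over their images since \<open>\<phi>\<close>
  preserves this limit. Thus the case of finite targets applies to each leg.
\<close>

lemma phi_fully_faithful: "fully_faithful FinStochI StoneStoch \<phi>"
  unfolding fully_faithful_def
proof (intro ballI)
  fix L M :: "('a point set, 'a stoch) copsh"
  assume L: "L \<in> Ob FinStochI" and M: "M \<in> Ob FinStochI"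
  obtain J X l where X: "\<And>j. j \<in> J \<Longrightarrow> finite (X j)" and pr: "itp_presentation FinStoch J X M l"
    using M unfolding FinStochI_Ob by blast
  obtain p where lim: "is_limit (op_cat (FinLO J)) (copsh_op FinStoch) (func_comp (yoneda FinStoch) (abstract_itp FinStoch X)) M p"
    using itp_presentation_limit[OF pr] by blast
  have fin: "finite (fprod X F)" if "F \<in> fin_sub J" for F using X that by (auto intro: finite_fprod)
  have pj: "p F \<in> hom FinStochI M (hom_copsh FinStoch (fprod X F))" if "F \<in> fin_sub J" for F
    using limit_proj[OF X lim that] .
  have bij: "bij_betw (FA \<phi>) (hom FinStochI L (hom_copsh FinStoch (fprod X F)))
      (hom StoneStoch (FO \<phi> L) (FO \<phi> (hom_copsh FinStoch (fprod X F))))" if "F \<in> fin_sub J" for F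
    using phi_bij_finite[OF L fin[OF that]] .
  have dI: "is_diagram (op_cat (FinLO J)) FinStochI (func_comp (yoneda FinStoch) (abstract_itp FinStoch X))"
    using X by (intro diagram_functor[OF FS.abstract_itp_diagram Yo.F_functor]) auto
  note limI = FinStochI_limit(2)[OF X lim]
  have D: "is_diagram (op_cat (FinLO J)) StoneStoch (func_comp fin_incl (abstract_itp FinStoch X))"
    using X by (rule fin_incl_product_diagram)
  \<comment> \<open>The arrows \<open>\<phi> (p F)\<close> are jointly monic, as a limit cone up to isomorphism.\<close>
  have monic: "k = k'"
    if k: "k \<in> hom StoneStoch S (FO \<phi> M)" and k': "k' \<in> hom StoneStoch S (FO \<phi> M)"
      and eq: "\<And>F. F \<in> fin_sub J \<Longrightarrow> FA \<phi> (p F) \<cdot>\<^bsub>StoneStoch\<^esub> k = FA \<phi> (p F) \<cdot>\<^bsub>StoneStoch\<^esub> k'" for S k k'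
  proof (rule St.limit_jointly_monic[OF D phi_limit[OF X lim] k k'])
    fix F assume "F \<in> Ob (op_cat (FinLO J))"
    then have F: "F \<in> fin_sub J" by simp
    note Pp = Ph.F_hom[OF pj[OF F]] and th = theta(1)[OF fin[OF F]]
    show "(\<theta> (fprod X F) \<cdot>\<^bsub>StoneStoch\<^esub> FA \<phi> (p F)) \<cdot>\<^bsub>StoneStoch\<^esub> k = (\<theta> (fprod X F) \<cdot>\<^bsub>StoneStoch\<^esub> FA \<phi> (p F)) \<cdot>\<^bsub>StoneStoch\<^esub> k'"
      using St.comp_assoc[OF k Pp th] St.comp_assoc[OF k' Pp th] eq[OF F] by simp
  qed
  show "bij_betw (FA \<phi>) (hom FinStochI L M) (hom StoneStoch (FO \<phi> L) (FO \<phi> M))"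
    unfolding bij_betw_def
  proof (intro conjI inj_onI subset_antisym subsetI)
    fix u w assume u: "u \<in> hom FinStochI L M" and w: "w \<in> hom FinStochI L M" and eq: "FA \<phi> u = FA \<phi> w"
    show "u = w"
    proof (rule FI.limit_jointly_monic[OF dI limI u w])
      fix F assume "F \<in> Ob (op_cat (FinLO J))"
      then have F: "F \<in> fin_sub J" by simp
      have "FA \<phi> (p F \<cdot>\<^bsub>FinStochI\<^esub> u) = FA \<phi> (p F \<cdot>\<^bsub>FinStochI\<^esub> w)"
        using is_functorD(4)[OF Ph.F_functor u pj[OF F]] is_functorD(4)[OF Ph.F_functor w pj[OF F]] eq by simp
      then show "p F \<cdot>\<^bsub>FinStochI\<^esub> u = p F \<cdot>\<^bsub>FinStochI\<^esub> w"
        using bij_betw_imp_inj_on[OF bij[OF F]] FI.comp_hom[OF u pj[OF F]] FI.comp_hom[OF w pj[OF F]] by (simp only: inj_on_eq_iff)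
    qed
  next
    fix k assume "k \<in> FA \<phi> ` hom FinStochI L M"
    then show "k \<in> hom StoneStoch (FO \<phi> L) (FO \<phi> M)" using Ph.F_hom by blast
  next
    fix k assume k: "k \<in> hom StoneStoch (FO \<phi> L) (FO \<phi> M)"
    have "\<exists>u\<in>hom FinStochI L (hom_copsh FinStoch (fprod X F)). FA \<phi> u = FA \<phi> (p F) \<cdot>\<^bsub>StoneStoch\<^esub> k" if F: "F \<in> fin_sub J" for F
    proof -
      have "FA \<phi> (p F) \<cdot>\<^bsub>StoneStoch\<^esub> k \<in> FA \<phi> ` hom FinStochI L (hom_copsh FinStoch (fprod X F))"
        using St.comp_hom[OF k Ph.F_hom[OF pj[OF F]]] bij[OF F] by (simp add: bij_betw_def)
      then obtain u where "FA \<phi> (p F) \<cdot>\<^bsub>StoneStoch\<^esub> k = FA \<phi> u" "u \<in> hom FinStochI L (hom_copsh FinStoch (fprod X F))"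
        by (rule imageE)
      then show ?thesis by (intro bexI[of _ u]) simp_all
    qed
    then have "\<forall>F\<in>fin_sub J. \<exists>u. u \<in> hom FinStochI L (hom_copsh FinStoch (fprod X F)) \<and> FA \<phi> u = FA \<phi> (p F) \<cdot>\<^bsub>StoneStoch\<^esub> k"
      unfolding Bex_def by (intro ballI)
    then obtain q where Q: "\<forall>F\<in>fin_sub J. q F \<in> hom FinStochI L (hom_copsh FinStoch (fprod X F)) \<and> FA \<phi> (q F) = FA \<phi> (p F) \<cdot>\<^bsub>StoneStoch\<^esub> k"
      unfolding bchoice_iff by (rule exE)
    note q = conjunct1[OF Q[rule_format]] and Pq = conjunct2[OF Q[rule_format]]
    have "is_cone (op_cat (FinLO J)) FinStochI (func_comp (yoneda FinStoch) (abstract_itp FinStoch X)) L q"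
      unfolding is_cone_def op_cat_simps FinLO_Ar_ball
    proof (intro conjI ballI impI)
      show "L \<in> Ob FinStochI" by (rule L)
      show "q F \<in> hom FinStochI L (FO (func_comp (yoneda FinStoch) (abstract_itp FinStoch X)) F)" if "F \<in> Ob (FinLO J)" for F
        using q[of F] that by (simp add: abstract_itp_FO)
      fix F F' assume F: "F \<in> fin_sub J" "F' \<in> fin_sub J" "F \<subseteq> F'"
      let ?d = "FA (abstract_itp FinStoch X) (F, F')"
      have d: "?d \<in> hom FinStoch (fprod X F') (fprod X F)"
        using directed_diagram.d_hom[OF FinStoch_directed_diagram[OF X] F] F by (simp add: abstract_itp_FO)
      have y: "FA (yoneda FinStoch) ?d \<in> hom FinStochI (hom_copsh FinStoch (fprod X F')) (hom_copsh FinStoch (fprod X F))"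
        using Yo.F_hom[OF d] by simp
      note Py = Ph.F_hom[OF y] and Pp = Ph.F_hom[OF pj[OF F(2)]]
      have "FA \<phi> (FA (yoneda FinStoch) ?d \<cdot>\<^bsub>FinStochI\<^esub> q F') = FA \<phi> (FA (yoneda FinStoch) ?d) \<cdot>\<^bsub>StoneStoch\<^esub> FA \<phi> (p F') \<cdot>\<^bsub>StoneStoch\<^esub> k"
        using is_functorD(4)[OF Ph.F_functor q[OF F(2)] y] Pq[OF F(2)] by simp
      also have "\<dots> = FA \<phi> (FA (yoneda FinStoch) ?d \<cdot>\<^bsub>FinStochI\<^esub> p F') \<cdot>\<^bsub>StoneStoch\<^esub> k"
        using St.comp_assoc[OF k Pp Py] is_functorD(4)[OF Ph.F_functor pj[OF F(2)] y] by simp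
      also have "\<dots> = FA \<phi> (q F)"
        using limit_proj_comp[OF X lim F] Pq[OF F(1)] by simp
      finally have "FA (yoneda FinStoch) ?d \<cdot>\<^bsub>FinStochI\<^esub> q F' = q F"
        using bij_betw_imp_inj_on[OF bij[OF F(1)]] FI.comp_hom[OF q[OF F(2)] y] q[OF F(1)] by (simp only: inj_on_eq_iff)
      then show "FA (func_comp (yoneda FinStoch) (abstract_itp FinStoch X)) (F, F') \<cdot>\<^bsub>FinStochI\<^esub> q (Cod (FinLO J) (F, F')) = q (Dom (FinLO J) (F, F'))"
        by simp
    qed
    then have "\<exists>!u. u \<in> hom FinStochI L M \<and> (\<forall>F\<in>Ob (op_cat (FinLO J)). p F \<cdot>\<^bsub>FinStochI\<^esub> u = q F)"
      using limI unfolding is_limit_def by blast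
    then obtain u where u: "u \<in> hom FinStochI L M" and "\<forall>F\<in>Ob (op_cat (FinLO J)). p F \<cdot>\<^bsub>FinStochI\<^esub> u = q F"
      by (elim ex1E conjE)
    then have pu: "p F \<cdot>\<^bsub>FinStochI\<^esub> u = q F" if "F \<in> fin_sub J" for F using that by simp
    have "FA \<phi> u = k"
    proof (rule monic[OF Ph.F_hom[OF u] k])
      fix F assume F: "F \<in> fin_sub J"
      show "FA \<phi> (p F) \<cdot>\<^bsub>StoneStoch\<^esub> FA \<phi> u = FA \<phi> (p F) \<cdot>\<^bsub>StoneStoch\<^esub> k"
        using is_functorD(4)[OF Ph.F_functor u pj[OF F]] pu[OF F] Pq[OF F] by simp
    qed
    then show "k \<in> FA \<phi> ` hom FinStochI L M" using u by blast
  qed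
qed

text \<open>Countable products may be reindexed by all natural numbers, with singletons for the missing factors.\<close>

lemma product_nat_homeomorphic:
  fixes X :: "nat \<Rightarrow> 'a point set"
  assumes X: "\<And>j. j \<in> J \<Longrightarrow> finite (X j)"
  obtains A :: "nat \<Rightarrow> nat set" where "\<And>n. finite (A n)"
    "product_topology (\<lambda>j. discrete_topology (X j)) J homeomorphic_space product_topology (\<lambda>n. discrete_topology (A n)) UNIV"
proof -
  have "\<exists>e :: 'a point \<Rightarrow> nat. inj_on e (X j)" if "j \<in> J" for j
    using finite_imp_inj_to_nat_seg[OF X[OF that]] by blast
  then obtain e :: "nat \<Rightarrow> 'a point \<Rightarrow> nat" where e: "\<And>j. j \<in> J \<Longrightarrow> inj_on (e j) (X j)" by metis
  define A where "A n = (if n \<in> J then e n ` X n else {0})" for n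
  let ?P = "product_topology (\<lambda>j. discrete_topology (X j)) J" and ?Q = "product_topology (\<lambda>n. discrete_topology (A n)) UNIV"
  define h where "h f n = (if n \<in> J then e n (f n) else 0)" for f :: "nat \<Rightarrow> 'a point" and n
  define k where "k g = (\<lambda>j\<in>J. inv_into (X j) (e j) (g j))" for g :: "nat \<Rightarrow> nat"
  have "continuous_map ?P ?Q h"
    unfolding continuous_map_componentwise_UNIV
  proof
    fix n
    have "continuous_map ?P (discrete_topology (A n)) (e n \<circ> (\<lambda>f. f n))" if "n \<in> J"
      by (rule continuous_map_compose[OF continuous_map_product_projection[OF that]]) (use that in \<open>auto simp: A_def\<close>)
    then show "continuous_map ?P (discrete_topology (A n)) (\<lambda>f. h f n)"
      by (cases "n \<in> J") (simp_all add: h_def A_def o_def)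
  qed
  moreover have "continuous_map ?Q ?P k"
    unfolding continuous_map_componentwise
  proof (intro conjI ballI)
    show "k ` topspace ?Q \<subseteq> extensional J" by (auto simp: k_def)
    fix j assume j: "j \<in> J"
    have "continuous_map ?Q (discrete_topology (X j)) (inv_into (X j) (e j) \<circ> (\<lambda>g. g j))"
      by (rule continuous_map_compose[OF continuous_map_product_projection[OF UNIV_I]]) (use j in \<open>auto simp: A_def inv_into_into\<close>)
    then show "continuous_map ?Q (discrete_topology (X j)) (\<lambda>g. k g j)"
      using j by (simp add: k_def o_def)
  qed
  moreover have "k (h f) = f" if "f \<in> topspace ?P" for f
    using that e by (auto simp: k_def h_def fun_eq_iff PiE_iff extensional_def restrict_def)
  moreover have "h (k g) = g" if "g \<in> topspace ?Q" for g
  proof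
    fix n
    have "g n \<in> A n" using that by (auto simp: PiE_iff)
    then show "h (k g) n = g n" by (auto simp: h_def k_def A_def f_inv_into_f)
  qed
  ultimately have "?P homeomorphic_space ?Q"
    unfolding homeomorphic_space_def homeomorphic_maps_def by blast
  moreover have "finite (A n)" for n using X by (simp add: A_def)
  ultimately show thesis using that by blast
qed

text \<open>
  By \<open>phi_product\<close> the values of \<open>\<phi>\<close> are the topological products up to isomorphism, and isomorphism of
  Stone spaces in the category of kernels is homeomorphism.
\<close>

lemma phi_ess_image:
  "ess_image FinStochI StoneStoch \<phi> = {S. \<exists>A :: nat \<Rightarrow> nat set. (\<forall>n. finite (A n)) \<and>
     S homeomorphic_space product_topology (\<lambda>n. discrete_topology (A n)) UNIV}"
proof (intro subset_antisym subsetI)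
  fix S assume "S \<in> ess_image FinStochI StoneStoch \<phi>"
  then obtain L where L: "L \<in> Ob FinStochI" and S: "isomorphic StoneStoch (FO \<phi> L) S"
    by (auto simp: ess_image_def)
  obtain J X l where X: "\<And>j. j \<in> J \<Longrightarrow> finite (X j)" and pr: "itp_presentation FinStoch J X L l"
    using L unfolding FinStochI_Ob by blast
  obtain p where lim: "is_limit (op_cat (FinLO J)) (copsh_op FinStoch) (func_comp (yoneda FinStoch) (abstract_itp FinStoch X)) L p"
    using itp_presentation_limit[OF pr] by blast
  obtain t where "t \<in> hom StoneStoch (FO \<phi> L) (sprod J X)" "is_iso StoneStoch t"
    using phi_product[OF X lim] by blast
  then have "FO \<phi> L homeomorphic_space sprod J X"
    using isomorphic_homeomorphic unfolding isomorphic_def by blast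
  moreover obtain A :: "nat \<Rightarrow> nat set" where A: "\<And>n. finite (A n)"
    "product_topology (\<lambda>j. discrete_topology (X j)) J homeomorphic_space product_topology (\<lambda>n. discrete_topology (A n)) UNIV"
    using product_nat_homeomorphic[of J X] X by blast
  ultimately have "S homeomorphic_space product_topology (\<lambda>n. discrete_topology (A n)) UNIV"
    using isomorphic_homeomorphic[OF S] sprod_homeomorphic[of X J] by (meson homeomorphic_space_sym homeomorphic_space_trans)
  then show "S \<in> {S. \<exists>A :: nat \<Rightarrow> nat set. (\<forall>n. finite (A n)) \<and>
     S homeomorphic_space product_topology (\<lambda>n. discrete_topology (A n)) UNIV}"
    using A(1) by blast
next
  fix S :: "'a point topology"
  assume "S \<in> {S. \<exists>A :: nat \<Rightarrow> nat set. (\<forall>n. finite (A n)) \<and>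
     S homeomorphic_space product_topology (\<lambda>n. discrete_topology (A n)) UNIV}"
  then obtain A :: "nat \<Rightarrow> nat set" where A: "\<And>n. finite (A n)"
    and S: "S homeomorphic_space product_topology (\<lambda>n. discrete_topology (A n)) UNIV" by blast
  \<comment> \<open>Natural numbers are coded as points, to obtain the factors as objects of \<open>FinStoch\<close>.\<close>
  define c :: "nat \<Rightarrow> 'a point" where "c n = (Pr Star ^^ n) Star" for n
  have c: "inj c"
  proof (rule injI)
    show "m = n" if "c m = c n" for m n
      using that
    proof (induction m arbitrary: n)
      case 0 then show ?case by (cases n) (auto simp: c_def)
    next
      case (Suc m) then show ?case by (cases n) (auto simp: c_def)
    qed
  qed
  define X where "X n = c ` A n" for n
  have X: "finite (X j)" if "j \<in> UNIV" for j using A by (simp add: X_def)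
  have "product_topology (\<lambda>n. discrete_topology (A n)) UNIV homeomorphic_space product_topology (\<lambda>n. discrete_topology (X n)) UNIV"
    unfolding homeomorphic_space_def homeomorphic_maps_def
  proof (intro exI[of _ "\<lambda>f n. c (f n)"] exI[of _ "\<lambda>f n. inv c (f n)"] conjI)
    show "continuous_map (product_topology (\<lambda>n. discrete_topology (A n)) UNIV) (product_topology (\<lambda>n. discrete_topology (X n)) UNIV) (\<lambda>f n. c (f n))"
      unfolding continuous_map_componentwise_UNIV
    proof
      fix n
      have "continuous_map (product_topology (\<lambda>n. discrete_topology (A n)) UNIV) (discrete_topology (X n)) (c \<circ> (\<lambda>f. f n))"
        by (rule continuous_map_compose[OF continuous_map_product_projection[OF UNIV_I]]) (auto simp: X_def)
      then show "continuous_map (product_topology (\<lambda>n. discrete_topology (A n)) UNIV) (discrete_topology (X n)) (\<lambda>f. c (f n))"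
        by (simp add: o_def)
    qed
    show "continuous_map (product_topology (\<lambda>n. discrete_topology (X n)) UNIV) (product_topology (\<lambda>n. discrete_topology (A n)) UNIV) (\<lambda>f n. inv c (f n))"
      unfolding continuous_map_componentwise_UNIV
    proof
      fix n
      have "continuous_map (product_topology (\<lambda>n. discrete_topology (X n)) UNIV) (discrete_topology (A n)) (inv c \<circ> (\<lambda>f. f n))"
        by (rule continuous_map_compose[OF continuous_map_product_projection[OF UNIV_I]]) (auto simp: X_def inv_f_f[OF c])
      then show "continuous_map (product_topology (\<lambda>n. discrete_topology (X n)) UNIV) (discrete_topology (A n)) (\<lambda>f. inv c (f n))"
        by (simp add: o_def)
    qed
    show "\<forall>f\<in>topspace (product_topology (\<lambda>n. discrete_topology (A n)) UNIV). (\<lambda>n. inv c (c (f n))) = f"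
      by (simp add: inv_f_f[OF c])
    show "\<forall>f\<in>topspace (product_topology (\<lambda>n. discrete_topology (X n)) UNIV). (\<lambda>n. c (inv c (f n))) = f"
    proof (intro ballI ext)
      fix f n assume "f \<in> topspace (product_topology (\<lambda>n. discrete_topology (X n)) UNIV)"
      then have "f n \<in> range c" by (auto simp: PiE_iff X_def)
      then show "c (inv c (f n)) = f n" by (rule f_inv_into_f)
    qed
  qed
  then have SP: "sprod UNIV X homeomorphic_space S"
    using S sprod_homeomorphic[of X UNIV] homeomorphic_space_sym homeomorphic_space_trans by metis
  have st: "stone_space (sprod UNIV X)" "stone_space S"
    using sprod_stone[of UNIV X] X stone_homeomorphic[OF _ SP] by auto
  interpret D: directed_diagram FinStoch "fin_sub UNIV" "(\<subseteq>)" "FO (abstract_itp FinStoch X)" "\<lambda>F F'. FA (abstract_itp FinStoch X) (F, F')"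
    by (rule FinStoch_directed_diagram[OF X])
  have "inj_on FS.index_code (fin_sub UNIV)" using FS.index_code_inj by (rule inj_on_subset) auto
  then obtain L l where pr: "itp_presentation FinStoch UNIV X L l" by (rule D.presentation_exists)
  obtain p where lim: "is_limit (op_cat (FinLO UNIV)) (copsh_op FinStoch) (func_comp (yoneda FinStoch) (abstract_itp FinStoch X)) L p"
    using itp_presentation_limit[OF pr] by blast
  have L: "L \<in> Ob FinStochI" by (rule FinStochI_limit(1)[OF X lim])
  obtain t where "t \<in> hom StoneStoch (FO \<phi> L) (sprod UNIV X)" "is_iso StoneStoch t"
    using phi_product[OF X lim] by blast
  then have "FO \<phi> L homeomorphic_space sprod UNIV X"
    using isomorphic_homeomorphic unfolding isomorphic_def by blast
  then have "FO \<phi> L homeomorphic_space S"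
    using SP homeomorphic_space_trans by blast
  then have "isomorphic StoneStoch (FO \<phi> L) S"
    using homeomorphic_isomorphic Ph.F_ob[OF L] by simp
  then show "S \<in> ess_image FinStochI StoneStoch \<phi>"
    using L st(2) by (auto simp: ess_image_def)
qed

end

theorem theorem7p7:
  fixes \<phi> :: "(('a point set, 'a stoch) copsh, ('a point set, 'a stoch) copsh_arrow,
               'a point topology, 'a kernel) smfunc"
  assumes "is_smfunctor (itp_completion FinStoch) StoneStoch \<phi>"
    and "itp_preserving (itp_completion FinStoch) StoneStoch \<phi>"
    and "monoidally_isomorphic FinStoch StoneStoch
           (smfunc_comp StoneStoch \<phi> (yoneda FinStoch)) fin_incl"
  shows "fully_faithful (itp_completion FinStoch) StoneStoch \<phi> \<and>
         ess_image (itp_completion FinStoch) StoneStoch \<phi> =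
           {S. \<exists>A :: nat \<Rightarrow> nat set. (\<forall>n. finite (A n)) \<and>
                 S homeomorphic_space product_topology (\<lambda>n. discrete_topology (A n)) UNIV}"
proof -
  obtain \<theta> where "is_monoidal_nat_iso FinStoch StoneStoch (smfunc_comp StoneStoch \<phi> (yoneda FinStoch)) fin_incl \<theta>"
    using assms(3) by (auto simp: monoidally_isomorphic_def)
  then show ?thesis
    using phi_fully_faithful[OF assms(1,2)] phi_ess_image[OF assms(1,2)] by blast
qed

end
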